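(* (i') For any $T>0$, the solution-map $u_0\mapsto u$ associated with the KdV equation $w_t+w_{xxx}-6ww_x=0$ on $\mathbb T$ is discontinuous at every $u_0\in H^\infty_0(\mathbb T)$, as a map from $H^\infty_0(\mathbb T)$ endowed with the weak topology of $H^{-1}(\mathbb T)$ into $\mathcal D'(]0,T[\times\mathbb T)$. (ii') For any $T>0$, the solution-map $u_0\mapsto u$ associated with the mKdV equation $v_t+v_{xxx}\mp6v^2v_x=0$ on $\mathbb T$ (either sign) is discontinuous at every non-constant function $u_0\in H^\infty(\mathbb T)$, as a map from $H^\infty(\mathbb T)$ endowed with the weak topology of $L^2(\mathbb T)$ into $\mathcal D'(]0,T[\times\mathbb T)$. (ii'') Let $u_0\in H^\infty(\mathbb T)$ be a non-constant function. There exists no $T>0$ such that for all $t\in]0,T[$ the flow-map $u_0\mapsto u(t)$ associated with the mKdV equation is continuous at $u_0$ from $H^\infty(\mathbb T)$ endowed with the weak topology of $L^2(\mathbb T)$ into $\mathcal D'(\mathbb T)$.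
   Context: $\mathbb T=\mathbb R/2\pi\mathbb Z$; all functions are real-valued. $H^\infty(\mathbb T)=\bigcap_sH^s(\mathbb T)$ and $H^\infty_0(\mathbb T)$ is the subspace of functions with zero mean value. For smooth data the KdV and mKdV equations have unique global smooth solutions; the solution-map sends the datum $u_0$ to the unique solution $u\in C(\mathbb R;H^\infty(\mathbb T))$ with $u(0)=u_0$ (restricted to $]0,T[\times\mathbb T$), and the flow-map at time $t$ sends $u_0$ to $u(t)$. *)

theory Defs
  imports "HOL-Analysis.Analysis"
begin

section \<open>Initial topologies, weak topologies, discontinuity at a point\<close>

definition initial_topology :: "'a set \<Rightarrow> ('a \<Rightarrow> real) set \<Rightarrow> 'a topology" where
  "initial_topology X F = topology_generated_by {X \<inter> f -` G | f G. f \<in> F \<and> open G}"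

lemma topspace_initial_topology:
  assumes "F \<noteq> {}"
  shows "topspace (initial_topology X F) = X"
proof -
  obtain f where "f \<in> F" using assms by blast
  then have "X \<in> {X \<inter> f -` G | f G. f \<in> F \<and> open G}"
    by (auto intro!: exI[of _ f] exI[of _ UNIV])
  then show ?thesis
    unfolding initial_topology_def topology_generated_by_topspace by blast
qed

text \<open>Vectors are real-valued functions on an arbitrary type \<open>'b\<close>; this covers functions on the
  circle as well as distributions, which are functionals on test functions.\<close>

definition linear_functional_on :: "('b \<Rightarrow> real) set \<Rightarrow> (('b \<Rightarrow> real) \<Rightarrow> real) \<Rightarrow> bool" where
  "linear_functional_on V L \<longleftrightarrow>
     (\<forall>f\<in>V. \<forall>g\<in>V. \<forall>a b. L (\<lambda>x. a * f x + b * g x) = a * L f + b * L g)"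

definition dual_space ::
    "('b \<Rightarrow> real) set \<Rightarrow> (('b \<Rightarrow> real) \<Rightarrow> real) \<Rightarrow> (('b \<Rightarrow> real) \<Rightarrow> real) set" where
  "dual_space V nrm =
     {L. linear_functional_on V L \<and> (\<exists>C. \<forall>f\<in>V. \<bar>L f\<bar> \<le> C * nrm f)}"

definition weak_topology ::
    "('b \<Rightarrow> real) set \<Rightarrow> (('b \<Rightarrow> real) \<Rightarrow> real) \<Rightarrow> ('b \<Rightarrow> real) topology" where
  "weak_topology V nrm = initial_topology V (dual_space V nrm)"

text \<open>The first two conjuncts make sure that the negated continuity does not hold merely because
  the map or the point lies outside the given spaces.\<close>

definition discontinuous_at :: "'a topology \<Rightarrow> 'b topology \<Rightarrow> ('a \<Rightarrow> 'b) \<Rightarrow> 'a \<Rightarrow> bool" where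
  "discontinuous_at X Y f x \<longleftrightarrow>
     x \<in> topspace X \<and> f \<in> topspace X \<rightarrow> topspace Y \<and> \<not> topcontinuous_at X Y f x"

section \<open>Distributions on the circle\<close>

text \<open>Functions on the circle are \<open>2\<pi>\<close>-periodic functions on the real line.\<close>

definition periodic :: "(real \<Rightarrow> 'a) \<Rightarrow> bool" where
  "periodic f \<longleftrightarrow> (\<forall>x. f (x + 2 * pi) = f x)"

definition test_circle :: "(real \<Rightarrow> real) set" where
  "test_circle = {\<phi>. periodic \<phi> \<and> (\<forall>n. (deriv ^^ n) \<phi> differentiable_on UNIV)}"

text \<open>A distribution is a functional on test functions; it is given the value 0 elsewhere, so that
  equality and pointwise vector space operations are the intended ones.\<close>

definition distr_circle :: "((real \<Rightarrow> real) \<Rightarrow> real) set" where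
  "distr_circle =
     {U. linear_functional_on test_circle U \<and> (\<forall>\<phi>. \<phi> \<notin> test_circle \<longrightarrow> U \<phi> = 0) \<and>
         (\<exists>C N. \<forall>\<phi>\<in>test_circle. \<bar>U \<phi>\<bar> \<le> C * (\<Sum>j\<le>(N::nat). SUP x. \<bar>(deriv ^^ j) \<phi> x\<bar>))}"

definition distr_circle_topology :: "((real \<Rightarrow> real) \<Rightarrow> real) topology" where
  "distr_circle_topology = initial_topology distr_circle ((\<lambda>\<phi> U. U \<phi>) ` test_circle)"

definition circle_distr :: "(real \<Rightarrow> real) \<Rightarrow> (real \<Rightarrow> real) \<Rightarrow> real" where
  "circle_distr f = (\<lambda>\<phi>. if \<phi> \<in> test_circle then LINT x:{0..2*pi}|lborel. f x * \<phi> x else 0)"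

section \<open>Sobolev spaces on the circle\<close>

text \<open>For a real distribution \<open>U\<close> this is \<open>\<langle>U, exp (- i k x)\<rangle> / (2\<pi>)\<close>.\<close>

definition fourier_coeff :: "((real \<Rightarrow> real) \<Rightarrow> real) \<Rightarrow> int \<Rightarrow> complex" where
  "fourier_coeff U k =
     Complex (U (\<lambda>x. cos (of_int k * x))) (- U (\<lambda>x. sin (of_int k * x))) / of_real (2 * pi)"

definition sobolev_term :: "real \<Rightarrow> ((real \<Rightarrow> real) \<Rightarrow> real) \<Rightarrow> int \<Rightarrow> real" where
  "sobolev_term s U k = (1 + (of_int k)\<^sup>2) powr s * (cmod (fourier_coeff U k))\<^sup>2"

definition Hs :: "real \<Rightarrow> ((real \<Rightarrow> real) \<Rightarrow> real) set" where
  "Hs s = {U \<in> distr_circle. sobolev_term s U summable_on UNIV}"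

definition Hs_norm :: "real \<Rightarrow> ((real \<Rightarrow> real) \<Rightarrow> real) \<Rightarrow> real" where
  "Hs_norm s U = sqrt (\<Sum>\<^sub>\<infinity>k. sobolev_term s U k)"

text \<open>The intersection of all \<open>Hs s\<close>, each element being identified with its unique continuous
  representative.\<close>

definition Hinf :: "(real \<Rightarrow> real) set" where
  "Hinf = {f. periodic f \<and> continuous_on UNIV f \<and> circle_distr f \<in> (\<Inter>s. Hs s)}"

definition Hinf0 :: "(real \<Rightarrow> real) set" where
  "Hinf0 = {f \<in> Hinf. (LINT x:{0..2*pi}|lborel. f x) = 0}"

definition L2_circle :: "(real \<Rightarrow> real) set" where
  "L2_circle = {f. periodic f \<and> f \<in> borel_measurable borel \<and>
                   set_integrable lborel {0..2*pi} (\<lambda>x. (f x)\<^sup>2)}"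

definition L2_norm_circle :: "(real \<Rightarrow> real) \<Rightarrow> real" where
  "L2_norm_circle f = sqrt (LINT x:{0..2*pi}|lborel. (f x)\<^sup>2)"

definition Hinf0_weak_Hm1 :: "(real \<Rightarrow> real) topology" where
  "Hinf0_weak_Hm1 = pullback_topology Hinf0 circle_distr (weak_topology (Hs (- 1)) (Hs_norm (- 1)))"

definition Hinf_weak_L2 :: "(real \<Rightarrow> real) topology" where
  "Hinf_weak_L2 = subtopology (weak_topology L2_circle L2_norm_circle) Hinf"

section \<open>Distributions on the space-time cylinder \<open>]0,T[ \<times> \<T>\<close>\<close>

definition partial_t :: "(real \<times> real \<Rightarrow> real) \<Rightarrow> real \<times> real \<Rightarrow> real" where
  "partial_t \<phi> = (\<lambda>(t, x). deriv (\<lambda>r. \<phi> (r, x)) t)"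

definition partial_x :: "(real \<times> real \<Rightarrow> real) \<Rightarrow> real \<times> real \<Rightarrow> real" where
  "partial_x \<phi> = (\<lambda>(t, x). deriv (\<lambda>y. \<phi> (t, y)) x)"

inductive_set iterated_partials :: "(real \<times> real \<Rightarrow> real) \<Rightarrow> (real \<times> real \<Rightarrow> real) set"
  for \<phi> :: "real \<times> real \<Rightarrow> real" where
  "\<phi> \<in> iterated_partials \<phi>"
| "\<psi> \<in> iterated_partials \<phi> \<Longrightarrow> partial_t \<psi> \<in> iterated_partials \<phi>"
| "\<psi> \<in> iterated_partials \<phi> \<Longrightarrow> partial_x \<psi> \<in> iterated_partials \<phi>"

text \<open>Smooth functions, periodic in space, supported in the time interval \<open>[a, b]\<close>. For
  \<open>0 < a\<close> and \<open>b < T\<close> they are the extensions by 0 of test functions on the cylinder.\<close>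

definition test_supported :: "real \<Rightarrow> real \<Rightarrow> (real \<times> real \<Rightarrow> real) set" where
  "test_supported a b =
     {\<phi>. (\<forall>\<psi>\<in>iterated_partials \<phi>. \<psi> differentiable_on UNIV) \<and> (\<forall>t. periodic (\<lambda>x. \<phi> (t, x))) \<and>
         (\<forall>t x. t \<notin> {a..b} \<longrightarrow> \<phi> (t, x) = 0)}"

definition test_cylinder :: "real \<Rightarrow> (real \<times> real \<Rightarrow> real) set" where
  "test_cylinder T = (\<Union>a\<in>{0<..}. \<Union>b\<in>{..<T}. test_supported a b)"

definition distr_cylinder :: "real \<Rightarrow> ((real \<times> real \<Rightarrow> real) \<Rightarrow> real) set" where
  "distr_cylinder T =
     {U. linear_functional_on (test_cylinder T) U \<and> (\<forall>\<phi>. \<phi> \<notin> test_cylinder T \<longrightarrow> U \<phi> = 0) \<and>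
         (\<forall>a>0. \<forall>b<T. \<exists>C N. \<forall>\<phi>\<in>test_supported a b.
            \<bar>U \<phi>\<bar> \<le> C * (\<Sum>i\<le>(N::nat). \<Sum>j\<le>N. SUP p. \<bar>(partial_t ^^ i) ((partial_x ^^ j) \<phi>) p\<bar>))}"

definition distr_cylinder_topology :: "real \<Rightarrow> ((real \<times> real \<Rightarrow> real) \<Rightarrow> real) topology" where
  "distr_cylinder_topology T =
     initial_topology (distr_cylinder T) ((\<lambda>\<phi> U. U \<phi>) ` test_cylinder T)"

definition cylinder_distr ::
    "real \<Rightarrow> (real \<Rightarrow> real \<Rightarrow> real) \<Rightarrow> (real \<times> real \<Rightarrow> real) \<Rightarrow> real" where
  "cylinder_distr T u =
     (\<lambda>\<phi>. if \<phi> \<in> test_cylinder T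
           then LINT (t, x):{0<..<T} \<times> {0..2*pi}|lborel. u t x * \<phi> (t, x) else 0)"

section \<open>Global smooth solutions and solution-maps\<close>

text \<open>A space-time function \<open>u\<close> is curried: \<open>u t\<close> is the function on the circle at time \<open>t\<close>.\<close>

definition continuous_in_Hinf :: "(real \<Rightarrow> real \<Rightarrow> real) \<Rightarrow> bool" where
  "continuous_in_Hinf u \<longleftrightarrow>
     (\<forall>t. u t \<in> Hinf) \<and>
     (\<forall>s t. ((\<lambda>\<tau>. Hs_norm s (circle_distr (\<lambda>x. u \<tau> x - u t x))) \<longlongrightarrow> 0) (at t))"

definition kdv_solution :: "(real \<Rightarrow> real) \<Rightarrow> (real \<Rightarrow> real \<Rightarrow> real) \<Rightarrow> bool" where
  "kdv_solution w0 w \<longleftrightarrow>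
     continuous_in_Hinf w \<and> w 0 = w0 \<and>
     (\<forall>t x. \<exists>w_t. ((\<lambda>r. w r x) has_real_derivative w_t) (at t) \<and>
        w_t + (deriv ^^ 3) (w t) x - 6 * w t x * deriv (w t) x = 0)"

text \<open>The sign \<open>\<sigma>\<close> is \<open>1\<close> (defocusing) or \<open>- 1\<close> (focusing).\<close>

definition mkdv_solution :: "real \<Rightarrow> (real \<Rightarrow> real) \<Rightarrow> (real \<Rightarrow> real \<Rightarrow> real) \<Rightarrow> bool" where
  "mkdv_solution \<sigma> v0 v \<longleftrightarrow>
     continuous_in_Hinf v \<and> v 0 = v0 \<and>
     (\<forall>t x. \<exists>v_t. ((\<lambda>r. v r x) has_real_derivative v_t) (at t) \<and>
        v_t + (deriv ^^ 3) (v t) x - \<sigma> * 6 * (v t x)\<^sup>2 * deriv (v t) x = 0)"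

text \<open>Since smooth data have unique global smooth solutions, these conditions determine \<open>S\<close>
  on \<open>Hinf\<close>.\<close>

definition kdv_solution_map :: "((real \<Rightarrow> real) \<Rightarrow> real \<Rightarrow> real \<Rightarrow> real) \<Rightarrow> bool" where
  "kdv_solution_map S \<longleftrightarrow> (\<forall>u0\<in>Hinf. kdv_solution u0 (S u0))"

definition mkdv_solution_map :: "real \<Rightarrow> ((real \<Rightarrow> real) \<Rightarrow> real \<Rightarrow> real \<Rightarrow> real) \<Rightarrow> bool" where
  "mkdv_solution_map \<sigma> S \<longleftrightarrow> (\<forall>u0\<in>Hinf. mkdv_solution \<sigma> u0 (S u0))"

end

theory Submission
  imports Defs
begin

text \<open>
  The argument uses conservation laws only. For smooth periodic \<open>V0\<close>, \<open>g\<close> let \<open>v\<^sub>n\<close> be the mKdV solution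
  with datum \<open>V0 + g cos (n x)\<close>, corrected to have the mean of \<open>V0\<close>. The datum converges weakly to \<open>V0\<close>
  while its square converges to \<open>V0^2 + g^2 / 2\<close>. At positive times the local conservation laws of
  \<open>v^2\<close> and \<open>v\<^sub>x^2 \<plusminus> v\<^sup>4\<close> force \<open>v\<^sub>x^2 / n^2\<close> and \<open>v\<^sub>x\<^sub>x^2 / n\<^sup>4\<close> to become constant in space, with total mass
  fixed by the conserved energies; hence for small times \<open>v\<^sub>n^2\<close> is close to \<open>V0^2 + c\<close> with \<open>c\<close> the mean of
  \<open>g^2 / 2\<close>. The product laws for \<open>\<rho> = exp (2 \<epsilon> \<integral> v)\<close> and \<open>1 / \<rho>\<close>, \<open>\<epsilon>^2 = \<plusminus>1\<close>, give equicontinuity in time of the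
  primitives of \<open>v\<^sub>n\<close>, with constants depending on the mass alone.

  For KdV, the Miura transform \<open>v\<^sub>x + v^2\<close> and a Galilean boost turn \<open>v\<^sub>n\<close> into KdV solutions whose data converge
  weakly to \<open>V0' + V0^2 + g^2 / 2\<close> minus its mean. Writing the given datum in this form with \<open>g^2\<close> not constant, the
  limit of the solutions differs from the solution for small positive times, since \<open>g^2 / 2\<close> is replaced by its mean.

  For mKdV, take \<open>g = 1\<close> and compare the product law along \<open>v\<^sub>n\<close> and along the solution starting at \<open>V0\<close>.
  If the solutions converged, the additional term \<open>c = 1 / 2\<close> in \<open>v^2\<close> would have to contribute nothing, which
  means that the variance of \<open>V0\<close> vanishes.
\<close>

section \<open>Smooth functions\<close>

text \<open>Weak convergence says nothing about squares, so the limit of v^2 has to be found by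
  other means. Put y = v + v_xx / n^2, which removes an oscillation of frequency n. Since y^2 - v^2
  equals v_xx^2 / n^4 - 2 v_x^2 / n^2 up to exact derivatives and small terms, the convexity bound
  y^2 \<ge> 2 y V0 - V0^2, linear in v, gives a lower bound for v^2 in terms of V0 and the two
  energy densities. These become constant in space because their products with the derivative of a
  test function appear in conservation laws whose remaining terms have lower order in n. A matching
  upper bound follows by applying the lower bound to a constant minus the weight, as the total mass
  is conserved; for KdV the lower bound with one well chosen weight gives the contradiction.

  The primitive of v is normalised at x = 0 and so moves with the flux at that point, which contains
  v_xx and is not bounded by the mass. The factor it puts on \<rho> and the opposite one on 1 /
  \<rho> cancel in the product of two pairings, which is why products and not single pairings are
  differentiated in time.\<close>

definition smooth :: "(real \<Rightarrow> real) \<Rightarrow> bool" where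
  "smooth f \<longleftrightarrow> (\<forall>n. (deriv ^^ n) f differentiable_on UNIV)"

lemma circle_iff: "f \<in> test_circle \<longleftrightarrow> periodic f \<and> smooth f"
  by (simp add: test_circle_def smooth_def)

text \<open>Smoothness treated coinductively: in a family closed under differentiation every
  iterated derivative stays in the family, so no closed formula for the n-th derivative is ever
  written down.\<close>

lemma smooth_coinduct:
  assumes "f \<in> S" and "\<And>g. g \<in> S \<Longrightarrow> \<exists>g'\<in>S. \<forall>x. (g has_real_derivative g' x) (at x)"
  shows "smooth f"
proof -
  have mem: "(deriv ^^ n) f \<in> S" for n
  proof (induction n)
    case (Suc n)
    then obtain g' where g': "g' \<in> S" "\<forall>x. ((deriv ^^ n) f has_real_derivative g' x) (at x)"
      using assms(2) by blast
    then have "deriv ((deriv ^^ n) f) = g'"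
      by (auto intro!: ext DERIV_imp_deriv)
    with g' show ?case by simp
  qed (simp add: assms)
  show ?thesis
    unfolding smooth_def
  proof
    fix n
    obtain g' where "\<forall>x. ((deriv ^^ n) f has_real_derivative g' x) (at x)"
      using assms(2)[OF mem] by blast
    then show "(deriv ^^ n) f differentiable_on UNIV"
      unfolding differentiable_on_def by (metis UNIV_I real_differentiable_def)
  qed
qed

lemma smooth_DERIV:
  assumes "smooth f" shows "(f has_real_derivative deriv f x) (at x)"
proof -
  have "(deriv ^^ 0) f differentiable_on UNIV"
    using assms unfolding smooth_def by blast
  then have "f differentiable at x" by (simp add: differentiable_on_def)
  then show ?thesis by (simp add: DERIV_deriv_iff_real_differentiable)
qed

lemma smooth_deriv:
  assumes "smooth f" shows "smooth (deriv f)"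
  unfolding smooth_def
proof
  fix n
  have "(deriv ^^ n) (deriv f) = (deriv ^^ Suc n) f" by (simp only: funpow_Suc_right comp_apply)
  then show "(deriv ^^ n) (deriv f) differentiable_on UNIV"
    using assms unfolding smooth_def by presburger
qed

lemma smooth_deriv_funpow: "smooth f \<Longrightarrow> smooth ((deriv ^^ n) f)"
  by (induction n) (auto intro: smooth_deriv)

lemma smooth_continuous: "smooth f \<Longrightarrow> continuous_on A f"
  by (meson DERIV_isCont continuous_at_imp_continuous_on smooth_DERIV)

text \<open>The ring generated by \<open>S\<close> and all smooth functions. By the product rule it
  is closed under differentiation as soon as the derivatives of the generators fall back into it, so
  generators may refer to each other, as a square root and its reciprocal do.\<close>

inductive_set smooth_algebra :: "(real \<Rightarrow> real) set \<Rightarrow> (real \<Rightarrow> real) set"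
  for S :: "(real \<Rightarrow> real) set" where
  "f \<in> S \<Longrightarrow> f \<in> smooth_algebra S"
| "smooth f \<Longrightarrow> f \<in> smooth_algebra S"
| "f \<in> smooth_algebra S \<Longrightarrow> g \<in> smooth_algebra S \<Longrightarrow> (\<lambda>x. f x + g x) \<in> smooth_algebra S"
| "f \<in> smooth_algebra S \<Longrightarrow> g \<in> smooth_algebra S \<Longrightarrow> (\<lambda>x. f x * g x) \<in> smooth_algebra S"

lemma smooth_algebra_smooth:
  assumes S: "\<And>g. g \<in> S \<Longrightarrow> \<exists>g'\<in>smooth_algebra S. \<forall>x. (g has_real_derivative g' x) (at x)"
    and "f \<in> smooth_algebra S"
  shows "smooth f"
  using assms(2)
proof (rule smooth_coinduct)
  fix g assume "g \<in> smooth_algebra S"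
  then show "\<exists>g'\<in>smooth_algebra S. \<forall>x. (g has_real_derivative g' x) (at x)"
  proof (induction rule: smooth_algebra.induct)
    case (1 f) then show ?case using S by blast
  next
    case (2 f) then show ?case
      by (meson smooth_DERIV smooth_algebra.intros(2) smooth_deriv)
  next
    case (3 f g)
    then obtain f' g' where
      "f' \<in> smooth_algebra S" "\<forall>x. (f has_real_derivative f' x) (at x)"
      "g' \<in> smooth_algebra S" "\<forall>x. (g has_real_derivative g' x) (at x)" by blast
    then show ?case
      by (intro bexI[of _ "\<lambda>x. f' x + g' x"])
        (auto intro!: smooth_algebra.intros(3) derivative_eq_intros)
  next
    case (4 f g)
    then obtain f' g' where
      "f' \<in> smooth_algebra S" "\<forall>x. (f has_real_derivative f' x) (at x)"
      "g' \<in> smooth_algebra S" "\<forall>x. (g has_real_derivative g' x) (at x)" by blast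
    with 4 show ?case
      by (intro bexI[of _ "\<lambda>x. f' x * g x + f x * g' x"])
        (auto intro!: smooth_algebra.intros(3,4) derivative_eq_intros)
  qed
qed

lemma smooth_algebra_empty: "f \<in> smooth_algebra {} \<Longrightarrow> smooth f"
  by (rule smooth_algebra_smooth) auto

lemma smooth_const [intro]: "smooth (\<lambda>x. c)"
  by (rule smooth_coinduct[of _ "range (\<lambda>c x. c)"]) (auto intro!: derivative_eq_intros exI[of _ 0])

lemma smooth_add [intro]: "smooth f \<Longrightarrow> smooth g \<Longrightarrow> smooth (\<lambda>x. f x + g x)"
  by (rule smooth_algebra_empty[OF smooth_algebra.intros(3)[OF smooth_algebra.intros(2) smooth_algebra.intros(2)]])

lemma smooth_mult [intro]: "smooth f \<Longrightarrow> smooth g \<Longrightarrow> smooth (\<lambda>x. f x * g x)"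
  by (rule smooth_algebra_empty[OF smooth_algebra.intros(4)[OF smooth_algebra.intros(2) smooth_algebra.intros(2)]])

lemma smooth_minus [intro]: "smooth f \<Longrightarrow> smooth (\<lambda>x. - f x)"
  using smooth_mult[of "\<lambda>_. - 1" f] by auto

lemma smooth_diff [intro]: "smooth f \<Longrightarrow> smooth g \<Longrightarrow> smooth (\<lambda>x. f x - g x)"
  using smooth_add[of f "\<lambda>x. - g x"] by auto

lemma smooth_power [intro]: "smooth f \<Longrightarrow> smooth (\<lambda>x. f x ^ n)"
  by (induction n) auto

lemma smooth_if_DERIV:
  assumes "\<And>x. (f has_real_derivative f' x) (at x)" "smooth f'"
  shows "smooth f"
proof (rule smooth_algebra_smooth[of "{f}"])
  show "f \<in> smooth_algebra {f}" by (intro smooth_algebra.intros(1)) simp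
qed (use assms smooth_algebra.intros(2) in blast)

lemma smooth_ident [intro]: "smooth (\<lambda>x. x)"
  by (rule smooth_if_DERIV[of _ "\<lambda>_. 1"]) auto

lemma smooth_cos_sin: "smooth cos" "smooth sin"
proof -
  let ?S = "{cos, sin, \<lambda>x. - cos x, \<lambda>x. - sin x :: real}"
  have *: "\<exists>g'\<in>?S. \<forall>x. (g has_real_derivative g' x) (at x)" if "g \<in> ?S" for g
  proof -
    consider "g = cos" | "g = sin" | "g = (\<lambda>x. - cos x)" | "g = (\<lambda>x. - sin x)"
      using \<open>g \<in> ?S\<close> by auto
    then show ?thesis
    proof cases
      case 1 show ?thesis unfolding 1
        by (rule bexI[of _ "\<lambda>x. - sin x"]) (auto simp: DERIV_cos)
    next
      case 2 show ?thesis unfolding 2 by (rule bexI[of _ cos]) (auto simp: DERIV_sin)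
    next
      case 3 show ?thesis unfolding 3
        by (rule bexI[of _ sin]) (auto intro: DERIV_cong[OF DERIV_minus[OF DERIV_cos]])
    next
      case 4 show ?thesis unfolding 4
        by (rule bexI[of _ "\<lambda>x. - cos x"]) (auto intro: DERIV_minus[OF DERIV_sin])
    qed
  qed
  show "smooth cos" by (rule smooth_coinduct[of cos ?S, OF _ *]) simp_all
  show "smooth sin" by (rule smooth_coinduct[of sin ?S, OF _ *]) simp_all
qed

lemma smooth_compose:
  assumes "smooth f" "smooth g"
  shows "smooth (\<lambda>x. f (g x))"
proof (rule smooth_algebra_smooth)
  let ?S = "{(\<lambda>x. f (g x)) | f. smooth f}"
  show "(\<lambda>x. f (g x)) \<in> smooth_algebra ?S"
    using assms by (intro smooth_algebra.intros(1)) auto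
  fix h assume "h \<in> ?S"
  then obtain f where f: "smooth f" and h: "h = (\<lambda>x. f (g x))" by (elim CollectE exE conjE)
  have "(\<lambda>x. deriv f (g x) * deriv g x) \<in> smooth_algebra ?S"
    using smooth_deriv[OF f] smooth_deriv[OF assms(2)]
    by (intro smooth_algebra.intros(4)[OF smooth_algebra.intros(1) smooth_algebra.intros(2)]) auto
  moreover have "(h has_real_derivative deriv f (g x) * deriv g x) (at x)" for x
    unfolding h by (rule DERIV_chain2[OF smooth_DERIV[OF f] smooth_DERIV[OF assms(2)]])
  ultimately show "\<exists>h'\<in>smooth_algebra ?S. \<forall>x. (h has_real_derivative h' x) (at x)"
    by (intro bexI[of _ "\<lambda>x. deriv f (g x) * deriv g x"] allI)
qed

lemma smooth_sqrt:
  assumes "smooth p" "\<And>x. p x > 0"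
  shows "smooth (\<lambda>x. sqrt (p x))"
proof (rule smooth_algebra_smooth)
  \<comment> \<open>The derivative of the root involves its reciprocal, and that of the reciprocal
    is a polynomial in it and \<open>deriv p\<close>; the pair is closed where the root alone is
    not.\<close>
  let ?S = "{\<lambda>x. sqrt (p x), \<lambda>x. inverse (sqrt (p x))}"
  let ?g' = "\<lambda>x. (1/2) * (deriv p x * inverse (sqrt (p x)))"
  let ?r' = "\<lambda>x. (-1) * (inverse (sqrt (p x)) * (inverse (sqrt (p x)) * ?g' x))"
  have mem: "?g' \<in> smooth_algebra ?S"
    by (rule smooth_algebra.intros(4)[OF smooth_algebra.intros(2)[OF smooth_const] smooth_algebra.intros(4)
        [OF smooth_algebra.intros(2)[OF smooth_deriv[OF assms(1)]] smooth_algebra.intros(1)]]) simp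
  have *: "((\<lambda>x. sqrt (p x)) has_real_derivative ?g' x) (at x)" for x
    by (rule DERIV_cong[OF DERIV_chain2[OF DERIV_real_sqrt[OF assms(2)] smooth_DERIV[OF assms(1)]]])
      simp
  have **: "((\<lambda>x. inverse (sqrt (p x))) has_real_derivative ?r' x) (at x)" for x
    by (rule DERIV_cong[OF DERIV_inverse_fun[OF *]])
      (use assms(2)[of x] in \<open>auto simp flip: inverse_mult_distrib\<close>)
  have mem2: "?r' \<in> smooth_algebra ?S"
    by (rule smooth_algebra.intros(4), rule smooth_algebra.intros(2), rule smooth_const,
        rule smooth_algebra.intros(4), rule smooth_algebra.intros(1), simp,
        rule smooth_algebra.intros(4), rule smooth_algebra.intros(1), simp, rule mem)
  show "\<exists>g'\<in>smooth_algebra ?S. \<forall>x. (g has_real_derivative g' x) (at x)" if g: "g \<in> ?S" for g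
  proof -
    consider "g = (\<lambda>x. sqrt (p x))" | "g = (\<lambda>x. inverse (sqrt (p x)))" using g by auto
    then show ?thesis
    proof cases
      case 1 show ?thesis unfolding 1 by (rule bexI[OF _ mem]) (rule allI, rule *)
    next
      case 2 show ?thesis unfolding 2 by (rule bexI[OF _ mem2]) (rule allI, rule **)
    qed
  qed
  show "(\<lambda>x. sqrt (p x)) \<in> smooth_algebra ?S"
    by (intro smooth_algebra.intros(1)) simp
qed

section \<open>Flat exponentials and bump functions\<close>

definition flat_exp :: "nat \<Rightarrow> real \<Rightarrow> real" where
  "flat_exp k x = (if x > 0 then inverse x ^ k * exp (- inverse x) else 0)"

text \<open>The powers \<open>k\<close> are carried along because differentiation raises them; the
  family as a whole is closed. At the origin the difference quotient of \<open>flat_exp k\<close> is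
  \<open>flat_exp (k + 1)\<close>, which tends to 0 since the exponential beats every power.\<close>

lemma flat_exp_DERIV:
  "(flat_exp k has_real_derivative - real k * flat_exp (k + 1) x + flat_exp (k + 2) x) (at x)"
proof -
  consider "x > 0" | "x < 0" | "x = 0" by linarith
  then show ?thesis
  proof cases
    case 1
    have "((\<lambda>x. inverse x ^ k) has_real_derivative - real k * inverse x ^ (k + 1)) (at x)"
    proof (rule DERIV_cong[OF DERIV_power[OF DERIV_inverse]])
      show "real k * (- (inverse x ^ Suc (Suc 0)) * inverse x ^ (k - Suc 0)) = - real k * inverse x ^ (k + 1)"
        by (cases k) (simp_all only: power_Suc power_0 of_nat_0 mult_zero_left diff_Suc_Suc minus_nat.diff_0
            add_Suc_right add_0_right minus_zero mult_1_right mult_ac mult_minus_left mult_minus_right One_nat_def)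
    qed (use 1 in simp)
    moreover have "((\<lambda>x. exp (- inverse x)) has_real_derivative exp (- inverse x) * inverse x ^ 2) (at x)"
      by (rule DERIV_cong[OF DERIV_fun_exp[OF DERIV_minus[OF DERIV_inverse]]])
        (use 1 in \<open>simp_all add: power2_eq_square\<close>)
    ultimately have "((\<lambda>x. inverse x ^ k * exp (- inverse x)) has_real_derivative
        - real k * flat_exp (k + 1) x + flat_exp (k + 2) x) (at x)"
      by (rule DERIV_cong[OF DERIV_mult])
        (use 1 in \<open>simp add: flat_exp_def algebra_simps power2_eq_square\<close>)
    then show ?thesis
      by (rule has_field_derivative_transform_within_open[of _ _ _ "{0<..}"])
        (use 1 in \<open>auto simp: flat_exp_def\<close>)
  next
    case 2
    have "((\<lambda>x. 0) has_real_derivative - real k * flat_exp (k + 1) x + flat_exp (k + 2) x) (at x)"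
      using 2 by (auto simp: flat_exp_def)
    then show ?thesis
      by (rule has_field_derivative_transform_within_open[of _ _ _ "{..<0}"])
        (use 2 in \<open>auto simp: flat_exp_def\<close>)
  next
    case 3
    have lim: "((\<lambda>y. flat_exp (k + 1) y) \<longlongrightarrow> 0) (at 0)"
    proof -
      have "((\<lambda>z. z ^ (k + 1) / exp z) \<longlongrightarrow> (0 :: real)) at_top"
        by (rule tendsto_power_div_exp_0)
      then have "((\<lambda>y. inverse y ^ (k + 1) / exp (inverse y)) \<longlongrightarrow> (0 :: real)) (at_right 0)"
        by (rule filterlim_compose[OF _ filterlim_inverse_at_top_right])
      then have r: "((\<lambda>y. flat_exp (k + 1) y) \<longlongrightarrow> 0) (at_right 0)"
        by (rule Lim_transform_eventually)
          (auto simp: eventually_at_right_field flat_exp_def exp_minus field_simps intro: exI[of _ 1])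
      have "((\<lambda>y. 0 :: real) \<longlongrightarrow> 0) (at_left (0 :: real))" by simp
      then have l: "((\<lambda>y. flat_exp (k + 1) y) \<longlongrightarrow> 0) (at_left 0)"
        by (rule Lim_transform_eventually)
          (auto simp: eventually_at_left_field flat_exp_def intro: exI[of _ "-1"])
      show ?thesis using r l by (simp add: filterlim_at_split)
    qed
    have "((\<lambda>y. (flat_exp k y - flat_exp k 0) / (y - 0)) \<longlongrightarrow> 0) (at 0)"
      using lim by (rule Lim_transform_eventually)
        (auto simp: eventually_at flat_exp_def divide_inverse intro!: exI[of _ 1])
    then have "(flat_exp k has_real_derivative 0) (at 0)"
      by (simp add: has_field_derivative_iff)
    then show ?thesis using 3 by (simp add: flat_exp_def)
  qed
qed

lemma flat_exp_smooth: "smooth (flat_exp k)"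
proof (rule smooth_algebra_smooth)
  show "flat_exp k \<in> smooth_algebra (range flat_exp)"
    by (intro smooth_algebra.intros(1)) auto
  fix g assume "g \<in> range flat_exp"
  then obtain k where k: "g = flat_exp k" by blast
  have "(\<lambda>x. - real k * flat_exp (k + 1) x + flat_exp (k + 2) x) \<in> smooth_algebra (range flat_exp)"
    by (rule smooth_algebra.intros(3), rule smooth_algebra.intros(4), rule smooth_algebra.intros(2),
        rule smooth_const) (rule smooth_algebra.intros(1), simp)+
  then show "\<exists>g'\<in>smooth_algebra (range flat_exp). \<forall>x. (g has_real_derivative g' x) (at x)"
    unfolding k by (rule bexI[rotated]) (rule allI, rule flat_exp_DERIV)
qed

definition bump :: "real \<Rightarrow> real \<Rightarrow> real \<Rightarrow> real" where
  "bump a b t = flat_exp 0 (t - a) * flat_exp 0 (b - t)"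

lemma bump_smooth: "smooth (bump a b)"
  unfolding bump_def[abs_def]
  by (rule smooth_mult[OF smooth_compose[OF flat_exp_smooth smooth_diff[OF smooth_ident smooth_const]]
      smooth_compose[OF flat_exp_smooth smooth_diff[OF smooth_const smooth_ident]]])

lemma bump_pos: "a < t \<Longrightarrow> t < b \<Longrightarrow> bump a b t > 0"
  and bump_nonneg: "bump a b t \<ge> 0"
  and bump_zero: "t \<notin> {a<..<b} \<Longrightarrow> bump a b t = 0"
  by (auto simp: bump_def flat_exp_def)

section \<open>Smooth periodic functions\<close>

lemma periodic_deriv:
  assumes "periodic f" "\<And>x. (f has_real_derivative f' x) (at x)"
  shows "periodic f'"
  unfolding periodic_def
proof
  fix x
  have "((\<lambda>x. f (x + 2 * pi)) has_real_derivative f' (x + 2 * pi)) (at x)"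
    using assms(2)[of "x + 2 * pi"] by (simp add: DERIV_shift)
  then have "(f has_real_derivative f' (x + 2 * pi)) (at x)"
    using assms(1) by (simp add: periodic_def)
  then show "f' (x + 2 * pi) = f' x" using assms(2) DERIV_unique by blast
qed

lemma circle_DERIV: "f \<in> test_circle \<Longrightarrow> (f has_real_derivative deriv f x) (at x)"
  by (simp add: circle_iff smooth_DERIV)

lemma circle_deriv: "f \<in> test_circle \<Longrightarrow> deriv f \<in> test_circle"
  using periodic_deriv smooth_DERIV smooth_deriv by (auto simp: circle_iff)

lemma circle_deriv_funpow: "f \<in> test_circle \<Longrightarrow> (deriv ^^ n) f \<in> test_circle"
  by (induction n) (auto intro: circle_deriv)

lemma circle_DERIV_funpow:
  "f \<in> test_circle \<Longrightarrow> ((deriv ^^ n) f has_real_derivative (deriv ^^ Suc n) f x) (at x)"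
  using circle_DERIV[OF circle_deriv_funpow] by simp

lemma circle_continuous: "f \<in> test_circle \<Longrightarrow> continuous_on A f"
  by (simp add: circle_iff smooth_continuous)

lemma circle_periodic: "f \<in> test_circle \<Longrightarrow> f (x + 2 * pi) = f x"
  by (simp add: circle_iff periodic_def)

lemma circle_const [intro]: "(\<lambda>x. c) \<in> test_circle"
  by (auto simp: circle_iff periodic_def)

lemma circle_add [intro]:
  "f \<in> test_circle \<Longrightarrow> g \<in> test_circle \<Longrightarrow> (\<lambda>x. f x + g x) \<in> test_circle"
  by (auto simp: circle_iff periodic_def)

lemma circle_diff [intro]:
  "f \<in> test_circle \<Longrightarrow> g \<in> test_circle \<Longrightarrow> (\<lambda>x. f x - g x) \<in> test_circle"
  by (auto simp: circle_iff periodic_def)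

lemma circle_mult [intro]:
  "f \<in> test_circle \<Longrightarrow> g \<in> test_circle \<Longrightarrow> (\<lambda>x. f x * g x) \<in> test_circle"
  by (auto simp: circle_iff periodic_def)

lemma circle_minus [intro]: "f \<in> test_circle \<Longrightarrow> (\<lambda>x. - f x) \<in> test_circle"
  by (auto simp: circle_iff periodic_def)

lemma circle_power [intro]: "f \<in> test_circle \<Longrightarrow> (\<lambda>x. f x ^ n) \<in> test_circle"
  by (auto simp: circle_iff periodic_def)

lemma circle_shift:
  assumes "f \<in> test_circle" shows "(\<lambda>x. f (x + a)) \<in> test_circle"
proof -
  have "smooth (\<lambda>x. f (x + a))"
    by (rule smooth_compose[OF _ smooth_add[OF smooth_ident smooth_const]])
      (use assms in \<open>simp add: circle_iff\<close>)
  moreover have "f (x + 2 * pi + a) = f (x + a)" for x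
    using circle_periodic[OF assms, of "x + a"] by (simp add: add_ac)
  ultimately show ?thesis by (simp add: circle_iff periodic_def)
qed

lemma circle_trig [intro]:
  "(\<lambda>x. cos (of_int k * x)) \<in> test_circle" "(\<lambda>x. sin (of_int k * x)) \<in> test_circle"
proof -
  have "smooth (\<lambda>x. cos (of_int k * x))" "smooth (\<lambda>x. sin (of_int k * x))"
    by (rule smooth_compose[OF smooth_cos_sin(1) smooth_mult[OF smooth_const smooth_ident]]
        smooth_compose[OF smooth_cos_sin(2) smooth_mult[OF smooth_const smooth_ident]])+
  moreover have "cos (of_int k * (x + 2 * pi)) = cos (of_int k * x)"
    "sin (of_int k * (x + 2 * pi)) = sin (of_int k * x)" for x
    using sin_cos_eq_iff[of "of_int k * (x + 2 * pi)" "of_int k * x"]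
    by (auto simp: algebra_simps)
  ultimately show "(\<lambda>x. cos (of_int k * x)) \<in> test_circle" "(\<lambda>x. sin (of_int k * x)) \<in> test_circle"
    by (auto simp: circle_iff periodic_def)
qed

lemma circle_trig_nat [intro]:
  "(\<lambda>x. cos (real n * x)) \<in> test_circle" "(\<lambda>x. sin (real n * x)) \<in> test_circle"
  using circle_trig[of "int n"] by simp_all

lemma circle_sqrt:
  "p \<in> test_circle \<Longrightarrow> (\<And>x. p x > 0) \<Longrightarrow> (\<lambda>x. sqrt (p x)) \<in> test_circle"
  using smooth_sqrt by (auto simp: circle_iff periodic_def)

lemma periodic_add_int:
  assumes "periodic f" shows "f (x + of_int k * (2 * pi)) = f x"
proof -
  have *: "f (x + real n * (2 * pi)) = f x" for n x
  proof (induction n)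
    case (Suc n)
    have "f (x + real (Suc n) * (2 * pi)) = f ((x + real n * (2 * pi)) + 2 * pi)"
      by (simp add: algebra_simps)
    then show ?case using assms Suc by (simp add: periodic_def)
  qed simp
  show ?thesis
  proof (cases k)
    case (nonneg n) then show ?thesis using *[of x n] by simp
  next
    case neg: (neg n)
    show ?thesis
      using *[of "x + of_int k * (2 * pi)" "Suc n"] by (simp add: neg algebra_simps)
  qed
qed

lemma periodic_reduce:
  assumes "periodic (f :: real \<Rightarrow> 'a)"
  obtains y where "y \<in> {0..<2 * pi}" "f y = f x"
proof
  let ?y = "x + of_int (- \<lfloor>x / (2 * pi)\<rfloor>) * (2 * pi)"
  show "f ?y = f x" using periodic_add_int[OF assms] .
  have "of_int \<lfloor>x / (2 * pi)\<rfloor> * (2 * pi) \<le> x"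
    by (metis floor_divide_lower mult_pos_pos pi_gt_zero zero_less_numeral)
  moreover have "x < (of_int \<lfloor>x / (2 * pi)\<rfloor> + 1) * (2 * pi)"
    by (rule floor_divide_upper) simp
  ultimately show "?y \<in> {0..<2 * pi}" by (simp add: algebra_simps)
qed

lemma periodic_bounded:
  assumes "periodic f" "continuous_on UNIV (f :: real \<Rightarrow> real)"
  obtains B where "B > 0" "\<And>x. \<bar>f x\<bar> \<le> B"
proof -
  have "compact (f ` {0..2 * pi})"
    by (intro compact_continuous_image continuous_on_subset[OF assms(2)]) auto
  then have "\<exists>b>0. \<forall>y\<in>f ` {0..2 * pi}. norm y \<le> b"
    by (rule bounded_pos[THEN iffD1, OF compact_imp_bounded])
  then obtain B where B: "B > 0" "\<forall>y\<in>f ` {0..2 * pi}. norm y \<le> B"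
    by blast
  have "\<bar>f x\<bar> \<le> B" for x
  proof -
    obtain y where "y \<in> {0..<2 * pi}" "f y = f x" using periodic_reduce[OF assms(1)] .
    then have "f x \<in> f ` {0..2 * pi}" by (intro image_eqI[of _ _ y]) auto
    then show ?thesis using B(2) by auto
  qed
  with B that show thesis by blast
qed

lemma circle_bounded:
  assumes "f \<in> test_circle"
  obtains B where "B > 0" "\<And>x. \<bar>f x\<bar> \<le> B"
  using periodic_bounded[of f] assms circle_continuous by (auto simp: circle_iff)

section \<open>Integrals of continuous functions\<close>

lemma int_add:
  fixes f g :: "real \<Rightarrow> 'a::banach"
  assumes "continuous_on {a..b} f" "continuous_on {a..b} g"
  shows "integral {a..b} (\<lambda>x. f x + g x) = integral {a..b} f + integral {a..b} g"
  by (intro integral_add integrable_continuous_real assms)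

lemma int_diff:
  fixes f g :: "real \<Rightarrow> 'a::banach"
  assumes "continuous_on {a..b} f" "continuous_on {a..b} g"
  shows "integral {a..b} (\<lambda>x. f x - g x) = integral {a..b} f - integral {a..b} g"
  by (intro integral_diff integrable_continuous_real assms)

lemmas int_split = int_add int_diff

lemma int_mono:
  fixes f g :: "real \<Rightarrow> real"
  assumes "continuous_on {a..b} f" "continuous_on {a..b} g" "\<And>x. x \<in> {a..b} \<Longrightarrow> f x \<le> g x"
  shows "integral {a..b} f \<le> integral {a..b} g"
  by (intro integral_le integrable_continuous_real assms)

lemma int_nonneg:
  fixes f :: "real \<Rightarrow> real"
  assumes "continuous_on {a..b} f" "\<And>x. x \<in> {a..b} \<Longrightarrow> 0 \<le> f x"
  shows "0 \<le> integral {a..b} f"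
  by (intro integral_nonneg integrable_continuous_real assms)

lemma int_norm_le:
  fixes f :: "real \<Rightarrow> 'a::banach"
  assumes "continuous_on {a..b} f" "continuous_on {a..b} g" "\<And>x. x \<in> {a..b} \<Longrightarrow> norm (f x) \<le> g x"
  shows "norm (integral {a..b} f) \<le> integral {a..b} g"
  by (intro integral_norm_bound_integral integrable_continuous_real assms)

lemma int_norm_le_const:
  fixes f :: "real \<Rightarrow> 'a::banach"
  assumes "continuous_on {a..b} f" "a \<le> b" "\<And>x. x \<in> {a..b} \<Longrightarrow> norm (f x) \<le> B"
  shows "norm (integral {a..b} f) \<le> B * (b - a)"
  using integral_bound[OF assms(2,1)] assms(3) by blast

lemma int_mult_le:
  fixes f g :: "real \<Rightarrow> 'a::{banach, real_normed_algebra}"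
  assumes "continuous_on {a..b} f" "continuous_on {a..b} g" "\<And>x. x \<in> {a..b} \<Longrightarrow> norm (f x) \<le> B"
  shows "norm (integral {a..b} (\<lambda>x. f x * g x)) \<le> B * integral {a..b} (\<lambda>x. norm (g x))"
proof -
  have "norm (integral {a..b} (\<lambda>x. f x * g x)) \<le> integral {a..b} (\<lambda>x. B * norm (g x))"
    by (rule int_norm_le)
      (use assms in \<open>auto intro!: continuous_intros order_trans[OF norm_mult_ineq] mult_right_mono\<close>)
  then show ?thesis by simp
qed

lemma int_square_nonneg:
  fixes f :: "real \<Rightarrow> real"
  shows "continuous_on {a..b} f \<Longrightarrow> 0 \<le> integral {a..b} (\<lambda>x. (f x)^2)"
  by (intro int_nonneg continuous_intros) auto

lemma int_Cauchy_Schwarz: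
  fixes f g :: "real \<Rightarrow> real"
  assumes f: "continuous_on {a..b} f" and g: "continuous_on {a..b} g"
  shows "(integral {a..b} (\<lambda>x. f x * g x))^2
    \<le> integral {a..b} (\<lambda>x. (f x)^2) * integral {a..b} (\<lambda>x. (g x)^2)"
proof -
  let ?A = "integral {a..b} (\<lambda>x. (f x)^2)" and ?B = "integral {a..b} (\<lambda>x. f x * g x)"
    and ?C = "integral {a..b} (\<lambda>x. (g x)^2)"
  have A: "?A \<ge> 0" and C: "?C \<ge> 0" using assms by (auto intro: int_square_nonneg)
  \<comment> \<open>A homogeneous form in (s, r): the later choice s = \<open>?C\<close>, r =
    \<open>?B\<close> yields the inequality without dividing by \<open>?B\<close>, and for
    \<open>?C = 0\<close> the form is affine in r, which forces \<open>?B = 0\<close>.\<close>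
  have quad: "0 \<le> s^2 * ?A - 2 * s * r * ?B + r^2 * ?C" for s r
  proof -
    have "0 \<le> integral {a..b} (\<lambda>x. (s * f x - r * g x)^2)"
      by (intro int_square_nonneg continuous_intros f g)
    also have "(\<lambda>x. (s * f x - r * g x)^2)
        = (\<lambda>x. (s^2 * (f x)^2 - (2 * s * r) * (f x * g x)) + r^2 * (g x)^2)"
      by (auto simp: power2_eq_square algebra_simps)
    also have "integral {a..b} \<dots> = s^2 * ?A - 2 * s * r * ?B + r^2 * ?C"
      by (subst int_add, (intro continuous_intros f g)+, subst int_diff, (intro continuous_intros f g)+) simp
    finally show ?thesis .
  qed
  show ?thesis
  proof (cases "?C = 0")
    case True
    have "?B = 0"
    proof (rule ccontr)
      assume B: "?B \<noteq> 0"
      have "0 \<le> ?A - 2 * ((?A + 1) / ?B) * ?B" using quad[of 1 "(?A + 1) / ?B"] True by simp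
      also have "\<dots> = - ?A - 2" using B by (simp add: field_simps)
      finally show False using A by simp
    qed
    then show ?thesis using A C by simp
  next
    case False
    then have "?C > 0" using C by simp
    have "0 \<le> ?C^2 * ?A - 2 * ?C * ?B * ?B + ?B^2 * ?C" by (rule quad)
    also have "\<dots> = ?C * (?C * ?A - ?B^2)" by (simp add: power2_eq_square algebra_simps)
    finally show ?thesis using \<open>?C > 0\<close> by (simp add: zero_le_mult_iff mult.commute)
  qed
qed

lemma int_abs_le_sqrt:
  fixes f g :: "real \<Rightarrow> real"
  assumes "continuous_on {a..b} f" "continuous_on {a..b} g"
  shows "\<bar>integral {a..b} (\<lambda>x. f x * g x)\<bar>
    \<le> sqrt (integral {a..b} (\<lambda>x. (f x)^2)) * sqrt (integral {a..b} (\<lambda>x. (g x)^2))"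
  using real_le_rsqrt[OF int_Cauchy_Schwarz[OF assms]] by (metis power2_abs real_le_rsqrt real_sqrt_mult
      int_Cauchy_Schwarz[OF assms])

lemma int_abs_product_le:
  fixes f g :: "real \<Rightarrow> real"
  assumes "continuous_on {a..b} f" "continuous_on {a..b} g"
  shows "integral {a..b} (\<lambda>x. \<bar>f x * g x\<bar>)
    \<le> sqrt (integral {a..b} (\<lambda>x. (f x)^2)) * sqrt (integral {a..b} (\<lambda>x. (g x)^2))"
  using int_abs_le_sqrt[of a b "\<lambda>x. \<bar>f x\<bar>" "\<lambda>x. \<bar>g x\<bar>"] assms
  by (auto simp: abs_mult continuous_intros)

lemma int_abs_le_sqrt_length:
  fixes f :: "real \<Rightarrow> real"
  assumes "continuous_on {a..b} f" "a \<le> b"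
  shows "integral {a..b} (\<lambda>x. \<bar>f x\<bar>) \<le> sqrt (b - a) * sqrt (integral {a..b} (\<lambda>x. (f x)^2))"
  using int_abs_product_le[of a b "\<lambda>x. 1" f] assms by simp

lemma int_of_real:
  fixes a b :: real
  assumes "continuous_on {a..b} k"
  shows "integral {a..b} (\<lambda>x. of_real (k x) :: complex) = of_real (integral {a..b} k)"
  using integral_linear[OF integrable_continuous_real[OF assms] bounded_linear_of_real] by (simp add: o_def)

lemma int_zero_imp_zero:
  fixes f :: "real \<Rightarrow> real"
  assumes "continuous_on {a..b} f" "integral {a..b} (\<lambda>x. (f x)^2) \<le> 0" "x \<in> {a..b}" "a < b"
  shows "f x = 0"
proof -
  have "integral {a..b} (\<lambda>x. (f x)^2) = 0"
    using int_square_nonneg[OF assms(1)] assms(2) by simp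
  then have "\<forall>x\<in>{a..b}. (f x)^2 = 0"
    using assms by (subst (asm) integral_eq_0_iff) (auto intro!: continuous_intros)
  then show ?thesis using assms(3) by simp
qed

section \<open>Primitives, integration by parts and shifts over a period\<close>

definition prim :: "(real \<Rightarrow> real) \<Rightarrow> real \<Rightarrow> real" where
  "prim f x = (if 0 \<le> x then integral {0..x} f else - integral {x..0} f)"

lemma prim_DERIV:
  assumes f: "continuous_on UNIV f"
  shows "(prim f has_real_derivative f x) (at x)"
proof -
  \<comment> \<open>A base point \<open>-R\<close> to the left of both 0 and x lets one indefinite
    integral represent \<open>prim\<close> near x, whatever the sign of x.\<close>
  define R where "R = \<bar>x\<bar> + 1"
  have int: "f integrable_on {c..d}" for c d
    by (intro integrable_continuous_real continuous_on_subset[OF f]) auto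
  have eq: "prim f y = integral {-R..y} f - integral {-R..0} f" if "y \<in> {-R<..<R}" for y
  proof (cases "0 \<le> y")
    case True
    then show ?thesis
      using Henstock_Kurzweil_Integration.integral_combine[where a="-R" and c=0 and b=y and f=f] int that by (simp add: prim_def R_def)
  next
    case False
    then show ?thesis
      using Henstock_Kurzweil_Integration.integral_combine[where a="-R" and c=y and b=0 and f=f] int that by (simp add: prim_def R_def)
  qed
  have "((\<lambda>y. integral {-R..y} f) has_real_derivative f x) (at x within {-R..R})"
    by (rule integral_has_real_derivative) (auto intro: continuous_on_subset[OF f] simp: R_def)
  then have "((\<lambda>y. integral {-R..y} f) has_real_derivative f x) (at x)"
    by (subst (asm) at_within_interior) (auto simp: R_def)
  then have "((\<lambda>y. integral {-R..y} f - integral {-R..0} f) has_real_derivative f x) (at x)"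
    by (auto intro!: derivative_eq_intros)
  then show ?thesis
    by (rule has_field_derivative_transform_within_open[of _ _ _ "{-R<..<R}"])
      (auto simp: eq R_def)
qed

lemma prim_0 [simp]: "prim f 0 = 0" by (simp add: prim_def)

lemma int_FTC:
  fixes F :: "real \<Rightarrow> real"
  assumes "\<And>x. (F has_real_derivative f x) (at x)" "a \<le> b"
  shows "integral {a..b} f = F b - F a"
  by (intro integral_unique fundamental_theorem_of_calculus assms(2))
    (use assms(1) in \<open>auto simp: has_real_derivative_iff_has_vector_derivative[symmetric]
      intro: has_field_derivative_at_within\<close>)

abbreviation cint :: "(real \<Rightarrow> 'a::real_normed_vector) \<Rightarrow> 'a" (binder "CI " 10) where
  "cint f \<equiv> integral {0..2 * pi} f"

lemma cint_prim: "prim f (2 * pi) = cint f" by (simp add: prim_def)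

lemma cint_deriv_zero:
  fixes F :: "real \<Rightarrow> real"
  assumes "\<And>x. (F has_real_derivative f x) (at x)" "F (2 * pi) = F 0"
  shows "cint f = 0"
  using int_FTC[of F f 0 "2 * pi"] assms by simp

lemma prim_shift_period:
  assumes "continuous_on UNIV f" "periodic f"
  shows "prim f (x + 2 * pi) = prim f x + cint f"
proof -
  have "((\<lambda>x. prim f (x + 2 * pi) - prim f x) has_real_derivative 0) (at x)" for x
  proof -
    have "((\<lambda>x. prim f (x + 2 * pi)) has_real_derivative f x) (at x)"
      using prim_DERIV[OF assms(1), of "x + 2 * pi"] assms(2) by (simp add: DERIV_shift periodic_def)
    from DERIV_diff[OF this prim_DERIV[OF assms(1), of x]] show ?thesis by simp
  qed
  then have "prim f (x + 2 * pi) - prim f x = prim f (0 + 2 * pi) - prim f 0"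
    by (intro DERIV_isconst_all) auto
  then show ?thesis by (simp add: cint_prim)
qed

lemma cint_shift:
  assumes "continuous_on UNIV f" "periodic (f :: real \<Rightarrow> real)"
  shows "(CI x. f (x + a)) = cint f"
proof -
  have "((\<lambda>x. prim f (x + a)) has_real_derivative f (x + a)) (at x)" for x
    using prim_DERIV[OF assms(1), of "x + a"] by (simp add: DERIV_shift)
  then have "(CI x. f (x + a)) = prim f (2 * pi + a) - prim f (0 + a)"
    by (rule int_FTC) simp
  then show ?thesis using prim_shift_period[OF assms, of a] by (simp add: add.commute)
qed

lemma prim_test_circle:
  assumes "f \<in> test_circle" "cint f = 0"
  shows "prim f \<in> test_circle"
proof -
  have c: "continuous_on UNIV f" by (rule circle_continuous[OF assms(1)])
  have "smooth (prim f)"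
    using assms(1) by (intro smooth_if_DERIV[OF prim_DERIV[OF c]]) (simp add: circle_iff)
  then show ?thesis
    using prim_shift_period[OF c] assms by (auto simp: circle_iff periodic_def)
qed

lemma cint_ibp:
  assumes "\<And>x. (f has_real_derivative f' x) (at x)" "\<And>x. (g has_real_derivative g' x) (at x)"
    and "continuous_on UNIV f'" "continuous_on UNIV g'" "f (2 * pi) * g (2 * pi) = f 0 * g 0"
  shows "(CI x. f' x * g x) = - (CI x. f x * g' x)"
proof -
  have c: "continuous_on A f" "continuous_on A g" for A
    using assms(1,2) by (meson DERIV_isCont continuous_at_imp_continuous_on)+
  have "((\<lambda>x. f x * g x) has_real_derivative f' x * g x + f x * g' x) (at x)" for x
    using DERIV_mult[OF assms(1,2)] by (simp add: algebra_simps)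
  then have "(CI x. f' x * g x + f x * g' x) = 0"
    by (rule cint_deriv_zero) (use assms in simp)
  moreover have "(CI x. f' x * g x + f x * g' x) = (CI x. f' x * g x) + (CI x. f x * g' x)"
    by (intro int_add continuous_intros c continuous_on_subset[OF assms(3)] continuous_on_subset[OF assms(4)]) auto
  ultimately show ?thesis by simp
qed

lemma circle_period_eq: "f \<in> test_circle \<Longrightarrow> f (2 * pi) = f 0"
  using circle_periodic[of f 0] by simp

lemma cint_ibp_test_circle:
  assumes "f \<in> test_circle" "g \<in> test_circle"
  shows "(CI x. deriv f x * g x) = - (CI x. f x * deriv g x)"
  by (rule cint_ibp) (use assms in \<open>auto intro: circle_DERIV circle_continuous
      circle_deriv simp: circle_period_eq\<close>)

lemma lborel_integral_eq_cint:
  fixes f :: "real \<Rightarrow> real"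
  assumes "continuous_on UNIV f"
  shows "(LINT x:{a..b}|lborel. f x) = integral {a..b} f"
  by (intro set_borel_integral_eq_integral borel_integrable_atLeastAtMost' continuous_on_subset[OF assms]) auto

section \<open>Fourier coefficients\<close>

definition fc :: "(real \<Rightarrow> real) \<Rightarrow> int \<Rightarrow> real" where
  "fc f k = (CI x. f x * cos (of_int k * x))"

definition fs :: "(real \<Rightarrow> real) \<Rightarrow> int \<Rightarrow> real" where
  "fs f k = (CI x. f x * sin (of_int k * x))"

lemma circle_distr_eq:
  assumes "continuous_on UNIV f" "\<phi> \<in> test_circle"
  shows "circle_distr f \<phi> = (CI x. f x * \<phi> x)"
  using assms unfolding circle_distr_def
  by (simp add: lborel_integral_eq_cint continuous_on_mult circle_continuous)

lemma cmod_fourier_coeff: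
  assumes "continuous_on UNIV f"
  shows "(cmod (fourier_coeff (circle_distr f) k))^2 = ((fc f k)^2 + (fs f k)^2) / (2 * pi)^2"
proof -
  have "fourier_coeff (circle_distr f) k = Complex (fc f k) (- fs f k) / of_real (2 * pi)"
    by (simp add: fourier_coeff_def circle_distr_eq[OF assms circle_trig(1)]
        circle_distr_eq[OF assms circle_trig(2)] fc_def fs_def)
  then have "cmod (fourier_coeff (circle_distr f) k) = cmod (Complex (fc f k) (- fs f k)) / (2 * pi)"
    by (simp only: norm_divide norm_of_real) simp
  then show ?thesis
    by (simp add: power_divide cmod_power2)
qed

lemma sobolev_term_eq:
  assumes "continuous_on UNIV f"
  shows "sobolev_term s (circle_distr f) k
    = (1 + (of_int k)^2) powr s * (((fc f k)^2 + (fs f k)^2) / (2 * pi)^2)"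
  by (simp add: sobolev_term_def cmod_fourier_coeff[OF assms])

lemma sobolev_term_nonneg: "sobolev_term s U k \<ge> 0"
  by (simp add: sobolev_term_def)

lemma fc_fs_deriv:
  assumes "f \<in> test_circle"
  shows "fc (deriv f) k = of_int k * fs f k" "fs (deriv f) k = - of_int k * fc f k"
proof -
  have c: "continuous_on A f" "continuous_on A (deriv f)" for A
    by (rule circle_continuous[OF assms] circle_continuous[OF circle_deriv[OF assms]])+
  have "(CI x. deriv f x * cos (of_int k * x)) = - (CI x. f x * (- sin (of_int k * x) * of_int k))"
    by (rule cint_ibp)
      (auto intro!: circle_DERIV[OF assms] derivative_eq_intros continuous_intros c
        simp: circle_period_eq[OF assms] circle_period_eq[OF circle_trig(1)])
  also have "(\<lambda>x. f x * (- sin (of_int k * x) * of_int k)) = (\<lambda>x. - of_int k * (f x * sin (of_int k * x)))"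
    by auto
  finally show "fc (deriv f) k = of_int k * fs f k" by (simp add: fc_def fs_def)
  have "(CI x. deriv f x * sin (of_int k * x)) = - (CI x. f x * (cos (of_int k * x) * of_int k))"
    by (rule cint_ibp)
      (auto intro!: circle_DERIV[OF assms] derivative_eq_intros continuous_intros c
        simp: circle_period_eq[OF assms] circle_period_eq[OF circle_trig(2)])
  also have "(\<lambda>x. f x * (cos (of_int k * x) * of_int k)) = (\<lambda>x. of_int k * (f x * cos (of_int k * x)))"
    by auto
  finally show "fs (deriv f) k = - of_int k * fc f k" by (simp add: fc_def fs_def)
qed

lemma fc_fs_bound:
  assumes "continuous_on UNIV f" "\<And>x. \<bar>f x\<bar> \<le> B"
  shows "\<bar>fc f k\<bar> \<le> 2 * pi * B" "\<bar>fs f k\<bar> \<le> 2 * pi * B"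
proof -
  have B: "0 \<le> B" using assms(2)[of 0] by linarith
  have *: "\<bar>f x * y\<bar> \<le> B" if "\<bar>y\<bar> \<le> 1" for x y
    using mult_mono[OF assms(2)[of x] that] B by (simp add: abs_mult)
  have "norm (fc f k) \<le> B * (2 * pi - 0)" unfolding fc_def
    by (rule int_norm_le_const)
      (auto intro!: * abs_cos_le_one continuous_intros continuous_on_subset[OF assms(1)])
  then show "\<bar>fc f k\<bar> \<le> 2 * pi * B" by (simp add: mult.commute)
  have "norm (fs f k) \<le> B * (2 * pi - 0)" unfolding fs_def
    by (rule int_norm_le_const)
      (auto intro!: * abs_sin_le_one continuous_intros continuous_on_subset[OF assms(1)])
  then show "\<bar>fs f k\<bar> \<le> 2 * pi * B" by (simp add: mult.commute)
qed

lemma fc_fs_diff: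
  assumes "continuous_on UNIV f" "continuous_on UNIV g"
  shows "fc (\<lambda>x. f x - g x) k = fc f k - fc g k" "fs (\<lambda>x. f x - g x) k = fs f k - fs g k"
proof -
  have c: "continuous_on A f" "continuous_on A g" for A
    using assms by (auto intro: continuous_on_subset)
  show "fc (\<lambda>x. f x - g x) k = fc f k - fc g k" "fs (\<lambda>x. f x - g x) k = fs f k - fs g k"
    unfolding fc_def fs_def left_diff_distrib
    by (intro int_diff continuous_intros c)+
qed

text \<open>The operator f - f'' has Fourier symbol 1 + k^2. Each application absorbs one power of
  the weight and leaves a smooth function, and the coefficients of a bounded function are
  bounded.\<close>

lemma fc_fs_decay:
  assumes "f \<in> test_circle"
  shows "\<exists>C. \<forall>k. (1 + (of_int k)^2) ^ m * \<bar>fc f k\<bar> \<le> C \<and> (1 + (of_int k)^2) ^ m * \<bar>fs f k\<bar> \<le> C"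
  using assms
proof (induction m arbitrary: f)
  case 0
  obtain B where "\<And>x. \<bar>f x\<bar> \<le> B" using circle_bounded[OF 0] by blast
  then show ?case
    using fc_fs_bound[of f B] circle_continuous[OF 0] by (intro exI[of _ "2 * pi * B"]) simp_all
next
  case (Suc m)
  note f = \<open>f \<in> test_circle\<close>
  let ?g = "\<lambda>x. f x - deriv (deriv f) x"
  have g: "?g \<in> test_circle" by (intro circle_diff circle_deriv f)
  obtain C where C: "\<forall>k. (1 + (of_int k)^2) ^ m * \<bar>fc ?g k\<bar> \<le> C \<and> (1 + (of_int k)^2) ^ m * \<bar>fs ?g k\<bar> \<le> C"
    using Suc.IH[OF g] by (elim exE)
  have f': "deriv f \<in> test_circle" by (intro circle_deriv f)
  have *: "fc ?g k = (1 + (of_int k)^2) * fc f k" "fs ?g k = (1 + (of_int k)^2) * fs f k" for k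
    using fc_fs_diff[of f "deriv (deriv f)" k] fc_fs_deriv[OF f, of k] fc_fs_deriv[OF f', of k]
      circle_continuous[OF f] circle_continuous[OF circle_deriv[OF f']]
    by (simp_all add: algebra_simps power2_eq_square)
  have "(1 + (of_int k)^2) ^ Suc m * \<bar>fc f k\<bar> \<le> C \<and> (1 + (of_int k)^2) ^ Suc m * \<bar>fs f k\<bar> \<le> C" for k
    using C[rule_format, of k] unfolding * by (simp add: abs_mult mult_ac)
  then show ?case by (intro exI[of _ C] allI)
qed

lemma sum_inverse_square_int:
  assumes "finite F"
  shows "(\<Sum>k\<in>F. 1 / (1 + (real_of_int k)^2)) \<le> 5"
proof -
  \<comment> \<open>The subtracted term makes the bound telescope: each step adds 2 / (1 + (n +
    1)^2), at most 4 / (n + 1) - 4 / (n + 2), and at n = 0 both sides are 1.\<close>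
  have *: "(\<Sum>k\<in>{-int n..int n}. 1 / (1 + (real_of_int k)^2)) \<le> 5 - 4 / (real n + 1)" for n
  proof (induction n)
    case (Suc n)
    have "{-int (Suc n)..int (Suc n)} = insert (- int (Suc n)) (insert (int (Suc n)) {-int n..int n})"
      by auto
    then have "(\<Sum>k\<in>{-int (Suc n)..int (Suc n)}. 1 / (1 + (real_of_int k)^2))
        = 2 / (1 + (real n + 1)^2) + (\<Sum>k\<in>{-int n..int n}. 1 / (1 + (real_of_int k)^2))"
      by (simp add: power2_eq_square algebra_simps)
    also have "\<dots> \<le> 2 / (1 + (real n + 1)^2) + (5 - 4 / (real n + 1))" using Suc by simp
    also have "2 / (1 + (real n + 1)^2) \<le> 4 / ((real n + 1) * (real n + 2))"
    proof -
      have h1: "2 * ((real n + 1) * (real n + 2)) \<le> 4 * (1 + (real n + 1)^2)"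
        by (simp add: power2_eq_square algebra_simps)
      have h2: "0 < 1 + (real n + 1)^2" by (intro add_pos_nonneg) auto
      have h3: "0 < (real n + 1) * (real n + 2)" by (intro mult_pos_pos) auto
      show ?thesis
        using mult_imp_le_div_pos[OF h3 h1] by (intro mult_imp_div_pos_le[OF h2]) simp
    qed
    also have "4 / ((real n + 1) * (real n + 2)) + (5 - 4 / (real n + 1)) = 5 - 4 / (real (Suc n) + 1)"
      by (simp add: divide_simps) (simp add: algebra_simps)
    finally show ?case by simp
  qed simp
  obtain n where "F \<subseteq> {-int n..int n}"
  proof
    show "F \<subseteq> {-int (nat (\<Sum>k\<in>F. \<bar>k\<bar>))..int (nat (\<Sum>k\<in>F. \<bar>k\<bar>))}"
    proof
      fix k assume "k \<in> F"
      then have "\<bar>k\<bar> \<le> (\<Sum>k\<in>F. \<bar>k\<bar>)" using assms by (intro member_le_sum) auto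
      then show "k \<in> {-int (nat (\<Sum>k\<in>F. \<bar>k\<bar>))..int (nat (\<Sum>k\<in>F. \<bar>k\<bar>))}" by auto
    qed
  qed
  then have "(\<Sum>k\<in>F. 1 / (1 + (real_of_int k)^2)) \<le> (\<Sum>k\<in>{-int n..int n}. 1 / (1 + (real_of_int k)^2))"
    by (intro sum_mono2) auto
  also have "\<dots> \<le> 5 - 4 / (real n + 1)" by (rule *)
  also have "\<dots> \<le> 5" by simp
  finally show ?thesis .
qed

lemma summable_inverse_square_int: "(\<lambda>k. 1 / (1 + (real_of_int k)^2)) summable_on UNIV"
  by (rule nonneg_bdd_above_summable_on) (auto intro!: bdd_aboveI[of _ 5] sum_inverse_square_int)

lemma circle_distr_in_distr_circle:
  assumes "continuous_on UNIV f" "periodic f"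
  shows "circle_distr f \<in> distr_circle"
proof -
  have c: "continuous_on A f" for A using assms by (auto intro: continuous_on_subset)
  obtain B where B: "\<And>x. \<bar>f x\<bar> \<le> B" using periodic_bounded[OF assms(2,1)] by blast
  have "linear_functional_on test_circle (circle_distr f)"
    unfolding linear_functional_on_def
  proof (intro ballI allI)
    fix \<phi> \<psi> and a b :: real assume *: "\<phi> \<in> test_circle" "\<psi> \<in> test_circle"
    then have "(\<lambda>x. a * \<phi> x + b * \<psi> x) \<in> test_circle"
      by (intro circle_add circle_mult circle_const)
    then have "circle_distr f (\<lambda>x. a * \<phi> x + b * \<psi> x) = (CI x. f x * (a * \<phi> x + b * \<psi> x))"
      by (rule circle_distr_eq[OF assms(1)])
    also have "(\<lambda>x. f x * (a * \<phi> x + b * \<psi> x)) = (\<lambda>x. a * (f x * \<phi> x) + b * (f x * \<psi> x))"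
      by (auto simp: algebra_simps)
    also have "cint \<dots> = a * (CI x. f x * \<phi> x) + b * (CI x. f x * \<psi> x)"
      by (subst int_add, (intro continuous_intros c circle_continuous *)+) simp
    finally show "circle_distr f (\<lambda>x. a * \<phi> x + b * \<psi> x) = a * circle_distr f \<phi> + b * circle_distr f \<psi>"
      by (simp add: circle_distr_eq[OF assms(1)] *)
  qed
  moreover have "\<bar>circle_distr f \<phi>\<bar> \<le> (2 * pi * B) * (\<Sum>j\<le>(0::nat). SUP x. \<bar>(deriv ^^ j) \<phi> x\<bar>)"
    if \<phi>: "\<phi> \<in> test_circle" for \<phi>
  proof -
    obtain D where D: "\<And>x. \<bar>\<phi> x\<bar> \<le> D" using circle_bounded[OF \<phi>] by blast
    then have "bdd_above (range (\<lambda>x. \<bar>\<phi> x\<bar>))" by (intro bdd_aboveI[of _ D]) auto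
    then have S: "\<bar>\<phi> x\<bar> \<le> (SUP x. \<bar>\<phi> x\<bar>)" for x by (intro cSUP_upper) auto
    have "norm (CI x. f x * \<phi> x) \<le> B * (SUP x. \<bar>\<phi> x\<bar>) * (2 * pi - 0)"
      by (rule int_norm_le_const)
        (use B order_trans[OF abs_ge_zero B] in
          \<open>auto intro!: continuous_on_mult[OF c circle_continuous[OF \<phi>]] mult_mono S simp: abs_mult\<close>)
    then show ?thesis by (simp add: circle_distr_eq[OF assms(1) \<phi>] mult_ac)
  qed
  moreover have "\<forall>\<phi>. \<phi> \<notin> test_circle \<longrightarrow> circle_distr f \<phi> = 0" by (simp add: circle_distr_def)
  ultimately show ?thesis
    unfolding distr_circle_def by blast
qed

lemma circle_in_Hs:
  assumes "f \<in> test_circle" shows "circle_distr f \<in> Hs s"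
proof -
  have c: "continuous_on UNIV f" by (rule circle_continuous[OF assms])
  \<comment> \<open>An integer exponent at least s + 1, so that the decay of order \<open>m\<close>
    leaves, besides the weight of order s, a spare factor 1 / (1 + k^2) to sum over.\<close>
  define m where "m = nat \<lceil>\<bar>s\<bar>\<rceil> + 1"
  have m: "s + 1 \<le> real m" unfolding m_def by linarith
  obtain C where "\<forall>k. (1 + (of_int k)^2) ^ m * \<bar>fc f k\<bar> \<le> C \<and> (1 + (of_int k)^2) ^ m * \<bar>fs f k\<bar> \<le> C"
    using fc_fs_decay[OF assms, of m] by (elim exE)
  then have C: "(1 + (of_int k)^2) ^ m * \<bar>fc f k\<bar> \<le> C" "(1 + (of_int k)^2) ^ m * \<bar>fs f k\<bar> \<le> C" for k
    by simp_all
  have C0: "0 \<le> C" using C(1)[of 0] by (simp add: order_trans[OF abs_ge_zero])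
  have "sobolev_term s (circle_distr f) k \<le> 2 * C^2 * (1 / (1 + (of_int k)^2))" for k
  proof -
    let ?w = "1 + (real_of_int k)^2"
    have w: "?w \<ge> 1" by simp
    have fc2: "?w ^ (2 * m) * (fc f k)^2 \<le> C^2" "?w ^ (2 * m) * (fs f k)^2 \<le> C^2"
      using power_mono[OF C(1)[of k], of 2] power_mono[OF C(2)[of k], of 2]
      by (auto simp: power_mult_distrib power_mult[symmetric] mult.commute[of m 2])
    have p: "(1::real) \<le> (2 * pi)^2" using pi_ge_two by (intro one_le_power) simp
    have "?w powr s * ?w \<le> ?w ^ (2 * m)"
    proof -
      have "?w powr s * ?w = ?w powr (s + 1)" using w by (simp add: powr_add)
      also have "\<dots> \<le> ?w powr real (2 * m)" using w m by (intro powr_mono) auto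
      also have "\<dots> = ?w ^ (2 * m)" using w by (intro powr_realpow) linarith
      finally show ?thesis .
    qed
    have "sobolev_term s (circle_distr f) k * ?w
        = (?w powr s * ?w) * (((fc f k)^2 + (fs f k)^2) / (2 * pi)^2)"
      by (simp add: sobolev_term_eq[OF c])
    also have "\<dots> \<le> ?w ^ (2 * m) * ((fc f k)^2 + (fs f k)^2)"
    proof (rule mult_mono)
      show "((fc f k)^2 + (fs f k)^2) / (2 * pi)^2 \<le> (fc f k)^2 + (fs f k)^2"
        using frac_le[of "(fc f k)^2 + (fs f k)^2" _ 1 "(2 * pi)^2"] p by simp
    qed (use \<open>?w powr s * ?w \<le> ?w ^ (2 * m)\<close> in auto)
    also have "\<dots> \<le> 2 * C^2" using fc2 by (simp add: algebra_simps)
    finally show ?thesis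
      using mult_imp_le_div_pos[of ?w "sobolev_term s (circle_distr f) k" "2 * C^2"] w by simp
  qed
  then have "sobolev_term s (circle_distr f) summable_on UNIV"
    by (intro summable_on_comparison_test[OF summable_on_cmult_right[OF summable_inverse_square_int]])
      (auto simp: sobolev_term_nonneg)
  then show ?thesis
    using circle_distr_in_distr_circle[OF c] assms by (auto simp: Hs_def circle_iff)
qed

lemma circle_subset_Hinf: "test_circle \<subseteq> Hinf"
  using circle_in_Hs circle_continuous by (auto simp: Hinf_def circle_iff)

section \<open>Orthogonality, Bessel's inequality and uniqueness of Fourier coefficients\<close>

lemma cint_trig:
  "(CI x. cos (of_int m * x)) = (if m = 0 then 2 * pi else 0)"
  "(CI x. sin (of_int m * x)) = 0"
proof -
  have "(CI x. cos (of_int m * x)) = 0" if "m \<noteq> 0"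
  proof (rule cint_deriv_zero)
    show "((\<lambda>x. sin (of_int m * x) / of_int m) has_real_derivative cos (of_int m * x)) (at x)" for x
      using that by (auto intro!: derivative_eq_intros)
  qed (use circle_period_eq[OF circle_trig(2), of m] in simp)
  then show "(CI x. cos (of_int m * x)) = (if m = 0 then 2 * pi else 0)" by simp
  show "(CI x. sin (of_int m * x)) = 0"
  proof (cases "m = 0")
    case False
    show ?thesis
    proof (rule cint_deriv_zero)
      show "((\<lambda>x. - cos (of_int m * x) / of_int m) has_real_derivative sin (of_int m * x)) (at x)" for x
        using False by (auto intro!: derivative_eq_intros)
    qed (use circle_period_eq[OF circle_trig(1), of m] in simp)
  qed simp
qed

lemma cint_trig_trig:
  fixes k l :: int
  shows "(CI x. cos (of_int k * x) * cos (of_int l * x))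
      = pi * ((if k = l then 1 else 0) + (if k = - l then 1 else 0))"
    and "(CI x. sin (of_int k * x) * sin (of_int l * x))
      = pi * ((if k = l then 1 else 0) - (if k = - l then 1 else 0))"
    and "(CI x. cos (of_int k * x) * sin (of_int l * x)) = 0"
proof -
  have c: "continuous_on A (\<lambda>x. cos (of_int m * x :: real))" "continuous_on A (\<lambda>x. sin (of_int m * x :: real))"
    for m A by (intro continuous_intros)+
  have "(\<lambda>x. cos (of_int k * x) * cos (of_int l * x))
      = (\<lambda>x. (1/2) * (cos (of_int (k - l) * x) + cos (of_int (k + l) * x)) :: real)"
    by (intro ext) (simp add: cos_times_cos left_diff_distrib distrib_right)
  then show "(CI x. cos (of_int k * x) * cos (of_int l * x))
      = pi * ((if k = l then 1 else 0) + (if k = - l then 1 else 0))"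
    using int_add[OF c(1) c(1), of 0 "2 * pi" "k - l" "k + l"]
    by (simp only: integral_mult_right cint_trig) auto
  have "(\<lambda>x. sin (of_int k * x) * sin (of_int l * x))
      = (\<lambda>x. (1/2) * (cos (of_int (k - l) * x) - cos (of_int (k + l) * x)) :: real)"
    by (intro ext) (simp add: sin_times_sin left_diff_distrib distrib_right)
  then show "(CI x. sin (of_int k * x) * sin (of_int l * x))
      = pi * ((if k = l then 1 else 0) - (if k = - l then 1 else 0))"
    using int_diff[OF c(1) c(1), of 0 "2 * pi" "k - l" "k + l"]
    by (simp only: integral_mult_right cint_trig) auto
  have "(\<lambda>x. cos (of_int k * x) * sin (of_int l * x))
      = (\<lambda>x. (1/2) * (sin (of_int (k + l) * x) - sin (of_int (k - l) * x)) :: real)"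
    by (intro ext) (simp add: cos_times_sin left_diff_distrib distrib_right)
  then show "(CI x. cos (of_int k * x) * sin (of_int l * x)) = 0"
    using int_diff[OF c(2) c(2), of 0 "2 * pi" "k + l" "k - l"]
    by (simp only: integral_mult_right cint_trig) auto
qed

lemma fc_fs_minus: "fc f (- k) = fc f k" "fs f (- k) = - fs f k"
  by (simp_all add: fc_def fs_def)

text \<open>The modes k and -k give the same cosine and opposite sines, so the trigonometric
  functions indexed by an arbitrary finite \<open>F\<close> are not orthogonal. The square norm of
  the partial sum \<open>P\<close> is therefore only bounded, by 2 pi times the sum in question, and
  Cauchy-Schwarz on the pairing of f with \<open>P\<close>, which equals that sum, closes the
  estimate.\<close>

lemma Bessel:
  assumes f: "continuous_on UNIV f" and "finite F"
  shows "(\<Sum>k\<in>F. (fc f k)^2 + (fs f k)^2) \<le> 2 * pi * (CI x. (f x)^2)"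
proof -
  let ?S = "\<Sum>k\<in>F. (fc f k)^2 + (fs f k)^2"
  define P where "P x = (\<Sum>k\<in>F. fc f k * cos (of_int k * x) + fs f k * sin (of_int k * x))" for x
  have c: "continuous_on A f" for A using f continuous_on_subset[OF f] by simp
  have cP: "continuous_on A P" for A unfolding P_def by (intro continuous_intros)
  have i: "continuous_on {0..2 * pi} g \<Longrightarrow> g integrable_on {0..2 * pi}" for g :: "real \<Rightarrow> real"
    by (rule integrable_continuous_real)
  have lin: "(CI x. h x * P x)
      = (\<Sum>k\<in>F. fc f k * (CI x. h x * cos (of_int k * x)) + fs f k * (CI x. h x * sin (of_int k * x)))"
    if h: "\<And>A. continuous_on A h" for h
  proof -
    have "(\<lambda>x. h x * P x) = (\<lambda>x. \<Sum>k\<in>F. fc f k * (h x * cos (of_int k * x)) + fs f k * (h x * sin (of_int k * x)))"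
      by (simp add: P_def sum_distrib_left algebra_simps)
    then have "(CI x. h x * P x)
        = (\<Sum>k\<in>F. CI x. fc f k * (h x * cos (of_int k * x)) + fs f k * (h x * sin (of_int k * x)))"
      by (simp only:) (intro integral_sum assms i continuous_intros h)
    also have "\<dots> = (\<Sum>k\<in>F. fc f k * (CI x. h x * cos (of_int k * x)) + fs f k * (CI x. h x * sin (of_int k * x)))"
      by (intro sum.cong refl, subst int_add, (intro continuous_intros h)+) simp
    finally show ?thesis .
  qed
  have fP: "(CI x. f x * P x) = ?S"
    by (subst lin[OF c]) (simp add: fc_def fs_def power2_eq_square)
  have trigP: "(CI x. cos (of_int l * x) * P x) = pi * (fc f l + (if - l \<in> F then fc f l else 0))"
    "(CI x. sin (of_int l * x) * P x) = pi * (fs f l + (if - l \<in> F then fs f l else 0))" if "l \<in> F" for l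
  proof -
    have cc: "(CI x. cos (of_int l * x) * cos (of_int k * x)) = pi * ((if k = l then 1 else 0) + (if k = - l then 1 else 0))"
      and ss: "(CI x. sin (of_int l * x) * sin (of_int k * x)) = pi * ((if k = l then 1 else 0) - (if k = - l then 1 else 0))"
      and sc: "(CI x. sin (of_int l * x) * cos (of_int k * x)) = 0" for k
      using cint_trig_trig[of k l] by (simp_all only: mult.commute)
    have "(CI x. cos (of_int l * x) * P x) = (\<Sum>k\<in>F. fc f k * (pi * ((if k = l then 1 else 0) + (if k = - l then 1 else 0))))"
      by (subst lin) (auto intro!: continuous_intros simp: cc cint_trig_trig(3))
    also have "\<dots> = pi * ((\<Sum>k\<in>F. if k = l then fc f k else 0) + (\<Sum>k\<in>F. if k = - l then fc f k else 0))"
      by (simp add: sum.distrib[symmetric] sum_distrib_left) (intro sum.cong refl, auto)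
    finally show "(CI x. cos (of_int l * x) * P x) = pi * (fc f l + (if - l \<in> F then fc f l else 0))"
      using \<open>finite F\<close> that by (simp add: fc_fs_minus)
    have "(CI x. sin (of_int l * x) * P x) = (\<Sum>k\<in>F. fs f k * (pi * ((if k = l then 1 else 0) - (if k = - l then 1 else 0))))"
      by (subst lin) (auto intro!: continuous_intros simp: ss sc)
    also have "\<dots> = pi * ((\<Sum>k\<in>F. if k = l then fs f k else 0) - (\<Sum>k\<in>F. if k = - l then fs f k else 0))"
      by (simp add: sum_subtractf[symmetric] sum_distrib_left) (intro sum.cong refl, auto)
    finally show "(CI x. sin (of_int l * x) * P x) = pi * (fs f l + (if - l \<in> F then fs f l else 0))"
      using \<open>finite F\<close> that by (simp add: fc_fs_minus)
  qed
  have "(CI x. P x * P x) = (\<Sum>k\<in>F. fc f k * (CI x. cos (of_int k * x) * P x) + fs f k * (CI x. sin (of_int k * x) * P x))"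
    by (subst lin[OF cP]) (simp add: mult.commute)
  also have "\<dots> \<le> (\<Sum>k\<in>F. 2 * pi * ((fc f k)^2 + (fs f k)^2))"
  proof (rule sum_mono)
    fix k assume k: "k \<in> F"
    show "fc f k * (CI x. cos (of_int k * x) * P x) + fs f k * (CI x. sin (of_int k * x) * P x)
        \<le> 2 * pi * ((fc f k)^2 + (fs f k)^2)"
      unfolding trigP[OF k] by (simp add: power2_eq_square algebra_simps)
  qed
  finally have PP: "(CI x. (P x)^2) \<le> 2 * pi * ?S"
    by (simp add: power2_eq_square sum_distrib_left)
  have "?S^2 \<le> (CI x. (f x)^2) * (CI x. (P x)^2)"
    using int_Cauchy_Schwarz[of 0 "2 * pi" f P, OF c cP] fP by simp
  also have "\<dots> \<le> (CI x. (f x)^2) * (2 * pi * ?S)"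
    by (intro mult_left_mono PP int_square_nonneg c)
  finally have "?S * ?S \<le> (2 * pi * (CI x. (f x)^2)) * ?S" by (simp add: power2_eq_square mult_ac)
  moreover have "?S \<ge> 0" by (intro sum_nonneg) simp
  moreover have "0 \<le> (CI x. (f x)^2)" by (rule int_square_nonneg[OF c])
  ultimately show ?thesis by (cases "?S = 0") auto
qed

text \<open>The powers of the kernel \<open>1 + cos (x - x0)\<close> concentrate at \<open>x0\<close> and are trigonometric
  polynomials.\<close>

lemma fourier_uniqueness:
  assumes d: "continuous_on UNIV d" "periodic d"
    and zero: "\<And>k. fc d k = 0" "\<And>k. fs d k = 0"
  shows "d x0 = 0"
proof -
  have c: "continuous_on A d" for A using continuous_on_subset[OF d(1)] by simp
  \<comment> \<open>All frequencies k are treated at once, because a further factor of the kernel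
    shifts frequencies by one in either direction.\<close>
  have kernel: "(CI x. d x * (1 + cos (x - x0)) ^ N * cos (of_int k * x)) = 0 \<and>
    (CI x. d x * (1 + cos (x - x0)) ^ N * sin (of_int k * x)) = 0" for N k
  proof (induction N arbitrary: k)
    case 0 then show ?case using zero by (simp add: fc_def fs_def)
  next
    case (Suc N)
    let ?C = "\<lambda>k x. d x * (1 + cos (x - x0)) ^ N * cos (of_int k * x)"
      and ?S = "\<lambda>k x. d x * (1 + cos (x - x0)) ^ N * sin (of_int k * x)"
    have cont: "continuous_on A (?C k)" "continuous_on A (?S k)" for A k
      by (intro continuous_intros c)+
    have lin: "(CI x. (f1 x + a * (f2 x + f3 x)) + b * (f4 x - f5 x)) = 0"
      if "\<And>A. continuous_on A f1" "\<And>A. continuous_on A f2" "\<And>A. continuous_on A f3"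
        "\<And>A. continuous_on A f4" "\<And>A. continuous_on A f5"
        "cint f1 = 0" "cint f2 = 0" "cint f3 = 0" "cint f4 = 0" "cint f5 = 0"
      for f1 f2 f3 f4 f5 :: "real \<Rightarrow> real" and a b
    proof -
      have "(CI x. (f1 x + a * (f2 x + f3 x)) + b * (f4 x - f5 x))
          = (CI x. f1 x + a * (f2 x + f3 x)) + (CI x. b * (f4 x - f5 x))"
        by (intro int_add continuous_intros that)
      also have "(CI x. f1 x + a * (f2 x + f3 x)) = cint f1 + (CI x. a * (f2 x + f3 x))"
        by (intro int_add continuous_intros that)
      finally show ?thesis
        by (simp add: int_add[OF that(2,3)] int_diff[OF that(4,5)] that)
    qed
    define \<alpha> \<beta> where "\<alpha> = cos x0 / 2" and "\<beta> = sin x0 / 2"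
    then have ab: "cos x0 = 2 * \<alpha>" "sin x0 = 2 * \<beta>" by auto
    have e: "cos (of_int (k + 1) * x) = cos (of_int k * x) * cos x - sin (of_int k * x) * sin x"
      "cos (of_int (k - 1) * x) = cos (of_int k * x) * cos x + sin (of_int k * x) * sin x"
      "sin (of_int (k + 1) * x) = sin (of_int k * x) * cos x + cos (of_int k * x) * sin x"
      "sin (of_int (k - 1) * x) = sin (of_int k * x) * cos x - cos (of_int k * x) * sin x" for x :: real
      by (simp_all add: distrib_right left_diff_distrib cos_add cos_diff sin_add sin_diff)
    have "(\<lambda>x. d x * (1 + cos (x - x0)) ^ Suc N * cos (of_int k * x))
      = (\<lambda>x. (?C k x + \<alpha> * (?C (k + 1) x + ?C (k - 1) x)) + \<beta> * (?S (k + 1) x - ?S (k - 1) x))"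
      unfolding e power_Suc by (intro ext) (simp add: cos_diff ab algebra_simps)
    then have 1: "(CI x. d x * (1 + cos (x - x0)) ^ Suc N * cos (of_int k * x)) = 0"
      by (simp only:) (intro lin cont; simp only: Suc)
    have "(\<lambda>x. d x * (1 + cos (x - x0)) ^ Suc N * sin (of_int k * x))
      = (\<lambda>x. (?S k x + \<alpha> * (?S (k + 1) x + ?S (k - 1) x)) + \<beta> * (?C (k - 1) x - ?C (k + 1) x))"
      unfolding e power_Suc by (intro ext) (simp add: cos_diff ab algebra_simps)
    then have 2: "(CI x. d x * (1 + cos (x - x0)) ^ Suc N * sin (of_int k * x)) = 0"
      by (simp only:) (intro lin cont; simp only: Suc)
    show ?case using 1 2 by blast
  qed
  \<comment> \<open>Stated for a generic \<open>e\<close> so that it can be applied to d and to -d;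
    a positive value at \<open>x0\<close> would make the concentrated integrals positive for large
    N.\<close>
  have "\<not> e x0 > 0" if e: "continuous_on UNIV e" "periodic e"
    and zero: "\<And>N. (CI x. e x * (1 + cos (x - x0)) ^ N) = 0" for e
  proof
    assume pos: "e x0 > 0"
    obtain D where D: "D > 0" "\<And>x. \<bar>e x\<bar> \<le> D" using periodic_bounded[OF e(2,1)] by blast
    have "isCont e x0" using e(1) by (simp add: continuous_on_eq_continuous_at)
    then have "\<exists>r>0. \<forall>x. dist x x0 < r \<longrightarrow> dist (e x) (e x0) < e x0 / 2"
      unfolding continuous_at_eps_delta using pos by (elim allE[of _ "e x0 / 2"]) auto
    then obtain r0 where r0: "r0 > 0" "\<forall>x. dist x x0 < r0 \<longrightarrow> dist (e x) (e x0) < e x0 / 2" by blast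
    define r where "r = min (r0 / 2) 1"
    have r: "0 < r" "r \<le> 1" "r < r0" using r0(1) by (auto simp: r_def min_def)
    define \<eta> where "\<eta> = e x0 / 2"
    have \<eta>: "\<eta> > 0" using pos by (simp add: \<eta>_def)
    have near: "e (x + x0) \<ge> \<eta>" if "\<bar>x\<bar> \<le> r" for x
    proof -
      have "dist (e (x + x0)) (e x0) < e x0 / 2" using r0(2) that r by (simp add: dist_real_def)
      then have "e (x + x0) > e x0 - e x0 / 2" by (simp only: dist_real_def abs_diff_less_iff)
      then show ?thesis by (simp add: \<eta>_def)
    qed
    \<comment> \<open>\<open>q1\<close> bounds the kernel from above at distance at least
      \<open>r\<close> from \<open>x0\<close>, \<open>q2\<close> bounds it from below within
      \<open>r / 2\<close>. Since \<open>q1 < q2\<close>, the positive part of the integral outgrows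
      the rest geometrically in N.\<close>
    define q1 where "q1 = 1 + cos r"
    define q2 where "q2 = 1 + cos (r / 2)"
    have q: "1 < q1" "q1 < q2"
      using cos_monotone_0_pi[of "r/2" r] cos_gt_zero[of r] r pi_gt3 by (auto simp: q1_def q2_def)
    define F where "F N x = e (x + x0) * (1 + cos x) ^ N" for N x
    have cF: "continuous_on A (F N)" for A N unfolding F_def
      by (intro continuous_intros continuous_on_compose2[OF e(1)]) auto
    have lower: "F N x \<ge> - D * q1 ^ N" if x: "x \<in> {0..2 * pi}" for N x
    proof (cases "cos x \<le> cos r")
      case True
      have "\<bar>(1 + cos x) ^ N\<bar> \<le> q1 ^ N"
        unfolding power_abs
      proof (rule power_mono)
        show "\<bar>1 + cos x\<bar> \<le> q1" using True cos_ge_minus_one[of x] unfolding q1_def by linarith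
      qed simp
      then have "\<bar>F N x\<bar> \<le> D * q1 ^ N"
        unfolding F_def abs_mult using D by (intro mult_mono) auto
      then show ?thesis by linarith
    next
      case False
      have "x < r \<or> 2 * pi - x < r"
      proof (rule ccontr)
        assume "\<not> ?thesis"
        then have *: "r \<le> x" "r \<le> 2 * pi - x" by auto
        have "cos x \<le> cos r"
        proof (cases "x \<le> pi")
          case True then show ?thesis using cos_monotone_0_pi_le[of r x] * r by simp
        next
          case False
          then show ?thesis
            using cos_monotone_0_pi_le[of r "2 * pi - x"] * r by (simp add: cos_diff)
        qed
        with False show False by simp
      qed
      then have "e (x + x0) \<ge> \<eta>"
      proof
        assume "x < r" then show ?thesis using near[of x] x by simp
      next
        assume "2 * pi - x < r"
        then have "e ((x - 2 * pi) + x0) \<ge> \<eta>" using near[of "x - 2 * pi"] x by simp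
        moreover have "e ((x - 2 * pi) + x0) = e (x + x0)"
          using e(2)[unfolded periodic_def, rule_format, of "x - 2 * pi + x0"] by (simp add: algebra_simps)
        ultimately show ?thesis by simp
      qed
      then have "F N x \<ge> 0" using \<eta> cos_ge_minus_one[of x]
        unfolding F_def by (intro mult_nonneg_nonneg zero_le_power) linarith+
      moreover have "- D * q1 ^ N \<le> 0" using D q by simp
      ultimately show ?thesis by linarith
    qed
    have upper: "F N x \<ge> \<eta> * q2 ^ N" if "x \<in> {0..r / 2}" for N x
      unfolding F_def using near[of x] that \<eta> cos_monotone_0_pi_le[of x "r/2"] r pi_gt3 q
      by (intro mult_mono power_mono) (auto simp: q2_def)
    have bound: "0 \<ge> (r / 2) * \<eta> * q2 ^ N - 2 * pi * D * q1 ^ N" for N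
    proof -
      have pr: "periodic (\<lambda>x. e x * (1 + cos (x - x0)) ^ N)"
        using e(2) unfolding periodic_def by (simp add: add_diff_eq[symmetric] cos_add cos_diff sin_add sin_diff)
      have "0 = (CI x. e x * (1 + cos (x - x0)) ^ N)" using zero by simp
      also have "\<dots> = cint (F N)"
        using cint_shift[OF _ pr, of x0] unfolding F_def[abs_def] by (simp add: continuous_intros e)
      also have "\<dots> = integral {0..r/2} (F N) + integral {r/2..2 * pi} (F N)"
        using r pi_gt3 by (intro Henstock_Kurzweil_Integration.integral_combine[symmetric] integrable_continuous_real cF) auto
      also have "\<dots> \<ge> integral {0..r/2} (\<lambda>x. \<eta> * q2 ^ N) + integral {r/2..2 * pi} (\<lambda>x. - D * q1 ^ N)"
        using r by (intro add_mono int_mono cF continuous_intros) (auto intro!: upper lower[simplified])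
      finally have "0 \<ge> (r/2) * (\<eta> * q2 ^ N) - (2 * pi - r/2) * (D * q1 ^ N)"
        using r pi_gt3 by (simp add: algebra_simps)
      moreover have "(2 * pi - r/2) * (D * q1 ^ N) \<le> 2 * pi * (D * q1 ^ N)"
        using r D q by (intro mult_right_mono) auto
      ultimately show ?thesis by (simp add: mult_ac)
    qed
    have "1 < q2 / q1" using q by simp
    then obtain N where N: "4 * pi * D / (r * \<eta>) < (q2 / q1) ^ N"
      using real_arch_pow by blast
    then have "4 * pi * D < (q2 ^ N / q1 ^ N) * (r * \<eta>)"
      using r \<eta> by (simp add: pos_divide_less_eq power_divide)
    then have "4 * pi * D * q1 ^ N < (q2 ^ N / q1 ^ N) * (r * \<eta>) * q1 ^ N"
      using q by (intro mult_strict_right_mono) auto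
    also have "\<dots> = r * \<eta> * q2 ^ N" using q by simp
    finally show False using bound[of N] by (simp add: field_simps)
  qed
  from this[of d] this[of "\<lambda>x. - d x"] have "\<not> d x0 > 0" "\<not> - d x0 > 0"
    using d kernel[of _ 0] by (auto simp: periodic_def continuous_on_minus)
  then show ?thesis by linarith
qed

section \<open>Rapidly convergent Fourier series\<close>

definition rapid :: "(nat \<Rightarrow> real) \<Rightarrow> bool" where
  "rapid a \<longleftrightarrow> (\<forall>m. \<exists>C. \<forall>k. \<bar>a k\<bar> * real (Suc k) ^ m \<le> C)"

lemma rapid_summable:
  assumes "rapid a" shows "summable (\<lambda>k. \<bar>a k\<bar>)"
proof -
  obtain C where C: "\<forall>k. \<bar>a k\<bar> * real (Suc k) ^ 2 \<le> C" using assms unfolding rapid_def by blast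
  have "summable (\<lambda>k. inverse (real (Suc k) ^ 2))"
    by (rule summable_Suc_iff[of "\<lambda>k. inverse (real k ^ 2)", THEN iffD2]) (rule inverse_power_summable, simp)
  then have "summable (\<lambda>k. C * inverse (real (Suc k) ^ 2))" by (rule summable_mult)
  moreover have "norm \<bar>a k\<bar> \<le> C * inverse (real (Suc k) ^ 2)" for k
  proof -
    have "\<bar>a k\<bar> \<le> C / real (Suc k) ^ 2"
      using C[rule_format, of k] by (intro mult_imp_le_div_pos) auto
    then show ?thesis by (simp only: divide_inverse) simp
  qed
  ultimately show ?thesis by (rule summable_comparison_test'[where N = 0])
qed

lemma rapid_mult_index:
  assumes "rapid a" shows "rapid (\<lambda>k. real k * a k)"
  unfolding rapid_def
proof
  fix m
  obtain C where C: "\<forall>k. \<bar>a k\<bar> * real (Suc k) ^ Suc m \<le> C" using assms unfolding rapid_def by blast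
  have "\<bar>real k * a k\<bar> * real (Suc k) ^ m \<le> C" for k
  proof -
    have "\<bar>real k * a k\<bar> * real (Suc k) ^ m = real k * (\<bar>a k\<bar> * real (Suc k) ^ m)"
      by (simp add: abs_mult)
    also have "\<dots> \<le> real (Suc k) * (\<bar>a k\<bar> * real (Suc k) ^ m)" by (intro mult_right_mono) auto
    also have "\<dots> \<le> C" using C[rule_format, of k] by (simp add: mult_ac)
    finally show ?thesis .
  qed
  then show "\<exists>C. \<forall>k. \<bar>real k * a k\<bar> * real (Suc k) ^ m \<le> C" by blast
qed

lemma rapid_uminus: "rapid a \<Longrightarrow> rapid (\<lambda>k. - a k)"
  by (simp add: rapid_def)

definition trig_term :: "(nat \<Rightarrow> real) \<Rightarrow> (nat \<Rightarrow> real) \<Rightarrow> nat \<Rightarrow> real \<Rightarrow> real" where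
  "trig_term a b k x = a k * cos (real k * x) + b k * sin (real k * x)"

definition trig_series :: "(nat \<Rightarrow> real) \<Rightarrow> (nat \<Rightarrow> real) \<Rightarrow> real \<Rightarrow> real" where
  "trig_series a b x = (\<Sum>k. trig_term a b k x)"

lemma trig_term_le: "\<bar>trig_term a b k x\<bar> \<le> \<bar>a k\<bar> + \<bar>b k\<bar>"
proof -
  have "\<bar>a k * cos (real k * x)\<bar> \<le> \<bar>a k\<bar> * 1" "\<bar>b k * sin (real k * x)\<bar> \<le> \<bar>b k\<bar> * 1"
    unfolding abs_mult by (intro mult_left_mono abs_cos_le_one abs_sin_le_one abs_ge_zero)+
  then show ?thesis unfolding trig_term_def by linarith
qed

lemma trig_series_uniform:
  assumes "rapid a" "rapid b"
  shows "uniform_limit UNIV (\<lambda>n x. \<Sum>k<n. trig_term a b k x) (trig_series a b) sequentially"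
  unfolding trig_series_def[abs_def]
  by (rule Weierstrass_m_test[of _ _ "\<lambda>k. \<bar>a k\<bar> + \<bar>b k\<bar>"])
    (auto simp: trig_term_le intro!: summable_add rapid_summable assms)

lemma trig_series_DERIV:
  assumes "rapid a" "rapid b"
  shows "(trig_series a b has_real_derivative
    trig_series (\<lambda>k. real k * b k) (\<lambda>k. - (real k * a k)) x) (at x)"
  unfolding trig_series_def[abs_def]
proof (rule has_field_derivative_series'(2)[of UNIV _ _ 0])
  show "(trig_term a b k has_field_derivative
      trig_term (\<lambda>k. real k * b k) (\<lambda>k. - (real k * a k)) k x) (at x within UNIV)" for k x
    unfolding trig_term_def[abs_def] by (auto intro!: derivative_eq_intros simp: algebra_simps)
  have r: "rapid (\<lambda>k. real k * b k)" "rapid (\<lambda>k. - (real k * a k))"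
    by (intro rapid_uminus rapid_mult_index assms)+
  show "uniformly_convergent_on UNIV (\<lambda>n x. \<Sum>i<n. trig_term (\<lambda>k. real k * b k) (\<lambda>k. - (real k * a k)) i x)"
    using trig_series_uniform[OF r] unfolding uniformly_convergent_on_def by blast
  show "summable (\<lambda>k. trig_term a b k 0)"
    by (rule summable_comparison_test'[of "\<lambda>k. \<bar>a k\<bar> + \<bar>b k\<bar>" 0])
      (auto simp: trig_term_le intro!: summable_add rapid_summable assms)
qed auto

lemma trig_series_test_circle:
  assumes "rapid a" "rapid b"
  shows "trig_series a b \<in> test_circle"
proof -
  let ?S = "{trig_series a b | a b. rapid a \<and> rapid b}"
  have "\<exists>g'\<in>?S. \<forall>x. (g has_real_derivative g' x) (at x)" if "g \<in> ?S" for g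
  proof -
    obtain a b where g: "g = trig_series a b" "rapid a" "rapid b" using \<open>g \<in> ?S\<close> by blast
    show ?thesis
    proof (rule bexI[of _ "trig_series (\<lambda>k. real k * b k) (\<lambda>k. - (real k * a k))"])
      show "\<forall>x. (g has_real_derivative trig_series (\<lambda>k. real k * b k) (\<lambda>k. - (real k * a k)) x) (at x)"
        unfolding g(1) using trig_series_DERIV[OF g(2,3)] by blast
      have "rapid (\<lambda>k. real k * b k)" "rapid (\<lambda>k. - (real k * a k))"
        by (intro rapid_uminus rapid_mult_index g)+
      then show "trig_series (\<lambda>k. real k * b k) (\<lambda>k. - (real k * a k)) \<in> ?S" by blast
    qed
  qed
  moreover have "trig_series a b \<in> ?S" using assms by blast
  ultimately have "smooth (trig_series a b)" by (rule smooth_coinduct[rotated])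
  moreover have "trig_series a b (x + 2 * pi) = trig_series a b x" for x
    unfolding trig_series_def trig_term_def
    using circle_periodic[OF circle_trig_nat(1)] circle_periodic[OF circle_trig_nat(2)]
    by simp
  ultimately show ?thesis by (simp add: circle_iff periodic_def)
qed

lemma cint_trig_series:
  assumes r: "rapid a" "rapid b" and h: "continuous_on UNIV h"
  shows "(\<lambda>n. \<Sum>k<n. CI x. trig_term a b k x * h x) \<longlonglongrightarrow> (CI x. trig_series a b x * h x)"
proof -
  have ch: "continuous_on A h" for A using continuous_on_subset[OF h] by simp
  have ct: "continuous_on A (trig_term a b k)" for A k
    unfolding trig_term_def[abs_def] by (intro continuous_intros)
  have "bounded (h ` {0..2 * pi})"
    by (intro compact_imp_bounded compact_continuous_image ch) auto
  moreover have "bounded (trig_series a b ` {0..2 * pi})"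
    by (intro compact_imp_bounded compact_continuous_image circle_continuous trig_series_test_circle r) auto
  ultimately have u: "uniform_limit {0..2 * pi} (\<lambda>n x. (\<Sum>k<n. trig_term a b k x) * h x)
      (\<lambda>x. trig_series a b x * h x) sequentially"
    by (intro bounded_bilinear.bounded_uniform_limit[OF bounded_bilinear_mult]
        uniform_limit_on_subset[OF trig_series_uniform[OF r]] uniform_limit_const) auto
  obtain I J where IJ: "\<And>n. ((\<lambda>x. (\<Sum>k<n. trig_term a b k x) * h x) has_integral I n) {0..2 * pi}"
    "((\<lambda>x. trig_series a b x * h x) has_integral J) {0..2 * pi}" "I \<longlonglongrightarrow> J"
    by (rule uniform_limit_integral[OF u]) (auto intro!: continuous_intros ct ch)
  have "I n = (\<Sum>k<n. CI x. trig_term a b k x * h x)" for n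
  proof -
    have "I n = (CI x. \<Sum>k<n. trig_term a b k x * h x)"
      using integral_unique[OF IJ(1)] by (simp add: sum_distrib_right)
    also have "\<dots> = (\<Sum>k<n. CI x. trig_term a b k x * h x)"
      by (intro integral_sum integrable_continuous_real continuous_intros ct ch) auto
    finally show ?thesis .
  qed
  then have "I = (\<lambda>n. \<Sum>k<n. CI x. trig_term a b k x * h x)" by (rule ext)
  then show ?thesis using IJ(3) integral_unique[OF IJ(2)] by (simp only:)
qed

lemma trig_series_coeff:
  assumes r: "rapid a" "rapid b" and "b 0 = 0"
  shows "fc (trig_series a b) (int j) = (if j = 0 then 2 * pi else pi) * a j"
    and "fs (trig_series a b) (int j) = pi * b j"
proof -
  have lin: "(CI x. trig_term a b k x * h x)
      = a k * (CI x. cos (of_int (int k) * x) * h x) + b k * (CI x. sin (of_int (int k) * x) * h x)"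
    if h: "\<And>A. continuous_on A h" for h k
  proof -
    have "(\<lambda>x. trig_term a b k x * h x)
        = (\<lambda>x. a k * (cos (of_int (int k) * x) * h x) + b k * (sin (of_int (int k) * x) * h x))"
      by (simp add: trig_term_def algebra_simps)
    then show ?thesis
      by (simp only:) (subst int_add, (intro continuous_intros h)+, simp)
  qed
  have sc: "(CI x. sin (of_int k * x) * cos (of_int l * x)) = 0" for k l
    using cint_trig_trig(3)[of l k] by (simp add: mult.commute)
  have c1: "(CI x. trig_term a b k x * cos (of_int (int j) * x))
      = (if k = j then (if j = 0 then 2 * pi else pi) * a j else 0)" for k
    by (subst lin, (intro continuous_intros)[1]) (simp only: sc cint_trig_trig, auto)
  have c2: "(CI x. trig_term a b k x * sin (of_int (int j) * x)) = (if k = j then pi * b j else 0)" for k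
    by (subst lin, (intro continuous_intros)[1]) (simp only: cint_trig_trig, auto simp: assms)
  have *: "(\<lambda>n. \<Sum>k<n. if k = j then C else (0::real)) \<longlonglongrightarrow> C" for C
    by (rule tendsto_eventually) (auto simp: eventually_sequentially intro!: exI[of _ "Suc j"])
  have "(\<lambda>n. \<Sum>k<n. CI x. trig_term a b k x * cos (of_int (int j) * x)) \<longlonglongrightarrow> fc (trig_series a b) (int j)"
    unfolding fc_def by (rule cint_trig_series[OF r]) (intro continuous_intros)
  then show "fc (trig_series a b) (int j) = (if j = 0 then 2 * pi else pi) * a j"
    unfolding c1 using * by (rule LIMSEQ_unique)
  have "(\<lambda>n. \<Sum>k<n. CI x. trig_term a b k x * sin (of_int (int j) * x)) \<longlonglongrightarrow> fs (trig_series a b) (int j)"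
    unfolding fs_def by (rule cint_trig_series[OF r]) (intro continuous_intros)
  then show "fs (trig_series a b) (int j) = pi * b j"
    unfolding c2 using * by (rule LIMSEQ_unique)
qed

section \<open>Sobolev spaces of smooth functions\<close>

text \<open>A single term of the Sobolev sum is at most the whole; the even exponent makes the
  weight a perfect square, so its root is an integer power.\<close>

lemma Hs_coeff_bound:
  assumes f: "continuous_on UNIV f" and Hs: "circle_distr f \<in> Hs (2 * real m)"
  shows "(1 + (of_int k)^2) ^ m * \<bar>fc f k\<bar> \<le> 2 * pi * Hs_norm (2 * real m) (circle_distr f)"
    and "(1 + (of_int k)^2) ^ m * \<bar>fs f k\<bar> \<le> 2 * pi * Hs_norm (2 * real m) (circle_distr f)"
proof -
  let ?w = "1 + (real_of_int k)^2" and ?N = "Hs_norm (2 * real m) (circle_distr f)"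
  have w: "?w > 0" by (intro add_pos_nonneg) auto
  have sm: "sobolev_term (2 * real m) (circle_distr f) summable_on UNIV" using Hs by (simp add: Hs_def)
  have "sum (sobolev_term (2 * real m) (circle_distr f)) {k} \<le> infsum (sobolev_term (2 * real m) (circle_distr f)) UNIV"
    by (rule finite_sum_le_infsum[OF sm]) (auto simp: sobolev_term_nonneg)
  moreover have "infsum (sobolev_term (2 * real m) (circle_distr f)) UNIV = ?N^2"
    unfolding Hs_norm_def by (simp add: infsum_nonneg sobolev_term_nonneg)
  moreover have "?w powr (2 * real m) = (?w ^ m)^2"
    using powr_realpow[OF w, of "2 * m"] by (simp add: power_mult[symmetric] mult.commute)
  ultimately have "(?w ^ m)^2 * (((fc f k)^2 + (fs f k)^2) / (2 * pi)^2) \<le> ?N^2"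
    by (simp add: sobolev_term_eq[OF f])
  then have "(?w ^ m)^2 * ((fc f k)^2 + (fs f k)^2) \<le> (2 * pi)^2 * ?N^2"
    by (simp add: field_simps)
  moreover have "(?w ^ m)^2 * ((fc f k)^2 + (fs f k)^2) = (?w ^ m * \<bar>fc f k\<bar>)^2 + (?w ^ m * \<bar>fs f k\<bar>)^2"
    by (simp add: power_mult_distrib algebra_simps)
  moreover have "(2 * pi)^2 * ?N^2 = (2 * pi * ?N)^2" by (simp add: power_mult_distrib)
  ultimately have "(?w ^ m * \<bar>fc f k\<bar>)^2 + (?w ^ m * \<bar>fs f k\<bar>)^2 \<le> (2 * pi * ?N)^2" by argo
  then have "(?w ^ m * \<bar>fc f k\<bar>)^2 \<le> (2 * pi * ?N)^2" "(?w ^ m * \<bar>fs f k\<bar>)^2 \<le> (2 * pi * ?N)^2"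
    using zero_le_power2[of "?w ^ m * \<bar>fc f k\<bar>"] zero_le_power2[of "?w ^ m * \<bar>fs f k\<bar>"] by linarith+
  moreover have "0 \<le> 2 * pi * ?N" by (simp add: Hs_norm_def infsum_nonneg sobolev_term_nonneg)
  ultimately show "?w ^ m * \<bar>fc f k\<bar> \<le> 2 * pi * ?N" "?w ^ m * \<bar>fs f k\<bar> \<le> 2 * pi * ?N"
    by (auto intro: power2_le_imp_le)
qed

text \<open>Elements of \<open>Hinf\<close> are a priori only continuous. Their coefficients decay
  rapidly, the series built from them is smooth with the same coefficients, and uniqueness
  identifies it with f. This is what turns \<open>Hinf\<close> into \<open>test_circle\<close>. The
  factor 1 / 2 at k = 0 reflects the square norm 2 pi of the constant mode, against pi for the
  others.\<close>

lemma Hinf_trig_series: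
  assumes "f \<in> Hinf"
  shows "rapid (\<lambda>k. (if k = 0 then 1 / 2 else 1) / pi * fc f (int k))" (is "rapid ?a")
    and "rapid (\<lambda>k. fs f (int k) / pi)" (is "rapid ?b")
    and "f = trig_series (\<lambda>k. (if k = 0 then 1 / 2 else 1) / pi * fc f (int k)) (\<lambda>k. fs f (int k) / pi)"
proof -
  have f: "continuous_on UNIV f" "periodic f" "\<And>s. circle_distr f \<in> Hs s" using assms by (auto simp: Hinf_def)
  have "\<exists>C. \<forall>k. \<bar>fc f (int k)\<bar> * real (Suc k) ^ m \<le> C \<and> \<bar>fs f (int k)\<bar> * real (Suc k) ^ m \<le> C" for m
  proof (intro exI[of _ "2 ^ m * (2 * pi * Hs_norm (2 * real m) (circle_distr f))"] allI conjI)
    fix k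
    have "real k \<le> 1 + (real k)^2"
      using zero_le_power2[of "real k - 1"] by (simp add: power2_eq_square algebra_simps)
    moreover have "y + 1 \<le> 2 * (1 + q)" if "y \<le> 1 + q" "0 \<le> q" for y q :: real using that by simp
    ultimately have "real k + 1 \<le> 2 * (1 + (real k)^2)" by (metis zero_le_power2)
    then have "real (Suc k) \<le> 2 * (1 + (real k)^2)" by (simp only: of_nat_Suc add.commute)
    then have "real (Suc k) ^ m \<le> (2 * (1 + (real k)^2)) ^ m" by (intro power_mono) auto
    then have p: "real (Suc k) ^ m \<le> 2 ^ m * (1 + (real_of_int (int k))^2) ^ m"
      by (simp only: power_mult_distrib of_int_of_nat_eq)
    have "\<bar>c\<bar> * real (Suc k) ^ m \<le> 2 ^ m * (2 * pi * Hs_norm (2 * real m) (circle_distr f))"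
      if "(1 + (real_of_int (int k))^2) ^ m * \<bar>c\<bar> \<le> 2 * pi * Hs_norm (2 * real m) (circle_distr f)" for c
    proof -
      have "\<bar>c\<bar> * real (Suc k) ^ m \<le> \<bar>c\<bar> * (2 ^ m * (1 + (real_of_int (int k))^2) ^ m)"
        by (intro mult_left_mono p) auto
      also have "\<dots> = 2 ^ m * ((1 + (real_of_int (int k))^2) ^ m * \<bar>c\<bar>)" by (simp only: mult_ac)
      also have "\<dots> \<le> 2 ^ m * (2 * pi * Hs_norm (2 * real m) (circle_distr f))"
        by (intro mult_left_mono that) auto
      finally show ?thesis .
    qed
    then show "\<bar>fc f (int k)\<bar> * real (Suc k) ^ m \<le> 2 ^ m * (2 * pi * Hs_norm (2 * real m) (circle_distr f))"
      "\<bar>fs f (int k)\<bar> * real (Suc k) ^ m \<le> 2 ^ m * (2 * pi * Hs_norm (2 * real m) (circle_distr f))"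
      using Hs_coeff_bound[OF f(1) f(3)] by blast+
  qed
  then have R: "\<exists>C. \<forall>k. \<bar>fc f (int k)\<bar> * real (Suc k) ^ m \<le> C" "\<exists>C. \<forall>k. \<bar>fs f (int k)\<bar> * real (Suc k) ^ m \<le> C" for m
    by meson+
  have small: "\<bar>u * c\<bar> * K \<le> \<bar>c\<bar> * K" if "\<bar>u\<bar> \<le> 1" "0 \<le> K" for u c K :: real
    using mult_right_mono[OF that(1), of "\<bar>c\<bar> * K"] that(2) by (simp add: abs_mult)
  have "\<bar>(if k = 0 then 1 / 2 else 1) / pi\<bar> \<le> 1" for k :: nat using pi_ge_two by (auto simp: field_simps)
  then show ra: "rapid ?a" unfolding rapid_def
    using R(1) small by (meson order_trans zero_le_power of_nat_0_le_iff)
  have "\<bar>1 / pi\<bar> \<le> 1" using pi_ge_two by simp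
  then have "rapid (\<lambda>k. (1 / pi) * fs f (int k))" unfolding rapid_def
    using R(2) small by (meson order_trans zero_le_power of_nat_0_le_iff)
  then show rb: "rapid ?b" by simp
  let ?G = "trig_series ?a ?b"
  have b0: "?b 0 = 0" by (simp add: fs_def)
  have G: "?G \<in> test_circle" by (rule trig_series_test_circle[OF ra rb])
  have coeff: "fc ?G (int j) = fc f (int j)" "fs ?G (int j) = fs f (int j)" for j
    using trig_series_coeff[OF ra rb b0, of j] by (auto split: if_splits)
  have coeff': "fc ?G k = fc f k" "fs ?G k = fs f k" for k
  proof -
    have "fc ?G k = fc f k \<and> fs ?G k = fs f k"
    proof (cases "k \<ge> 0")
      case True then show ?thesis using coeff[of "nat k"] by simp
    next
      case False
      then show ?thesis using coeff[of "nat (- k)"] by (simp add: fc_fs_minus)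
    qed
    then show "fc ?G k = fc f k" "fs ?G k = fs f k" by auto
  qed
  have "f x - ?G x = 0" for x
  proof (rule fourier_uniqueness[of "\<lambda>x. f x - ?G x"])
    show "continuous_on UNIV (\<lambda>x. f x - ?G x)" by (intro continuous_intros f circle_continuous[OF G])
    show "periodic (\<lambda>x. f x - ?G x)" using f(2) G by (auto simp: periodic_def circle_iff)
  qed (simp_all only: fc_fs_diff[OF f(1) circle_continuous[OF G]] coeff' diff_self)
  then show "f = ?G" by (auto intro!: ext)
qed

lemma Hinf_eq: "Hinf = test_circle"
proof
  show "Hinf \<subseteq> test_circle"
  proof
    fix f assume f: "f \<in> Hinf"
    show "f \<in> test_circle"
      by (subst Hinf_trig_series(3)[OF f], rule trig_series_test_circle)
        (rule Hinf_trig_series(1,2)[OF f])+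
  qed
qed (rule circle_subset_Hinf)

text \<open>The embedding of \<open>H^2\<close> into bounded functions: the weight makes the
  coefficients absolutely summable with a bound linear in the norm. A constant independent of f is
  what later makes convergence in Sobolev norm uniform in space.\<close>

lemma Sobolev_bound:
  obtains C where "\<And>f x. f \<in> test_circle \<Longrightarrow> \<bar>f x\<bar> \<le> C * Hs_norm 2 (circle_distr f)"
proof
  fix f x assume f: "f \<in> test_circle"
  let ?a = "\<lambda>k. (if k = 0 then 1 / 2 else 1) / pi * fc f (int k)" and ?b = "\<lambda>k. fs f (int k) / pi"
  let ?N = "Hs_norm 2 (circle_distr f)"
  have H: "f \<in> Hinf" using f by (simp add: Hinf_eq)
  have N: "0 \<le> ?N" by (simp add: Hs_norm_def infsum_nonneg sobolev_term_nonneg)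
  have sm: "summable (\<lambda>k. \<bar>?a k\<bar> + \<bar>?b k\<bar>)"
    using H by (intro summable_add rapid_summable Hinf_trig_series)
  have S: "summable (\<lambda>k. 1 / (1 + (real k)^2))"
    by (rule summable_comparison_test'[OF inverse_power_summable[of 2], of 1])
      (auto simp: inverse_eq_divide abs_of_nonneg add_nonneg_nonneg intro!: frac_le)
  have "\<bar>?a k\<bar> + \<bar>?b k\<bar> \<le> 4 * ?N * (1 / (1 + (real k)^2))" for k
  proof -
    have "(1 + (real k)^2) * \<bar>fc f (int k)\<bar> \<le> 2 * pi * ?N" "(1 + (real k)^2) * \<bar>fs f (int k)\<bar> \<le> 2 * pi * ?N"
      using Hs_coeff_bound[of f 1 "int k"] f by (simp_all add: circle_continuous circle_in_Hs)
    moreover have w: "(1 + (real k)^2) > 0" by (intro add_pos_nonneg) auto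
    ultimately have "\<bar>fc f (int k)\<bar> \<le> 2 * pi * ?N / (1 + (real k)^2)" "\<bar>fs f (int k)\<bar> \<le> 2 * pi * ?N / (1 + (real k)^2)"
      by (simp_all add: pos_le_divide_eq mult.commute)
    then have "\<bar>fc f (int k)\<bar> / pi \<le> 2 * ?N / (1 + (real k)^2)" "\<bar>fs f (int k)\<bar> / pi \<le> 2 * ?N / (1 + (real k)^2)"
      using w by (simp_all add: pos_divide_le_eq mult_ac)
    moreover have "\<bar>?a k\<bar> \<le> \<bar>fc f (int k)\<bar> / pi" by (auto simp: abs_mult field_simps)
    ultimately show ?thesis by (simp add: abs_mult)
  qed
  then have "(\<Sum>k. \<bar>?a k\<bar> + \<bar>?b k\<bar>) \<le> (\<Sum>k. 4 * ?N * (1 / (1 + (real k)^2)))"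
    by (intro suminf_le sm summable_mult S)
  also have "\<dots> = 4 * ?N * (\<Sum>k. 1 / (1 + (real k)^2))" by (rule suminf_mult[OF S])
  finally have 1: "(\<Sum>k. \<bar>?a k\<bar> + \<bar>?b k\<bar>) \<le> (4 * (\<Sum>k. 1 / (1 + (real k)^2))) * ?N" by (simp add: mult_ac)
  have st: "summable (\<lambda>k. \<bar>trig_term ?a ?b k x\<bar>)"
    by (rule summable_comparison_test'[OF sm, of 0]) (simp only: real_norm_def abs_abs, rule trig_term_le)
  have "\<bar>trig_series ?a ?b x\<bar> \<le> (\<Sum>k. \<bar>trig_term ?a ?b k x\<bar>)"
    unfolding trig_series_def by (rule summable_rabs[OF st])
  also have "\<dots> \<le> (\<Sum>k. \<bar>?a k\<bar> + \<bar>?b k\<bar>)" by (intro suminf_le trig_term_le st sm)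
  also note 1
  finally show "\<bar>f x\<bar> \<le> (4 * (\<Sum>k. 1 / (1 + (real k)^2))) * ?N"
    using Hinf_trig_series(3)[OF H] by simp
qed

lemma Hs_norm_deriv_le:
  assumes f: "f \<in> test_circle"
  shows "Hs_norm s (circle_distr (deriv f)) \<le> Hs_norm (s + 1) (circle_distr f)"
proof -
  have f': "deriv f \<in> test_circle" by (rule circle_deriv[OF f])
  have "sobolev_term s (circle_distr (deriv f)) k \<le> sobolev_term (s + 1) (circle_distr f) k" for k
  proof -
    let ?w = "1 + (real_of_int k)^2" and ?A = "((fc f k)^2 + (fs f k)^2) / (2 * pi)^2"
    have w: "?w > 0" by (intro add_pos_nonneg) auto
    have "sobolev_term s (circle_distr (deriv f)) k = ?w powr s * ((real_of_int k)^2 * ?A)"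
      by (simp add: sobolev_term_eq[OF circle_continuous[OF f']] fc_fs_deriv[OF f] power_mult_distrib
          add_divide_distrib[symmetric] distrib_left[symmetric] add.commute)
    also have "\<dots> \<le> ?w powr s * (?w * ?A)" by (intro mult_left_mono mult_right_mono) auto
    also have "\<dots> = sobolev_term (s + 1) (circle_distr f) k"
      using w by (simp add: sobolev_term_eq[OF circle_continuous[OF f]] powr_add)
    finally show ?thesis .
  qed
  then show ?thesis
    unfolding Hs_norm_def
    using circle_in_Hs[OF f, of "s + 1"] circle_in_Hs[OF f', of s]
    by (intro real_sqrt_le_mono infsum_mono) (auto simp: Hs_def)
qed

text \<open>A functional bounded on \<open>H^(-1)\<close> is thus bounded by the L2 norm of f, both
  on f and on f'; the weight 1 / (1 + k^2) absorbs the k^2 of one derivative. The second bound lets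
  the derivative of an oscillation disappear in the weak limit.\<close>

lemma Hs_norm_minus_one_le:
  assumes "f \<in> test_circle"
  shows "Hs_norm (- 1) (circle_distr f) \<le> sqrt (CI x. (f x)^2)"
    and "Hs_norm (- 1) (circle_distr (deriv f)) \<le> sqrt (CI x. (f x)^2)"
proof -
  note c = circle_continuous[OF assms]
  have f': "deriv f \<in> test_circle" by (rule circle_deriv[OF assms])
  have *: "sqrt (infsum g UNIV) \<le> sqrt (CI x. (f x)^2)"
    if g: "g summable_on UNIV" "\<And>k. g k \<le> ((fc f k)^2 + (fs f k)^2) / (2 * pi)^2" for g
  proof (intro real_sqrt_le_mono infsum_le_finite_sums g(1))
    fix F :: "int set" assume F: "finite F"
    have "sum g F \<le> (\<Sum>k\<in>F. ((fc f k)^2 + (fs f k)^2) / (2 * pi)^2)" by (intro sum_mono g)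
    also have "\<dots> = (\<Sum>k\<in>F. (fc f k)^2 + (fs f k)^2) / (2 * pi)^2" by (simp add: sum_divide_distrib)
    also have "\<dots> \<le> (2 * pi * (CI x. (f x)^2)) / (2 * pi)^2"
      by (intro divide_right_mono Bessel F c) auto
    also have "\<dots> = (CI x. (f x)^2) / (2 * pi)" by (simp add: power2_eq_square)
    also have "\<dots> \<le> (CI x. (f x)^2) / 1"
      using pi_ge_two int_square_nonneg[OF c, of 0 "2 * pi"] by (intro divide_left_mono) auto
    finally show "sum g F \<le> (CI x. (f x)^2)" by simp
  qed
  have w: "0 < 1 + (real_of_int k)^2" for k by (intro add_pos_nonneg) auto
  have wle: "(1 + (real_of_int k)^2) powr - 1 \<le> 1" for k
    using w[of k] by (simp add: powr_minus inverse_le_1_iff)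
  show "Hs_norm (- 1) (circle_distr f) \<le> sqrt (CI x. (f x)^2)"
    unfolding Hs_norm_def
  proof (rule *)
    show "sobolev_term (- 1) (circle_distr f) summable_on UNIV"
      using circle_in_Hs[OF assms] by (simp add: Hs_def)
    show "sobolev_term (- 1) (circle_distr f) k \<le> ((fc f k)^2 + (fs f k)^2) / (2 * pi)^2" for k
      unfolding sobolev_term_eq[OF c] using mult_right_mono[OF wle, of "((fc f k)^2 + (fs f k)^2) / (2 * pi)^2" k] by simp
  qed
  show "Hs_norm (- 1) (circle_distr (deriv f)) \<le> sqrt (CI x. (f x)^2)"
    unfolding Hs_norm_def
  proof (rule *)
    show "sobolev_term (- 1) (circle_distr (deriv f)) summable_on UNIV"
      using circle_in_Hs[OF f'] by (simp add: Hs_def)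
    show "sobolev_term (- 1) (circle_distr (deriv f)) k \<le> ((fc f k)^2 + (fs f k)^2) / (2 * pi)^2" for k
    proof -
      let ?w = "1 + (real_of_int k)^2" and ?A = "((fc f k)^2 + (fs f k)^2) / (2 * pi)^2"
      have "sobolev_term (- 1) (circle_distr (deriv f)) k = ?w powr - 1 * ((real_of_int k)^2 * ?A)"
        by (simp add: sobolev_term_eq[OF circle_continuous[OF f']] fc_fs_deriv[OF assms] power_mult_distrib
            add_divide_distrib[symmetric] distrib_left[symmetric] add.commute)
      also have "\<dots> \<le> ?w powr - 1 * (?w * ?A)" by (intro mult_left_mono mult_right_mono) auto
      also have "\<dots> = (?w powr - 1 * ?w) * ?A" by (simp only: mult.assoc)
      also have "?w powr - 1 * ?w = 1" using w[of k] by (simp add: powr_minus)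
      also have "1 * ?A = ?A" by simp
      finally show ?thesis .
    qed
  qed
qed

section \<open>Differentiation under the integral sign\<close>

lemma int_DERIV_param:
  fixes f :: "real \<Rightarrow> real \<Rightarrow> 'a::banach"
  assumes "\<And>t x. ((\<lambda>t. f t x) has_vector_derivative ft t x) (at t)"
    and "\<And>t. continuous_on {a..b} (f t)" "continuous_on UNIV (\<lambda>(t, x). ft t x)"
  shows "((\<lambda>t. integral {a..b} (f t)) has_vector_derivative integral {a..b} (ft t)) (at t)"
proof -
  have "((\<lambda>t. integral (cbox a b) (f t)) has_vector_derivative integral (cbox a b) (ft t)) (at t within UNIV)"
    by (rule leibniz_rule_vector_derivative)
      (use assms in \<open>auto intro: integrable_continuous_real continuous_on_subset[OF assms(3)]\<close>)
  then show ?thesis by simp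
qed

lemma int_DERIV_param_real:
  fixes f :: "real \<Rightarrow> real \<Rightarrow> real"
  assumes "\<And>t x. ((\<lambda>t. f t x) has_real_derivative ft t x) (at t)"
    and "\<And>t. continuous_on {a..b} (f t)" "continuous_on UNIV (\<lambda>(t, x). ft t x)"
  shows "((\<lambda>t. integral {a..b} (f t)) has_real_derivative integral {a..b} (ft t)) (at t)"
  using int_DERIV_param[of f ft a b t] assms by (simp add: has_real_derivative_iff_has_vector_derivative)

lemma int_continuous_param:
  fixes f :: "real \<Rightarrow> real \<Rightarrow> 'a::banach"
  assumes "continuous_on UNIV (\<lambda>(t, x). f t x)"
  shows "continuous_on A (\<lambda>t. integral {a..b} (f t))"
  using integral_continuous_on_param[of A a b f] continuous_on_subset[OF assms, of "A \<times> {a..b}"] by simp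

lemma continuous_uncurry_compose:
  assumes "continuous_on UNIV (\<lambda>(t, x). f t x)" "continuous_on A g" "continuous_on A h"
  shows "continuous_on A (\<lambda>p. f (g p) (h p))"
  using continuous_on_compose2[OF assms(1) continuous_on_Pair[OF assms(2,3)]] by simp

text \<open>Interchange of the two derivatives by integration: write \<open>f\<close> as a time
  integral of \<open>F\<close>, differentiate the integral in space, and read the result as a time
  antiderivative of \<open>Fx\<close>. It yields the equations for the spatial derivatives of a
  solution.\<close>

lemma DERIV_mixed:
  fixes f :: "real \<Rightarrow> real \<Rightarrow> real"
  assumes ft: "\<And>t x. ((\<lambda>t. f t x) has_real_derivative F t x) (at t)"
    and fx: "\<And>t x. (f t has_real_derivative fx t x) (at x)"
    and Fx: "\<And>t x. (F t has_real_derivative Fx t x) (at x)"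
    and cF: "continuous_on UNIV (\<lambda>(t, x). F t x)" and cFx: "continuous_on UNIV (\<lambda>(t, x). Fx t x)"
  shows "((\<lambda>t. fx t x) has_real_derivative Fx t x) (at t)"
proof -
  define a where "a = t - 1"
  note cc = continuous_uncurry_compose[OF cF] continuous_uncurry_compose[OF cFx]
  have eq: "fx s x = fx a x + integral {a..s} (\<lambda>r. Fx r x)" if "s \<ge> a" for s
  proof -
    have "f s y - f a y = integral {a..s} (\<lambda>r. F r y)" for y
      using int_FTC[OF ft that] by simp
    then have e: "(\<lambda>y. f s y - f a y) = (\<lambda>y. integral {a..s} (\<lambda>r. F r y))" by auto
    have "((\<lambda>y. integral {a..s} (\<lambda>r. F r y)) has_real_derivative integral {a..s} (\<lambda>r. Fx r x)) (at x)"
    proof (rule int_DERIV_param_real[of "\<lambda>y r. F r y" "\<lambda>y r. Fx r y"])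
      show "continuous_on {a..s} (\<lambda>r. F r y)" for y by (intro cc continuous_intros)
      show "continuous_on UNIV (\<lambda>(y, r). Fx r y)"
        unfolding case_prod_unfold by (intro cc continuous_intros)
    qed (rule Fx)
    moreover have "((\<lambda>y. f s y - f a y) has_real_derivative fx s x - fx a x) (at x)"
      by (intro DERIV_diff fx)
    ultimately have "fx s x - fx a x = integral {a..s} (\<lambda>r. Fx r x)"
      unfolding e using DERIV_unique by blast
    then show ?thesis by simp
  qed
  have "((\<lambda>s. integral {a..s} (\<lambda>r. Fx r x)) has_real_derivative Fx t x) (at t within {a..t + 1})"
    by (rule integral_has_real_derivative) (auto intro!: cc continuous_intros simp: a_def)
  then have "((\<lambda>s. integral {a..s} (\<lambda>r. Fx r x)) has_real_derivative Fx t x) (at t)"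
    by (subst (asm) at_within_interior) (auto simp: a_def)
  from DERIV_add[OF DERIV_const[of "fx a x"] this]
  have "((\<lambda>s. fx a x + integral {a..s} (\<lambda>r. Fx r x)) has_real_derivative Fx t x) (at t)"
    by simp
  then show ?thesis
    by (rule has_field_derivative_transform_within_open[of _ _ _ "{a<..}"])
      (simp, simp add: a_def, rule eq[symmetric], simp)
qed

text \<open>Chain rule at a moving point, for the Galilean boost. The two partial derivatives give
  total differentiability because one of them, \<open>Gx\<close>, is jointly continuous.\<close>

lemma DERIV_along_line:
  fixes G :: "real \<Rightarrow> real \<Rightarrow> real"
  assumes Gt: "\<And>t x. ((\<lambda>t. G t x) has_real_derivative Gt t x) (at t)"
    and Gx: "\<And>t x. (G t has_real_derivative Gx t x) (at x)"
    and cont: "continuous_on UNIV (\<lambda>(t, x). Gx t x)"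
  shows "((\<lambda>t. G t (x + a * t)) has_real_derivative Gt t (x + a * t) + a * Gx t (x + a * t)) (at t)"
proof -
  let ?y = "x + a * t"
  have "((\<lambda>(t, x). G t x) has_derivative (\<lambda>(tt, ty). Gt t ?y * tt + blinfun_mult_right (Gx t ?y) ty))
      (at (t, ?y) within UNIV \<times> UNIV)"
  proof (rule has_derivative_partialsI)
    show "((\<lambda>t. G t ?y) has_derivative (*) (Gt t ?y)) (at t within UNIV)"
      using Gt[of ?y t] by (simp add: has_field_derivative_def)
    show "(G s has_derivative blinfun_apply (blinfun_mult_right (Gx s y))) (at y within UNIV)" for s y
      using Gx[of s y] by (simp add: has_field_derivative_def)
    have "continuous_on UNIV (\<lambda>p. blinfun_mult_right (case p of (s, y) \<Rightarrow> Gx s y))"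
      by (rule bounded_linear.continuous_on[OF bounded_linear_blinfun_mult_right cont])
    then have "continuous_on UNIV (\<lambda>(s, y). blinfun_mult_right (Gx s y))"
      by (simp add: case_prod_unfold)
    then show "continuous (at (t, ?y) within UNIV \<times> UNIV) (\<lambda>(s, y). blinfun_mult_right (Gx s y))"
      by (simp add: continuous_on_eq_continuous_at)
  qed auto
  then have 1: "((\<lambda>(t, x). G t x) has_derivative (\<lambda>(tt, ty). Gt t ?y * tt + Gx t ?y * ty)) (at (t, ?y))"
    by simp
  have 2: "((\<lambda>t. (t, x + a * t)) has_derivative (\<lambda>h. (h, a * h))) (at t)"
    by (auto intro!: derivative_eq_intros)
  have "((\<lambda>t. G t (x + a * t)) has_derivative (\<lambda>h. Gt t ?y * h + Gx t ?y * (a * h))) (at t)"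
    using has_derivative_compose[OF 2 1] by simp
  moreover have "(\<lambda>h. Gt t ?y * h + Gx t ?y * (a * h)) = (*) (Gt t ?y + a * Gx t ?y)"
    by (auto simp: algebra_simps)
  ultimately show ?thesis by (simp only: has_field_derivative_def)
qed

section \<open>Uniqueness for the KdV equation\<close>

text \<open>An L2 estimate for the difference followed by Gronwall. The derivatives are given as
  explicit functions instead of through \<open>kdv_solution\<close>, because one of the two
  solutions will be a boosted Miura transform, for which pointwise derivatives and joint continuity
  are at hand while continuity in Sobolev norms would need a separate argument.\<close>

lemma kdv_unique:
  fixes w0 w1 w2 w3 z0 z1 z2 z3 :: "real \<Rightarrow> real \<Rightarrow> real"
  assumes w: "\<And>t x. (w0 t has_real_derivative w1 t x) (at x)" "\<And>t x. (w1 t has_real_derivative w2 t x) (at x)"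
      "\<And>t x. (w2 t has_real_derivative w3 t x) (at x)"
    and z: "\<And>t x. (z0 t has_real_derivative z1 t x) (at x)" "\<And>t x. (z1 t has_real_derivative z2 t x) (at x)"
      "\<And>t x. (z2 t has_real_derivative z3 t x) (at x)"
    and cw: "continuous_on UNIV (\<lambda>(t, x). w0 t x)" "continuous_on UNIV (\<lambda>(t, x). w1 t x)"
      "continuous_on UNIV (\<lambda>(t, x). w2 t x)" "continuous_on UNIV (\<lambda>(t, x). w3 t x)"
    and cz: "continuous_on UNIV (\<lambda>(t, x). z0 t x)" "continuous_on UNIV (\<lambda>(t, x). z1 t x)"
      "continuous_on UNIV (\<lambda>(t, x). z2 t x)" "continuous_on UNIV (\<lambda>(t, x). z3 t x)"
    and per: "\<And>t. periodic (w0 t)" "\<And>t. periodic (z0 t)"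
    and wt: "\<And>t x. ((\<lambda>t. w0 t x) has_real_derivative - w3 t x + 6 * w0 t x * w1 t x) (at t)"
    and zt: "\<And>t x. ((\<lambda>t. z0 t x) has_real_derivative - z3 t x + 6 * z0 t x * z1 t x) (at t)"
    and init: "w0 0 = z0 0" and "0 \<le> T"
  shows "w0 T x = z0 T x"
proof -
  note cc = cw[THEN continuous_uncurry_compose] cz[THEN continuous_uncurry_compose]
  have per1: "periodic (w1 t)" "periodic (z1 t)" for t
    using periodic_deriv[OF per(1) w(1)] periodic_deriv[OF per(2) z(1)] .
  have per2: "periodic (w2 t)" "periodic (z2 t)" for t
    using periodic_deriv[OF per1(1) w(2)] periodic_deriv[OF per1(2) z(2)] .
  have p: "w0 t (2 * pi) = w0 t 0" "w1 t (2 * pi) = w1 t 0" "w2 t (2 * pi) = w2 t 0"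
    "z0 t (2 * pi) = z0 t 0" "z1 t (2 * pi) = z1 t 0" "z2 t (2 * pi) = z2 t 0" for t
    using per per1 per2 unfolding periodic_def by (metis add_0)+
  define Y where "Y t = (CI x. (w0 t x - z0 t x)^2)" for t
  define S where "S t x = w1 t x + z1 t x" for t x
  have DY: "(Y has_real_derivative 3 * (CI x. S t x * (w0 t x - z0 t x)^2)) (at t)" for t
  proof -
    let ?d = "\<lambda>x. w0 t x - z0 t x"
    let ?R = "\<lambda>t x. 2 * (w0 t x - z0 t x) * ((- w3 t x + 6 * w0 t x * w1 t x) - (- z3 t x + 6 * z0 t x * z1 t x))"
    \<comment> \<open>Flux of the squared difference d: 2 d d_t minus the derivative of
      \<open>?Q\<close> is 3 (w + z)_x d^2, the only term that survives integration over the
      period.\<close>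
    let ?Q = "\<lambda>x. (w1 t x - z1 t x)^2 - 2 * (w0 t x - z0 t x) * (w2 t x - z2 t x)
        + 3 * (w0 t x + z0 t x) * (w0 t x - z0 t x)^2"
    have "(Y has_real_derivative cint (?R t)) (at t)"
      unfolding Y_def[abs_def]
      by (rule int_DERIV_param_real)
        (auto intro!: derivative_eq_intros wt zt continuous_intros cc simp: case_prod_unfold)
    moreover have "(CI x. ?R t x - 3 * (S t x * ?d x ^ 2)) = 0"
    proof (rule cint_deriv_zero)
      show "(?Q has_real_derivative ?R t x - 3 * (S t x * ?d x ^ 2)) (at x)" for x
        by (rule derivative_eq_intros w z refl)+
          (simp add: S_def power2_eq_square algebra_simps)
    qed (simp add: p)
    moreover have "(CI x. ?R t x - 3 * (S t x * ?d x ^ 2)) = cint (?R t) - (CI x. 3 * (S t x * ?d x ^ 2))"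
      unfolding S_def by (intro int_diff continuous_intros cc)
    ultimately show ?thesis by simp
  qed
  have "continuous_on ({0..T} \<times> {0..2 * pi}) (\<lambda>p. S (fst p) (snd p))"
    unfolding S_def by (intro continuous_intros cc)
  then have "bounded ((\<lambda>p. S (fst p) (snd p)) ` ({0..T} \<times> {0..2 * pi}))"
    by (intro compact_imp_bounded compact_continuous_image compact_Times) auto
  then obtain B where B: "B > 0" "\<forall>y\<in>(\<lambda>p. S (fst p) (snd p)) ` ({0..T} \<times> {0..2 * pi}). norm y \<le> B"
    unfolding bounded_pos by blast
  have Bd: "S t x \<le> B" if "t \<in> {0..T}" "x \<in> {0..2 * pi}" for t x
    using B(2)[rule_format, of "S t x"] that by (force simp: image_iff)
  \<comment> \<open>Gronwall: the exponential compensates the growth rate \<open>3 * B\<close>,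
    where \<open>B\<close> bounds (w + z)_x on the compact space-time rectangle.\<close>
  have "exp (- (3 * B) * T) * Y T \<le> exp (- (3 * B) * 0) * Y 0"
  proof (rule DERIV_nonpos_imp_nonincreasing[where f = "\<lambda>t. exp (- (3 * B) * t) * Y t"])
    fix t assume t: "0 \<le> t" "t \<le> T"
    have "(CI x. S t x * (w0 t x - z0 t x)^2) \<le> (CI x. B * (w0 t x - z0 t x)^2)"
      unfolding S_def
      by (intro int_mono continuous_intros cc mult_right_mono) (use Bd t in \<open>auto simp: S_def\<close>)
    then have "3 * (CI x. S t x * (w0 t x - z0 t x)^2) \<le> 3 * B * Y t" by (simp add: Y_def)
    then have "exp (- (3 * B) * t) * (3 * (CI x. S t x * (w0 t x - z0 t x)^2) - 3 * B * Y t) \<le> 0"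
      by (simp add: mult_le_0_iff)
    moreover have "((\<lambda>t. exp (- (3 * B) * t) * Y t) has_real_derivative
        exp (- (3 * B) * t) * (3 * (CI x. S t x * (w0 t x - z0 t x)^2) - 3 * B * Y t)) (at t)"
      by (rule derivative_eq_intros DY refl)+ (simp add: algebra_simps)
    ultimately show "\<exists>y. ((\<lambda>t. exp (- (3 * B) * t) * Y t) has_real_derivative y) (at t) \<and> y \<le> 0" by blast
  qed (rule \<open>0 \<le> T\<close>)
  also have "Y 0 = 0" by (simp add: Y_def init)
  finally have "Y T \<le> 0" by (simp add: mult_le_0_iff)
  obtain y where y: "y \<in> {0..<2 * pi}" "w0 T y - z0 T y = w0 T x - z0 T x"
    using periodic_reduce[of "\<lambda>x. w0 T x - z0 T x"] per unfolding periodic_def by metis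
  have "w0 T y - z0 T y = 0"
    by (rule int_zero_imp_zero[of 0 "2 * pi" "\<lambda>x. w0 T x - z0 T x"])
      (use \<open>Y T \<le> 0\<close> y in \<open>auto intro!: continuous_intros cc simp: Y_def\<close>)
  with y show ?thesis by simp
qed

section \<open>Regularity of solutions\<close>

abbreviation jet :: "(real \<Rightarrow> real \<Rightarrow> real) \<Rightarrow> nat \<Rightarrow> real \<Rightarrow> real \<Rightarrow> real" where
  "jet u j t \<equiv> (deriv ^^ j) (u t)"

lemma deriv_funpow_diff:
  assumes "smooth f" "smooth g"
  shows "(deriv ^^ j) (\<lambda>x. f x - g x) = (\<lambda>x. (deriv ^^ j) f x - (deriv ^^ j) g x)"
proof (induction j)
  case (Suc j)
  have "((\<lambda>x. (deriv ^^ j) f x - (deriv ^^ j) g x) has_real_derivative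
      deriv ((deriv ^^ j) f) x - deriv ((deriv ^^ j) g) x) (at x)" for x
    by (intro DERIV_diff smooth_DERIV smooth_deriv_funpow assms)
  then show ?case using Suc by (auto intro!: ext DERIV_imp_deriv)
qed simp

text \<open>Continuity in time with values in \<open>H^(2 + j)\<close> makes the j-th derivative
  continuous in time uniformly in x; with continuity in x at a fixed time this gives joint
  continuity.\<close>

lemma jet_continuous:
  assumes "continuous_in_Hinf u"
  shows "continuous_on UNIV (\<lambda>(t, x). jet u j t x)"
proof -
  have u: "u t \<in> test_circle" for t using assms by (auto simp: continuous_in_Hinf_def Hinf_eq)
  obtain C where C: "\<And>f x. f \<in> test_circle \<Longrightarrow> \<bar>f x\<bar> \<le> C * Hs_norm 2 (circle_distr f)"
    using Sobolev_bound by blast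
  have C0: "0 \<le> C"
  proof -
    have "1 \<le> C * Hs_norm 2 (circle_distr (\<lambda>x. 1))" using C[OF circle_const, of 1] by simp
    moreover have "0 \<le> Hs_norm 2 (circle_distr (\<lambda>x. 1))"
      by (simp add: Hs_norm_def infsum_nonneg sobolev_term_nonneg)
    ultimately show ?thesis by (metis mult_nonpos_nonneg not_one_le_zero order_trans linorder_le_cases)
  qed
  have step: "Hs_norm s (circle_distr ((deriv ^^ j) f)) \<le> Hs_norm (s + real j) (circle_distr f)"
    if "f \<in> test_circle" for f s
  proof (induction j arbitrary: s)
    case (Suc j)
    have "Hs_norm s (circle_distr (deriv ((deriv ^^ j) f))) \<le> Hs_norm (s + 1) (circle_distr ((deriv ^^ j) f))"
      by (rule Hs_norm_deriv_le[OF circle_deriv_funpow[OF that]])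
    also have "\<dots> \<le> Hs_norm (s + 1 + real j) (circle_distr f)" by (rule Suc)
    finally show ?case by (simp add: add_ac)
  qed simp
  have bd: "\<bar>jet u j \<tau> y - jet u j t y\<bar> \<le> C * Hs_norm (2 + real j) (circle_distr (\<lambda>x. u \<tau> x - u t x))" for \<tau> t y
  proof -
    have d: "(\<lambda>x. u \<tau> x - u t x) \<in> test_circle" by (intro circle_diff u)
    have "(deriv ^^ j) (\<lambda>x. u \<tau> x - u t x) = (\<lambda>x. jet u j \<tau> x - jet u j t x)"
      using u by (intro deriv_funpow_diff) (auto simp: circle_iff)
    then have "\<bar>jet u j \<tau> y - jet u j t y\<bar> \<le> C * Hs_norm 2 (circle_distr ((deriv ^^ j) (\<lambda>x. u \<tau> x - u t x)))"
      using C[OF circle_deriv_funpow[OF d, of j], of y] by simp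
    also have "\<dots> \<le> C * Hs_norm (2 + real j) (circle_distr (\<lambda>x. u \<tau> x - u t x))"
      by (intro mult_left_mono step d C0)
    finally show ?thesis .
  qed
  have "isCont (\<lambda>(t, x). jet u j t x) (t, x)" for t x
  proof -
    let ?h = "\<lambda>\<tau>. Hs_norm (2 + real j) (circle_distr (\<lambda>x. u \<tau> x - u t x))"
    have "(?h \<longlongrightarrow> 0) (at t)" using assms by (simp add: continuous_in_Hinf_def)
    \<comment> \<open>The definition of continuity in time only speaks of the limit at t; the value
      0 there turns it into continuity of \<open>?h\<close>.\<close>
    moreover have "?h t = 0"
    proof -
      have "sobolev_term (2 + real j) (circle_distr (\<lambda>x. 0)) = (\<lambda>k. 0)"
        by (auto simp: sobolev_term_eq fc_def fs_def)
      then show ?thesis by (simp add: Hs_norm_def)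
    qed
    ultimately have "isCont ?h t" by (simp add: isCont_def)
    then have h: "isCont (\<lambda>p. C * ?h (fst p)) (t, x)"
      by (intro continuous_intros isCont_o2[where g = ?h and f = fst]) auto
    have "isCont (\<lambda>p :: real \<times> real. snd p) (t, x)" by (intro continuous_intros)
    moreover have "isCont (jet u j t) (snd (t, x))"
      by (rule DERIV_isCont[OF circle_DERIV_funpow[OF u]])
    ultimately have g: "isCont (\<lambda>p. jet u j t (snd p)) (t, x)"
      by (rule isCont_o2)
    have "((\<lambda>p. C * ?h (fst p) + \<bar>jet u j t (snd p) - jet u j t x\<bar>) \<longlongrightarrow> 0) (at (t, x))"
    proof -
      have "isCont (\<lambda>p. C * ?h (fst p) + \<bar>jet u j t (snd p) - jet u j t x\<bar>) (t, x)"
        by (intro continuous_intros h g)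
      then show ?thesis using \<open>?h t = 0\<close> by (simp add: isCont_def)
    qed
    then have "((\<lambda>p. (case p of (t, x) \<Rightarrow> jet u j t x) - jet u j t x) \<longlongrightarrow> 0) (at (t, x))"
    proof (rule Lim_null_comparison[rotated], intro always_eventually allI)
      fix p :: "real \<times> real"
      obtain s y where p: "p = (s, y)" by (cases p)
      have "\<bar>jet u j s y - jet u j t x\<bar> \<le> \<bar>jet u j s y - jet u j t y\<bar> + \<bar>jet u j t y - jet u j t x\<bar>"
        by linarith
      also have "\<dots> \<le> C * ?h s + \<bar>jet u j t y - jet u j t x\<bar>" by (intro add_right_mono bd)
      finally show "norm ((case p of (t, x) \<Rightarrow> jet u j t x) - jet u j t x)
          \<le> C * ?h (fst p) + \<bar>jet u j t (snd p) - jet u j t x\<bar>" by (simp add: p)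
    qed
    then show ?thesis by (simp add: isCont_def LIM_zero_iff)
  qed
  then show ?thesis by (intro continuous_at_imp_continuous_on ballI) auto
qed

lemma jet_DERIV:
  assumes "continuous_in_Hinf u"
  shows "(jet u j t has_real_derivative jet u (Suc j) t x) (at x)"
  using assms by (intro circle_DERIV_funpow) (auto simp: continuous_in_Hinf_def Hinf_eq)

lemma jet_test_circle: "continuous_in_Hinf u \<Longrightarrow> jet u j t \<in> test_circle"
  by (intro circle_deriv_funpow) (auto simp: continuous_in_Hinf_def Hinf_eq)

section \<open>Smooth solutions of the mKdV equation and their conservation laws\<close>

text \<open>\<open>v j\<close> stands for the j-th spatial derivative of the solution
  \<open>v 0\<close>. With the derivatives as separate functions, each conservation law reduces to a
  polynomial identity in the jet, and -v is an instance of the same locale.\<close>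

locale mkdv =
  fixes \<sigma> :: real and v :: "nat \<Rightarrow> real \<Rightarrow> real \<Rightarrow> real"
  assumes sign: "\<sigma> = 1 \<or> \<sigma> = - 1"
    and periodic_v: "v j t (x + 2 * pi) = v j t x"
    and DERIV_v: "(v j t has_real_derivative v (Suc j) t x) (at x)"
    and continuous_v: "continuous_on UNIV (\<lambda>(t, x). v j t x)"
    and equation: "((\<lambda>t. v 0 t x) has_real_derivative - v 3 t x + 6 * \<sigma> * (v 0 t x)^2 * v 1 t x) (at t)"
begin

lemma cv [continuous_intros]:
  "continuous_on A g \<Longrightarrow> continuous_on A h \<Longrightarrow> continuous_on A (\<lambda>p. v j (g p) (h p))"
  by (rule continuous_uncurry_compose[OF continuous_v])

lemma sign_square: "\<sigma> * \<sigma> = 1"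
  using sign by auto

lemma per_v: "v j t (2 * pi) = v j t 0"
  using periodic_v[of j t 0] by simp

lemma DERIV_v_num:
  "(v 0 t has_real_derivative v 1 t x) (at x)" "(v 1 t has_real_derivative v 2 t x) (at x)"
  "(v 2 t has_real_derivative v 3 t x) (at x)" "(v 3 t has_real_derivative v 4 t x) (at x)"
  "(v 4 t has_real_derivative v 5 t x) (at x)"
  using DERIV_v[of 0 t x] DERIV_v[of 1 t x] DERIV_v[of 2 t x] DERIV_v[of 3 t x] DERIV_v[of 4 t x]
  by (simp_all add: eval_nat_numeral)

lemma circle_v: "v j t \<in> test_circle"
proof -
  have "smooth (v j t)"
    by (rule smooth_coinduct[of _ "range (\<lambda>j. v j t)"]) (use DERIV_v in blast)+
  then show ?thesis by (simp add: circle_iff periodic_def periodic_v)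
qed

lemma equation_x:
  "((\<lambda>t. v 1 t x) has_real_derivative - v 4 t x + 6 * \<sigma> * (2 * v 0 t x * (v 1 t x)^2 + (v 0 t x)^2 * v 2 t x)) (at t)"
proof (rule DERIV_mixed[where f = "v 0" and F = "\<lambda>t x. - v 3 t x + 6 * \<sigma> * (v 0 t x)^2 * v 1 t x" and fx = "v 1"
      and Fx = "\<lambda>t x. - v 4 t x + 6 * \<sigma> * (2 * v 0 t x * (v 1 t x)^2 + (v 0 t x)^2 * v 2 t x)"])
  show "((\<lambda>x. - v 3 t x + 6 * \<sigma> * (v 0 t x)^2 * v 1 t x) has_real_derivative
      - v 4 t x + 6 * \<sigma> * (2 * v 0 t x * (v 1 t x)^2 + (v 0 t x)^2 * v 2 t x)) (at x)" for t x
    by (rule derivative_eq_intros DERIV_v_num refl)+ (simp add: power2_eq_square algebra_simps)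
qed ((rule equation DERIV_v_num)+, auto intro!: continuous_intros simp: case_prod_unfold)

lemma equation_xx:
  "((\<lambda>t. v 2 t x) has_real_derivative - v 5 t x + 6 * \<sigma> * (2 * (v 1 t x) ^ 3
    + 6 * v 0 t x * v 1 t x * v 2 t x + (v 0 t x)^2 * v 3 t x)) (at t)"
proof (rule DERIV_mixed[where f = "v 1" and fx = "v 2"
      and F = "\<lambda>t x. - v 4 t x + 6 * \<sigma> * (2 * v 0 t x * (v 1 t x)^2 + (v 0 t x)^2 * v 2 t x)"
      and Fx = "\<lambda>t x. - v 5 t x + 6 * \<sigma> * (2 * (v 1 t x) ^ 3 + 6 * v 0 t x * v 1 t x * v 2 t x + (v 0 t x)^2 * v 3 t x)"])
  show "((\<lambda>x. - v 4 t x + 6 * \<sigma> * (2 * v 0 t x * (v 1 t x)^2 + (v 0 t x)^2 * v 2 t x)) has_real_derivative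
      - v 5 t x + 6 * \<sigma> * (2 * (v 1 t x) ^ 3 + 6 * v 0 t x * v 1 t x * v 2 t x + (v 0 t x)^2 * v 3 t x)) (at x)" for t x
    by (rule derivative_eq_intros DERIV_v_num refl)+ (simp add: power2_eq_square power3_eq_cube algebra_simps)
qed ((rule equation_x DERIV_v_num)+, auto intro!: continuous_intros simp: case_prod_unfold)

text \<open>Common form of the conservation laws: \<open>ft\<close> is the time derivative of the
  density, and \<open>r\<close> is what remains of it after subtraction of the derivative of a
  periodic flux \<open>Q\<close>.\<close>

lemma cint_DERIV_cancel:
  assumes "\<And>t x. ((\<lambda>t. f t x) has_real_derivative ft t x) (at t)"
    and "\<And>t. continuous_on {0..2 * pi} (f t)" "continuous_on UNIV (\<lambda>(t, x). ft t x)"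
    and "\<And>x. (Q has_real_derivative ft t x - r x) (at x)" "Q (2 * pi) = Q 0"
    and "continuous_on {0..2 * pi} r"
  shows "((\<lambda>t. cint (f t)) has_real_derivative cint r) (at t)"
proof -
  have c: "continuous_on {0..2 * pi} (ft t)"
    by (rule continuous_uncurry_compose[OF assms(3)]) (intro continuous_intros)+
  have "(CI x. ft t x - r x) = 0" by (rule cint_deriv_zero[OF assms(4,5)])
  then have "cint (ft t) = cint r" using int_diff[OF c assms(6)] by simp
  then show ?thesis using int_DERIV_param_real[OF assms(1,2,3), of t] by simp
qed

text \<open>The localised law gives access to v_x^2: read backwards, it expresses the pairing of
  v_x^2 with the derivative of a test function through a time derivative and terms of lower order in
  the frequency.\<close>

lemma mass_law:
  assumes \<phi>: "\<phi> \<in> test_circle"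
  shows "((\<lambda>t. CI x. \<phi> x * (v 0 t x)^2) has_real_derivative
    (CI x. (deriv ^^ 3) \<phi> x * (v 0 t x)^2 - 3 * (deriv \<phi> x * ((v 1 t x)^2 + \<sigma> * (v 0 t x) ^ 4)))) (at t)"
proof -
  note mem = \<phi> circle_deriv[OF \<phi>] circle_deriv[OF circle_deriv[OF \<phi>]]
  let ?cha = "deriv \<phi>" and ?chb = "deriv (deriv \<phi>)" and ?chc = "(deriv ^^ 3) \<phi>"
  have chc: "deriv ?chb = ?chc" by (simp add: eval_nat_numeral)
  note c = mem[THEN circle_continuous] circle_continuous[OF circle_deriv_funpow[OF \<phi>]]
  note d = mem[THEN circle_DERIV, unfolded chc]
  note p = mem[THEN circle_period_eq]
  have cs: "continuous_on UNIV (\<lambda>p :: real \<times> real. \<phi> (snd p))"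
    by (rule continuous_on_compose2[OF c(1)[of UNIV] continuous_on_snd[OF continuous_on_id]]) simp
  show ?thesis
  proof (rule cint_DERIV_cancel[where ft = "\<lambda>t x. \<phi> x * (2 * v 0 t x * (- v 3 t x + 6 * \<sigma> * (v 0 t x)^2 * v 1 t x))"
        and Q = "\<lambda>x. \<phi> x * ((v 1 t x)^2 - 2 * v 0 t x * v 2 t x + 3 * \<sigma> * (v 0 t x) ^ 4)
          + ?cha x * (2 * v 0 t x * v 1 t x) - ?chb x * (v 0 t x)^2"])
    show "((\<lambda>t. \<phi> x * (v 0 t x)^2) has_real_derivative
        \<phi> x * (2 * v 0 t x * (- v 3 t x + 6 * \<sigma> * (v 0 t x)^2 * v 1 t x))) (at t)" for t x
      by (rule derivative_eq_intros equation refl)+ (simp add: algebra_simps)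
    show "((\<lambda>x. \<phi> x * ((v 1 t x)^2 - 2 * v 0 t x * v 2 t x + 3 * \<sigma> * (v 0 t x) ^ 4)
        + ?cha x * (2 * v 0 t x * v 1 t x) - ?chb x * (v 0 t x)^2) has_real_derivative
        \<phi> x * (2 * v 0 t x * (- v 3 t x + 6 * \<sigma> * (v 0 t x)^2 * v 1 t x)) -
        (?chc x * (v 0 t x)^2 - 3 * (deriv \<phi> x * ((v 1 t x)^2 + \<sigma> * (v 0 t x) ^ 4)))) (at x)" for x
      by (rule derivative_eq_intros DERIV_v_num d refl)+
        (simp add: eval_nat_numeral algebra_simps)
    show "\<phi> (2 * pi) * ((v 1 t (2 * pi))^2 - 2 * v 0 t (2 * pi) * v 2 t (2 * pi) + 3 * \<sigma> * (v 0 t (2 * pi)) ^ 4)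
        + ?cha (2 * pi) * (2 * v 0 t (2 * pi) * v 1 t (2 * pi)) - ?chb (2 * pi) * (v 0 t (2 * pi))^2
      = \<phi> 0 * ((v 1 t 0)^2 - 2 * v 0 t 0 * v 2 t 0 + 3 * \<sigma> * (v 0 t 0) ^ 4)
        + ?cha 0 * (2 * v 0 t 0 * v 1 t 0) - ?chb 0 * (v 0 t 0)^2"
      by (simp only: per_v p)
    show "continuous_on {0..2 * pi} (\<lambda>x. (deriv ^^ 3) \<phi> x * (v 0 t x)^2
        - 3 * (deriv \<phi> x * ((v 1 t x)^2 + \<sigma> * (v 0 t x) ^ 4)))"
      by (intro continuous_intros c)
  qed (auto intro!: continuous_intros c cs simp: case_prod_unfold)
qed

text \<open>Plays for v_xx^2 the role that \<open>mass_law\<close> plays for v_x^2. The term v^6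
  arises with the coefficient \<sigma>^2, which is 1 for both signs.\<close>

lemma energy_law:
  assumes \<phi>: "\<phi> \<in> test_circle"
  shows "((\<lambda>t. CI x. \<phi> x * ((v 1 t x)^2 + \<sigma> * (v 0 t x) ^ 4)) has_real_derivative
    (CI x. (deriv ^^ 3) \<phi> x * (v 1 t x)^2 - deriv \<phi> x * (3 * (v 2 t x)^2
      + 12 * \<sigma> * (v 0 t x)^2 * (v 1 t x)^2 - 4 * \<sigma> * (v 0 t x) ^ 3 * v 2 t x + 4 * (v 0 t x) ^ 6))) (at t)"
proof -
  note mem = \<phi> circle_deriv[OF \<phi>] circle_deriv[OF circle_deriv[OF \<phi>]]
  let ?cha = "deriv \<phi>" and ?chb = "deriv (deriv \<phi>)" and ?chc = "(deriv ^^ 3) \<phi>"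
  have chc: "deriv ?chb = ?chc" by (simp add: eval_nat_numeral)
  note c = mem[THEN circle_continuous] circle_continuous[OF circle_deriv_funpow[OF \<phi>]]
  note d = mem[THEN circle_DERIV, unfolded chc]
  note p = mem[THEN circle_period_eq]
  have cs: "continuous_on UNIV (\<lambda>p :: real \<times> real. \<phi> (snd p))"
    by (rule continuous_on_compose2[OF c(1)[of UNIV] continuous_on_snd[OF continuous_on_id]]) simp
  let ?\<Psi> = "\<lambda>x. (v 2 t x)^2 - 2 * v 1 t x * v 3 t x + 12 * \<sigma> * (v 0 t x)^2 * (v 1 t x)^2
    - 4 * \<sigma> * (v 0 t x) ^ 3 * v 2 t x + 4 * (v 0 t x) ^ 6"
  let ?ft = "\<lambda>t x. \<phi> x * (2 * v 1 t x * (- v 4 t x + 6 * \<sigma> * (2 * v 0 t x * (v 1 t x)^2 + (v 0 t x)^2 * v 2 t x))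
    + \<sigma> * (4 * (v 0 t x) ^ 3 * (- v 3 t x + 6 * \<sigma> * (v 0 t x)^2 * v 1 t x)))"
  let ?r = "\<lambda>x. ?chc x * (v 1 t x)^2 - deriv \<phi> x * (3 * (v 2 t x)^2
      + 12 * \<sigma> * (v 0 t x)^2 * (v 1 t x)^2 - 4 * \<sigma> * (v 0 t x) ^ 3 * v 2 t x + 4 * (v 0 t x) ^ 6)"
  show ?thesis
  proof (rule cint_DERIV_cancel[where ft = ?ft
        and Q = "\<lambda>x. \<phi> x * ?\<Psi> x + ?cha x * (2 * v 1 t x * v 2 t x) - ?chb x * (v 1 t x)^2"])
    show "((\<lambda>t. \<phi> x * ((v 1 t x)^2 + \<sigma> * (v 0 t x) ^ 4)) has_real_derivative ?ft t x) (at t)" for t x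
      by (rule derivative_eq_intros equation equation_x refl)+ (simp add: eval_nat_numeral algebra_simps)
    show "((\<lambda>x. \<phi> x * ?\<Psi> x + ?cha x * (2 * v 1 t x * v 2 t x) - ?chb x * (v 1 t x)^2) has_real_derivative
        ?ft t x - ?r x) (at x)" for x
      by (rule derivative_eq_intros DERIV_v_num d refl)+
        (use sign_square in \<open>simp, algebra\<close>)
    show "\<phi> (2 * pi) * ?\<Psi> (2 * pi) + ?cha (2 * pi) * (2 * v 1 t (2 * pi) * v 2 t (2 * pi)) - ?chb (2 * pi) * (v 1 t (2 * pi))^2
      = \<phi> 0 * ?\<Psi> 0 + ?cha 0 * (2 * v 1 t 0 * v 2 t 0) - ?chb 0 * (v 1 t 0)^2"
      by (simp only: per_v p)
    show "continuous_on {0..2 * pi} ?r"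
      by (intro continuous_intros c)
  qed (auto intro!: continuous_intros c cs simp: case_prod_unfold)
qed

text \<open>The next invariant of the mKdV hierarchy, at the level of \<open>H^2\<close>. It fixes
  the total of v_xx^2 to leading order, while the distribution of v_xx^2 in space is governed by the
  flux in \<open>energy_law\<close>.\<close>

lemma second_energy_law:
  "((\<lambda>t. CI x. (v 2 t x)^2 + 10 * \<sigma> * (v 0 t x)^2 * (v 1 t x)^2 + 2 * (v 0 t x) ^ 6) has_real_derivative 0) (at t)"
proof -
  let ?vt = "\<lambda>t x. - v 3 t x + 6 * \<sigma> * (v 0 t x)^2 * v 1 t x"
  let ?v1t = "\<lambda>t x. - v 4 t x + 6 * \<sigma> * (2 * v 0 t x * (v 1 t x)^2 + (v 0 t x)^2 * v 2 t x)"
  let ?v2t = "\<lambda>t x. - v 5 t x + 6 * \<sigma> * (2 * (v 1 t x) ^ 3 + 6 * v 0 t x * v 1 t x * v 2 t x + (v 0 t x)^2 * v 3 t x)"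
  let ?ft = "\<lambda>t x. 2 * v 2 t x * ?v2t t x + 10 * \<sigma> * (2 * v 0 t x * ?vt t x * (v 1 t x)^2
    + (v 0 t x)^2 * (2 * v 1 t x * ?v1t t x)) + 12 * (v 0 t x) ^ 5 * ?vt t x"
  let ?X = "\<lambda>x. (v 3 t x)^2 - 2 * v 2 t x * v 4 t x + \<sigma> * ((v 1 t x) ^ 4 + 16 * (v 0 t x)^2 * (v 2 t x)^2
    - 20 * (v 0 t x)^2 * v 1 t x * v 3 t x + 20 * v 0 t x * (v 1 t x)^2 * v 2 t x)
    + 90 * (v 0 t x) ^ 4 * (v 1 t x)^2 - 12 * (v 0 t x) ^ 5 * v 2 t x + 9 * \<sigma> * (v 0 t x) ^ 8"
  have "((\<lambda>t. CI x. (v 2 t x)^2 + 10 * \<sigma> * (v 0 t x)^2 * (v 1 t x)^2 + 2 * (v 0 t x) ^ 6)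
      has_real_derivative (CI x. 0)) (at t)"
  proof (rule cint_DERIV_cancel[where ft = ?ft and Q = ?X])
    show "((\<lambda>t. (v 2 t x)^2 + 10 * \<sigma> * (v 0 t x)^2 * (v 1 t x)^2 + 2 * (v 0 t x) ^ 6) has_real_derivative ?ft t x) (at t)" for t x
      by (rule derivative_eq_intros equation equation_x equation_xx refl)+ (simp add: eval_nat_numeral algebra_simps)
    show "(?X has_real_derivative ?ft t x - 0) (at x)" for x
      by (rule derivative_eq_intros DERIV_v_num refl)+
        (use sign_square in \<open>simp, algebra\<close>)
    show "?X (2 * pi) = ?X 0" by (simp only: per_v)
  qed (auto intro!: continuous_intros simp: case_prod_unfold)
  then show ?thesis by simp
qed

end

lemma mkdv_solution_imp_mkdv:
  assumes "mkdv_solution \<sigma> v0 u" "\<sigma> \<in> {1, -1}"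
  shows "mkdv \<sigma> (jet u)"
proof
  have c: "continuous_in_Hinf u" using assms by (simp add: mkdv_solution_def)
  show "\<sigma> = 1 \<or> \<sigma> = - 1" using assms by auto
  show "jet u j t (x + 2 * pi) = jet u j t x" for j t x
    by (rule circle_periodic[OF jet_test_circle[OF c]])
  show "(jet u j t has_real_derivative jet u (Suc j) t x) (at x)" for j t x by (rule jet_DERIV[OF c])
  show "continuous_on UNIV (\<lambda>(t, x). jet u j t x)" for j by (rule jet_continuous[OF c])
  show "((\<lambda>t. jet u 0 t x) has_real_derivative - jet u 3 t x + 6 * \<sigma> * (jet u 0 t x)^2 * jet u 1 t x) (at t)" for t x
  proof -
    obtain d where d: "((\<lambda>r. u r x) has_real_derivative d) (at t)"
      "d + (deriv ^^ 3) (u t) x - \<sigma> * 6 * (u t x)^2 * deriv (u t) x = 0"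
      using assms(1) unfolding mkdv_solution_def by blast
    then have "d = - jet u 3 t x + 6 * \<sigma> * (jet u 0 t x)^2 * jet u 1 t x" by (simp add: algebra_simps)
    then show ?thesis using d(1) by simp
  qed
qed

section \<open>A priori bounds\<close>

lemma circle_continuous_comp:
  "\<phi> \<in> test_circle \<Longrightarrow> continuous_on A h \<Longrightarrow> continuous_on A (\<lambda>p. \<phi> (h p))"
  by (rule continuous_on_compose2[OF circle_continuous[of \<phi> UNIV]]) auto

lemma abs_int_subinterval_le:
  fixes g :: "real \<Rightarrow> real"
  assumes "continuous_on UNIV g" "0 \<le> a" "b \<le> 2 * pi"
  shows "\<bar>integral {a..b} g\<bar> \<le> (CI x. \<bar>g x\<bar>)"
proof -
  have c: "continuous_on A g" for A using continuous_on_subset[OF assms(1)] by simp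
  have "norm (integral {a..b} g) \<le> integral {a..b} (\<lambda>x. \<bar>g x\<bar>)"
    by (rule int_norm_le) (auto intro!: continuous_intros c)
  also have "\<dots> \<le> (CI x. \<bar>g x\<bar>)"
    by (rule integral_subset_le)
      (use assms in \<open>auto intro!: integrable_continuous_real continuous_intros c\<close>)
  finally show ?thesis by simp
qed

text \<open>Agmon's inequality on the circle: compare f^2 at x with f^2 at y by integrating (f^2)',
  then average over y.\<close>

lemma square_sup_bound:
  assumes d: "\<And>x. (f has_real_derivative f' x) (at x)" and c': "continuous_on UNIV f'"
    and x: "x \<in> {0..2 * pi}"
  shows "(f x)^2 \<le> (CI x. (f x)^2) / (2 * pi) + 2 * (sqrt (CI x. (f x)^2) * sqrt (CI x. (f' x)^2))"
proof -
  have cf': "continuous_on A f'" for A using continuous_on_subset[OF c'] by simp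
  have cf: "continuous_on A f" for A
    using d by (meson DERIV_isCont continuous_at_imp_continuous_on)
  let ?W = "2 * (sqrt (CI x. (f x)^2) * sqrt (CI x. (f' x)^2))"
  have D: "((\<lambda>x. (f x)^2) has_real_derivative 2 * (f x * f' x)) (at x)" for x
    by (rule derivative_eq_intros d refl)+ simp
  have W: "(CI x. \<bar>2 * (f x * f' x)\<bar>) \<le> ?W"
    using int_abs_product_le[OF cf[of "{0..2 * pi}"] cf'] by (simp add: abs_mult)
  have *: "(f x)^2 \<le> (f y)^2 + ?W" if y: "y \<in> {0..2 * pi}" for y
  proof (cases "y \<le> x")
    case True
    have "(f x)^2 - (f y)^2 = integral {y..x} (\<lambda>x. 2 * (f x * f' x))" using int_FTC[OF D True] by simp
    also have "\<dots> \<le> \<bar>integral {y..x} (\<lambda>x. 2 * (f x * f' x))\<bar>" by simp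
    also have "\<dots> \<le> (CI x. \<bar>2 * (f x * f' x)\<bar>)"
      by (rule abs_int_subinterval_le) (use x y in \<open>auto intro!: continuous_intros cf cf'\<close>)
    finally show ?thesis using W by simp
  next
    case False
    then have "x \<le> y" by simp
    have "(f x)^2 - (f y)^2 = - integral {x..y} (\<lambda>x. 2 * (f x * f' x))" using int_FTC[OF D \<open>x \<le> y\<close>] by simp
    also have "\<dots> \<le> \<bar>integral {x..y} (\<lambda>x. 2 * (f x * f' x))\<bar>" by simp
    also have "\<dots> \<le> (CI x. \<bar>2 * (f x * f' x)\<bar>)"
      by (rule abs_int_subinterval_le) (use x y in \<open>auto intro!: continuous_intros cf cf'\<close>)
    finally show ?thesis using W by simp
  qed
  have "(CI y. (f x)^2) \<le> (CI y. (f y)^2 + ?W)"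
    by (intro int_mono continuous_intros cf *)
  also have "\<dots> = (CI y. (f y)^2) + 2 * pi * ?W"
    by (subst int_add) (auto intro!: continuous_intros cf)
  finally have "(f x)^2 * (2 * pi) \<le> (CI y. (f y)^2) + 2 * pi * ?W" by (simp add: mult.commute)
  then have "(f x)^2 \<le> ((CI y. (f y)^2) + 2 * pi * ?W) / (2 * pi)" by (subst pos_le_divide_eq) auto
  also have "\<dots> = (CI y. (f y)^2) / (2 * pi) + ?W" by (simp add: add_divide_distrib)
  finally show ?thesis .
qed

lemma quadratic_bound:
  fixes s a b :: real
  assumes "s^2 \<le> a + b * s" "0 \<le> a" "0 \<le> b"
  shows "s \<le> b + sqrt a"
proof (rule ccontr)
  assume "\<not> s \<le> b + sqrt a"
  then have s: "s - b > sqrt a" "s > sqrt a" using assms by auto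
  have "sqrt a * sqrt a < s * (s - b)"
    using s by (intro mult_strict_mono') (auto simp: assms)
  then show False using assms by (simp add: power2_eq_square algebra_simps)
qed

text \<open>The size of data of amplitude \<open>B\<close> oscillating at frequency
  \<open>n\<close>: every derivative costs one factor \<open>n\<close>.\<close>

definition rough_data :: "(nat \<Rightarrow> real \<Rightarrow> real \<Rightarrow> real) \<Rightarrow> real \<Rightarrow> real \<Rightarrow> bool" where
  "rough_data v B n \<longleftrightarrow> 1 \<le> n \<and> 0 \<le> B \<and>
     (\<forall>x. \<bar>v 0 0 x\<bar> \<le> B \<and> \<bar>v 1 0 x\<bar> \<le> B * n \<and> \<bar>v 2 0 x\<bar> \<le> B * n^2)"

context mkdv
begin

lemma mean_invariant: "cint (v 0 t) = cint (v 0 0)"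
proof -
  have "((\<lambda>t. cint (v 0 t)) has_real_derivative (CI x. 0)) (at t)" for t
  proof (rule cint_DERIV_cancel[where ft = "\<lambda>t x. - v 3 t x + 6 * \<sigma> * (v 0 t x)^2 * v 1 t x"
        and Q = "\<lambda>x. - v 2 t x + 2 * \<sigma> * (v 0 t x) ^ 3"])
    show "((\<lambda>x. - v 2 t x + 2 * \<sigma> * (v 0 t x) ^ 3) has_real_derivative
        - v 3 t x + 6 * \<sigma> * (v 0 t x)^2 * v 1 t x - 0) (at x)" for x
      by (rule derivative_eq_intros DERIV_v_num refl)+ (simp add: eval_nat_numeral algebra_simps)
  qed ((rule equation)+, auto intro!: continuous_intros simp: case_prod_unfold per_v)
  then show ?thesis
    by (intro DERIV_isconst_all[where f = "\<lambda>t. cint (v 0 t)"]) auto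
qed

lemma mass_conserved: "(CI x. (v 0 t x)^2) = (CI x. (v 0 0 x)^2)"
proof -
  have "((\<lambda>t. CI x. (v 0 t x)^2) has_real_derivative 0) (at t)" for t
    using mass_law[OF circle_const[of 1], of t] by (simp add: eval_nat_numeral)
  then show ?thesis by (intro DERIV_isconst_all allI)
qed

lemma energy_conserved:
  "(CI x. (v 1 t x)^2) + \<sigma> * (CI x. (v 0 t x) ^ 4)
    = (CI x. (v 1 0 x)^2) + \<sigma> * (CI x. (v 0 0 x) ^ 4)"
proof -
  have eq: "(CI x. (v 1 t x)^2 + \<sigma> * (v 0 t x) ^ 4) = (CI x. (v 1 t x)^2) + \<sigma> * (CI x. (v 0 t x) ^ 4)" for t
    by (subst int_add) (auto intro!: continuous_intros)
  have "((\<lambda>t. CI x. (v 1 t x)^2 + \<sigma> * (v 0 t x) ^ 4) has_real_derivative 0) (at t)" for t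
    using energy_law[OF circle_const[of 1], of t] by (simp add: eval_nat_numeral)
  then have "(CI x. (v 1 t x)^2 + \<sigma> * (v 0 t x) ^ 4) = (CI x. (v 1 0 x)^2 + \<sigma> * (v 0 0 x) ^ 4)"
    by (intro DERIV_isconst_all[where f = "\<lambda>t. (CI x. (v 1 t x)^2 + \<sigma> * (v 0 t x) ^ 4)"] allI)
  then show ?thesis by (simp only: eq)
qed

lemma second_energy_conserved:
  "(CI x. (v 2 t x)^2) + (10 * \<sigma> * (CI x. (v 0 t x)^2 * (v 1 t x)^2) + 2 * (CI x. (v 0 t x) ^ 6))
    = (CI x. (v 2 0 x)^2) + (10 * \<sigma> * (CI x. (v 0 0 x)^2 * (v 1 0 x)^2) + 2 * (CI x. (v 0 0 x) ^ 6))"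
proof -
  let ?F = "\<lambda>t. (CI x. (v 2 t x)^2 + 10 * \<sigma> * (v 0 t x)^2 * (v 1 t x)^2 + 2 * (v 0 t x) ^ 6)"
  have eq: "?F t = (CI x. (v 2 t x)^2) + (10 * \<sigma> * (CI x. (v 0 t x)^2 * (v 1 t x)^2) + 2 * (CI x. (v 0 t x) ^ 6))" for t
    by (simp add: int_split continuous_intros mult.assoc)
  have "?F t = ?F 0"
    by (intro DERIV_isconst_all[where f = ?F] allI second_energy_law)
  then show ?thesis by (simp only: eq)
qed

lemma abs_le_if_square_bound:
  assumes "\<bar>cint f\<bar> \<le> X" shows "\<bar>\<sigma> * cint f\<bar> \<le> X"
  using assms sign by auto

text \<open>Mass and Agmon give v^2 = O(n) as soon as v_x = O(n) in L2, so the quartic part of the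
  energy is O(n) against n^2, and the other parts of the second energy are O(n^3) against n^4. Hence
  the quadratic parts are conserved to leading order. In the focusing case the energy has no sign;
  this does no harm since the quartic part grows at most linearly in the L2 norm of v_x.\<close>

lemma rough_bounds:
  assumes r: "rough_data v B n"
  defines "E \<equiv> 2 * pi * B^2"
  defines "c1 \<equiv> 2 * E * sqrt E + sqrt (E + 2 * E * B^2)"
  defines "c0 \<equiv> B^2 + 2 * sqrt E * c1"
  defines "c3 \<equiv> 10 * c0 * c1^2 + 2 * c0^2 * E + 10 * B^2 * E + 2 * B ^ 4 * E"
  shows "(CI x. (v 0 t x)^2) \<le> E"
    and "(v 0 t x)^2 \<le> c0 * n"
    and "(CI x. (v 1 t x)^2) \<le> c1^2 * n^2"
    and "\<bar>(CI x. (v 1 t x)^2) - (CI x. (v 1 0 x)^2)\<bar> \<le> (E * c0 + E * B^2) * n"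
    and "\<bar>(CI x. (v 2 t x)^2) - (CI x. (v 2 0 x)^2)\<bar> \<le> c3 * n ^ 3"
    and "(CI x. (v 2 t x)^2) \<le> (E + c3) * n ^ 4"
proof -
  have n: "1 \<le> n" and B: "0 \<le> B" and b: "\<bar>v 0 0 x\<bar> \<le> B" "\<bar>v 1 0 x\<bar> \<le> B * n" "\<bar>v 2 0 x\<bar> \<le> B * n^2" for x
    using r by (auto simp: rough_data_def)
  have E: "0 \<le> E" by (simp add: E_def)
  have c1: "0 \<le> c1" unfolding c1_def using E by (intro add_nonneg_nonneg mult_nonneg_nonneg) auto
  have c0: "0 \<le> c0" unfolding c0_def using E c1 by (intro add_nonneg_nonneg mult_nonneg_nonneg) auto
  have c3: "0 \<le> c3" unfolding c3_def using E c0 B by (intro add_nonneg_nonneg mult_nonneg_nonneg) auto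
  have sq: "f^2 \<le> K^2" if "\<bar>f\<bar> \<le> K" for f K :: real using power_mono[OF that, of 2] by simp
  have cb: "cint g \<le> K * (2 * pi)" if "continuous_on {0..2 * pi} g" "\<And>x. g x \<le> K" for g and K :: real
    using int_mono[OF that(1) continuous_on_const[of _ K]] that(2) by (simp add: mult.commute)
  have N0: "(CI x. (v 0 t x)^2) \<le> E" for t
    unfolding mass_conserved[of t] E_def
    using cb[of "\<lambda>x. (v 0 0 x)^2" "B^2"] sq[OF b(1)] by (simp add: mult_ac continuous_intros)
  then show "(CI x. (v 0 t x)^2) \<le> E" .
  have N0': "0 \<le> (CI x. (v 0 t x)^2)" for t by (intro int_square_nonneg continuous_intros)
  have N10: "(CI x. (v 1 0 x)^2) \<le> E * n^2"
    using cb[of "\<lambda>x. (v 1 0 x)^2" "(B * n)^2"] sq[OF b(2)] by (simp add: E_def power_mult_distrib mult_ac continuous_intros)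
  have N20: "(CI x. (v 2 0 x)^2) \<le> E * n ^ 4"
    using cb[of "\<lambda>x. (v 2 0 x)^2" "(B * n^2)^2"] sq[OF b(3)]
    by (simp add: E_def power_mult_distrib mult_ac continuous_intros power_mult[symmetric])
  define s where "s t = sqrt (CI x. (v 1 t x)^2)" for t
  have s: "0 \<le> s t" "(CI x. (v 1 t x)^2) = (s t)^2" for t
    using int_square_nonneg[of 0 "2 * pi" "v 1 t"] by (auto simp: s_def continuous_intros)
  have red: "\<exists>y\<in>{0..2 * pi}. v 0 t y = v 0 t x" for t x
    using periodic_reduce[of "v 0 t" x] periodic_v by (force simp: periodic_def)
  have sup: "(v 0 t x)^2 \<le> B^2 + 2 * sqrt E * s t" for t x
  proof -
    obtain y where y: "y \<in> {0..2 * pi}" "v 0 t y = v 0 t x" using red by blast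
    have "(v 0 t y)^2 \<le> (CI x. (v 0 t x)^2) / (2 * pi) + 2 * (sqrt (CI x. (v 0 t x)^2) * s t)"
      unfolding s_def by (rule square_sup_bound[OF DERIV_v_num(1) _ y(1)]) (intro continuous_intros)
    also have "(CI x. (v 0 t x)^2) / (2 * pi) \<le> B^2"
      using N0[of t] by (simp add: E_def field_simps)
    also have "sqrt (CI x. (v 0 t x)^2) * s t \<le> sqrt E * s t"
      using N0[of t] s by (intro mult_right_mono) auto
    finally show ?thesis using y by (simp add: mult.assoc)
  qed
  have v4: "\<bar>(CI x. (v 0 t x) ^ 4)\<bar> \<le> K * E" if "\<And>x. (v 0 t x)^2 \<le> K" for t K
  proof -
    have "norm (CI x. (v 0 t x)^2 * (v 0 t x)^2) \<le> K * (CI x. norm ((v 0 t x)^2))"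
      by (rule int_mult_le) (use that in \<open>auto intro!: continuous_intros\<close>)
    also have "\<dots> \<le> K * E" using N0[of t] that[of 0] order_trans[OF zero_le_power2[of "v 0 t 0"]]
      by (intro mult_left_mono) auto
    finally show ?thesis by (simp add: power_add[symmetric])
  qed
  have B0: "(v 0 0 x)^2 \<le> B^2" for x by (rule sq[OF b(1)])
  have diff1: "\<bar>(CI x. (v 1 t x)^2) - (CI x. (v 1 0 x)^2)\<bar> \<le> K * E + B^2 * E" if "\<And>x. (v 0 t x)^2 \<le> K" for t K
    using energy_conserved[of t] abs_le_if_square_bound[OF v4[OF that]] abs_le_if_square_bound[OF v4[OF B0]] by linarith
  \<comment> \<open>The energy identity is a quadratic inequality for \<open>s t\<close>; its linear
    coefficient and the root of its constant term make up \<open>c1\<close>, where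
    \<open>1 \<le> n\<close> collects everything under one factor \<open>n\<close>.\<close>
  have "s t \<le> c1 * n" for t
  proof -
    have "(s t)^2 \<le> E * n^2 + ((B^2 + 2 * sqrt E * s t) * E + B^2 * E)"
      using diff1[OF sup, of t] N10 unfolding s(2) by linarith
    also have "\<dots> = (E * n^2 + 2 * E * B^2) + 2 * E * sqrt E * s t" by (simp add: algebra_simps)
    finally have "s t \<le> 2 * E * sqrt E + sqrt (E * n^2 + 2 * E * B^2)"
      by (rule quadratic_bound) (use E in auto)
    also have "sqrt (E * n^2 + 2 * E * B^2) \<le> sqrt ((E + 2 * E * B^2) * n^2)"
    proof -
      have "2 * E * B^2 * 1 \<le> 2 * E * B^2 * n^2" using E n by (intro mult_left_mono) auto
      then show ?thesis by (simp add: distrib_right)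
    qed
    also have "sqrt ((E + 2 * E * B^2) * n^2) = sqrt (E + 2 * E * B^2) * n" using n by (simp add: real_sqrt_mult)
    finally have "s t \<le> 2 * E * sqrt E + sqrt (E + 2 * E * B^2) * n" by simp
    moreover have "2 * E * sqrt E * 1 \<le> 2 * E * sqrt E * n" using E n by (intro mult_left_mono) auto
    ultimately show ?thesis by (simp add: c1_def distrib_right)
  qed note s_le = this
  have sup': "(v 0 t x)^2 \<le> c0 * n" for t x
  proof -
    have "2 * sqrt E * s t \<le> 2 * sqrt E * (c1 * n)" using s_le E by (intro mult_left_mono) auto
    moreover have "B^2 * 1 \<le> B^2 * n" using n by (intro mult_left_mono) auto
    ultimately show ?thesis using sup[of t x] by (simp add: c0_def algebra_simps)
  qed
  then show "(v 0 t x)^2 \<le> c0 * n" .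
  have N1: "(CI x. (v 1 t x)^2) \<le> c1^2 * n^2" for t
    unfolding s(2) using power_mono[OF s_le s(1), of t 2] by (simp add: power_mult_distrib)
  then show "(CI x. (v 1 t x)^2) \<le> c1^2 * n^2" .
  have "B^2 * E * 1 \<le> B^2 * E * n" using E n by (intro mult_left_mono) auto
  then show "\<bar>(CI x. (v 1 t x)^2) - (CI x. (v 1 0 x)^2)\<bar> \<le> (E * c0 + E * B^2) * n"
    using diff1[OF sup', of t] by (simp add: algebra_simps)
  have v2v1: "\<bar>(CI x. (v 0 t x)^2 * (v 1 t x)^2)\<bar> \<le> K * M"
    if "\<And>x. (v 0 t x)^2 \<le> K" "(CI x. (v 1 t x)^2) \<le> M" for t K M
  proof -
    have "norm (CI x. (v 0 t x)^2 * (v 1 t x)^2) \<le> K * (CI x. norm ((v 1 t x)^2))"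
      by (rule int_mult_le) (use that in \<open>auto intro!: continuous_intros\<close>)
    also have "\<dots> \<le> K * M" using that(2) that(1)[of 0] order_trans[OF zero_le_power2[of "v 0 t 0"]]
      by (intro mult_left_mono) auto
    finally show ?thesis by simp
  qed
  have v6: "\<bar>(CI x. (v 0 t x) ^ 6)\<bar> \<le> K^2 * E" if K: "\<And>x. (v 0 t x)^2 \<le> K" for t K
  proof -
    have "((v 0 t x)^2)^2 \<le> K^2" for x using K[of x] by (intro power_mono) auto
    then have "norm (CI x. (v 0 t x) ^ 4 * (v 0 t x)^2) \<le> K^2 * (CI x. norm ((v 0 t x)^2))"
      by (intro int_mult_le) (auto intro!: continuous_intros simp: power_mult[symmetric])
    also have "\<dots> \<le> K^2 * E" using N0[of t] by (intro mult_left_mono) auto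
    finally show ?thesis by (simp add: power_add[symmetric])
  qed
  have "\<bar>(CI x. (v 2 t x)^2) - (CI x. (v 2 0 x)^2)\<bar>
    \<le> 10 * ((c0 * n) * (c1^2 * n^2)) + 2 * ((c0 * n)^2 * E) + 10 * (B^2 * (E * n^2)) + 2 * ((B^2)^2 * E)" for t
  proof -
    have "\<bar>10 * \<sigma> * (CI x. (v 0 t x)^2 * (v 1 t x)^2)\<bar> \<le> 10 * ((c0 * n) * (c1^2 * n^2))"
      using abs_le_if_square_bound[OF v2v1[OF sup' N1, of t]] by (simp add: abs_mult mult_ac)
    moreover have "\<bar>10 * \<sigma> * (CI x. (v 0 0 x)^2 * (v 1 0 x)^2)\<bar> \<le> 10 * (B^2 * (E * n^2))"
      using abs_le_if_square_bound[OF v2v1[OF B0 N10]] by (simp add: abs_mult mult_ac)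
    ultimately show ?thesis
      using second_energy_conserved[of t] v6[OF sup', of t] v6[OF B0] by linarith
  qed
  moreover have "10 * ((c0 * n) * (c1^2 * n^2)) + 2 * ((c0 * n)^2 * E) + 10 * (B^2 * (E * n^2)) + 2 * ((B^2)^2 * E) \<le> c3 * n ^ 3"
  proof -
    have p: "n^2 \<le> n ^ 3" "1 \<le> n ^ 3" using n by (auto intro: power_increasing one_le_power)
    have "c0^2 * E * n^2 \<le> c0^2 * E * n ^ 3" "B^2 * E * n^2 \<le> B^2 * E * n ^ 3" "B ^ 4 * E * 1 \<le> B ^ 4 * E * n ^ 3"
      using p E mult_left_mono[OF p(2), of "B ^ 4 * E"] by (auto intro!: mult_left_mono)
    moreover have "10 * ((c0 * n) * (c1^2 * n^2)) = 10 * c0 * c1^2 * n ^ 3" by algebra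
    moreover have "2 * ((c0 * n)^2 * E) = 2 * (c0^2 * E * n^2)" by algebra
    moreover have "10 * (B^2 * (E * n^2)) = 10 * (B^2 * E * n^2)" by algebra
    moreover have "2 * ((B^2)^2 * E) = 2 * (B ^ 4 * E * 1)" by algebra
    moreover have "c3 * n ^ 3 = 10 * c0 * c1^2 * n ^ 3 + 2 * (c0^2 * E * n ^ 3) + 10 * (B^2 * E * n ^ 3) + 2 * (B ^ 4 * E * n ^ 3)"
      unfolding c3_def by algebra
    ultimately show ?thesis by linarith
  qed
  ultimately have diff2: "\<bar>(CI x. (v 2 t x)^2) - (CI x. (v 2 0 x)^2)\<bar> \<le> c3 * n ^ 3" for t
    using order_trans by blast
  then show "\<bar>(CI x. (v 2 t x)^2) - (CI x. (v 2 0 x)^2)\<bar> \<le> c3 * n ^ 3" .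
  have "c3 * n ^ 3 \<le> c3 * n ^ 4" using c3 n by (intro mult_left_mono power_increasing) auto
  then show "(CI x. (v 2 t x)^2) \<le> (E + c3) * n ^ 4"
    using diff2[of t] N20 by (simp add: distrib_right)
qed

end

text \<open>One constant for all bounds, depending on \<open>B\<close> alone and fixed before the
  sign, the solution, the frequency and the time, since the frequency later tends to
  infinity.\<close>

lemma a_priori_bounds:
  obtains C where "C \<ge> 1"
    and "\<And>\<sigma> v n t. mkdv \<sigma> v \<Longrightarrow> rough_data v B n \<Longrightarrow> (CI x. (v 0 t x)^2) \<le> C"
    and "\<And>\<sigma> v n t x. mkdv \<sigma> v \<Longrightarrow> rough_data v B n \<Longrightarrow> (v 0 t x)^2 \<le> C * n"
    and "\<And>\<sigma> v n t. mkdv \<sigma> v \<Longrightarrow> rough_data v B n \<Longrightarrow> (CI x. (v 1 t x)^2) \<le> C * n^2"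
    and "\<And>\<sigma> v n t. mkdv \<sigma> v \<Longrightarrow> rough_data v B n \<Longrightarrow> (CI x. (v 2 t x)^2) \<le> C * n ^ 4"
    and "\<And>\<sigma> v n t. mkdv \<sigma> v \<Longrightarrow> rough_data v B n \<Longrightarrow>
      \<bar>(CI x. (v 1 t x)^2) - (CI x. (v 1 0 x)^2)\<bar> \<le> C * n"
    and "\<And>\<sigma> v n t. mkdv \<sigma> v \<Longrightarrow> rough_data v B n \<Longrightarrow>
      \<bar>(CI x. (v 2 t x)^2) - (CI x. (v 2 0 x)^2)\<bar> \<le> C * n ^ 3"
proof -
  define E where "E = 2 * pi * B^2"
  define c1 where "c1 = 2 * E * sqrt E + sqrt (E + 2 * E * B^2)"
  define c0 where "c0 = B^2 + 2 * sqrt E * c1"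
  define c3 where "c3 = 10 * c0 * c1^2 + 2 * c0^2 * E + 10 * B^2 * E + 2 * B ^ 4 * E"
  define C where "C = 1 + \<bar>E\<bar> + \<bar>c0\<bar> + \<bar>c1^2\<bar> + \<bar>E * c0 + E * B^2\<bar> + \<bar>c3\<bar>"
  have C: "E \<le> C" "c0 \<le> C" "c1^2 \<le> C" "E * c0 + E * B^2 \<le> C" "c3 \<le> C" "E + c3 \<le> C" "1 \<le> C"
    unfolding C_def by linarith+
  have mono: "X \<le> C * y" if "X \<le> k * y" "k \<le> C" "0 \<le> y" for X k y
    using mult_right_mono[OF that(2,3)] that(1) by linarith
  show ?thesis
  proof (rule that[OF C(7)])
    fix \<sigma> v n t x assume m: "mkdv \<sigma> v" "rough_data v B n"
    have n: "0 \<le> n" using m(2) by (simp add: rough_data_def)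
    note b = mkdv.rough_bounds[OF m, folded E_def, folded c1_def, folded c0_def, folded c3_def]
    show "(CI x. (v 0 t x)^2) \<le> C" using b(1)[of t] C(1) by linarith
    show "(v 0 t x)^2 \<le> C * n" by (rule mono[OF b(2) C(2) n])
    show "(CI x. (v 1 t x)^2) \<le> C * n^2" by (rule mono[OF b(3) C(3)]) simp
    show "(CI x. (v 2 t x)^2) \<le> C * n ^ 4" by (rule mono[OF b(6) C(6)]) simp
    show "\<bar>(CI x. (v 1 t x)^2) - (CI x. (v 1 0 x)^2)\<bar> \<le> C * n" by (rule mono[OF b(4) C(4) n])
    show "\<bar>(CI x. (v 2 t x)^2) - (CI x. (v 2 0 x)^2)\<bar> \<le> C * n ^ 3"
      by (rule mono[OF b(5) C(5)]) (use n in simp)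
  qed
qed

section \<open>Lower bound for the weak limit of the mass density\<close>

text \<open>Averaging against \<eta> in time costs only the supremum of \<open>A\<close>, because
  the time derivative is moved onto \<eta>.\<close>

lemma time_ibp_bound:
  fixes A A' \<eta> \<eta>' :: "real \<Rightarrow> real"
  assumes A: "\<And>t. (A has_real_derivative A' t) (at t)" "\<And>X. continuous_on X A'"
    and \<eta>: "\<And>t. (\<eta> has_real_derivative \<eta>' t) (at t)" "\<And>X. continuous_on X \<eta>'"
    and K: "\<And>t. \<bar>A t\<bar> \<le> K" and "0 \<le> \<tau>"
  shows "\<bar>integral {0..\<tau>} (\<lambda>t. \<eta> t * A' t)\<bar>
    \<le> (\<bar>\<eta> \<tau>\<bar> + \<bar>\<eta> 0\<bar> + integral {0..\<tau>} (\<lambda>t. \<bar>\<eta>' t\<bar>)) * K"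
proof -
  have c: "continuous_on X A" "continuous_on X \<eta>" for X
    using A(1) \<eta>(1) by (meson DERIV_isCont continuous_at_imp_continuous_on)+
  have "((\<lambda>t. \<eta> t * A t) has_real_derivative \<eta>' t * A t + \<eta> t * A' t) (at t)" for t
    using DERIV_mult[OF \<eta>(1) A(1)] by (simp add: algebra_simps)
  then have "integral {0..\<tau>} (\<lambda>t. \<eta>' t * A t + \<eta> t * A' t) = \<eta> \<tau> * A \<tau> - \<eta> 0 * A 0"
    by (rule int_FTC[OF _ \<open>0 \<le> \<tau>\<close>])
  moreover have "integral {0..\<tau>} (\<lambda>t. \<eta>' t * A t + \<eta> t * A' t)
      = integral {0..\<tau>} (\<lambda>t. \<eta>' t * A t) + integral {0..\<tau>} (\<lambda>t. \<eta> t * A' t)"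
    by (intro int_add continuous_intros c A \<eta>)
  moreover have "\<bar>\<eta> \<tau> * A \<tau>\<bar> \<le> \<bar>\<eta> \<tau>\<bar> * K" "\<bar>\<eta> 0 * A 0\<bar> \<le> \<bar>\<eta> 0\<bar> * K"
    unfolding abs_mult by (intro mult_left_mono K abs_ge_zero)+
  moreover have "\<bar>integral {0..\<tau>} (\<lambda>t. \<eta>' t * A t)\<bar> \<le> integral {0..\<tau>} (\<lambda>t. \<bar>\<eta>' t\<bar>) * K"
    using int_mult_le[of 0 \<tau> A \<eta>' K] K c \<eta>(2) by (simp add: mult.commute)
  ultimately show ?thesis by (simp add: distrib_right)
qed

text \<open>The local conservation laws make the energy densities spatially uniform to leading order.\<close>

lemma uniform_densities:
  assumes \<phi>: "\<phi> \<in> test_circle" and \<eta>: "\<And>t. (\<eta> has_real_derivative \<eta>' t) (at t)" "\<And>X. continuous_on X \<eta>'"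
    and \<tau>: "0 \<le> \<tau>"
  obtains C where
    "\<And>\<sigma> v n. mkdv \<sigma> v \<Longrightarrow> rough_data v B n \<Longrightarrow>
      \<bar>integral {0..\<tau>} (\<lambda>t. \<eta> t * (CI x. deriv \<phi> x * (v 1 t x)^2))\<bar> \<le> C * n"
    "\<And>\<sigma> v n. mkdv \<sigma> v \<Longrightarrow> rough_data v B n \<Longrightarrow>
      \<bar>integral {0..\<tau>} (\<lambda>t. \<eta> t * (CI x. deriv \<phi> x * (v 2 t x)^2))\<bar> \<le> C * n ^ 3"
proof -
  obtain D where D: "D \<ge> 1"
    "\<And>\<sigma> v n t. mkdv \<sigma> v \<Longrightarrow> rough_data v B n \<Longrightarrow> (CI x. (v 0 t x)^2) \<le> D"
    "\<And>\<sigma> v n t x. mkdv \<sigma> v \<Longrightarrow> rough_data v B n \<Longrightarrow> (v 0 t x)^2 \<le> D * n"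
    "\<And>\<sigma> v n t. mkdv \<sigma> v \<Longrightarrow> rough_data v B n \<Longrightarrow> (CI x. (v 1 t x)^2) \<le> D * n^2"
    "\<And>\<sigma> v n t. mkdv \<sigma> v \<Longrightarrow> rough_data v B n \<Longrightarrow> (CI x. (v 2 t x)^2) \<le> D * n ^ 4"
    by (rule a_priori_bounds[of B]) blast
  have \<phi>1: "deriv \<phi> \<in> test_circle" and \<phi>3: "(deriv ^^ 3) \<phi> \<in> test_circle"
    by (intro circle_deriv circle_deriv_funpow \<phi>)+
  obtain F where F: "F > 0" "\<And>x. \<bar>\<phi> x\<bar> \<le> F" using circle_bounded[OF \<phi>] by blast
  obtain F1 where F1: "F1 > 0" "\<And>x. \<bar>deriv \<phi> x\<bar> \<le> F1" using circle_bounded[OF \<phi>1] by blast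
  obtain F3 where F3: "F3 > 0" "\<And>x. \<bar>(deriv ^^ 3) \<phi> x\<bar> \<le> F3" using circle_bounded[OF \<phi>3] by blast
  define I where "I = integral {0..\<tau>} (\<lambda>t. \<bar>\<eta> t\<bar>)"
  define J where "J = \<bar>\<eta> \<tau>\<bar> + \<bar>\<eta> 0\<bar> + integral {0..\<tau>} (\<lambda>t. \<bar>\<eta>' t\<bar>)"
  have c\<eta>: "continuous_on X \<eta>" for X
    using \<eta>(1) by (meson DERIV_isCont continuous_at_imp_continuous_on)
  have I: "0 \<le> I" unfolding I_def by (intro int_nonneg continuous_intros c\<eta>) auto
  have J: "0 \<le> J" unfolding J_def
    by (intro add_nonneg_nonneg int_nonneg continuous_intros \<eta>(2)) auto
  define C1 where "C1 = J * (F * D) + I * (F3 * D + 3 * (F1 * (D * D)))"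
  define C2 where "C2 = J * (F * (D + D * D)) + I * (F3 * D + F1 * (12 * (D * D) + 4 * (D * D) + 4 * D ^ 3))"
  have main: "\<bar>integral {0..\<tau>} (\<lambda>t. \<eta> t * (CI x. deriv \<phi> x * (v 1 t x)^2))\<bar> \<le> C1 * n \<and>
    \<bar>integral {0..\<tau>} (\<lambda>t. \<eta> t * (CI x. deriv \<phi> x * (v 2 t x)^2))\<bar> \<le> C2 * n ^ 3"
    if m: "mkdv \<sigma> v" and r: "rough_data v B n" for \<sigma> v n
  proof -
    interpret mkdv \<sigma> v by (rule m)
    note D = D(1) D(2-5)[OF m r]
    have n: "1 \<le> n" using r by (simp add: rough_data_def)
    note cc = continuous_intros circle_continuous_comp[OF \<phi>] circle_continuous_comp[OF \<phi>1]
      circle_continuous_comp[OF \<phi>3]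
    have mono: "norm (CI x. f x * g x) \<le> K * M"
      if "\<And>A. continuous_on A f" "\<And>A. continuous_on A g" "\<And>x. \<bar>f x\<bar> \<le> K" "(CI x. \<bar>g x\<bar>) \<le> M" for f g K M
    proof -
      have "norm (CI x. f x * g x) \<le> K * (CI x. norm (g x))"
        by (rule int_mult_le) (use that in auto)
      also have "\<dots> \<le> K * M" using that(3)[of 0] that(4) by (intro mult_left_mono) auto
      finally show ?thesis .
    qed
    have abs_sign: "\<bar>\<sigma> * y\<bar> = \<bar>y\<bar>" for y using sign by auto
    have sq: "(CI x. \<bar>(v j t x)^2\<bar>) = (CI x. (v j t x)^2)" for j t by simp
    have Dn: "0 \<le> D * n" using D(1) n by simp
    \<comment> \<open>One factor v^2 in supremum norm costs n, the remaining product v v_xx costs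
      n^2 by Cauchy-Schwarz: n^3 in total, below the n^4 of v_xx^2.\<close>
    have cub: "(CI x. \<bar>(v 0 t x) ^ 3 * v 2 t x\<bar>) \<le> (D * n) * (D * n^2)" for t
    proof -
      have "norm (CI x. (v 0 t x)^2 * \<bar>v 0 t x * v 2 t x\<bar>) \<le> (D * n) * (D * n^2)"
      proof (rule mono)
        have "(CI x. \<bar>v 0 t x * v 2 t x\<bar>) \<le> sqrt (CI x. (v 0 t x)^2) * sqrt (CI x. (v 2 t x)^2)"
          by (intro int_abs_product_le continuous_intros)
        also have "\<dots> \<le> sqrt D * sqrt (D * n ^ 4)"
          using D(2)[of t] D(5)[of t] D(1)
          by (intro mult_mono) (auto intro!: int_square_nonneg continuous_intros)
        also have "\<dots> = D * n^2"
          using D(1) real_sqrt_abs[of "n^2"] by (simp add: real_sqrt_mult power_mult[symmetric])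
        finally show "(CI x. \<bar>\<bar>v 0 t x * v 2 t x\<bar>\<bar>) \<le> D * n^2" by simp
      qed (use D(3) in \<open>auto intro!: continuous_intros\<close>)
      moreover have "(\<lambda>x. (v 0 t x)^2 * \<bar>v 0 t x * v 2 t x\<bar>) = (\<lambda>x. \<bar>(v 0 t x) ^ 3 * v 2 t x\<bar>)"
        by (simp add: abs_mult power3_eq_cube power2_eq_square fun_eq_iff)
      ultimately show ?thesis by simp
    qed
    have quart: "(CI x. \<bar>(v 0 t x) ^ 4\<bar>) \<le> (D * n) * D" for t
    proof -
      have "norm (CI x. (v 0 t x)^2 * (v 0 t x)^2) \<le> (D * n) * D"
        by (rule mono) (use D(2,3) in \<open>auto intro!: continuous_intros\<close>)
      then show ?thesis by (simp add: power_add[symmetric])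
    qed
    have sext: "(CI x. \<bar>(v 0 t x) ^ 6\<bar>) \<le> (D * n) * ((D * n) * D)" for t
    proof -
      have "norm (CI x. (v 0 t x)^2 * (v 0 t x) ^ 4) \<le> (D * n) * ((D * n) * D)"
        by (rule mono) (use quart D(3) in \<open>auto intro!: continuous_intros\<close>)
      then show ?thesis by (simp add: power_add[symmetric])
    qed
    have mixed: "(CI x. \<bar>(v 0 t x)^2 * (v 1 t x)^2\<bar>) \<le> (D * n) * (D * n^2)" for t
    proof -
      have "norm (CI x. (v 0 t x)^2 * (v 1 t x)^2) \<le> (D * n) * (D * n^2)"
        by (rule mono) (use D(4,3) in \<open>auto intro!: continuous_intros\<close>)
      then show ?thesis by simp
    qed
    have ct: "continuous_on X (\<lambda>t. CI x. \<psi> x * G t x)"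
      if "\<psi> \<in> test_circle" "continuous_on UNIV (\<lambda>p. G (fst p) (snd p))" for X \<psi> and G :: "real \<Rightarrow> real \<Rightarrow> real"
      by (rule int_continuous_param)
        (simp only: case_prod_unfold, intro continuous_intros circle_continuous_comp[OF that(1)] that(2))
    have tb: "\<bar>integral {0..\<tau>} (\<lambda>t. \<eta> t * G t)\<bar> \<le> I * M" if "continuous_on {0..\<tau>} G" "\<And>t. \<bar>G t\<bar> \<le> M" for G M
      using int_mult_le[of 0 \<tau> G \<eta> M] that c\<eta> by (simp add: I_def mult.commute)
    have n23: "n \<le> n ^ 3" "n^2 \<le> n ^ 3" "1 \<le> n ^ 3"
      using n power_increasing[of 1 3 n] by (auto intro: power_increasing one_le_power)
    have sum2: "\<bar>integral {0..\<tau>} (\<lambda>t. \<eta> t * P t + \<eta> t * Q t)\<bar> \<le> a + b"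
      if "continuous_on {0..\<tau>} P" "continuous_on {0..\<tau>} Q" "\<bar>integral {0..\<tau>} (\<lambda>t. \<eta> t * P t)\<bar> \<le> a"
        "\<bar>integral {0..\<tau>} (\<lambda>t. \<eta> t * Q t)\<bar> \<le> b" for P Q a b
    proof -
      have "integral {0..\<tau>} (\<lambda>t. \<eta> t * P t + \<eta> t * Q t) = integral {0..\<tau>} (\<lambda>t. \<eta> t * P t) + integral {0..\<tau>} (\<lambda>t. \<eta> t * Q t)"
        by (intro int_add continuous_intros that c\<eta>)
      then show ?thesis using that by linarith
    qed

    let ?A = "\<lambda>t. (CI x. \<phi> x * (v 0 t x)^2)"
    let ?A' = "\<lambda>t. (CI x. (deriv ^^ 3) \<phi> x * (v 0 t x)^2 - 3 * (deriv \<phi> x * ((v 1 t x)^2 + \<sigma> * (v 0 t x) ^ 4)))"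
    let ?R = "\<lambda>t. (CI x. (deriv ^^ 3) \<phi> x * (v 0 t x)^2) - 3 * (\<sigma> * (CI x. deriv \<phi> x * (v 0 t x) ^ 4))"
    \<comment> \<open>\<open>mass_law\<close> solved for its leading term. The remainder
      \<open>?R\<close> is O(n), and the time derivative \<open>?A'\<close> is integrated by parts
      in time, so the time average of the left side, a priori O(n^2), is O(n).\<close>
    have split1: "3 * (CI x. deriv \<phi> x * (v 1 t x)^2) = - ?A' t + ?R t" for t
    proof -
      have "?A' t = (CI x. (deriv ^^ 3) \<phi> x * (v 0 t x)^2 - (3 * (deriv \<phi> x * (v 1 t x)^2) + 3 * (\<sigma> * (deriv \<phi> x * (v 0 t x) ^ 4))))"
        by (simp add: algebra_simps)
      then show ?thesis by (simp add: int_split cc)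
    qed
    have A'c: "continuous_on X ?A'" for X
      by (rule int_continuous_param) (simp only: case_prod_unfold, intro cc)
    have Rc: "continuous_on X ?R" for X
      by (intro continuous_intros ct \<phi>1 \<phi>3)
    have "\<bar>?A t\<bar> \<le> F * D" for t
      using mono[of \<phi> "\<lambda>x. (v 0 t x)^2" F D] F D(2)[of t] by (simp add: cc)
    then have i1: "\<bar>integral {0..\<tau>} (\<lambda>t. \<eta> t * ?A' t)\<bar> \<le> J * (F * D)"
      unfolding J_def by (intro time_ibp_bound[of ?A] mass_law \<phi> A'c \<eta> \<tau>)
    have "\<bar>?R t\<bar> \<le> F3 * D + 3 * (F1 * (D * n * D))" for t
    proof -
      have "\<bar>(CI x. (deriv ^^ 3) \<phi> x * (v 0 t x)^2)\<bar> \<le> F3 * D"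
        using mono[of "(deriv ^^ 3) \<phi>" "\<lambda>x. (v 0 t x)^2" F3 D] F3 D(2)[of t] by (simp add: cc)
      moreover have "\<bar>\<sigma> * (CI x. deriv \<phi> x * (v 0 t x) ^ 4)\<bar> \<le> F1 * (D * n * D)"
        using mono[of "deriv \<phi>" "\<lambda>x. (v 0 t x) ^ 4" F1 "D * n * D"] F1 quart[of t]
        by (intro abs_le_if_square_bound) (simp add: cc)
      ultimately show ?thesis by linarith
    qed
    then have i2: "\<bar>integral {0..\<tau>} (\<lambda>t. \<eta> t * ?R t)\<bar> \<le> I * (F3 * D + 3 * (F1 * (D * n * D)))"
      by (intro tb Rc)
    have "\<bar>integral {0..\<tau>} (\<lambda>t. \<eta> t * (- ?A' t) + \<eta> t * ?R t)\<bar> \<le> J * (F * D) + I * (F3 * D + 3 * (F1 * (D * n * D)))"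
      using i1 by (intro sum2[OF continuous_on_minus[OF A'c] Rc _ i2]) simp
    moreover have "(\<lambda>t. \<eta> t * (- ?A' t) + \<eta> t * ?R t) = (\<lambda>t. 3 * (\<eta> t * (CI x. deriv \<phi> x * (v 1 t x)^2)))"
    proof
      fix t
      have "\<eta> t * (- ?A' t) + \<eta> t * ?R t = \<eta> t * (- ?A' t + ?R t)" by (simp only: distrib_left)
      also have "\<dots> = \<eta> t * (3 * (CI x. deriv \<phi> x * (v 1 t x)^2))" by (simp only: split1)
      finally show "\<eta> t * (- ?A' t) + \<eta> t * ?R t = 3 * (\<eta> t * (CI x. deriv \<phi> x * (v 1 t x)^2))" by simp
    qed
    moreover have "J * (F * D) + I * (F3 * D + 3 * (F1 * (D * n * D))) \<le> C1 * n"
    proof -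
      have "J * (F * D) * 1 \<le> J * (F * D) * n" "I * (F3 * D) * 1 \<le> I * (F3 * D) * n"
        using I J F F3 D(1) by (intro mult_left_mono[OF n] mult_nonneg_nonneg; simp)+
      then show ?thesis by (simp add: C1_def algebra_simps)
    qed
    ultimately have r1: "\<bar>integral {0..\<tau>} (\<lambda>t. \<eta> t * (CI x. deriv \<phi> x * (v 1 t x)^2))\<bar> \<le> C1 * n"
      by (simp add: abs_mult)

    let ?B = "\<lambda>t. (CI x. \<phi> x * ((v 1 t x)^2 + \<sigma> * (v 0 t x) ^ 4))"
    let ?G = "\<lambda>t x. 12 * \<sigma> * ((v 0 t x)^2 * (v 1 t x)^2) - 4 * \<sigma> * ((v 0 t x) ^ 3 * v 2 t x) + 4 * (v 0 t x) ^ 6"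
    let ?B' = "\<lambda>t. (CI x. (deriv ^^ 3) \<phi> x * (v 1 t x)^2 - deriv \<phi> x * (3 * (v 2 t x)^2
      + 12 * \<sigma> * (v 0 t x)^2 * (v 1 t x)^2 - 4 * \<sigma> * (v 0 t x) ^ 3 * v 2 t x + 4 * (v 0 t x) ^ 6))"
    let ?S = "\<lambda>t. (CI x. (deriv ^^ 3) \<phi> x * (v 1 t x)^2) - (CI x. deriv \<phi> x * ?G t x)"
    \<comment> \<open>The same with \<open>energy_law\<close>, one level up: O(n^3) instead of the a
      priori O(n^4).\<close>
    have split2: "3 * (CI x. deriv \<phi> x * (v 2 t x)^2) = - ?B' t + ?S t" for t
    proof -
      have "?B' t = (CI x. (deriv ^^ 3) \<phi> x * (v 1 t x)^2 - (3 * (deriv \<phi> x * (v 2 t x)^2) + deriv \<phi> x * ?G t x))"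
        by (simp add: algebra_simps)
      then show ?thesis by (simp add: int_split cc)
    qed
    have B'c: "continuous_on X ?B'" for X
      by (rule int_continuous_param) (simp only: case_prod_unfold, intro cc)
    have Sc: "continuous_on X ?S" for X
      by (intro continuous_intros ct \<phi>1 \<phi>3)
    have "\<bar>?B t\<bar> \<le> F * (D * n^2 + D * n * D)" for t
    proof -
      have "(CI x. \<bar>(v 1 t x)^2 + \<sigma> * (v 0 t x) ^ 4\<bar>) \<le> (CI x. (v 1 t x)^2 + \<bar>(v 0 t x) ^ 4\<bar>)"
      proof (intro int_mono continuous_intros)
        fix x
        show "\<bar>(v 1 t x)^2 + \<sigma> * (v 0 t x) ^ 4\<bar> \<le> (v 1 t x)^2 + \<bar>(v 0 t x) ^ 4\<bar>"
          using abs_triangle_ineq[of "(v 1 t x)^2" "\<sigma> * (v 0 t x) ^ 4"] abs_sign by simp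
      qed
      also have "\<dots> = (CI x. (v 1 t x)^2) + (CI x. \<bar>(v 0 t x) ^ 4\<bar>)" by (intro int_add continuous_intros)
      also have "\<dots> \<le> D * n^2 + D * n * D" by (intro add_mono D(4) quart)
      finally have "norm (?B t) \<le> F * (D * n^2 + D * n * D)"
        by (intro mono) (use F in \<open>auto intro!: cc\<close>)
      then show ?thesis by simp
    qed
    then have j1: "\<bar>integral {0..\<tau>} (\<lambda>t. \<eta> t * ?B' t)\<bar> \<le> J * (F * (D * n^2 + D * n * D))"
      unfolding J_def by (intro time_ibp_bound[of ?B] energy_law \<phi> B'c \<eta> \<tau>)
    have "\<bar>?S t\<bar> \<le> F3 * (D * n^2) + F1 * (12 * (D * n * (D * n^2)) + 4 * (D * n * (D * n^2)) + 4 * (D * n * (D * n * D)))" for t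
    proof -
      have 1: "\<bar>(CI x. (deriv ^^ 3) \<phi> x * (v 1 t x)^2)\<bar> \<le> F3 * (D * n^2)"
        using mono[of "(deriv ^^ 3) \<phi>" "\<lambda>x. (v 1 t x)^2" F3 "D * n^2"] F3 D(4)[of t] by (simp add: cc)
      have "(CI x. \<bar>?G t x\<bar>) \<le> (CI x. (12 * \<bar>(v 0 t x)^2 * (v 1 t x)^2\<bar> + 4 * \<bar>(v 0 t x) ^ 3 * v 2 t x\<bar>) + 4 * \<bar>(v 0 t x) ^ 6\<bar>)"
      proof (intro int_mono continuous_intros)
        fix x
        have tri: "\<bar>12 * a - 4 * b + 4 * c\<bar> \<le> 12 * \<bar>a\<bar> + 4 * \<bar>b\<bar> + 4 * \<bar>c\<bar>" for a b c :: real by linarith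
        show "\<bar>?G t x\<bar> \<le> 12 * \<bar>(v 0 t x)^2 * (v 1 t x)^2\<bar> + 4 * \<bar>(v 0 t x) ^ 3 * v 2 t x\<bar> + 4 * \<bar>(v 0 t x) ^ 6\<bar>"
          using tri[of "\<sigma> * ((v 0 t x)^2 * (v 1 t x)^2)" "\<sigma> * ((v 0 t x) ^ 3 * v 2 t x)" "(v 0 t x) ^ 6"]
          by (simp only: abs_sign mult.assoc)
      qed
      also have "\<dots> \<le> 12 * (D * n * (D * n^2)) + 4 * (D * n * (D * n^2)) + 4 * (D * n * (D * n * D))"
        using mixed[of t] cub[of t] sext[of t]
        by (simp only: int_split cc integral_mult_right)
      finally have "norm (CI x. deriv \<phi> x * ?G t x)
          \<le> F1 * (12 * (D * n * (D * n^2)) + 4 * (D * n * (D * n^2)) + 4 * (D * n * (D * n * D)))"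
        by (intro mono) (use F1 in \<open>auto intro!: cc\<close>)
      then show ?thesis using 1 unfolding real_norm_def by linarith
    qed
    then have j2: "\<bar>integral {0..\<tau>} (\<lambda>t. \<eta> t * ?S t)\<bar>
        \<le> I * (F3 * (D * n^2) + F1 * (12 * (D * n * (D * n^2)) + 4 * (D * n * (D * n^2)) + 4 * (D * n * (D * n * D))))"
      by (intro tb Sc)
    have "\<bar>integral {0..\<tau>} (\<lambda>t. \<eta> t * (- ?B' t) + \<eta> t * ?S t)\<bar> \<le> J * (F * (D * n^2 + D * n * D))
        + I * (F3 * (D * n^2) + F1 * (12 * (D * n * (D * n^2)) + 4 * (D * n * (D * n^2)) + 4 * (D * n * (D * n * D))))"
      using j1 by (intro sum2[OF continuous_on_minus[OF B'c] Sc _ j2]) simp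
    moreover have "(\<lambda>t. \<eta> t * (- ?B' t) + \<eta> t * ?S t) = (\<lambda>t. 3 * (\<eta> t * (CI x. deriv \<phi> x * (v 2 t x)^2)))"
    proof
      fix t
      have "\<eta> t * (- ?B' t) + \<eta> t * ?S t = \<eta> t * (- ?B' t + ?S t)" by (simp only: distrib_left)
      also have "\<dots> = \<eta> t * (3 * (CI x. deriv \<phi> x * (v 2 t x)^2))" by (simp only: split2)
      finally show "\<eta> t * (- ?B' t) + \<eta> t * ?S t = 3 * (\<eta> t * (CI x. deriv \<phi> x * (v 2 t x)^2))" by simp
    qed
    moreover have "J * (F * (D * n^2 + D * n * D))
        + I * (F3 * (D * n^2) + F1 * (12 * (D * n * (D * n^2)) + 4 * (D * n * (D * n^2)) + 4 * (D * n * (D * n * D)))) \<le> C2 * n ^ 3"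
    proof -
      have "D * n^2 \<le> D * n ^ 3" "D * D * n \<le> D * D * n ^ 3" "D ^ 3 * n^2 \<le> D ^ 3 * n ^ 3"
        using n23 D(1) by (auto intro!: mult_left_mono)
      then have "D * n^2 + D * n * D \<le> (D + D * D) * n ^ 3" "D * n^2 \<le> D * n ^ 3"
        "12 * (D * n * (D * n^2)) + 4 * (D * n * (D * n^2)) + 4 * (D * n * (D * n * D)) \<le> (12 * (D * D) + 4 * (D * D) + 4 * D ^ 3) * n ^ 3"
        by (simp_all add: algebra_simps power2_eq_square power3_eq_cube)
      then have q: "J * (F * (D * n^2 + D * n * D)) \<le> J * (F * ((D + D * D) * n ^ 3))"
        "F3 * (D * n^2) \<le> F3 * (D * n ^ 3)"
        "F1 * (12 * (D * n * (D * n^2)) + 4 * (D * n * (D * n^2)) + 4 * (D * n * (D * n * D))) \<le> F1 * ((12 * (D * D) + 4 * (D * D) + 4 * D ^ 3) * n ^ 3)"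
        using J F F1 F3 by (auto intro!: mult_left_mono)
      have "J * (F * (D * n^2 + D * n * D))
        + I * (F3 * (D * n^2) + F1 * (12 * (D * n * (D * n^2)) + 4 * (D * n * (D * n^2)) + 4 * (D * n * (D * n * D))))
        \<le> J * (F * ((D + D * D) * n ^ 3)) + I * (F3 * (D * n ^ 3) + F1 * ((12 * (D * D) + 4 * (D * D) + 4 * D ^ 3) * n ^ 3))"
        by (rule add_mono[OF q(1) mult_left_mono[OF add_mono[OF q(2,3)] I]])
      also have "\<dots> = C2 * n ^ 3" by (simp add: C2_def algebra_simps)
      finally show ?thesis .
    qed
    ultimately have "\<bar>integral {0..\<tau>} (\<lambda>t. \<eta> t * (CI x. deriv \<phi> x * (v 2 t x)^2))\<bar> \<le> C2 * n ^ 3"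
      by (simp add: abs_mult)
    with r1 show ?thesis by blast
  qed
  show ?thesis
  proof (rule that[of "max C1 C2"])
    fix \<sigma> v n assume m: "mkdv \<sigma> v" "rough_data v B n"
    have n: "1 \<le> n" using m(2) by (simp add: rough_data_def)
    have "C1 * n \<le> max C1 C2 * n" "C2 * n ^ 3 \<le> max C1 C2 * n ^ 3"
      using n by (auto intro!: mult_right_mono)
    then show "\<bar>integral {0..\<tau>} (\<lambda>t. \<eta> t * (CI x. deriv \<phi> x * (v 1 t x)^2))\<bar> \<le> max C1 C2 * n"
      "\<bar>integral {0..\<tau>} (\<lambda>t. \<eta> t * (CI x. deriv \<phi> x * (v 2 t x)^2))\<bar> \<le> max C1 C2 * n ^ 3"
      using main[OF m] by linarith+
  qed
qed

text \<open>The parameter \<kappa> measures the distance of v to \<open>V0\<close> in the supremum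
  norm of primitives, a topology weak enough to tolerate the oscillation. The coefficient
  \<open>C\<close> is fixed before the solution, n and \<kappa>. The combination of the two
  normalised energies comes from expanding the square of v + v_xx / n^2, called \<open>?y\<close> in
  the proof.\<close>

theorem mass_lower_bound:
  assumes V0: "V0 \<in> test_circle" and f: "f \<in> test_circle" and fpos: "\<And>x. 0 \<le> f x"
    and \<eta>: "\<And>t. (\<eta> has_real_derivative \<eta>' t) (at t)" "\<And>X. continuous_on X \<eta>'"
    and \<eta>pos: "\<And>t. 0 \<le> \<eta> t" and \<tau>: "0 \<le> \<tau>"
  obtains C where "\<And>\<sigma> v n \<kappa>. mkdv \<sigma> v \<Longrightarrow> rough_data v B n \<Longrightarrow> cint (v 0 0) = cint V0 \<Longrightarrow>
    (\<And>t x. t \<in> {0..\<tau>} \<Longrightarrow> x \<in> {0..2 * pi} \<Longrightarrow> \<bar>prim (\<lambda>x. v 0 t x - V0 x) x\<bar> \<le> \<kappa>) \<Longrightarrow>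
    integral {0..\<tau>} \<eta> * ((CI x. f x * (V0 x)^2)
      + cint f / (2 * pi) * (2 * ((CI x. (v 1 0 x)^2) / n^2) - (CI x. (v 2 0 x)^2) / n ^ 4)
      - 2 * (CI x. \<bar>deriv (\<lambda>x. f x * V0 x) x\<bar>) * \<kappa>) - C / n
    \<le> integral {0..\<tau>} (\<lambda>t. \<eta> t * (CI x. f x * (v 0 t x)^2))"
proof -
  define m where "m = cint f / (2 * pi)"
  \<comment> \<open>Removing the mean \<open>m\<close> from \<open>f\<close> leaves a derivative:
    against it the densities v_x^2 and v_xx^2 average out by \<open>uniform_densities\<close>, and
    against the constant \<open>m\<close> they contribute their totals, conserved to leading
    order.\<close>
  define \<phi> where "\<phi> = prim (\<lambda>x. f x - m)"
  have fm: "(\<lambda>x. f x - m) \<in> test_circle" by (intro circle_diff f circle_const)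
  have "(CI x. f x - m) = 0"
    by (subst int_diff) (use f in \<open>auto intro!: circle_continuous simp: m_def\<close>)
  then have \<phi>: "\<phi> \<in> test_circle" unfolding \<phi>_def by (rule prim_test_circle[OF fm])
  have d\<phi>: "deriv \<phi> x = f x - m" for x
    unfolding \<phi>_def by (rule DERIV_imp_deriv[OF prim_DERIV[OF circle_continuous[OF fm]]])
  have m0: "0 \<le> m" unfolding m_def
    by (intro divide_nonneg_nonneg int_nonneg circle_continuous f fpos) simp
  define g where "g x = f x * V0 x" for x
  have g: "g \<in> test_circle" unfolding g_def[abs_def] by (intro circle_mult f V0)
  have g': "deriv g \<in> test_circle" and g'': "deriv (deriv g) \<in> test_circle" and f': "deriv f \<in> test_circle"
    by (intro circle_deriv g f)+
  obtain F' where F': "F' > 0" "\<And>x. \<bar>deriv f x\<bar> \<le> F'" using circle_bounded[OF f'] by blast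
  obtain D where D: "D \<ge> 1"
    "\<And>\<sigma> v n t. mkdv \<sigma> v \<Longrightarrow> rough_data v B n \<Longrightarrow> (CI x. (v 0 t x)^2) \<le> D"
    "\<And>\<sigma> v n t. mkdv \<sigma> v \<Longrightarrow> rough_data v B n \<Longrightarrow> (CI x. (v 1 t x)^2) \<le> D * n^2"
    "\<And>\<sigma> v n t. mkdv \<sigma> v \<Longrightarrow> rough_data v B n \<Longrightarrow> \<bar>(CI x. (v 1 t x)^2) - (CI x. (v 1 0 x)^2)\<bar> \<le> D * n"
    "\<And>\<sigma> v n t. mkdv \<sigma> v \<Longrightarrow> rough_data v B n \<Longrightarrow> \<bar>(CI x. (v 2 t x)^2) - (CI x. (v 2 0 x)^2)\<bar> \<le> D * n ^ 3"
    by (rule a_priori_bounds[of B]) blast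
  obtain C where C: "\<And>\<sigma> v n. mkdv \<sigma> v \<Longrightarrow> rough_data v B n \<Longrightarrow>
      \<bar>integral {0..\<tau>} (\<lambda>t. \<eta> t * (CI x. deriv \<phi> x * (v 1 t x)^2))\<bar> \<le> C * n"
    "\<And>\<sigma> v n. mkdv \<sigma> v \<Longrightarrow> rough_data v B n \<Longrightarrow>
      \<bar>integral {0..\<tau>} (\<lambda>t. \<eta> t * (CI x. deriv \<phi> x * (v 2 t x)^2))\<bar> \<le> C * n ^ 3"
    by (rule uniform_densities[OF \<phi> \<eta> \<tau>, of B]) blast
  have c\<eta>: "continuous_on X \<eta>" for X
    using \<eta>(1) by (meson DERIV_isCont continuous_at_imp_continuous_on)
  define I where "I = integral {0..\<tau>} \<eta>"
  have I: "0 \<le> I" unfolding I_def by (intro int_nonneg c\<eta> \<eta>pos)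
  define G where "G = sqrt (CI x. (deriv (deriv g) x)^2) * sqrt D"
  have G: "0 \<le> G" using D(1) by (auto simp: G_def intro!: mult_nonneg_nonneg int_square_nonneg circle_continuous g'')
  define K where "K = 2 * G + 3 * m * D + 2 * (F' * D)"
  show ?thesis
  proof (rule that[of "I * K + 3 * C"], fold g_def m_def I_def)
    fix \<sigma> v n \<kappa>
    assume mk: "mkdv \<sigma> v" and r: "rough_data v B n" and mean: "cint (v 0 0) = cint V0"
      and \<kappa>: "\<And>t x. t \<in> {0..\<tau>} \<Longrightarrow> x \<in> {0..2 * pi} \<Longrightarrow> \<bar>prim (\<lambda>x. v 0 t x - V0 x) x\<bar> \<le> \<kappa>"
    interpret mkdv \<sigma> v by (rule mk)
    note D = D(1) D(2-5)[OF mk r] and C = C[OF mk r]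
    have n: "1 \<le> n" using r by (simp add: rough_data_def)
    note cc = continuous_intros circle_continuous[OF f] circle_continuous[OF V0]
      circle_continuous[OF f'] circle_continuous[OF g] circle_continuous[OF g']
      circle_continuous[OF g''] circle_continuous[OF \<phi>] circle_continuous[OF circle_deriv[OF \<phi>]]
    have mass0: "cint (v 0 t) = cint V0" for t using mean_invariant[of t] mean by simp
    define L where "L = (CI x. f x * (V0 x)^2)
      + m * (2 * ((CI x. (v 1 0 x)^2) / n^2) - (CI x. (v 2 0 x)^2) / n ^ 4)
      - 2 * (CI x. \<bar>deriv g x\<bar>) * \<kappa>"
    let ?P = "\<lambda>t. (CI x. deriv \<phi> x * (v 1 t x)^2)" and ?Q = "\<lambda>t. (CI x. deriv \<phi> x * (v 2 t x)^2)"
    have arith: "L - Kn + p - q \<le> r"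
      if "c \<le> r" "c = h" "h = (2 * gv + gw - fv) + (fa + fb - fc)" "gv \<ge> fv - gk" "gw \<ge> - G2"
        "fa \<ge> p + A - a1" "fc \<le> q + Bq + a2" "fb \<ge> - a3" "Kn = G2 + a1 + a2 + a3" "L = fv + A - Bq - 2 * gk"
      for L Kn p q r c h gv gw fv fa fb fc gk G2 A a1 a2 a3 Bq :: real
      using that by linarith
    have pointwise: "L - K / n + 2 / n^2 * ?P t - 1 / n ^ 4 * ?Q t \<le> (CI x. f x * (v 0 t x)^2)"
      if t: "t \<in> {0..\<tau>}" for t
    proof -
      let ?y = "\<lambda>x. v 0 t x + v 2 t x / n^2"
      let ?H = "\<lambda>x. (2 * (g x * v 0 t x) + 2 / n^2 * (g x * v 2 t x) - f x * (V0 x)^2)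
        + (2 / n^2 * (f x * (v 1 t x)^2) + 2 / n^2 * (deriv f x * (v 0 t x * v 1 t x)) - 1 / n ^ 4 * (f x * (v 2 t x)^2))"
      \<comment> \<open>An exact derivative, by which f v_x^2 + f' v v_x in \<open>?H\<close> is
        exchanged for - f v v_xx, the term that the expansion of the square of \<open>?y\<close>
        produces.\<close>
      let ?Z = "\<lambda>x. 2 / n^2 * (deriv f x * (v 0 t x * v 1 t x) + f x * ((v 1 t x)^2 + v 0 t x * v 2 t x))"
      have Z: "cint ?Z = 0"
      proof (rule cint_deriv_zero)
        show "((\<lambda>x. 2 / n^2 * (f x * (v 0 t x * v 1 t x))) has_real_derivative ?Z x) (at x)" for x
          by (rule derivative_eq_intros DERIV_v_num circle_DERIV[OF f] refl)+
            (simp add: power2_eq_square algebra_simps)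
      qed (simp add: per_v circle_period_eq[OF f])
      have "?H x - ?Z x \<le> f x * (v 0 t x)^2" for x
      proof -
        \<comment> \<open>Convexity: the square of y - V0 is nonnegative. The resulting lower bound
          is linear in y, hence stable under weak convergence.\<close>
        have "f x * (2 * ?y x * V0 x - (V0 x)^2) \<le> f x * (?y x)^2"
          using zero_le_power2[of "?y x - V0 x"] by (intro mult_left_mono fpos) (simp add: power2_eq_square algebra_simps)
        moreover have "f x * (?y x)^2 = f x * (v 0 t x)^2 + 2 / n^2 * (f x * (v 0 t x * v 2 t x)) + 1 / n ^ 4 * (f x * (v 2 t x)^2)"
          using n by (simp add: power2_eq_square power4_eq_xxxx field_simps)
        moreover have "f x * (2 * ?y x * V0 x - (V0 x)^2) = 2 * (g x * v 0 t x) + 2 / n^2 * (g x * v 2 t x) - f x * (V0 x)^2"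
          using n by (simp add: g_def power2_eq_square field_simps)
        ultimately show ?thesis by (simp add: distrib_left)
      qed
      then have "(CI x. ?H x - ?Z x) \<le> (CI x. f x * (v 0 t x)^2)"
        by (intro int_mono cc)
      moreover have "(CI x. ?H x - ?Z x) = cint ?H" using Z n by (subst int_diff) (auto intro!: cc)
      moreover have "cint ?H = (2 * (CI x. g x * v 0 t x) + 2 / n^2 * (CI x. g x * v 2 t x) - (CI x. f x * (V0 x)^2))
        + (2 / n^2 * (CI x. f x * (v 1 t x)^2) + 2 / n^2 * (CI x. deriv f x * (v 0 t x * v 1 t x))
          - 1 / n ^ 4 * (CI x. f x * (v 2 t x)^2))"
        by (simp only: int_split cc integral_mult_right)
      moreover have "(CI x. g x * v 0 t x) \<ge> (CI x. f x * (V0 x)^2) - (CI x. \<bar>deriv g x\<bar>) * \<kappa>"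
      proof -
        let ?q = "prim (\<lambda>x. v 0 t x - V0 x)"
        have dv: "(\<lambda>x. v 0 t x - V0 x) \<in> test_circle" by (intro circle_diff circle_v V0)
        have "(CI x. v 0 t x - V0 x) = 0"
          by (subst int_diff) (auto intro!: cc simp: mass0)
        then have q: "?q \<in> test_circle" by (rule prim_test_circle[OF dv])
        have dq: "(?q has_real_derivative v 0 t x - V0 x) (at x)" for x
          by (rule prim_DERIV) (intro cc)
        have "(CI x. deriv g x * ?q x) = - (CI x. g x * (v 0 t x - V0 x))"
          by (rule cint_ibp[OF circle_DERIV[OF g] dq])
            (auto intro!: cc simp: circle_period_eq[OF g] circle_period_eq[OF q])
        moreover have "(CI x. g x * (v 0 t x - V0 x)) = (CI x. g x * v 0 t x) - (CI x. f x * (V0 x)^2)"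
        proof -
          have "(CI x. g x * v 0 t x - f x * (V0 x)^2) = (CI x. g x * v 0 t x) - (CI x. f x * (V0 x)^2)"
            by (intro int_diff cc)
          then show ?thesis by (simp add: g_def power2_eq_square algebra_simps)
        qed
        moreover have "\<bar>(CI x. deriv g x * ?q x)\<bar> \<le> (CI x. \<bar>deriv g x\<bar>) * \<kappa>"
          using int_mult_le[of 0 "2 * pi" ?q "deriv g" \<kappa>] \<kappa>[OF t] circle_continuous[OF q] circle_continuous[OF g']
          by (simp add: mult.commute)
        ultimately show ?thesis by linarith
      qed
      moreover have "2 / n^2 * (CI x. g x * v 2 t x) \<ge> - (2 * G / n)"
      proof -
        have "(CI x. v 2 t x * g x) = - (CI x. v 1 t x * deriv g x)"
          by (rule cint_ibp[OF DERIV_v_num(2) circle_DERIV[OF g]])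
            (auto intro!: cc simp: circle_period_eq[OF g] per_v)
        also have "(CI x. v 1 t x * deriv g x) = - (CI x. v 0 t x * deriv (deriv g) x)"
          by (rule cint_ibp[OF DERIV_v_num(1) circle_DERIV[OF g']])
            (auto intro!: cc simp: circle_period_eq[OF g'] per_v)
        finally have e: "(CI x. g x * v 2 t x) = (CI x. deriv (deriv g) x * v 0 t x)" by (simp add: mult.commute)
        have "\<bar>(CI x. deriv (deriv g) x * v 0 t x)\<bar> \<le> sqrt (CI x. (deriv (deriv g) x)^2) * sqrt (CI x. (v 0 t x)^2)"
          by (intro int_abs_le_sqrt cc)
        also have "\<dots> \<le> G" unfolding G_def using D(2)[of t]
          by (intro mult_left_mono) (auto intro!: int_square_nonneg cc)
        finally have "- G \<le> (CI x. g x * v 2 t x)" unfolding e by linarith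
        then have "2 / n^2 * (- G) \<le> 2 / n^2 * (CI x. g x * v 2 t x)" by (intro mult_left_mono) auto
        moreover have "2 * G / n^2 \<le> 2 * G / n"
          using G n by (intro divide_left_mono) (auto simp: power2_eq_square)
        ultimately show ?thesis by simp
      qed
      moreover have "2 / n^2 * (CI x. f x * (v 1 t x)^2)
          \<ge> 2 / n^2 * ?P t + m * (2 * ((CI x. (v 1 0 x)^2) / n^2)) - 2 * m * D / n"
      proof -
        have "(CI x. f x * (v 1 t x)^2) = (CI x. deriv \<phi> x * (v 1 t x)^2 + m * (v 1 t x)^2)"
          by (simp add: d\<phi> algebra_simps)
        also have "\<dots> = ?P t + m * (CI x. (v 1 t x)^2)" by (subst int_add) (auto intro!: cc)
        finally have e: "(CI x. f x * (v 1 t x)^2) = ?P t + m * (CI x. (v 1 t x)^2)" .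
        have "m * ((CI x. (v 1 0 x)^2) - D * n) \<le> m * (CI x. (v 1 t x)^2)"
          using D(4)[of t] m0 by (intro mult_left_mono) auto
        then have "2 / n^2 * (?P t + m * ((CI x. (v 1 0 x)^2) - D * n)) \<le> 2 / n^2 * (CI x. f x * (v 1 t x)^2)"
          unfolding e by (intro mult_left_mono) auto
        moreover have "2 / n^2 * (?P t + m * ((CI x. (v 1 0 x)^2) - D * n))
            = 2 / n^2 * ?P t + m * (2 * ((CI x. (v 1 0 x)^2) / n^2)) - 2 * m * D / n"
          using n by (simp add: power2_eq_square field_simps)
        ultimately show ?thesis by simp
      qed
      moreover have "1 / n ^ 4 * (CI x. f x * (v 2 t x)^2)
          \<le> 1 / n ^ 4 * ?Q t + m * ((CI x. (v 2 0 x)^2) / n ^ 4) + m * D / n"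
      proof -
        have "(CI x. f x * (v 2 t x)^2) = (CI x. deriv \<phi> x * (v 2 t x)^2 + m * (v 2 t x)^2)"
          by (simp add: d\<phi> algebra_simps)
        also have "\<dots> = ?Q t + m * (CI x. (v 2 t x)^2)" by (subst int_add) (auto intro!: cc)
        finally have e: "(CI x. f x * (v 2 t x)^2) = ?Q t + m * (CI x. (v 2 t x)^2)" .
        have "m * (CI x. (v 2 t x)^2) \<le> m * ((CI x. (v 2 0 x)^2) + D * n ^ 3)"
          using D(5)[of t] m0 by (intro mult_left_mono) auto
        then have "1 / n ^ 4 * (CI x. f x * (v 2 t x)^2) \<le> 1 / n ^ 4 * (?Q t + m * ((CI x. (v 2 0 x)^2) + D * n ^ 3))"
          unfolding e by (intro mult_left_mono) auto
        moreover have "1 / n ^ 4 * (?Q t + m * ((CI x. (v 2 0 x)^2) + D * n ^ 3))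
            = 1 / n ^ 4 * ?Q t + m * ((CI x. (v 2 0 x)^2) / n ^ 4) + m * D / n"
          using n by (simp add: power3_eq_cube power4_eq_xxxx field_simps)
        ultimately show ?thesis by simp
      qed
      moreover have "2 / n^2 * (CI x. deriv f x * (v 0 t x * v 1 t x)) \<ge> - (2 * (F' * D) / n)"
      proof -
        have "(CI x. \<bar>v 0 t x * v 1 t x\<bar>) \<le> sqrt (CI x. (v 0 t x)^2) * sqrt (CI x. (v 1 t x)^2)"
          by (intro int_abs_product_le cc)
        also have "\<dots> \<le> sqrt D * sqrt (D * n^2)"
          using D(1) D(2)[of t] D(3)[of t] by (intro mult_mono) (auto intro!: int_square_nonneg cc)
        also have "\<dots> = D * n" using D(1) n by (simp add: real_sqrt_mult)
        finally have 1: "(CI x. \<bar>v 0 t x * v 1 t x\<bar>) \<le> D * n" .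
        have "norm (CI x. deriv f x * (v 0 t x * v 1 t x)) \<le> F' * (CI x. norm (v 0 t x * v 1 t x))"
          by (rule int_mult_le) (use F' in \<open>auto intro!: cc\<close>)
        also have "\<dots> \<le> F' * (D * n)" using 1 F' by (intro mult_left_mono) auto
        finally have "- (F' * (D * n)) \<le> (CI x. deriv f x * (v 0 t x * v 1 t x))" unfolding real_norm_def by linarith
        then have "2 / n^2 * (- (F' * (D * n))) \<le> 2 / n^2 * (CI x. deriv f x * (v 0 t x * v 1 t x))"
          by (intro mult_left_mono) auto
        moreover have "2 / n^2 * (- (F' * (D * n))) = - (2 * (F' * D) / n)"
          using n by (simp add: power2_eq_square field_simps)
        ultimately show ?thesis by simp
      qed
      moreover have "K / n = 2 * G / n + 2 * m * D / n + m * D / n + 2 * (F' * D) / n"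
        by (simp add: K_def add_divide_distrib[symmetric] algebra_simps)
      moreover have "L = (CI x. f x * (V0 x)^2) + m * (2 * ((CI x. (v 1 0 x)^2) / n^2))
          - m * ((CI x. (v 2 0 x)^2) / n ^ 4) - 2 * ((CI x. \<bar>deriv g x\<bar>) * \<kappa>)"
        by (simp add: L_def right_diff_distrib)
      ultimately show ?thesis by (rule arith)
    qed
    have ct: "continuous_on X (\<lambda>t. CI x. \<psi> x * (v j t x)^2)" if "\<psi> \<in> test_circle" for X \<psi> j
      by (rule int_continuous_param)
        (simp only: case_prod_unfold, intro continuous_intros circle_continuous_comp[OF that])
    note ct' = ct[OF f] ct[OF circle_deriv[OF \<phi>]]
    have "integral {0..\<tau>} (\<lambda>t. \<eta> t * (L - K / n + 2 / n^2 * ?P t - 1 / n ^ 4 * ?Q t))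
        \<le> integral {0..\<tau>} (\<lambda>t. \<eta> t * (CI x. f x * (v 0 t x)^2))"
      by (intro int_mono mult_left_mono pointwise \<eta>pos continuous_intros c\<eta> ct')
    moreover have "integral {0..\<tau>} (\<lambda>t. \<eta> t * (L - K / n + 2 / n^2 * ?P t - 1 / n ^ 4 * ?Q t))
        = I * (L - K / n) + 2 / n^2 * integral {0..\<tau>} (\<lambda>t. \<eta> t * ?P t) - 1 / n ^ 4 * integral {0..\<tau>} (\<lambda>t. \<eta> t * ?Q t)"
    proof -
      have "integral {0..\<tau>} (\<lambda>t. \<eta> t * (L - K / n + 2 / n^2 * ?P t - 1 / n ^ 4 * ?Q t))
          = integral {0..\<tau>} (\<lambda>t. (\<eta> t * (L - K / n) + 2 / n^2 * (\<eta> t * ?P t)) - 1 / n ^ 4 * (\<eta> t * ?Q t))"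
        by (simp only: right_diff_distrib distrib_left mult_ac)
      then show ?thesis
        by (simp only: int_split continuous_intros c\<eta> ct' integral_mult_right integral_mult_left I_def)
    qed
    moreover have "2 / n^2 * integral {0..\<tau>} (\<lambda>t. \<eta> t * ?P t) \<ge> - (2 * C / n)"
    proof -
      have "2 / n^2 * (- (C * n)) \<le> 2 / n^2 * integral {0..\<tau>} (\<lambda>t. \<eta> t * ?P t)"
        using C(1) by (intro mult_left_mono) auto
      then show ?thesis using n by (simp add: power2_eq_square)
    qed
    moreover have "1 / n ^ 4 * integral {0..\<tau>} (\<lambda>t. \<eta> t * ?Q t) \<le> C / n"
    proof -
      have "1 / n ^ 4 * integral {0..\<tau>} (\<lambda>t. \<eta> t * ?Q t) \<le> 1 / n ^ 4 * (C * n ^ 3)"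
        using C(2) by (intro mult_left_mono) auto
      also have "\<dots> = C / n" using n by (simp add: power3_eq_cube power4_eq_xxxx)
      finally show ?thesis .
    qed
    moreover have "(I * K + 3 * C) / n = I * (K / n) + 2 * C / n + C / n"
      by (simp add: add_divide_distrib)
    ultimately show "I * ((CI x. f x * (V0 x)^2)
        + m * (2 * ((CI x. (v 1 0 x)^2) / n^2) - (CI x. (v 2 0 x)^2) / n ^ 4)
        - 2 * (CI x. \<bar>deriv g x\<bar>) * \<kappa>) - (I * K + 3 * C) / n
      \<le> integral {0..\<tau>} (\<lambda>t. \<eta> t * (CI x. f x * (v 0 t x)^2))"
      unfolding L_def[symmetric] by (simp add: right_diff_distrib)
  qed
qed

section \<open>Periodic bump functions\<close>

text \<open>For 0 < r < pi the condition cos z > cos r describes the neighbourhood of radius r of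
  the multiples of 2 pi, so the bump is periodic by construction.\<close>

definition pbump :: "real \<Rightarrow> real \<Rightarrow> real" where
  "pbump r z = flat_exp 0 (cos z - cos r)"

lemma pbump_test_circle: "pbump r \<in> test_circle"
proof -
  have "smooth (\<lambda>z. flat_exp 0 (cos z - cos r))"
    by (rule smooth_compose[OF flat_exp_smooth smooth_diff[OF smooth_cos_sin(1) smooth_const]])
  then show ?thesis
    by (auto simp: circle_iff periodic_def pbump_def[abs_def])
qed

lemma pbump_nonneg: "0 \<le> pbump r z"
  by (simp add: pbump_def flat_exp_def)

lemma pbump_nonzero:
  assumes "pbump r z \<noteq> 0" "0 < r" "r < pi" "\<bar>z\<bar> \<le> 2 * pi"
  shows "\<bar>z\<bar> < r \<or> 2 * pi - \<bar>z\<bar> < r"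
proof (rule ccontr)
  assume "\<not> ?thesis"
  then have *: "r \<le> \<bar>z\<bar>" "r \<le> 2 * pi - \<bar>z\<bar>" by auto
  have "cos \<bar>z\<bar> \<le> cos r"
  proof (cases "\<bar>z\<bar> \<le> pi")
    case True then show ?thesis using cos_monotone_0_pi_le[of r "\<bar>z\<bar>"] * assms by simp
  next
    case False
    then have "cos (2 * pi - \<bar>z\<bar>) \<le> cos r" using cos_monotone_0_pi_le[of r "2 * pi - \<bar>z\<bar>"] * assms by simp
    then show ?thesis by (simp add: cos_diff)
  qed
  then show False using assms(1) by (simp add: pbump_def flat_exp_def split: if_splits)
qed

lemma cint_pbump_pos:
  assumes "0 < r" "r < pi"
  shows "0 < cint (pbump r)"
proof -
  have c: "continuous_on {0..2 * pi} (pbump r)" by (rule circle_continuous[OF pbump_test_circle])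
  have "0 \<le> cint (pbump r)" by (intro int_nonneg c pbump_nonneg)
  moreover have "cint (pbump r) \<noteq> 0"
  proof
    assume "cint (pbump r) = 0"
    then have "\<forall>x\<in>{0..2 * pi}. pbump r x = 0"
      using integral_eq_0_iff[OF c] pbump_nonneg by simp
    then have "pbump r 0 = 0" by simp
    moreover have "cos r < 1" using cos_monotone_0_pi[of 0 r] assms by simp
    ultimately show False by (simp add: pbump_def flat_exp_def)
  qed
  ultimately show ?thesis by simp
qed

lemma pbump_shift_test_circle: "(\<lambda>x. pbump r (x - x0)) \<in> test_circle"
  using circle_shift[OF pbump_test_circle, of r "- x0"] by simp

lemma cint_pbump_shift: "(CI x. pbump r (x - x0)) = cint (pbump r)"
  using cint_shift[of "pbump r" "- x0"] pbump_test_circle[of r] circle_continuous[OF pbump_test_circle]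
  by (simp add: circle_iff)

text \<open>The support of the bump may cross the seam between 0 and 2 pi. There \<open>G x\<close>
  and \<open>G x0\<close> are compared through the common end value, by two increments of length at
  most r; hence the factor 2. Values in a Banach space cover real primitives as well as complex
  exponentials of them.\<close>

lemma pbump_approx:
  fixes G :: "real \<Rightarrow> 'a::banach"
  assumes r: "0 < r" "r < pi" and x0: "x0 \<in> {0..2 * pi}"
    and G: "continuous_on {0..2 * pi} G" "G (2 * pi) = G 0"
    and w: "\<And>x y. x \<in> {0..2 * pi} \<Longrightarrow> y \<in> {0..2 * pi} \<Longrightarrow> y \<le> x \<Longrightarrow> x - y \<le> r \<Longrightarrow> norm (G x - G y) \<le> w"
  shows "norm ((CI x. pbump r (x - x0) *\<^sub>R G x) - cint (pbump r) *\<^sub>R G x0) \<le> 2 * w * cint (pbump r)"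
proof -
  have c: "continuous_on {0..2 * pi} (\<lambda>x. pbump r (x - x0))"
    by (rule circle_continuous[OF pbump_shift_test_circle])
  have w0: "0 \<le> w" using w[of 0 0] r by simp
  have w': "norm (G x - G y) \<le> w" if "x \<in> {0..2 * pi}" "y \<in> {0..2 * pi}" "\<bar>x - y\<bar> \<le> r" for x y
    using w[of x y] w[of y x] that by (cases "y \<le> x") (auto simp: norm_minus_commute)
  have near: "norm (pbump r (x - x0) *\<^sub>R (G x - G x0)) \<le> 2 * w * pbump r (x - x0)" if x: "x \<in> {0..2 * pi}" for x
  proof (cases "pbump r (x - x0) = 0")
    case False
    have "norm (G x - G x0) \<le> 2 * w"
    proof -
      consider "\<bar>x - x0\<bar> < r" | "2 * pi - \<bar>x - x0\<bar> < r"
        using pbump_nonzero[OF False r] x x0 unfolding atLeastAtMost_iff abs_le_iff by linarith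
      then show ?thesis
      proof cases
        case 1 then show ?thesis using w'[OF x x0] w0 by simp
      next
        case 2
        have tri: "norm (G x - G x0) \<le> norm (G x - G y) + norm (G z - G x0)" if "G y = G z" for y z
          using norm_triangle_ineq[of "G x - G y" "G z - G x0"] that by simp
        show ?thesis
        proof (cases "x0 \<le> x")
          case True
          have "norm (G x - G (2 * pi)) \<le> w" "norm (G 0 - G x0) \<le> w"
            using w'[of x "2 * pi"] w'[of 0 x0] x x0 2 True by auto
          then show ?thesis using tri[OF G(2)] by linarith
        next
          case False
          have "norm (G x - G 0) \<le> w" "norm (G (2 * pi) - G x0) \<le> w"
            using w'[of x 0] w'[of "2 * pi" x0] x x0 2 False by auto
          then show ?thesis using tri[OF G(2)[symmetric]] by linarith
        qed
      qed
    qed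
    from mult_left_mono[OF this pbump_nonneg[of r "x - x0"]]
    show ?thesis by (simp add: pbump_nonneg mult_ac)
  qed simp
  have "(CI x. pbump r (x - x0) *\<^sub>R G x - pbump r (x - x0) *\<^sub>R G x0)
      = (CI x. pbump r (x - x0) *\<^sub>R G x) - (CI x. pbump r (x - x0) *\<^sub>R G x0)"
    by (intro int_diff continuous_intros c G)
  moreover have "(CI x. pbump r (x - x0) *\<^sub>R G x0) = cint (pbump r) *\<^sub>R G x0"
  proof -
    have "((\<lambda>x. pbump r (x - x0)) has_integral cint (pbump r)) {0..2 * pi}"
      using integrable_integral[OF integrable_continuous_real[OF c]] by (simp add: cint_pbump_shift)
    then show ?thesis by (intro integral_unique has_integral_scaleR_left)
  qed
  moreover have "norm (CI x. pbump r (x - x0) *\<^sub>R (G x - G x0)) \<le> (CI x. 2 * w * pbump r (x - x0))"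
    by (rule int_norm_le) (auto intro!: continuous_intros c G near simp del: norm_scaleR)
  ultimately show ?thesis by (simp add: scaleR_diff_right cint_pbump_shift)
qed

text \<open>The primitives are uniformly Hoelder continuous, hence close to their mollifications, which are
  pairings with test functions.\<close>

lemma prim_tendsto_zero:
  assumes h: "\<And>n. h n \<in> test_circle" "\<And>n. cint (h n) = 0" "\<And>n. (CI x. (h n x)^2) \<le> E"
    and weak: "\<And>\<phi>. \<phi> \<in> test_circle \<Longrightarrow> (\<lambda>n. CI x. h n x * \<phi> x) \<longlonglongrightarrow> 0"
    and x0: "x0 \<in> {0..2 * pi}"
  shows "(\<lambda>n. prim (h n) x0) \<longlonglongrightarrow> 0"
proof (rule LIMSEQ_I)
  fix e :: real assume e: "e > 0"
  note ch = circle_continuous[OF h(1)]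
  have E: "0 \<le> E" using int_square_nonneg[OF ch[of "{0..2 * pi}" 0]] h(3)[of 0] by linarith
  have dp: "(prim (h n) has_real_derivative h n x) (at x)" for n x by (rule prim_DERIV[OF ch])
  have Q: "prim (h n) \<in> test_circle" for n by (rule prim_test_circle[OF h(1,2)])
  \<comment> \<open>Cauchy-Schwarz bounds increments of the primitives over a distance
    \<open>r\<close> by sqrt(r E); this radius makes that at most \<open>e / 8\<close>.\<close>
  define r where "r = min 1 ((e / 8)^2 / (E + 1))"
  have r: "0 < r" "r < pi" using e E pi_gt3 by (auto simp: r_def min_less_iff_disj)
  have "r * E \<le> (e / 8)^2"
  proof -
    have "r * E \<le> ((e / 8)^2 / (E + 1)) * (E + 1)" using E r by (intro mult_mono) (auto simp: r_def)
    then show ?thesis using E by simp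
  qed
  then have rE: "sqrt (r * E) \<le> e / 8" using e by (intro real_le_lsqrt) auto
  have hoelder: "norm (prim (h n) x - prim (h n) y) \<le> e / 8"
    if "x \<in> {0..2 * pi}" "y \<in> {0..2 * pi}" "y \<le> x" "x - y \<le> r" for n x y
  proof -
    have "prim (h n) x - prim (h n) y = integral {y..x} (h n)" using int_FTC[OF dp \<open>y \<le> x\<close>] by simp
    moreover have "norm (integral {y..x} (h n)) \<le> integral {y..x} (\<lambda>x. \<bar>h n x\<bar>)"
      by (rule int_norm_le) (auto intro!: continuous_intros ch)
    moreover have "integral {y..x} (\<lambda>x. \<bar>h n x\<bar>) \<le> sqrt (x - y) * sqrt (integral {y..x} (\<lambda>x. (h n x)^2))"
      by (rule int_abs_le_sqrt_length[OF ch \<open>y \<le> x\<close>])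
    moreover have "integral {y..x} (\<lambda>x. (h n x)^2) \<le> (CI x. (h n x)^2)"
      using that by (intro integral_subset_le integrable_continuous_real continuous_intros ch) auto
    then have "sqrt (x - y) * sqrt (integral {y..x} (\<lambda>x. (h n x)^2)) \<le> sqrt r * sqrt E"
      using that h(3)[of n] r by (intro mult_mono) (auto intro!: int_square_nonneg ch)
    ultimately show ?thesis using rE by (simp add: real_sqrt_mult)
  qed
  define \<beta> where "\<beta> = cint (pbump r)"
  have \<beta>: "0 < \<beta>" unfolding \<beta>_def by (rule cint_pbump_pos[OF r])
  have approx: "\<bar>(CI x. pbump r (x - y) * prim (h n) x) - \<beta> * prim (h n) y\<bar> \<le> 2 * (e / 8) * \<beta>"
    if "y \<in> {0..2 * pi}" for n y
    using pbump_approx[OF r that circle_continuous[OF Q[of n]] circle_period_eq[OF Q[of n]] hoelder[where n = n]]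
    by (simp add: \<beta>_def)
  \<comment> \<open>A difference of two bumps has mean zero, so its primitive is a test function.
    The second bump sits at 0, where every \<open>prim (h n)\<close> vanishes, so the comparison
    determines the value at \<open>x0\<close>.\<close>
  define \<phi> where "\<phi> = prim (\<lambda>x. pbump r (x - x0) - pbump r (x - 0))"
  have b: "(\<lambda>x. pbump r (x - x0) - pbump r (x - 0)) \<in> test_circle"
    by (intro circle_diff pbump_shift_test_circle)
  have "(CI x. pbump r (x - x0) - pbump r (x - 0)) = 0"
    by (subst int_diff) (auto simp only: cint_pbump_shift diff_self intro!: circle_continuous[OF pbump_shift_test_circle])
  then have \<phi>: "\<phi> \<in> test_circle" unfolding \<phi>_def by (rule prim_test_circle[OF b])
  have d\<phi>: "(\<phi> has_real_derivative pbump r (x - x0) - pbump r (x - 0)) (at x)" for x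
    unfolding \<phi>_def by (rule prim_DERIV[OF circle_continuous[OF b]])
  have ibp: "(CI x. pbump r (x - x0) * prim (h n) x) - (CI x. pbump r (x - 0) * prim (h n) x)
      = - (CI x. h n x * \<phi> x)" for n
  proof -
    have "(CI x. (pbump r (x - x0) - pbump r (x - 0)) * prim (h n) x) = - (CI x. \<phi> x * h n x)"
      by (rule cint_ibp[OF d\<phi> dp circle_continuous[OF b] ch])
        (simp add: circle_period_eq[OF \<phi>] circle_period_eq[OF Q])
    moreover have "(CI x. pbump r (x - x0) * prim (h n) x - pbump r (x - 0) * prim (h n) x)
        = (CI x. pbump r (x - x0) * prim (h n) x) - (CI x. pbump r (x - 0) * prim (h n) x)"
      by (intro int_diff continuous_on_mult circle_continuous[OF pbump_shift_test_circle] circle_continuous[OF Q])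
    moreover have "(CI x. \<phi> x * h n x) = (CI x. h n x * \<phi> x)" by (simp only: mult.commute)
    ultimately show ?thesis by (simp only: left_diff_distrib)
  qed
  obtain N where N: "\<And>n. n \<ge> N \<Longrightarrow> norm ((CI x. h n x * \<phi> x) - 0) < e / 4 * \<beta>"
    using LIMSEQ_D[OF weak[OF \<phi>], of "e / 4 * \<beta>"] e \<beta> by auto
  show "\<exists>N. \<forall>n\<ge>N. norm (prim (h n) x0 - 0) < e"
  proof (intro exI[of _ N] allI impI)
    fix n assume n: "n \<ge> N"
    have "\<bar>\<beta> * prim (h n) x0\<bar> \<le> 2 * (e / 8) * \<beta> + 2 * (e / 8) * \<beta> + \<bar>(CI x. h n x * \<phi> x)\<bar>"
    proof -
      have tri: "\<bar>p\<bar> \<le> W + W + \<bar>c\<bar>" if "\<bar>a - p\<bar> \<le> W" "\<bar>b\<bar> \<le> W" "a - b = - c" for a b c p W :: real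
        using that by linarith
      have "\<bar>(CI x. pbump r (x - 0) * prim (h n) x)\<bar> \<le> 2 * (e / 8) * \<beta>"
        using approx[of 0 n] by simp
      from tri[OF approx[OF x0] this ibp] show ?thesis .
    qed
    also have "\<dots> < e * \<beta>" using N[OF n] mult_pos_pos[OF e \<beta>] by (simp add: mult.commute[of \<beta> e])
    finally have "\<beta> * \<bar>prim (h n) x0\<bar> < \<beta> * e" using \<beta> by (simp add: abs_mult mult.commute)
    then show "norm (prim (h n) x0 - 0) < e" using \<beta> by simp
  qed
qed

section \<open>The product law\<close>

text \<open>With \<open>\<epsilon>\<^sup>2 = \<sigma>\<close>, the function \<open>\<rho> = exp (2 \<epsilon> \<integral> v)\<close> satisfies
  \<open>\<rho>\<^sub>t + \<rho>\<^sub>x\<^sub>x\<^sub>x = 6 \<sigma> (v\<^sup>2 \<rho>)\<^sub>x\<close> up to a factor depending on time only, and \<open>1 / \<rho>\<close> solves the same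
  equation with the opposite factor. The pairs \<open>weight j\<close> encode the coefficients of the \<open>j\<close>-th
  derivative of \<open>f exp (- 2 \<epsilon> \<integral> V0)\<close> with respect to the basis \<open>1, \<epsilon>\<close>.\<close>

fun weight :: "real \<Rightarrow> (real \<Rightarrow> real) \<Rightarrow> (real \<Rightarrow> real) \<Rightarrow> nat \<Rightarrow> (real \<Rightarrow> real) \<times> (real \<Rightarrow> real)" where
  "weight \<sigma> V0 f 0 = (f, \<lambda>x. 0)"
| "weight \<sigma> V0 f (Suc j) =
     (\<lambda>x. deriv (fst (weight \<sigma> V0 f j)) x - 2 * \<sigma> * V0 x * snd (weight \<sigma> V0 f j) x,
      \<lambda>x. deriv (snd (weight \<sigma> V0 f j)) x - 2 * V0 x * fst (weight \<sigma> V0 f j) x)"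

text \<open>Two real components and a scalar \<epsilon>, which will be 1 or the imaginary unit, keep
  all differentiations of weights within real test functions while both signs of the equation share
  one formula.\<close>

definition cweight :: "complex \<Rightarrow> real \<Rightarrow> (real \<Rightarrow> real) \<Rightarrow> (real \<Rightarrow> real) \<Rightarrow> nat \<Rightarrow> real \<Rightarrow> complex" where
  "cweight \<epsilon> \<sigma> V0 f j x = of_real (fst (weight \<sigma> V0 f j) x) + \<epsilon> * of_real (snd (weight \<sigma> V0 f j) x)"

lemma weight_test_circle:
  assumes "V0 \<in> test_circle" "f \<in> test_circle"
  shows "fst (weight \<sigma> V0 f j) \<in> test_circle \<and> snd (weight \<sigma> V0 f j) \<in> test_circle"
proof (induction j)
  case (Suc j)
  then show ?case
    by (auto intro!: circle_diff circle_mult circle_deriv assms circle_const)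
qed (use assms in auto)

lemma exp_of_real_vector_derivative:
  assumes "(p has_real_derivative p') (at t)"
  shows "((\<lambda>t. exp (c * of_real (p t)) :: complex) has_vector_derivative c * of_real p' * exp (c * of_real (p t))) (at t)"
proof -
  have "((\<lambda>t. c * of_real (p t)) has_vector_derivative c * of_real p') (at t)"
    using assms by (intro has_vector_derivative_mult_right has_vector_derivative_of_real)
      (simp add: has_real_derivative_iff_has_vector_derivative)
  from field_vector_diff_chain_at[OF this DERIV_exp]
  show ?thesis by (simp add: o_def)
qed

text \<open>Moving the upper limit x into the integrand over a fixed interval makes joint continuity
  of primitives in time and space an instance of continuity of parameter integrals.\<close>

lemma prim_scale:
  assumes "continuous_on UNIV f"
  shows "prim f x = x * integral {0..1} (\<lambda>s. f (s * x))"
proof -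
  have "((\<lambda>s. prim f (s * x)) has_real_derivative f (s * x) * x) (at s)" for s
    by (rule DERIV_cong[OF DERIV_chain2[OF prim_DERIV[OF assms]]]) (auto intro!: derivative_eq_intros)
  from int_FTC[OF this, of 0 1] show ?thesis by (simp add: mult.commute)
qed

lemma prim_minus: "prim (\<lambda>x. - f x) x = - prim f x"
  by (simp add: prim_def)

lemma prim_diff:
  assumes "continuous_on UNIV f" "continuous_on UNIV g"
  shows "prim (\<lambda>x. f x - g x) x = prim f x - prim g x"
proof -
  have "continuous_on A f" "continuous_on A g" for A using assms by (auto intro: continuous_on_subset)
  then show ?thesis by (simp add: prim_def int_diff)
qed

lemma abs_prim_le:
  assumes c: "continuous_on UNIV f" and x: "x \<in> {0..2 * pi}" and E: "(CI x. (f x)^2) \<le> E"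
  shows "\<bar>prim f x\<bar> \<le> sqrt (2 * pi) * sqrt E"
proof -
  have "\<bar>prim f x\<bar> \<le> (CI x. \<bar>f x\<bar>)"
    using abs_int_subinterval_le[OF c, of 0 x] x by (simp add: prim_def)
  also have "\<dots> \<le> sqrt (2 * pi - 0) * sqrt (CI x. (f x)^2)"
    by (rule int_abs_le_sqrt_length) (use c in \<open>auto intro: continuous_on_subset\<close>)
  also have "\<dots> \<le> sqrt (2 * pi - 0) * sqrt E" using E by (intro mult_left_mono) auto
  finally show ?thesis by simp
qed

text \<open>Equal means make the primitive of v - \<open>V0\<close> periodic, and with it
  \<open>R\<close>. The profile \<open>V0\<close> is a reference: the constant mean in the
  equicontinuity proof, the unperturbed datum in the comparison for mKdV.\<close>

locale mkdv_gauge = mkdv +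
  fixes \<epsilon> :: complex and V0 :: "real \<Rightarrow> real"
  assumes eps: "\<epsilon> * \<epsilon> = of_real \<sigma>"
    and V0: "V0 \<in> test_circle" and mean: "cint (v 0 0) = cint V0"
begin

definition R :: "real \<Rightarrow> real \<Rightarrow> complex" where
  "R t x = exp (2 * \<epsilon> * of_real (prim (v 0 t) x - prim V0 x))"

text \<open>Signed so that v_t is the spatial derivative of \<open>flux\<close>. Its value at 0,
  which enters through the normalisation of primitives, contains v_xx pointwise and has no bound in
  terms of the mass.\<close>

definition flux :: "real \<Rightarrow> real \<Rightarrow> real" where
  "flux t x = - v 2 t x + 2 * \<sigma> * (v 0 t x) ^ 3"

lemma mean_conserved: "cint (v 0 t) = cint V0"
  using mean_invariant[of t] mean by simp

lemma prim_v_DERIV: "(prim (v 0 t) has_real_derivative v 0 t x) (at x)"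
  by (rule prim_DERIV) (intro continuous_intros)

lemma prim_v_time_DERIV: "((\<lambda>t. prim (v 0 t) x) has_real_derivative flux t x - flux t 0) (at t)"
proof -
  have d: "(flux t has_real_derivative - v 3 t x + 6 * \<sigma> * (v 0 t x)^2 * v 1 t x) (at x)" for t x
    unfolding flux_def[abs_def]
    by (rule derivative_eq_intros DERIV_v_num refl)+ (simp add: eval_nat_numeral algebra_simps)
  have *: "((\<lambda>t. integral {a..b} (v 0 t)) has_real_derivative flux t b - flux t a) (at t)" if "a \<le> b" for a b
  proof -
    have "((\<lambda>t. integral {a..b} (v 0 t)) has_real_derivative
        integral {a..b} (\<lambda>x. - v 3 t x + 6 * \<sigma> * (v 0 t x)^2 * v 1 t x)) (at t)"
      by (rule int_DERIV_param_real[where f = "v 0" and ft = "\<lambda>t x. - v 3 t x + 6 * \<sigma> * (v 0 t x)^2 * v 1 t x"])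
        ((rule equation)+, auto intro!: continuous_intros simp: case_prod_unfold)
    then show ?thesis using int_FTC[OF d that] by simp
  qed
  show ?thesis
  proof (cases "0 \<le> x")
    case True then show ?thesis using *[OF True] by (simp add: prim_def)
  next
    case False
    then show ?thesis using DERIV_minus[OF *[of x 0]] by (simp add: prim_def)
  qed
qed

lemma prim_v_continuous: "continuous_on UNIV (\<lambda>p. prim (v 0 (fst p)) (snd p))"
proof -
  have "continuous_on UNIV (\<lambda>p :: real \<times> real. integral (cbox 0 1) (\<lambda>s :: real. v 0 (fst p) (s * snd p)))"
    by (rule integral_continuous_on_param) (simp only: case_prod_unfold, intro continuous_intros)
  then have "continuous_on UNIV (\<lambda>p. snd p * integral {0..1} (\<lambda>s. v 0 (fst p) (s * snd p)))"
    by (intro continuous_intros) simp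
  moreover have "prim (v 0 t) x = x * integral {0..1} (\<lambda>s. v 0 t (s * x))" for t x
    by (rule prim_scale) (intro continuous_intros)
  ultimately show ?thesis by simp
qed

lemma prim_V0_DERIV: "(prim V0 has_real_derivative V0 x) (at x)"
  by (rule prim_DERIV[OF circle_continuous[OF V0]])

lemma prim_V0_continuous: "continuous_on A h \<Longrightarrow> continuous_on A (\<lambda>p. prim V0 (h p))"
proof -
  have "continuous_on UNIV (prim V0)"
    using prim_V0_DERIV by (meson DERIV_isCont continuous_at_imp_continuous_on)
  then show "continuous_on A h \<Longrightarrow> continuous_on A (\<lambda>p. prim V0 (h p))"
    by (rule continuous_on_compose2) auto
qed

lemma R_continuous [continuous_intros]:
  "continuous_on A g \<Longrightarrow> continuous_on A h \<Longrightarrow> continuous_on A (\<lambda>p. R (g p) (h p))"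
  unfolding R_def
  by (intro continuous_intros prim_V0_continuous
      continuous_on_compose2[OF prim_v_continuous, of A "\<lambda>p. (g p, h p)", simplified])

lemma R_DERIV: "(R t has_vector_derivative 2 * \<epsilon> * of_real (v 0 t x - V0 x) * R t x) (at x)"
  unfolding R_def[abs_def]
  by (rule exp_of_real_vector_derivative[of "\<lambda>x. prim (v 0 t) x - prim V0 x"])
    (intro DERIV_diff prim_v_DERIV prim_V0_DERIV)

lemma R_time_DERIV:
  "((\<lambda>t. R t x) has_vector_derivative 2 * \<epsilon> * of_real (flux t x - flux t 0) * R t x) (at t)"
  unfolding R_def
  by (rule exp_of_real_vector_derivative[of "\<lambda>t. prim (v 0 t) x - prim V0 x"])
    (use DERIV_diff[OF prim_v_time_DERIV DERIV_const] in simp)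

lemma R_0 [simp]: "R t 0 = 1"
  by (simp add: R_def)

lemma R_period: "R t (2 * pi) = 1"
  by (simp add: R_def cint_prim mean_conserved)

abbreviation W :: "(real \<Rightarrow> real) \<Rightarrow> nat \<Rightarrow> real \<Rightarrow> complex" where
  "W \<equiv> cweight \<epsilon> \<sigma> V0"

lemma W_DERIV:
  assumes "f \<in> test_circle"
  shows "(W f j has_vector_derivative W f (Suc j) x + 2 * \<epsilon> * of_real (V0 x) * W f j x) (at x)"
proof -
  let ?p = "fst (weight \<sigma> V0 f j)" and ?q = "snd (weight \<sigma> V0 f j)"
  have "(?p has_real_derivative deriv ?p x) (at x)" "(?q has_real_derivative deriv ?q x) (at x)"
    by (rule circle_DERIV[OF weight_test_circle[OF V0 assms, THEN conjunct1]]
        circle_DERIV[OF weight_test_circle[OF V0 assms, THEN conjunct2]])+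
  then have "((\<lambda>x. of_real (?p x) + \<epsilon> * of_real (?q x)) has_vector_derivative
      of_real (deriv ?p x) + \<epsilon> * of_real (deriv ?q x)) (at x)"
    by (intro has_vector_derivative_add has_vector_derivative_mult_right has_vector_derivative_of_real)
      (simp_all add: has_real_derivative_iff_has_vector_derivative)
  moreover have "of_real (deriv ?p x) + \<epsilon> * of_real (deriv ?q x)
      = W f (Suc j) x + 2 * \<epsilon> * of_real (V0 x) * W f j x"
    by (simp add: cweight_def eps[symmetric] algebra_simps)
  ultimately show ?thesis by (simp add: cweight_def[abs_def])
qed

lemma W_continuous: "f \<in> test_circle \<Longrightarrow> continuous_on A h \<Longrightarrow> continuous_on A (\<lambda>p. W f j (h p))"
  unfolding cweight_def
  by (intro continuous_intros circle_continuous_comp[OF weight_test_circle[OF V0, THEN conjunct1]]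
      circle_continuous_comp[OF weight_test_circle[OF V0, THEN conjunct2]])

lemma W_period: "f \<in> test_circle \<Longrightarrow> W f j (2 * pi) = W f j 0"
  unfolding cweight_def using weight_test_circle[OF V0, of f \<sigma> j] by (simp add: circle_period_eq)

text \<open>All derivatives rest on the weight: the solution enters only through v^2 and
  \<open>R\<close>, so the mass and the mean alone control this expression.\<close>

definition src :: "(real \<Rightarrow> real) \<Rightarrow> real \<Rightarrow> complex" where
  "src f t = (CI x. (W f 3 x - 6 * of_real \<sigma> * W f 1 x * of_real ((v 0 t x)^2)) * R t x)"

text \<open>With \<rho> = exp(2 \<epsilon> prim v) the algebraic fact behind it is 2 \<epsilon> flux
  \<rho> = 6 \<sigma> (v^2 \<rho>)_x - \<rho>_xxx. The derivatives on the right are then moved onto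
  the weight; \<open>?Q\<close> in the proof collects the boundary terms of these integrations by
  parts.\<close>

lemma gauge_law:
  assumes f: "f \<in> test_circle"
  shows "((\<lambda>t. CI x. of_real (f x) * R t x) has_vector_derivative
    src f t - 2 * \<epsilon> * of_real (flux t 0) * (CI x. of_real (f x) * R t x)) (at t)"
proof -
  let ?ft = "\<lambda>t x. of_real (f x) * (2 * \<epsilon> * of_real (flux t x - flux t 0) * R t x)"
  let ?s = "\<lambda>x. (W f 3 x - 6 * of_real \<sigma> * W f 1 x * of_real ((v 0 t x)^2)) * R t x"
  have cflux: "continuous_on A g \<Longrightarrow> continuous_on A h \<Longrightarrow> continuous_on A (\<lambda>p. flux (g p) (h p))" for A and g h :: "'c::topological_space \<Rightarrow> real"
    unfolding flux_def by (intro continuous_intros)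
  have cflux': "continuous_on A g \<Longrightarrow> continuous_on A h \<Longrightarrow> continuous_on A (\<lambda>p. flux (g p) (h p))" for A and g h :: "real \<times> real \<Rightarrow> real"
    unfolding flux_def by (intro continuous_intros)
  note cc = continuous_intros cflux circle_continuous_comp[OF f] W_continuous[OF f]
  have "((\<lambda>t. CI x. of_real (f x) * R t x) has_vector_derivative cint (?ft t)) (at t)"
  proof (rule int_DERIV_param)
    show "((\<lambda>t. of_real (f x) * R t x) has_vector_derivative ?ft t x) (at t)" for t x
      by (intro has_vector_derivative_mult_right R_time_DERIV)
    show "continuous_on UNIV (\<lambda>(t, x). ?ft t x)"
      unfolding case_prod_unfold
      by (intro continuous_intros cflux' circle_continuous_comp[OF f])
    show "continuous_on {0..2 * pi} (\<lambda>x. of_real (f x) * R t x)" for t by (intro cc)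
  qed
  moreover have "cint (?ft t) = cint ?s - 2 * \<epsilon> * of_real (flux t 0) * (CI x. of_real (f x) * R t x)"
  proof -
    let ?Q = "\<lambda>x. ((2 * of_real \<sigma> * (of_real (v 0 t x) * of_real (v 0 t x)) - 2 * \<epsilon> * of_real (v 1 t x)) * W f 0 x
      + 2 * \<epsilon> * of_real (v 0 t x) * W f 1 x - W f 2 x) * R t x"
    have W0: "W f 0 x = of_real (f x)" for x by (simp add: cweight_def)
    have "(?Q has_vector_derivative ?ft t x + 2 * \<epsilon> * of_real (flux t 0) * (of_real (f x) * R t x) - ?s x) (at x)" for x
    proof -
      have v: "((\<lambda>x. of_real (v 0 t x) :: complex) has_vector_derivative of_real (v 1 t x)) (at x)"
        "((\<lambda>x. of_real (v 1 t x) :: complex) has_vector_derivative of_real (v 2 t x)) (at x)"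
        using DERIV_v_num(1,2)[of t x]
        by (auto intro!: has_vector_derivative_of_real simp: has_real_derivative_iff_has_vector_derivative)
      have w: "(W f 0 has_vector_derivative W f 1 x + 2 * \<epsilon> * of_real (V0 x) * W f 0 x) (at x)"
        "(W f 1 has_vector_derivative W f 2 x + 2 * \<epsilon> * of_real (V0 x) * W f 1 x) (at x)"
        "(W f 2 has_vector_derivative W f 3 x + 2 * \<epsilon> * of_real (V0 x) * W f 2 x) (at x)"
        using W_DERIV[OF f, of 0 x] W_DERIV[OF f, of 1 x] W_DERIV[OF f, of 2 x] by (simp_all add: eval_nat_numeral)
      show ?thesis
        by (rule has_vector_derivative_eq_rhs)
          ((rule derivative_intros v w R_DERIV)+,
            simp add: W0[symmetric] flux_def power2_eq_square power3_eq_cube eps[symmetric] algebra_simps)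
    qed
    then have "((\<lambda>x. ?ft t x + 2 * \<epsilon> * of_real (flux t 0) * (of_real (f x) * R t x) - ?s x) has_integral ?Q (2 * pi) - ?Q 0) {0..2 * pi}"
      by (intro fundamental_theorem_of_calculus) (simp, rule has_vector_derivative_at_within)
    then have "(CI x. ?ft t x + 2 * \<epsilon> * of_real (flux t 0) * (of_real (f x) * R t x) - ?s x) = 0"
      by (simp add: integral_unique R_period per_v W_period[OF f])
    then show ?thesis by (simp add: int_split cc eq_diff_eq)
  qed
  ultimately show ?thesis by (simp add: src_def)
qed

lemma prim_diff_eq: "prim (v 0 t) x - prim V0 x = prim (\<lambda>x. v 0 t x - V0 x) x"
  by (rule prim_diff[symmetric]) (intro continuous_intros circle_continuous[OF V0])+

text \<open>The equation is odd in v, and changing the signs of v and \<open>V0\<close> turns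
  \<open>R\<close> into its inverse, so the law for 1 / \<open>R\<close> is another instance of
  \<open>gauge_law\<close>.\<close>

lemma gauge_minus: "mkdv_gauge \<sigma> (\<lambda>j t x. - v j t x) \<epsilon> (\<lambda>x. - V0 x)"
proof
  show "\<sigma> = 1 \<or> \<sigma> = - 1" by (rule sign)
  show "- v j t (x + 2 * pi) = - v j t x" for j t x by (simp add: periodic_v)
  show "((\<lambda>x. - v j t x) has_real_derivative - v (Suc j) t x) (at x)" for j t x by (rule DERIV_minus[OF DERIV_v])
  show "continuous_on UNIV (\<lambda>(t, x). - v j t x)" for j
    unfolding case_prod_unfold by (intro continuous_intros)
  show "((\<lambda>t. - v 0 t x) has_real_derivative - (- v 3 t x) + 6 * \<sigma> * (- v 0 t x)^2 * - v 1 t x) (at t)" for t x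
    using DERIV_minus[OF equation[of x t]] by simp
  show "\<epsilon> * \<epsilon> = of_real \<sigma>" by (rule eps)
  show "(\<lambda>x. - V0 x) \<in> test_circle" by (rule circle_minus[OF V0])
  show "(CI x. - v 0 0 x) = (CI x. - V0 x)" using mean by simp
qed

text \<open>The terms with \<open>flux t 0\<close> enter the two factors with opposite signs and
  cancel in the product rule; what is left can be bounded by the mass.\<close>

lemma product_law:
  assumes f: "f \<in> test_circle" and k: "k \<in> test_circle"
  shows "((\<lambda>t. (CI x. of_real (f x) * R t x) * (CI x. of_real (k x) * inverse (R t x))) has_vector_derivative
    src f t * (CI x. of_real (k x) * inverse (R t x)) +
    (CI x. of_real (f x) * R t x) * (CI x. (cweight \<epsilon> \<sigma> (\<lambda>x. - V0 x) k 3 x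
      - 6 * of_real \<sigma> * cweight \<epsilon> \<sigma> (\<lambda>x. - V0 x) k 1 x * of_real ((v 0 t x)^2)) * inverse (R t x))) (at t)"
proof -
  interpret m: mkdv_gauge \<sigma> "\<lambda>j t x. - v j t x" \<epsilon> "\<lambda>x. - V0 x" by (rule gauge_minus)
  have mR: "m.R t x = inverse (R t x)" for t x
    by (simp add: R_def m.R_def prim_minus exp_minus[symmetric] algebra_simps)
  have mf: "m.flux t x = - flux t x" for t x
    by (simp add: flux_def m.flux_def)
  have A: "((\<lambda>t. CI x. of_real (f x) * R t x) has_vector_derivative
    src f t - 2 * \<epsilon> * of_real (flux t 0) * (CI x. of_real (f x) * R t x)) (at t)"
    by (rule gauge_law[OF f])
  have B: "((\<lambda>t. CI x. of_real (k x) * inverse (R t x)) has_vector_derivative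
    m.src k t + 2 * \<epsilon> * of_real (flux t 0) * (CI x. of_real (k x) * inverse (R t x))) (at t)"
    using m.gauge_law[OF k, of t] by (simp add: mR mf)
  have src: "m.src k t = (CI x. (cweight \<epsilon> \<sigma> (\<lambda>x. - V0 x) k 3 x
      - 6 * of_real \<sigma> * cweight \<epsilon> \<sigma> (\<lambda>x. - V0 x) k 1 x * of_real ((v 0 t x)^2)) * inverse (R t x))"
    by (simp add: m.src_def mR)
  show ?thesis
    unfolding src[symmetric]
    by (rule has_vector_derivative_eq_rhs[OF has_vector_derivative_mult[OF A B]]) (simp add: algebra_simps)
qed

end

section \<open>Equicontinuity in time\<close>

text \<open>Makes bounds on the weights uniform in the centre of the bump; the shift invariance of
  \<open>V0\<close> is met by a constant profile.\<close>

lemma weight_shift: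
  assumes "V0 \<in> test_circle" "f \<in> test_circle" "\<And>x. V0 (x + a) = V0 x"
  shows "fst (weight \<sigma> V0 (\<lambda>x. f (x + a)) j) = (\<lambda>x. fst (weight \<sigma> V0 f j) (x + a)) \<and>
    snd (weight \<sigma> V0 (\<lambda>x. f (x + a)) j) = (\<lambda>x. snd (weight \<sigma> V0 f j) (x + a))"
proof (induction j)
  case (Suc j)
  have d: "deriv (\<lambda>x. g (x + a)) x = deriv g (x + a)" if "g \<in> test_circle" for g x
    using circle_DERIV[OF that, of "x + a"] by (intro DERIV_imp_deriv) (simp add: DERIV_shift)
  show ?case
    using Suc weight_test_circle[OF assms(1,2), of \<sigma> j] by (simp add: d assms(3))
qed simp

lemma cweight_bound:
  assumes "V0 \<in> test_circle" "f \<in> test_circle" "norm \<epsilon> \<le> 1"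
  obtains B where "B > 0" "\<And>x. norm (cweight \<epsilon> \<sigma> V0 f j x) \<le> B"
proof -
  obtain B1 where B1: "B1 > 0" "\<And>x. \<bar>fst (weight \<sigma> V0 f j) x\<bar> \<le> B1"
    using circle_bounded[OF weight_test_circle[OF assms(1,2), THEN conjunct1]] by blast
  obtain B2 where B2: "B2 > 0" "\<And>x. \<bar>snd (weight \<sigma> V0 f j) x\<bar> \<le> B2"
    using circle_bounded[OF weight_test_circle[OF assms(1,2), THEN conjunct2]] by blast
  show ?thesis
  proof (rule that[of "B1 + B2"])
    fix x
    have "norm (\<epsilon> * of_real (snd (weight \<sigma> V0 f j) x)) \<le> 1 * B2"
      unfolding norm_mult using B2 assms(3) by (intro mult_mono) auto
    then show "norm (cweight \<epsilon> \<sigma> V0 f j x) \<le> B1 + B2"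
      unfolding cweight_def using B1(2)[of x] by (intro norm_triangle_le) (simp add: add_mono)
  qed (use B1 B2 in simp)
qed

lemma small_exponent_real:
  fixes a e :: real
  assumes "\<bar>exp (2 * a) - 1\<bar> \<le> e" "e \<le> 1 / 2"
  shows "\<bar>a\<bar> \<le> e"
proof -
  have "2 * a \<le> e" using exp_ge_add_one_self[of "2 * a"] assms by linarith
  moreover have "0 \<le> e" using assms by linarith
  moreover have "- a \<le> e"
  proof -
    have "(1 - 2 * a) * exp (2 * a) \<le> 1"
      using mult_right_mono[OF exp_ge_add_one_self[of "- (2 * a)"], of "exp (2 * a)"] by (simp add: exp_minus)
    moreover have "1 - e \<le> exp (2 * a)" using assms by linarith
    then have "(1 - 2 * a) * (1 - e) \<le> (1 - 2 * a) * exp (2 * a)" if "a \<le> 0" using that by (intro mult_left_mono) auto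
    ultimately have "a \<le> 0 \<Longrightarrow> (1 - 2 * a) * (1 - e) \<le> 1" by linarith
    then have "a \<le> 0 \<Longrightarrow> (- 2 * a) * (1 - e) \<le> e" by (simp add: algebra_simps)
    moreover have "a \<le> 0 \<Longrightarrow> (- 2 * a) * (1 / 2) \<le> (- 2 * a) * (1 - e)" using assms by (intro mult_left_mono) auto
    ultimately show ?thesis using \<open>0 \<le> e\<close> by linarith
  qed
  ultimately show ?thesis by linarith
qed

lemma norm_exp_imaginary_minus_one: "norm (exp (2 * \<i> * of_real a) - 1) = 2 * \<bar>sin a\<bar>"
proof -
  have "exp (2 * \<i> * of_real a) = cis (2 * a)" by (simp add: cis_conv_exp mult_ac)
  then have "(norm (exp (2 * \<i> * of_real a) - 1))^2 = (cos (2 * a) - 1)^2 + (sin (2 * a))^2"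
    by (simp add: cmod_power2)
  also have "\<dots> = (cos (2 * a))^2 + (sin (2 * a))^2 + 1 - 2 * cos (2 * a)"
    by (simp add: power2_eq_square algebra_simps)
  also have "\<dots> = 2 - 2 * cos (2 * a)" by (simp add: add.commute)
  also have "\<dots> = (2 * \<bar>sin a\<bar>)^2" by (simp add: cos_double_sin power_mult_distrib)
  finally show ?thesis by (rule power2_eq_imp_eq) simp_all
qed

text \<open>For \<epsilon> = \<i> the exponential knows the phase only modulo pi. The phase is
  continuous and starts at 0, so to exceed e in modulus it would have to equal e in modulus
  somewhere, where 2 sin e > e contradicts the smallness.\<close>

lemma small_exponent_imaginary:
  fixes a :: "real \<Rightarrow> real"
  assumes a: "continuous_on {0..b} a" "a 0 = 0" and x: "x \<in> {0..b}"
    and e: "0 < e" "e \<le> 1 / 2" and small: "\<And>x. x \<in> {0..b} \<Longrightarrow> norm (exp (2 * \<i> * of_real (a x)) - 1) \<le> e"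
  shows "\<bar>a x\<bar> \<le> e"
proof (rule ccontr)
  assume "\<not> \<bar>a x\<bar> \<le> e"
  then have "\<exists>y. 0 \<le> y \<and> y \<le> x \<and> \<bar>a y\<bar> = e"
    using a x e by (intro IVT') (auto intro!: continuous_intros continuous_on_subset[OF a(1)])
  then obtain y where y: "0 \<le> y" "y \<le> x" "\<bar>a y\<bar> = e" by blast
  have "2 * \<bar>sin (a y)\<bar> \<le> e" using small[of y] y x by (simp add: norm_exp_imaginary_minus_one)
  moreover have "\<bar>sin (a y)\<bar> = \<bar>sin e\<bar>" using y(3) by (cases "a y \<ge> 0") auto
  moreover have "sin e > e / 2"
  proof -
    obtain z where z: "0 < z" "z < e" "sin e - sin 0 = (e - 0) * cos z"
      using MVT2[of 0 e sin cos] e by auto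
    have "cos (pi / 3) < cos z" using z e pi_gt3 by (intro cos_monotone_0_pi) auto
    then have "e * (1 / 2) < e * cos z" using e by (intro mult_strict_left_mono) (auto simp: cos_60)
    then show ?thesis using z by simp
  qed
  ultimately show False by linarith
qed

lemma norm_diff_le_of_derivative_bound:
  fixes S :: "real \<Rightarrow> complex"
  assumes "\<And>t. (S has_vector_derivative S' t) (at t)" "\<And>t. norm (S' t) \<le> C"
  shows "norm (S t - S s) \<le> C * \<bar>t - s\<bar>"
proof -
  have C: "0 \<le> C" using norm_ge_zero assms(2) by (rule order_trans)
  have *: "norm (S t - S s) \<le> C * (t - s)" if "s \<le> t" for s t
  proof -
    have "(S' has_integral (S t - S s)) (cbox s t)"
      unfolding cbox_interval
      by (rule fundamental_theorem_of_calculus[OF that]) (rule has_vector_derivative_at_within[OF assms(1)])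
    from has_integral_bound[OF C this] show ?thesis using assms(2) that by simp
  qed
  show ?thesis using *[of s t] *[of t s] by (cases "s \<le> t") (auto simp: norm_minus_commute)
qed

lemma (in mkdv) source_bound:
  fixes G3 G1 H :: "real \<Rightarrow> complex"
  assumes c: "\<And>A. continuous_on A G3" "\<And>A. continuous_on A G1" "\<And>A. continuous_on A H"
    and G: "\<And>x. norm (G3 x) \<le> X3" "\<And>x. norm (G1 x) \<le> X1" and H: "\<And>x. x \<in> {0..2 * pi} \<Longrightarrow> norm (H x) \<le> K"
    and mass: "(CI x. (v 0 t x)^2) \<le> E"
  shows "norm (CI x. (G3 x - 6 * of_real \<sigma> * G1 x * of_real ((v 0 t x)^2)) * H x) \<le> K * (X3 * (2 * pi) + 6 * X1 * E)"
proof -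
  have X: "0 \<le> X1" "0 \<le> X3" using G[of 0] norm_ge_zero order_trans by blast+
  have "norm (H 0) \<le> K" by (rule H) simp
  then have K: "0 \<le> K" by (rule order_trans[OF norm_ge_zero])
  have "norm (CI x. (G3 x - 6 * of_real \<sigma> * G1 x * of_real ((v 0 t x)^2)) * H x) \<le> (CI x. K * X3 + (6 * K * X1) * (v 0 t x)^2)"
  proof (rule int_norm_le)
    fix x :: real assume x: "x \<in> {0..2 * pi}"
    have "norm (6 * of_real \<sigma> * G1 x * of_real ((v 0 t x)^2)) = 6 * (norm (G1 x) * (v 0 t x)^2)"
      using sign by (auto simp: norm_mult norm_power)
    also have "\<dots> \<le> 6 * (X1 * (v 0 t x)^2)" using G(2)[of x] by (intro mult_left_mono mult_right_mono) auto
    finally have "norm (G3 x - 6 * of_real \<sigma> * G1 x * of_real ((v 0 t x)^2)) \<le> X3 + 6 * (X1 * (v 0 t x)^2)"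
      using G(1)[of x] by (intro order_trans[OF norm_triangle_ineq4] add_mono)
    then have "norm (G3 x - 6 * of_real \<sigma> * G1 x * of_real ((v 0 t x)^2)) * norm (H x) \<le> (X3 + 6 * (X1 * (v 0 t x)^2)) * K"
      using H[OF x] X by (intro mult_mono) auto
    then show "norm ((G3 x - 6 * of_real \<sigma> * G1 x * of_real ((v 0 t x)^2)) * H x) \<le> K * X3 + (6 * K * X1) * (v 0 t x)^2"
      by (simp only: norm_mult) (simp add: algebra_simps)
  qed (intro continuous_intros c)+
  also have "\<dots> = (CI x. K * X3) + (CI x. (6 * K * X1) * (v 0 t x)^2)" by (intro int_add continuous_intros)
  also have "\<dots> = K * X3 * (2 * pi) + (6 * K * X1) * (CI x. (v 0 t x)^2)" by simp
  also have "\<dots> \<le> K * X3 * (2 * pi) + (6 * K * X1) * E" using mass K X by (intro add_left_mono mult_left_mono) auto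
  finally show ?thesis by (simp add: algebra_simps)
qed

lemma norm_exp_phase_le:
  assumes "norm \<epsilon> = 1" "\<bar>y\<bar> \<le> K"
  shows "norm (exp (2 * \<epsilon> * of_real y) :: complex) \<le> exp (2 * K)"
proof -
  have "norm (exp (2 * \<epsilon> * of_real y)) \<le> exp (norm (2 * \<epsilon> * of_real y))" by (rule norm_exp)
  also have "\<dots> \<le> exp (2 * K)" using assms by (simp add: norm_mult)
  finally show ?thesis .
qed

text \<open>The step \<open>d\<close> depends on \<open>e\<close>, mass and mean only, so it
  survives the limit of high frequency. A bump at x tests \<open>R\<close>, and a bump at 0, where
  \<open>R\<close> is 1, tests 1 / \<open>R\<close>. The product of the pairings is Lipschitz in
  time by \<open>product_law\<close> and differs little from \<beta>^2 \<open>R t x\<close>; so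
  \<open>R\<close> varies little in time, and the phase is recovered from it.\<close>

theorem equicontinuity:
  fixes E M e :: real
  assumes "e > 0"
  obtains d where "d > 0"
    "\<And>\<sigma> v s t x. mkdv \<sigma> v \<Longrightarrow> (CI x. (v 0 0 x)^2) \<le> E \<Longrightarrow> cint (v 0 0) = M \<Longrightarrow>
      \<bar>t - s\<bar> \<le> d \<Longrightarrow> x \<in> {0..2 * pi} \<Longrightarrow> \<bar>prim (v 0 t) x - prim (v 0 s) x\<bar> \<le> e"
proof -
  have one: "\<exists>d>0. \<forall>v s t x. mkdv \<sigma> v \<longrightarrow> (CI x. (v 0 0 x)^2) \<le> E \<longrightarrow> cint (v 0 0) = M \<longrightarrow>
      \<bar>t - s\<bar> \<le> d \<longrightarrow> x \<in> {0..2 * pi} \<longrightarrow> \<bar>prim (v 0 t) x - prim (v 0 s) x\<bar> \<le> e"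
    if eps: "\<epsilon> * \<epsilon> = complex_of_real \<sigma>" and sg: "\<sigma> = 1 \<and> \<epsilon> = 1 \<or> \<sigma> = - 1 \<and> \<epsilon> = \<i>" and E: "0 \<le> E" for \<sigma> \<epsilon>
  proof -
    have ne: "norm \<epsilon> = 1" using sg by auto
    define \<mu> where "\<mu> = M / (2 * pi)"
    \<comment> \<open>With a constant profile the weights commute with shifts, and the square norm
      of v - \<open>U\<close> is a variance, at most the mass.\<close>
    define U :: "real \<Rightarrow> real" where "U = (\<lambda>x. \<mu>)"
    have U: "U \<in> test_circle" "(\<lambda>x. - U x) \<in> test_circle" and cU: "cint U = M" by (auto simp: U_def \<mu>_def)
    define e1 where "e1 = min e (1 / 2)"
    have e1: "0 < e1" "e1 \<le> 1 / 2" "e1 \<le> e" using assms by (auto simp: e1_def)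
    define K where "K = exp (2 * (sqrt (2 * pi) * sqrt E))"
    have K: "1 \<le> K" using E by (simp add: K_def)
    \<comment> \<open>Chosen for \<open>w_le\<close>: the modulus \<open>w\<close> of
      \<open>R\<close> and its inverse over a distance \<open>r\<close> enters the final estimate as
      \<open>8 * K^2 * w\<close>, that is 16 K^3 sqrt(r E), which must not exceed
      \<open>e1 / 2\<close>.\<close>
    define r where "r = min 1 ((e1 / (32 * K ^ 3))^2 / (E + 1))"
    have r: "0 < r" "r < pi" using e1 E K pi_gt3 by (auto simp: r_def min_less_iff_disj)
    define w where "w = 2 * K * sqrt (r * E)"
    have w: "0 \<le> w" using K r E by (simp add: w_def)
    have w_le: "8 * K^2 * w \<le> e1 / 2"
    proof -
      have "r * E \<le> ((e1 / (32 * K ^ 3))^2 / (E + 1)) * (E + 1)" using E r by (intro mult_mono) (auto simp: r_def)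
      then have "r * E \<le> (e1 / (32 * K ^ 3))^2" using E by simp
      then have "sqrt (r * E) \<le> e1 / (32 * K ^ 3)" using e1 K by (intro real_le_lsqrt) auto
      then have "32 * K ^ 3 * sqrt (r * E) \<le> e1" using K by (simp add: field_simps)
      then show ?thesis by (simp add: w_def power2_eq_square power3_eq_cube mult_ac)
    qed
    define \<beta> where "\<beta> = cint (pbump r)"
    have \<beta>: "0 < \<beta>" unfolding \<beta>_def by (rule cint_pbump_pos[OF r])
    obtain P where P: "P > 0" "\<And>x. \<bar>pbump r x\<bar> \<le> P" using circle_bounded[OF pbump_test_circle] by blast
    obtain B1 where B1: "B1 > 0" "\<And>x. norm (cweight \<epsilon> \<sigma> U (pbump r) 1 x) \<le> B1"
      using cweight_bound[OF U(1) pbump_test_circle] ne by (metis order_refl)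
    obtain B3 where B3: "B3 > 0" "\<And>x. norm (cweight \<epsilon> \<sigma> U (pbump r) 3 x) \<le> B3"
      using cweight_bound[OF U(1) pbump_test_circle] ne by (metis order_refl)
    obtain D1 where D1: "D1 > 0" "\<And>x. norm (cweight \<epsilon> \<sigma> (\<lambda>x. - U x) (pbump r) 1 x) \<le> D1"
      using cweight_bound[OF U(2) pbump_test_circle] ne by (metis order_refl)
    obtain D3 where D3: "D3 > 0" "\<And>x. norm (cweight \<epsilon> \<sigma> (\<lambda>x. - U x) (pbump r) 3 x) \<le> D3"
      using cweight_bound[OF U(2) pbump_test_circle] ne by (metis order_refl)
    define C where "C = (K * (B3 * (2 * pi) + 6 * B1 * E)) * (P * K * (2 * pi)) + (P * K * (2 * pi)) * (K * (D3 * (2 * pi) + 6 * D1 * E))"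
    have C: "0 \<le> C" unfolding C_def using K B1 B3 D1 D3 P E by (intro add_nonneg_nonneg mult_nonneg_nonneg) auto
    \<comment> \<open>The Lipschitz constant \<open>C\<close> of the product, divided by
      \<open>\<beta>^2\<close> and multiplied by the bound \<open>K\<close> of the inverse of
      \<open>R\<close>, contributes at most \<open>e1 / 2\<close> over a time
      \<open>d\<close>.\<close>
    define d where "d = e1 * \<beta>^2 / (2 * K * (C + 1))"
    have d: "0 < d" using e1 \<beta> K C by (simp add: d_def)
    have "\<bar>prim (v 0 t) x - prim (v 0 s) x\<bar> \<le> e"
      if mk: "mkdv \<sigma> v" and mass: "(CI x. (v 0 0 x)^2) \<le> E" and mean: "cint (v 0 0) = M"
        and ts: "\<bar>t - s\<bar> \<le> d" and x: "x \<in> {0..2 * pi}" for v s t x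
    proof -
      interpret mkdv_gauge \<sigma> v \<epsilon> U
        by (intro mkdv_gauge.intro mk mkdv_gauge_axioms.intro eps U(1)) (simp add: mean cU)
      have massU: "(CI x. (v 0 t x)^2) \<le> E" for t using mass mass_conserved[of t] by simp
      have var: "(CI x. (v 0 t x - U x)^2) \<le> E" for t
      proof -
        have "(CI x. (v 0 t x - U x)^2) = (CI x. (v 0 t x)^2 + ((-2 * \<mu>) * v 0 t x + \<mu>^2))"
          by (simp add: U_def power2_eq_square algebra_simps)
        also have "\<dots> = (CI x. (v 0 t x)^2) - 2 * pi * \<mu>^2"
          using mean_conserved[of t] cU by (simp add: int_split continuous_intros \<mu>_def power2_eq_square)
        finally show ?thesis using massU[of t] by (simp add: order_trans[rotated])
      qed
      have dv: "integral {a..b} (\<lambda>x. \<bar>v 0 t x - U x\<bar>) \<le> sqrt (b - a) * sqrt E"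
        if "0 \<le> a" "a \<le> b" "b \<le> 2 * pi" for a b t
      proof -
        have "integral {a..b} (\<lambda>x. \<bar>v 0 t x - U x\<bar>) \<le> sqrt (b - a) * sqrt (integral {a..b} (\<lambda>x. (v 0 t x - U x)^2))"
          by (intro int_abs_le_sqrt_length that continuous_intros circle_continuous[OF U(1)])
        also have "integral {a..b} (\<lambda>x. (v 0 t x - U x)^2) \<le> (CI x. (v 0 t x - U x)^2)"
          using that by (intro integral_subset_le integrable_continuous_real continuous_intros circle_continuous[OF U(1)]) auto
        also have "\<dots> \<le> E" by (rule var)
        finally show ?thesis using that by (simp add: mult_left_mono)
      qed
      have absq: "\<bar>prim (v 0 t) x - prim U x\<bar> \<le> sqrt (2 * pi) * sqrt E" if "x \<in> {0..2 * pi}" for t x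
        unfolding prim_diff_eq by (rule abs_prim_le[OF _ that var]) (intro continuous_intros circle_continuous[OF U(1)])
      have RK: "norm (R t x) \<le> K" if "x \<in> {0..2 * pi}" for t x
        unfolding R_def K_def by (intro norm_exp_phase_le ne absq that)
      have RK': "norm (inverse (R t x)) \<le> K" if "x \<in> {0..2 * pi}" for t x
      proof -
        have "inverse (R t x) = exp (2 * \<epsilon> * of_real (- (prim (v 0 t) x - prim U x)))"
          unfolding R_def exp_minus[symmetric] by (simp add: algebra_simps)
        then show ?thesis using absq[OF that, of t] unfolding K_def by (simp only:) (intro norm_exp_phase_le ne, simp)
      qed
      have Rne: "R t x \<noteq> 0" for t x by (simp add: R_def)
      have hoel: "norm (F x - F y) \<le> w"
        if "x \<in> {0..2 * pi}" "y \<in> {0..2 * pi}" "y \<le> x" "x - y \<le> r"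
          and F: "\<And>x. (F has_vector_derivative c * of_real (v 0 t x - U x) * F x) (at x)" "norm c = 2"
            "\<And>x. x \<in> {0..2 * pi} \<Longrightarrow> norm (F x) \<le> K" for F :: "real \<Rightarrow> complex" and c t x y
      proof -
        have cF: "continuous_on A F" for A
          by (rule continuous_on_vector_derivative) (rule has_vector_derivative_at_within[OF F(1)])
        have "((\<lambda>x. c * of_real (v 0 t x - U x) * F x) has_integral F x - F y) {y..x}"
          by (rule fundamental_theorem_of_calculus[OF that(3)]) (rule has_vector_derivative_at_within[OF F(1)])
        then have "F x - F y = integral {y..x} (\<lambda>x. c * of_real (v 0 t x - U x) * F x)"
          by (simp add: integral_unique)
        moreover have "norm (integral {y..x} (\<lambda>x. c * of_real (v 0 t x - U x) * F x)) \<le> integral {y..x} (\<lambda>x. 2 * K * \<bar>v 0 t x - U x\<bar>)"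
        proof (rule int_norm_le)
          fix z assume "z \<in> {y..x}"
          then have "norm (F z) \<le> K" using that by (intro F(3)) auto
          then have "2 * \<bar>v 0 t z - U z\<bar> * norm (F z) \<le> 2 * \<bar>v 0 t z - U z\<bar> * K" by (intro mult_left_mono) auto
          then show "norm (c * of_real (v 0 t z - U z) * F z) \<le> 2 * K * \<bar>v 0 t z - U z\<bar>"
            by (simp only: norm_mult F(2) norm_of_real) (simp add: mult_ac)
        qed (intro continuous_intros cF circle_continuous[OF U(1)])+
        moreover have "integral {y..x} (\<lambda>x. 2 * K * \<bar>v 0 t x - U x\<bar>) \<le> w"
        proof -
          have "integral {y..x} (\<lambda>x. \<bar>v 0 t x - U x\<bar>) \<le> sqrt (x - y) * sqrt E" using that by (intro dv) auto
          also have "\<dots> \<le> sqrt r * sqrt E" using that E by (intro mult_right_mono) auto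
          finally show ?thesis using K by (simp add: w_def real_sqrt_mult)
        qed
        ultimately show ?thesis by simp
      qed
      have R'_DERIV: "((\<lambda>x. inverse (R t x)) has_vector_derivative (- 2 * \<epsilon>) * of_real (v 0 t x - U x) * inverse (R t x)) (at x)" for t x
      proof -
        interpret m: mkdv_gauge \<sigma> "\<lambda>j t x. - v j t x" \<epsilon> "\<lambda>x. - U x" by (rule gauge_minus)
        have "m.R t x = inverse (R t x)" for x
          by (simp add: R_def m.R_def prim_minus exp_minus[symmetric] algebra_simps)
        then have "m.R t = (\<lambda>x. inverse (R t x))" by (rule ext)
        then show ?thesis using m.R_DERIV[of t x] by (simp add: algebra_simps)
      qed
      have R'c: "continuous_on A g \<Longrightarrow> continuous_on A h \<Longrightarrow> continuous_on A (\<lambda>p. inverse (R (g p) (h p)))"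
        for A and g h :: "real \<Rightarrow> real"
        by (intro continuous_intros) (auto simp: Rne)
      have RR: "\<beta>^2 * norm (R t x - R s x) \<le> 8 * K * w * \<beta>^2 + C * d" if x: "x \<in> {0..2 * pi}" for x
      proof -
        let ?f = "\<lambda>y. pbump r (y - x)" and ?k = "\<lambda>y. pbump r (y - 0)"
        let ?A = "\<lambda>t. (CI y. of_real (?f y) * R t y)" and ?B = "\<lambda>t. (CI y. of_real (?k y) * inverse (R t y))"
        have fk: "?f \<in> test_circle" "?k \<in> test_circle" by (rule pbump_shift_test_circle)+
        have A: "norm (?A t - of_real \<beta> * R t x) \<le> 2 * w * \<beta>" for t
        proof -
          have "norm ((CI y. pbump r (y - x) *\<^sub>R R t y) - cint (pbump r) *\<^sub>R R t x) \<le> 2 * w * cint (pbump r)"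
          proof (rule pbump_approx[OF r x])
            show "norm (R t y - R t z) \<le> w" if "y \<in> {0..2 * pi}" "z \<in> {0..2 * pi}" "z \<le> y" "y - z \<le> r" for y z
              by (rule hoel[OF that, of "R t" "2 * \<epsilon>" t]) (use R_DERIV RK ne in \<open>auto simp: norm_mult\<close>)
          qed (auto intro!: continuous_intros simp: R_period)
          then show ?thesis by (simp add: scaleR_conv_of_real \<beta>_def)
        qed
        have B: "norm (?B t - of_real \<beta>) \<le> 2 * w * \<beta>" for t
        proof -
          have "norm ((CI y. pbump r (y - 0) *\<^sub>R inverse (R t y)) - cint (pbump r) *\<^sub>R inverse (R t 0)) \<le> 2 * w * cint (pbump r)"
          proof (rule pbump_approx[OF r])
            show "norm (inverse (R t y) - inverse (R t z)) \<le> w"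
              if "y \<in> {0..2 * pi}" "z \<in> {0..2 * pi}" "z \<le> y" "y - z \<le> r" for y z
              by (rule hoel[OF that, of "\<lambda>x. inverse (R t x)" "- 2 * \<epsilon>" t]) (use R'_DERIV RK' ne in \<open>auto simp: norm_mult\<close>)
          qed (auto intro!: continuous_intros R'c simp: R_period)
          then show ?thesis by (simp add: scaleR_conv_of_real \<beta>_def)
        qed
        have AK: "norm (?A t) \<le> P * K * (2 * pi)" and BK: "norm (?B t) \<le> P * K * (2 * pi)" for t
        proof -
          have 1: "norm (of_real (pbump r y) * z) \<le> P * K" if "norm z \<le> K" for y and z :: complex
            unfolding norm_mult norm_of_real using P that by (intro mult_mono) auto
          have "norm (?A t) \<le> P * K * (2 * pi - 0)"
            by (rule int_norm_le_const) (auto intro!: 1 RK continuous_intros circle_continuous[OF fk(1)])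
          then show "norm (?A t) \<le> P * K * (2 * pi)" by simp
          have "norm (?B t) \<le> P * K * (2 * pi - 0)"
          proof (rule int_norm_le_const)
            show "continuous_on {0..2 * pi} (\<lambda>y. of_real (?k y) * inverse (R t y))"
              by (intro continuous_intros R'c circle_continuous[OF fk(2)])
            show "norm (of_real (?k y) * inverse (R t y)) \<le> P * K" if "y \<in> {0..2 * pi}" for y
              by (rule 1[OF RK'[OF that]])
          qed simp
          then show "norm (?B t) \<le> P * K * (2 * pi)" by simp
        qed
        have cw_shift: "cweight \<epsilon> \<sigma> u (\<lambda>y. pbump r (y - z)) j y = cweight \<epsilon> \<sigma> u (pbump r) j (y - z)"
          if "u = U \<or> u = (\<lambda>x. - U x)" for u z j y
        proof -
          have "u \<in> test_circle" "\<And>x. u (x + - z) = u x" using that U by (auto simp: U_def)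
          from weight_shift[OF this(1) pbump_test_circle this(2), of \<sigma> r j] show ?thesis by (simp add: cweight_def)
        qed
        have Lip: "norm (?A t * ?B t - ?A s * ?B s) \<le> C * \<bar>t - s\<bar>"
        proof (rule norm_diff_le_of_derivative_bound[OF product_law[OF fk]])
          fix t
          interpret m: mkdv_gauge \<sigma> "\<lambda>j t x. - v j t x" \<epsilon> "\<lambda>x. - U x" by (rule gauge_minus)
          have 1: "norm (src ?f t) \<le> K * (B3 * (2 * pi) + 6 * B1 * E)"
            unfolding src_def
          proof (rule source_bound)
            show "continuous_on A (W ?f 3)" "continuous_on A (W ?f 1)" "continuous_on A (R t)" for A
              by (intro W_continuous[OF fk(1) continuous_on_id] R_continuous continuous_intros)+
            show "norm (W ?f 3 y) \<le> B3" "norm (W ?f 1 y) \<le> B1" for y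
              by (simp_all only: cw_shift[OF disjI1[OF refl]] B1 B3)
          qed (rule RK massU; assumption?)+
          have 2: "norm (CI x. (cweight \<epsilon> \<sigma> (\<lambda>x. - U x) ?k 3 x - 6 * of_real \<sigma> * cweight \<epsilon> \<sigma> (\<lambda>x. - U x) ?k 1 x * of_real ((v 0 t x)^2)) * inverse (R t x))
              \<le> K * (D3 * (2 * pi) + 6 * D1 * E)"
          proof (rule source_bound)
            show "continuous_on A (cweight \<epsilon> \<sigma> (\<lambda>x. - U x) ?k 3)" "continuous_on A (cweight \<epsilon> \<sigma> (\<lambda>x. - U x) ?k 1)"
              "continuous_on A (\<lambda>y. inverse (R t y))" for A
              by (intro m.W_continuous[OF fk(2) continuous_on_id] R'c continuous_intros)+
            show "norm (cweight \<epsilon> \<sigma> (\<lambda>x. - U x) ?k 3 y) \<le> D3" "norm (cweight \<epsilon> \<sigma> (\<lambda>x. - U x) ?k 1 y) \<le> D1" for y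
              by (simp_all only: cw_shift[OF disjI2[OF refl]] D1 D3)
          qed (rule RK' massU; assumption?)+
          show "norm (src ?f t * ?B t + ?A t * (CI x. (cweight \<epsilon> \<sigma> (\<lambda>x. - U x) ?k 3 x - 6 * of_real \<sigma> * cweight \<epsilon> \<sigma> (\<lambda>x. - U x) ?k 1 x * of_real ((v 0 t x)^2)) * inverse (R t x))) \<le> C"
            unfolding C_def
          proof (rule norm_triangle_le, rule add_mono)
            show "norm (src ?f t * ?B t) \<le> (K * (B3 * (2 * pi) + 6 * B1 * E)) * (P * K * (2 * pi))"
              unfolding norm_mult by (rule mult_mono[OF 1 BK order_trans[OF norm_ge_zero 1] norm_ge_zero])
            show "norm (?A t * (CI x. (cweight \<epsilon> \<sigma> (\<lambda>x. - U x) ?k 3 x - 6 * of_real \<sigma> * cweight \<epsilon> \<sigma> (\<lambda>x. - U x) ?k 1 x * of_real ((v 0 t x)^2)) * inverse (R t x)))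
                \<le> (P * K * (2 * pi)) * (K * (D3 * (2 * pi) + 6 * D1 * E))"
              unfolding norm_mult[of "?A t"] by (rule mult_mono[OF AK 2 order_trans[OF norm_ge_zero AK] norm_ge_zero])
          qed
        qed
        \<comment> \<open>Each of the two pairings is off by at most \<open>2 * w * \<beta>\<close>
          while the accompanying factor is at most \<open>K * \<beta>\<close>; together this makes
          the coefficient 4.\<close>
        have approx: "norm (?A t * ?B t - of_real (\<beta>^2) * R t x) \<le> 4 * K * w * \<beta>^2" for t
        proof -
          have BK': "norm (?B t) \<le> K * \<beta>"
          proof -
            have "norm (?B t) \<le> (CI y. K * pbump r (y - 0))"
            proof (rule int_norm_le)
              fix y :: real assume y: "y \<in> {0..2 * pi}"
              show "norm (of_real (pbump r (y - 0)) * inverse (R t y)) \<le> K * pbump r (y - 0)"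
                using mult_left_mono[OF RK'[OF y, of t] pbump_nonneg[of r "y - 0"]]
                by (simp only: norm_mult norm_of_real abs_of_nonneg[OF pbump_nonneg] mult.commute)
            qed (intro continuous_intros R'c circle_continuous[OF fk(2)])+
            then show ?thesis by (simp only: integral_mult_right cint_pbump_shift \<beta>_def)
          qed
          have arith: "norm (a * b - of_real (\<beta>^2) * z) \<le> 4 * K * w * \<beta>^2"
            if "norm (a - of_real \<beta> * z) \<le> 2 * w * \<beta>" "norm (b - of_real \<beta>) \<le> 2 * w * \<beta>"
              "norm b \<le> K * \<beta>" "norm z \<le> K" for a b z :: complex
          proof -
            have "norm (of_real \<beta> * z) \<le> \<beta> * K" using that(4) \<beta> by (simp add: norm_mult)
            moreover have "0 \<le> 2 * w * \<beta>" "0 \<le> \<beta> * K" using w \<beta> K by simp_all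
            ultimately have "norm (a - of_real \<beta> * z) * norm b + norm (of_real \<beta> * z) * norm (b - of_real \<beta>)
                \<le> (2 * w * \<beta>) * (K * \<beta>) + (\<beta> * K) * (2 * w * \<beta>)"
              by (intro add_mono mult_mono that norm_ge_zero)
            moreover have "a * b - of_real (\<beta>^2) * z = (a - of_real \<beta> * z) * b + of_real \<beta> * z * (b - of_real \<beta>)"
              by (simp add: power2_eq_square algebra_simps)
            moreover have "norm ((a - of_real \<beta> * z) * b + of_real \<beta> * z * (b - of_real \<beta>))
                \<le> norm (a - of_real \<beta> * z) * norm b + norm (of_real \<beta> * z) * norm (b - of_real \<beta>)"
              unfolding norm_mult[symmetric] by (rule norm_triangle_ineq)
            moreover have "(2 * w * \<beta>) * (K * \<beta>) + (\<beta> * K) * (2 * w * \<beta>) = 4 * K * w * \<beta>^2"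
              by (simp add: power2_eq_square)
            ultimately show ?thesis by simp
          qed
          show ?thesis by (rule arith[OF A B BK' RK[OF x]])
        qed
        have "norm (of_real (\<beta>^2) * R t x - of_real (\<beta>^2) * R s x) \<le> 8 * K * w * \<beta>^2 + C * d"
        proof -
          have arith: "norm (p - q) \<le> 8 * K * w * \<beta>^2 + C * d"
            if "norm (a - p) \<le> 4 * K * w * \<beta>^2" "norm (b - q) \<le> 4 * K * w * \<beta>^2" "norm (a - b) \<le> C * \<bar>t - s\<bar>"
            for a b p q :: complex
          proof -
            have "norm (p - q) \<le> norm (a - b) + norm (a - p) + norm (b - q)"
              using norm_triangle_ineq4[of "a - b" "a - p"] norm_triangle_ineq[of "(a - b) - (a - p)" "b - q"] by simp
            then show ?thesis using that mult_left_mono[OF ts C] by linarith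
          qed
          show ?thesis by (rule arith[OF approx approx Lip])
        qed
        then show ?thesis by (simp add: right_diff_distrib[symmetric] norm_mult norm_power)
      qed
      have small: "norm (exp (2 * \<epsilon> * of_real (prim (v 0 t) x - prim (v 0 s) x)) - 1) \<le> e1" if x: "x \<in> {0..2 * pi}" for x
      proof -
        have "exp (2 * \<epsilon> * of_real (prim (v 0 t) x - prim (v 0 s) x)) = R t x * inverse (R s x)"
          unfolding R_def exp_minus[symmetric] exp_add[symmetric] by (simp add: algebra_simps)
        then have "exp (2 * \<epsilon> * of_real (prim (v 0 t) x - prim (v 0 s) x)) - 1 = (R t x - R s x) * inverse (R s x)"
          using Rne[of s x] by (simp add: left_diff_distrib)
        then have "norm (exp (2 * \<epsilon> * of_real (prim (v 0 t) x - prim (v 0 s) x)) - 1) \<le> norm (R t x - R s x) * K"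
          using RK'[OF x, of s] by (simp only: norm_mult) (intro mult_left_mono, auto)
        also have "norm (R t x - R s x) \<le> (8 * K * w * \<beta>^2 + C * d) / \<beta>^2"
          using RR[OF x] \<beta> by (simp add: pos_le_divide_eq mult.commute)
        also have "(8 * K * w * \<beta>^2 + C * d) / \<beta>^2 * K = 8 * K^2 * w + C * d * K / \<beta>^2"
          using \<beta> by (simp add: power2_eq_square field_simps)
        also have "C * d * K / \<beta>^2 = e1 / 2 * (C / (C + 1))"
          using \<beta> K C by (simp add: d_def)
        also have "e1 / 2 * (C / (C + 1)) \<le> e1 / 2 * 1" using e1 C by (intro mult_left_mono) auto
        finally show ?thesis using w_le K by simp
      qed
      have "\<bar>prim (v 0 t) x - prim (v 0 s) x\<bar> \<le> e1"
        using sg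
      proof (elim disjE conjE)
        assume "\<epsilon> = 1"
        then have "exp (2 * \<epsilon> * of_real (prim (v 0 t) x - prim (v 0 s) x)) - 1
            = of_real (exp (2 * (prim (v 0 t) x - prim (v 0 s) x)) - 1)"
          by (simp add: exp_of_real[symmetric])
        then have "norm (exp (2 * \<epsilon> * of_real (prim (v 0 t) x - prim (v 0 s) x)) - 1)
            = \<bar>exp (2 * (prim (v 0 t) x - prim (v 0 s) x)) - 1\<bar>"
          by (simp only: norm_of_real)
        from small[OF x, unfolded this] e1(2) show ?thesis by (rule small_exponent_real)
      next
        assume "\<epsilon> = \<i>"
        have "continuous_on {0..2 * pi} (\<lambda>x. prim (v 0 t) x - prim (v 0 s) x)"
          by (intro continuous_intros) (auto intro: DERIV_continuous_on has_field_derivative_at_within prim_v_DERIV)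
        then show ?thesis
          by (rule small_exponent_imaginary) (use x e1 small in \<open>auto simp: \<open>\<epsilon> = \<i>\<close>\<close>)
      qed
      then show ?thesis using e1 by simp
    qed
    then show ?thesis using d by blast
  qed
  show ?thesis
  proof (cases "0 \<le> E")
    case True
    obtain d1 where d1: "d1 > 0" "\<And>v s t x. mkdv 1 v \<Longrightarrow> (CI x. (v 0 0 x)^2) \<le> E \<Longrightarrow> cint (v 0 0) = M \<Longrightarrow>
      \<bar>t - s\<bar> \<le> d1 \<Longrightarrow> x \<in> {0..2 * pi} \<Longrightarrow> \<bar>prim (v 0 t) x - prim (v 0 s) x\<bar> \<le> e"
      using one[of 1 1] True by auto
    obtain d2 where d2: "d2 > 0" "\<And>v s t x. mkdv (- 1) v \<Longrightarrow> (CI x. (v 0 0 x)^2) \<le> E \<Longrightarrow> cint (v 0 0) = M \<Longrightarrow>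
      \<bar>t - s\<bar> \<le> d2 \<Longrightarrow> x \<in> {0..2 * pi} \<Longrightarrow> \<bar>prim (v 0 t) x - prim (v 0 s) x\<bar> \<le> e"
      using one[of \<i> "- 1"] True by auto
    show ?thesis
    proof (rule that[of "min d1 d2"])
      show "min d1 d2 > 0" using d1 d2 by simp
      fix \<sigma> v s t x
      assume *: "mkdv \<sigma> v" "(CI x. (v 0 0 x)^2) \<le> E" "cint (v 0 0) = M" "\<bar>t - s\<bar> \<le> min d1 d2" "x \<in> {0..2 * pi}"
      have "\<sigma> = 1 \<or> \<sigma> = - 1" using mkdv.sign[OF *(1)] .
      then show "\<bar>prim (v 0 t) x - prim (v 0 s) x\<bar> \<le> e"
        using d1(2)[of v t s x] d2(2)[of v t s x] * by auto
    qed
  next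
    case False
    show ?thesis
    proof (rule that[of 1])
      fix \<sigma> v s t x
      assume *: "mkdv \<sigma> v" "(CI x. (v 0 0 x)^2) \<le> E"
      interpret mkdv \<sigma> v by (rule *)
      have "0 \<le> (CI x. (v 0 0 x)^2)" by (intro int_square_nonneg continuous_intros)
      then show "\<bar>prim (v 0 t) x - prim (v 0 s) x\<bar> \<le> e" using *(2) False by linarith
    qed simp
  qed
qed

section \<open>Oscillating data\<close>

lemma linear_functional_onD:
  assumes "linear_functional_on V L" "f \<in> V" "g \<in> V"
  shows "L (\<lambda>x. a * f x + b * g x) = a * L f + b * L g"
  using assms unfolding linear_functional_on_def by simp

lemma linear_functional_sum:
  fixes f :: "nat \<Rightarrow> real \<Rightarrow> real" and a :: "nat \<Rightarrow> real"
  assumes L: "linear_functional_on test_circle L" and f: "\<And>n. f n \<in> test_circle"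
  shows "(\<lambda>x. \<Sum>n<N. a n * f n x) \<in> test_circle \<and> L (\<lambda>x. \<Sum>n<N. a n * f n x) = (\<Sum>n<N. a n * L (f n))"
proof (induction N)
  case 0
  have "L (\<lambda>x. 0 * f 0 x + 0 * f 0 x) = 0 * L (f 0) + 0 * L (f 0)"
    by (rule linear_functional_onD[OF L f f])
  then show ?case by auto
next
  case (Suc N)
  have "L (\<lambda>x. 1 * (\<Sum>n<N. a n * f n x) + a N * f N x) = 1 * L (\<lambda>x. \<Sum>n<N. a n * f n x) + a N * L (f N)"
    by (rule linear_functional_onD[OF L Suc[THEN conjunct1] f])
  then show ?case using Suc f by (auto intro!: circle_add circle_mult)
qed

lemma cint_cosine_sum:
  fixes a :: "nat \<Rightarrow> real"
  shows "(CI x. (\<Sum>n<N. a n * cos (real n * x))^2) \<le> 2 * pi * (\<Sum>n<N. (a n)^2)"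
proof -
  have c: "(CI x. cos (real n * x) * cos (real m * x)) = (if n = m then (if n = 0 then 2 * pi else pi) else 0)" for n m
    using cint_trig_trig(1)[of "int n" "int m"] by auto
  have "(CI x. (\<Sum>n<N. a n * cos (real n * x))^2)
      = (CI x. \<Sum>n<N. \<Sum>m<N. (a n * a m) * (cos (real n * x) * cos (real m * x)))"
    by (simp add: power2_eq_square sum_product mult_ac)
  also have "\<dots> = (\<Sum>n<N. CI x. \<Sum>m<N. (a n * a m) * (cos (real n * x) * cos (real m * x)))"
    by (rule integral_sum) (auto intro!: integrable_continuous_real continuous_intros)
  also have "\<dots> = (\<Sum>n<N. \<Sum>m<N. CI x. (a n * a m) * (cos (real n * x) * cos (real m * x)))"
    by (intro sum.cong refl integral_sum) (auto intro!: integrable_continuous_real continuous_intros)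
  also have "\<dots> = (\<Sum>n<N. (a n)^2 * (if n = 0 then 2 * pi else pi))"
    by (intro sum.cong refl) (simp add: c power2_eq_square if_distrib[of "(*) _"] cong: if_cong)
  also have "\<dots> \<le> (\<Sum>n<N. (a n)^2 * (2 * pi))" by (intro sum_mono mult_left_mono) auto
  finally show ?thesis by (simp add: sum_distrib_right mult.commute sum_distrib_left)
qed

text \<open>A Bessel argument for an arbitrary bounded functional: testing \<open>L\<close> on the
  sum of a_n g cos(n x), with a_n the values of \<open>L\<close> themselves, gives square
  summability, because the square norm of that sum is at most a constant times the sum of the
  a_n^2.\<close>

lemma oscillation_functional_vanishes:
  assumes L: "linear_functional_on test_circle L"
    and bound: "\<And>f. f \<in> test_circle \<Longrightarrow> \<bar>L f\<bar> \<le> C * sqrt (CI x. (f x)^2)"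
    and g: "g \<in> test_circle"
  shows "(\<lambda>n. L (\<lambda>x. g x * cos (real n * x))) \<longlonglongrightarrow> 0"
proof -
  define a where "a n = L (\<lambda>x. g x * cos (real n * x))" for n
  have f: "(\<lambda>x. g x * cos (real n * x)) \<in> test_circle" for n by (intro circle_mult g circle_trig_nat)
  obtain B where B: "B > 0" "\<And>x. \<bar>g x\<bar> \<le> B" using circle_bounded[OF g] by blast
  have "(\<Sum>n<N. (a n)^2) \<le> C^2 * B^2 * (2 * pi)" for N
  proof -
    define s where "s = (\<Sum>n<N. (a n)^2)"
    have s: "0 \<le> s" by (auto simp: s_def intro: sum_nonneg)
    let ?p = "\<lambda>x. \<Sum>n<N. a n * cos (real n * x)" and ?q = "\<lambda>x. \<Sum>n<N. a n * (g x * cos (real n * x))"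
    have q: "?q \<in> test_circle" "L ?q = s"
      using linear_functional_sum[OF L f, where a = a and N = N] by (auto simp: a_def s_def power2_eq_square)
    have "(CI x. (?q x)^2) \<le> (CI x. B^2 * (?p x)^2)"
    proof (rule int_mono)
      fix x
      have "?q x = g x * ?p x" by (simp add: sum_distrib_left mult_ac)
      then show "(?q x)^2 \<le> B^2 * (?p x)^2"
        using power_mono[OF B(2)[of x], of 2] by (simp add: power_mult_distrib mult_right_mono)
    qed (intro continuous_intros circle_continuous[OF g])+
    also have "\<dots> \<le> B^2 * (2 * pi * s)"
      using mult_left_mono[OF cint_cosine_sum[where N = N and a = a], of "B^2"] by (simp add: s_def)
    finally have "sqrt (CI x. (?q x)^2) \<le> sqrt (B^2 * (2 * pi * s))" by simp
    then have "\<bar>C\<bar> * sqrt (CI x. (?q x)^2) \<le> \<bar>C\<bar> * sqrt (B^2 * (2 * pi * s))" by (intro mult_left_mono) auto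
    moreover have "C * sqrt (CI x. (?q x)^2) \<le> \<bar>C\<bar> * sqrt (CI x. (?q x)^2)"
      by (intro mult_right_mono) (auto intro!: int_square_nonneg circle_continuous[OF q(1)])
    ultimately have "s \<le> \<bar>C\<bar> * sqrt (B^2 * (2 * pi * s))" using bound[OF q(1)] q(2) by linarith
    then have "s^2 \<le> (\<bar>C\<bar> * sqrt (B^2 * (2 * pi * s)))^2" using s by (intro power_mono) auto
    also have "(\<bar>C\<bar> * sqrt (B^2 * (2 * pi * s)))^2 = (C^2 * B^2 * (2 * pi)) * s"
      using s by (simp add: power_mult_distrib)
    finally have "s * s \<le> (C^2 * B^2 * (2 * pi)) * s" by (simp only: power2_eq_square[of s])
    then have "s \<le> C^2 * B^2 * (2 * pi) \<or> s = 0" using s by (auto simp: mult_le_cancel_right)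
    then show ?thesis by (auto simp: s_def[symmetric])
  qed
  then have "summable (\<lambda>n. (a n)^2)" by (intro summableI_nonneg_bounded) auto
  then have "(\<lambda>n. (a n)^2) \<longlonglongrightarrow> 0" by (rule summable_LIMSEQ_zero)
  then have "(\<lambda>n. sqrt ((a n)^2)) \<longlonglongrightarrow> sqrt 0" by (rule tendsto_real_sqrt)
  then show ?thesis by (simp add: a_def tendsto_rabs_zero_iff)
qed

lemma cint_linear: "linear_functional_on test_circle (cint :: (real \<Rightarrow> real) \<Rightarrow> real)"
  unfolding linear_functional_on_def
  by (auto simp: int_add continuous_intros circle_continuous)

lemma cint_L2_bound:
  assumes "f \<in> test_circle"
  shows "\<bar>cint f\<bar> \<le> sqrt (2 * pi) * sqrt (CI x. (f x)^2)"
  using int_abs_le_sqrt[of 0 "2 * pi" "\<lambda>x. 1" f] circle_continuous[OF assms] by simp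

lemma cint_oscillation: "g \<in> test_circle \<Longrightarrow> (\<lambda>n. CI x. g x * cos (real n * x)) \<longlonglongrightarrow> 0"
  by (rule oscillation_functional_vanishes[OF cint_linear cint_L2_bound])

lemma oscillation_prim_bound:
  assumes "g \<in> test_circle"
  obtains K where "\<And>n x. 1 \<le> n \<Longrightarrow> x \<in> {0..2 * pi} \<Longrightarrow>
    \<bar>integral {0..x} (\<lambda>x. g x * cos (real n * x))\<bar> \<le> K / real n"
proof -
  obtain B where B: "B > 0" "\<And>x. \<bar>g x\<bar> \<le> B" using circle_bounded[OF assms] by blast
  obtain B' where B': "B' > 0" "\<And>x. \<bar>deriv g x\<bar> \<le> B'" using circle_bounded[OF circle_deriv[OF assms]] by blast
  note gc = circle_continuous[OF assms] and gc' = circle_continuous[OF circle_deriv[OF assms]]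
  show ?thesis
  proof (rule that[of "B + 2 * pi * B'"])
    fix n :: nat and x :: real assume n: "1 \<le> n" and x: "x \<in> {0..2 * pi}"
    have "((\<lambda>x. g x * sin (real n * x)) has_real_derivative
        real n * (g x * cos (real n * x)) + deriv g x * sin (real n * x)) (at x)" for x
      by (rule derivative_eq_intros circle_DERIV[OF assms] refl)+ simp
    from int_FTC[OF this, of 0 x] x
    have "integral {0..x} (\<lambda>x. real n * (g x * cos (real n * x)) + deriv g x * sin (real n * x)) = g x * sin (real n * x)" by simp
    moreover have "integral {0..x} (\<lambda>x. real n * (g x * cos (real n * x)) + deriv g x * sin (real n * x))
        = integral {0..x} (\<lambda>x. real n * (g x * cos (real n * x))) + integral {0..x} (\<lambda>x. deriv g x * sin (real n * x))"
      by (intro int_add continuous_intros gc gc')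
    moreover have "norm (integral {0..x} (\<lambda>x. deriv g x * sin (real n * x))) \<le> B' * (x - 0)"
    proof (rule int_norm_le_const)
      show "norm (deriv g y * sin (real n * y)) \<le> B'" for y
        using mult_mono[OF B'(2)[of y] abs_sin_le_one[of "real n * y"]] B'(1) by (simp add: abs_mult)
    qed (use x in \<open>auto intro!: continuous_intros gc'\<close>)
    moreover have "B' * (x - 0) \<le> 2 * pi * B'" using x B' by (simp add: mult.commute)
    moreover have "\<bar>g x * sin (real n * x)\<bar> \<le> B"
      using mult_mono[OF B(2)[of x] abs_sin_le_one[of "real n * x"]] B(1) by (simp add: abs_mult)
    ultimately have "\<bar>real n * integral {0..x} (\<lambda>x. g x * cos (real n * x))\<bar> \<le> B + 2 * pi * B'" by simp
    then show "\<bar>integral {0..x} (\<lambda>x. g x * cos (real n * x))\<bar> \<le> (B + 2 * pi * B') / real n"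
      using n by (simp add: abs_mult pos_le_divide_eq mult.commute)
  qed
qed

section \<open>Oscillating perturbations of a profile and their energies\<close>

definition osc_mean :: "(real \<Rightarrow> real) \<Rightarrow> nat \<Rightarrow> real" where
  "osc_mean g n = (CI x. g x * cos (real n * x)) / (2 * pi)"

definition osc :: "(real \<Rightarrow> real) \<Rightarrow> (real \<Rightarrow> real) \<Rightarrow> nat \<Rightarrow> real \<Rightarrow> real" where
  "osc V0 g n x = V0 x + (g x * cos (real n * x) - osc_mean g n)"

lemma osc_mean_tendsto: "g \<in> test_circle \<Longrightarrow> osc_mean g \<longlonglongrightarrow> 0"
  unfolding osc_mean_def[abs_def] using tendsto_divide[OF cint_oscillation tendsto_const, of g "2 * pi"] by simp

lemma osc_carrier: "g \<in> test_circle \<Longrightarrow> (\<lambda>x. g x * cos (real n * x)) \<in> test_circle"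
  by (intro circle_mult circle_trig_nat)

lemma osc_test_circle:
  assumes "V0 \<in> test_circle" "g \<in> test_circle" shows "osc V0 g n \<in> test_circle"
  unfolding osc_def[abs_def] by (intro circle_add circle_diff osc_carrier assms circle_const)

lemma cint_osc:
  assumes "V0 \<in> test_circle" "g \<in> test_circle" shows "cint (osc V0 g n) = cint V0"
proof -
  note c = circle_continuous[OF assms(1)] circle_continuous[OF assms(2)]
  have "cint (osc V0 g n) = cint V0 + (CI x. g x * cos (real n * x) - osc_mean g n)"
    unfolding osc_def[abs_def] by (intro int_add continuous_intros c)
  also have "(CI x. g x * cos (real n * x) - osc_mean g n) = (CI x. g x * cos (real n * x)) - (CI x. osc_mean g n)"
    by (intro int_diff continuous_intros c)
  finally show ?thesis by (simp add: osc_mean_def)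
qed

lemma osc_prim_tendsto:
  assumes "V0 \<in> test_circle" "g \<in> test_circle" "e > 0"
  shows "\<forall>\<^sub>F n in sequentially. \<forall>x\<in>{0..2 * pi}. \<bar>prim (\<lambda>x. osc V0 g n x - V0 x) x\<bar> \<le> e"
proof -
  obtain K where K: "\<And>n x. 1 \<le> n \<Longrightarrow> x \<in> {0..2 * pi} \<Longrightarrow> \<bar>integral {0..x} (\<lambda>x. g x * cos (real n * x))\<bar> \<le> K / real n"
    using oscillation_prim_bound[OF assms(2)] by blast
  have "((\<lambda>n. 2 * K / real n) \<longlongrightarrow> 0) sequentially" by real_asymp
  then have "\<forall>\<^sub>F n in sequentially. 2 * K / real n < e" using assms(3) by (rule order_tendstoD)
  then show ?thesis
    using eventually_ge_at_top[of 1]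
  proof eventually_elim
    case (elim n)
    show ?case
    proof
      fix x :: real assume x: "x \<in> {0..2 * pi}"
      have "prim (\<lambda>x. osc V0 g n x - V0 x) x = integral {0..x} (\<lambda>x. g x * cos (real n * x)) - x * osc_mean g n"
        using x by (simp add: prim_def osc_def) (subst int_diff, auto intro!: continuous_intros circle_continuous[OF assms(2)])
      moreover have "\<bar>x * osc_mean g n\<bar> \<le> \<bar>(CI x. g x * cos (real n * x))\<bar>"
      proof -
        have "\<bar>x\<bar> * \<bar>(CI x. g x * cos (real n * x))\<bar> \<le> (2 * pi) * \<bar>(CI x. g x * cos (real n * x))\<bar>"
          using x by (intro mult_right_mono) auto
        then show ?thesis by (simp add: osc_mean_def abs_mult pos_divide_le_eq mult.commute)
      qed
      moreover have "\<bar>(CI x. g x * cos (real n * x))\<bar> \<le> K / real n" using K[OF elim(2), of "2 * pi"] by simp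
      ultimately show "\<bar>prim (\<lambda>x. osc V0 g n x - V0 x) x\<bar> \<le> e" using K[OF elim(2) x] elim(1) by simp
    qed
  qed
qed

lemma osc_DERIV:
  assumes "V0 \<in> test_circle" "g \<in> test_circle"
  shows "deriv (osc V0 g n) x = real n * (- g x * sin (real n * x)) + (deriv V0 x + deriv g x * cos (real n * x))"
    and "(deriv ^^ 2) (osc V0 g n) x = (real n)^2 * (- g x * cos (real n * x)) +
      ((deriv ^^ 2) V0 x + ((deriv ^^ 2) g x * cos (real n * x) - 2 * real n * deriv g x * sin (real n * x)))"
proof -
  have d2: "(deriv f has_real_derivative (deriv ^^ 2) f x) (at x)" if "f \<in> test_circle" for f x
    using circle_DERIV_funpow[OF that, of 1] by (simp add: eval_nat_numeral)
  have 1: "deriv (osc V0 g n) x = real n * (- g x * sin (real n * x)) + (deriv V0 x + deriv g x * cos (real n * x))" for x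
    unfolding osc_def[abs_def]
    by (rule DERIV_imp_deriv) ((rule derivative_eq_intros circle_DERIV assms refl)+, simp)
  then show "deriv (osc V0 g n) x = real n * (- g x * sin (real n * x)) + (deriv V0 x + deriv g x * cos (real n * x))" .
  have "deriv (osc V0 g n) = (\<lambda>x. real n * (- g x * sin (real n * x)) + (deriv V0 x + deriv g x * cos (real n * x)))"
    using 1 by (rule ext)
  then have "(deriv ^^ 2) (osc V0 g n) x = deriv (\<lambda>x. real n * (- g x * sin (real n * x)) + (deriv V0 x + deriv g x * cos (real n * x))) x"
    by (simp add: eval_nat_numeral)
  also have "\<dots> = (real n)^2 * (- g x * cos (real n * x)) +
      ((deriv ^^ 2) V0 x + ((deriv ^^ 2) g x * cos (real n * x) - 2 * real n * deriv g x * sin (real n * x)))"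
    by (rule DERIV_imp_deriv)
      ((rule derivative_eq_intros circle_DERIV d2 assms refl)+, simp add: power2_eq_square algebra_simps)
  finally show "(deriv ^^ 2) (osc V0 g n) x = (real n)^2 * (- g x * cos (real n * x)) +
      ((deriv ^^ 2) V0 x + ((deriv ^^ 2) g x * cos (real n * x) - 2 * real n * deriv g x * sin (real n * x)))" .
qed

text \<open>Isolates the leading amplitude of a derivative of the data after division by a power of
  n; the rest is O(1 / n) uniformly in space.\<close>

lemma square_perturbation_tendsto:
  fixes p r :: "nat \<Rightarrow> real \<Rightarrow> real"
  assumes p: "\<And>n. continuous_on {0..2 * pi} (p n)" "\<And>n x. \<bar>p n x\<bar> \<le> B"
    and r: "\<And>n. continuous_on {0..2 * pi} (r n)" "\<And>n x. 1 \<le> n \<Longrightarrow> \<bar>r n x\<bar> \<le> D / real n"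
    and lim: "(\<lambda>n. CI x. (p n x)^2) \<longlonglongrightarrow> l"
  shows "(\<lambda>n. CI x. (p n x + r n x)^2) \<longlonglongrightarrow> l"
proof -
  have B: "0 \<le> B" using p(2)[of 0 0] by linarith
  have D: "0 \<le> D" using r(2)[of 1 0] by simp
  have "(\<lambda>n. (CI x. (p n x + r n x)^2) - (CI x. (p n x)^2)) \<longlonglongrightarrow> 0"
  proof (rule Lim_null_comparison)
    show "\<forall>\<^sub>F n in sequentially. norm ((CI x. (p n x + r n x)^2) - (CI x. (p n x)^2)) \<le> (2 * B + D / real n) * (D / real n) * (2 * pi)"
      using eventually_ge_at_top[of 1]
    proof eventually_elim
      case (elim n)
      have "(CI x. (p n x + r n x)^2) - (CI x. (p n x)^2) = (CI x. (2 * p n x + r n x) * r n x)"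
      proof -
        have "(2 * p n x + r n x) * r n x = (p n x + r n x)^2 - (p n x)^2" for x
          by (simp add: power2_eq_square algebra_simps)
        then show ?thesis by (simp only:) (intro int_diff[symmetric] continuous_intros p r)
      qed
      moreover have "norm (CI x. (2 * p n x + r n x) * r n x) \<le> ((2 * B + D / real n) * (D / real n)) * (2 * pi - 0)"
      proof (rule int_norm_le_const)
        show "norm ((2 * p n x + r n x) * r n x) \<le> (2 * B + D / real n) * (D / real n)" for x
          unfolding norm_mult
        proof (rule mult_mono)
          show "norm (2 * p n x + r n x) \<le> 2 * B + D / real n" using p(2)[of n x] r(2)[OF elim, of x] by simp
        qed (use r(2)[OF elim, of x] B D in auto)
      qed (auto intro!: continuous_intros p r)
      ultimately show ?case by simp
    qed
    show "(\<lambda>n. (2 * B + D / real n) * (D / real n) * (2 * pi)) \<longlonglongrightarrow> 0" by real_asymp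
  qed
  from tendsto_add[OF this lim] show ?thesis by simp
qed

lemma cint_square_oscillation:
  assumes g: "g \<in> test_circle"
  shows "(\<lambda>n. CI x. (g x * cos (real n * x))^2) \<longlonglongrightarrow> (CI x. (g x)^2) / 2"
    and "(\<lambda>n. CI x. (g x * sin (real n * x))^2) \<longlonglongrightarrow> (CI x. (g x)^2) / 2"
proof -
  note gc = circle_continuous[OF g]
  have "strict_mono (\<lambda>n :: nat. 2 * n)" by (auto simp: strict_mono_def)
  from LIMSEQ_subseq_LIMSEQ[OF cint_oscillation[OF circle_power[OF g, of 2]] this]
  have l: "(\<lambda>n. CI x. (g x)^2 * cos (2 * (real n * x))) \<longlonglongrightarrow> 0" by (simp add: o_def mult.assoc)
  have c: "(CI x. (g x * cos (real n * x))^2) = (CI x. (g x)^2) / 2 + (CI x. (g x)^2 * cos (2 * (real n * x))) / 2" for n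
  proof -
    have "(g x * cos (real n * x))^2 = (g x)^2 / 2 + (g x)^2 * cos (2 * (real n * x)) / 2" for x
      unfolding cos_double_cos by (simp add: power_mult_distrib field_simps)
    then show ?thesis by (simp add: int_split continuous_intros gc)
  qed
  have s: "(CI x. (g x * sin (real n * x))^2) = (CI x. (g x)^2) / 2 - (CI x. (g x)^2 * cos (2 * (real n * x))) / 2" for n
  proof -
    have "(g x * sin (real n * x))^2 = (g x)^2 / 2 - (g x)^2 * cos (2 * (real n * x)) / 2" for x
      unfolding cos_double_sin by (simp add: power_mult_distrib field_simps)
    then show ?thesis by (simp add: int_split continuous_intros gc)
  qed
  show "(\<lambda>n. CI x. (g x * cos (real n * x))^2) \<longlonglongrightarrow> (CI x. (g x)^2) / 2"
    unfolding c using tendsto_add[OF tendsto_const tendsto_divide[OF l tendsto_const], of 2 "(CI x. (g x)^2) / 2"] by simp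
  show "(\<lambda>n. CI x. (g x * sin (real n * x))^2) \<longlonglongrightarrow> (CI x. (g x)^2) / 2"
    unfolding s using tendsto_diff[OF tendsto_const tendsto_divide[OF l tendsto_const], of 2 "(CI x. (g x)^2) / 2"] by simp
qed

lemma osc_mass_tendsto:
  assumes V0: "V0 \<in> test_circle" and g: "g \<in> test_circle"
  shows "(\<lambda>n. CI x. (osc V0 g n x)^2) \<longlonglongrightarrow> (CI x. (V0 x)^2) + (CI x. (g x)^2) / 2"
proof -
  note c = circle_continuous[OF V0] circle_continuous[OF g]
  let ?\<gamma> = "osc_mean g"
  have "(CI x. (osc V0 g n x)^2) = (CI x. (V0 x)^2) + ((CI x. (g x * cos (real n * x))^2)
      + (2 * (CI x. (V0 x * g x) * cos (real n * x)) - (2 * ?\<gamma> n * cint (osc V0 g n) + (?\<gamma> n)^2 * (2 * pi))))" for n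
  proof -
    have oc: "continuous_on {0..2 * pi} (osc V0 g n)" by (rule circle_continuous[OF osc_test_circle[OF V0 g]])
    have "(CI x. (osc V0 g n x)^2) = (CI x. (V0 x)^2 + ((g x * cos (real n * x))^2
        + (2 * ((V0 x * g x) * cos (real n * x)) - (2 * ?\<gamma> n * osc V0 g n x + (?\<gamma> n)^2))))"
      by (simp add: osc_def power2_eq_square algebra_simps)
    then show ?thesis by (simp add: int_split continuous_intros c oc)
  qed
  moreover have "(\<lambda>n. (CI x. (V0 x)^2) + ((CI x. (g x * cos (real n * x))^2)
      + (2 * (CI x. (V0 x * g x) * cos (real n * x)) - (2 * ?\<gamma> n * cint V0 + (?\<gamma> n)^2 * (2 * pi)))))
      \<longlonglongrightarrow> (CI x. (V0 x)^2) + ((CI x. (g x)^2) / 2 + (2 * 0 - (2 * 0 * cint V0 + 0^2 * (2 * pi))))"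
    by (intro tendsto_intros cint_square_oscillation(1) g osc_mean_tendsto cint_oscillation circle_mult V0)
  ultimately show ?thesis by (simp add: cint_osc[OF V0 g])
qed

lemma osc_mass_bounded:
  assumes "V0 \<in> test_circle" "g \<in> test_circle"
  obtains E where "\<And>n. (CI x. (osc V0 g n x)^2) \<le> E"
  using convergent_imp_Bseq[OF convergentI[OF osc_mass_tendsto[OF assms]]] unfolding Bseq_def by (metis abs_le_D1 real_norm_def)

text \<open>Both normalised energies have the same limit, equal to the mass added by the
  oscillation. The combination 2 a - b of them in \<open>mass_lower_bound\<close> therefore tends to
  that mass as well, so the lower bound is sharp in the limit.\<close>

lemma osc_energies_tendsto:
  assumes V0: "V0 \<in> test_circle" and g: "g \<in> test_circle"
  shows "(\<lambda>n. (CI x. (deriv (osc V0 g n) x)^2) / (real n)^2) \<longlonglongrightarrow> (CI x. (g x)^2) / 2"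
    and "(\<lambda>n. (CI x. ((deriv ^^ 2) (osc V0 g n) x)^2) / (real n) ^ 4) \<longlonglongrightarrow> (CI x. (g x)^2) / 2"
proof -
  have t: "deriv V0 \<in> test_circle" "deriv g \<in> test_circle" "(deriv ^^ 2) V0 \<in> test_circle" "(deriv ^^ 2) g \<in> test_circle"
    by (intro circle_deriv circle_deriv_funpow V0 g)+
  note c = circle_continuous[OF V0] circle_continuous[OF g] t[THEN circle_continuous]
  obtain B where B: "B > 0" "\<And>x. \<bar>g x\<bar> \<le> B" using circle_bounded[OF g] by blast
  obtain D0 where D0: "D0 > 0" "\<And>x. \<bar>deriv V0 x\<bar> \<le> D0" using circle_bounded[OF t(1)] by blast
  obtain D1 where D1: "D1 > 0" "\<And>x. \<bar>deriv g x\<bar> \<le> D1" using circle_bounded[OF t(2)] by blast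
  obtain D2 where D2: "D2 > 0" "\<And>x. \<bar>(deriv ^^ 2) V0 x\<bar> \<le> D2" using circle_bounded[OF t(3)] by blast
  obtain D3 where D3: "D3 > 0" "\<And>x. \<bar>(deriv ^^ 2) g x\<bar> \<le> D3" using circle_bounded[OF t(4)] by blast
  have trig: "\<bar>y * cos z\<bar> \<le> Y" "\<bar>y * sin z\<bar> \<le> Y" if "\<bar>y\<bar> \<le> Y" for y z Y :: real
    using mult_mono[OF that abs_cos_le_one[of z]] mult_mono[OF that abs_sin_le_one[of z]] that by (simp_all add: abs_mult)
  have tail: "(\<lambda>n. F n) \<longlonglongrightarrow> l" if "(\<lambda>n. G n) \<longlonglongrightarrow> l" "\<And>n. 1 \<le> n \<Longrightarrow> F n = G n" for F G :: "nat \<Rightarrow> real" and l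
    by (rule Lim_transform_eventually[OF that(1)]) (rule eventually_mono[OF eventually_ge_at_top[of 1]], simp only: that(2))
  have "(\<lambda>n. CI x. (- g x * sin (real n * x) + (deriv V0 x + deriv g x * cos (real n * x)) / real n)^2) \<longlonglongrightarrow> (CI x. (g x)^2) / 2"
  proof (rule square_perturbation_tendsto[where B = B and D = "D0 + D1"])
    show "\<bar>- g x * sin (real n * x)\<bar> \<le> B" for n x using trig(2)[of "- g x" B] B by simp
    show "\<bar>(deriv V0 x + deriv g x * cos (real n * x)) / real n\<bar> \<le> (D0 + D1) / real n" for n x
      using D0(2)[of x] trig(1)[OF D1(2)[of x], of "real n * x"] by (simp add: abs_divide divide_right_mono)
    show "(\<lambda>n. CI x. (- g x * sin (real n * x))^2) \<longlonglongrightarrow> (CI x. (g x)^2) / 2"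
      using cint_square_oscillation(2)[OF g] by simp
  qed (unfold divide_inverse, (intro continuous_intros c)+)
  then show "(\<lambda>n. (CI x. (deriv (osc V0 g n) x)^2) / (real n)^2) \<longlonglongrightarrow> (CI x. (g x)^2) / 2"
  proof (rule tail)
    fix n :: nat assume n: "1 \<le> n"
    have "(CI x. (deriv (osc V0 g n) x)^2) / (real n)^2 = (CI x. (deriv (osc V0 g n) x)^2 / (real n)^2)" by simp
    also have "\<dots> = (CI x. (- g x * sin (real n * x) + (deriv V0 x + deriv g x * cos (real n * x)) / real n)^2)"
      unfolding osc_DERIV(1)[OF V0 g] power_divide[symmetric] using n by (simp add: field_simps)
    finally show "(CI x. (deriv (osc V0 g n) x)^2) / (real n)^2
      = (CI x. (- g x * sin (real n * x) + (deriv V0 x + deriv g x * cos (real n * x)) / real n)^2)" .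
  qed
  let ?r = "\<lambda>n x. ((deriv ^^ 2) V0 x + (deriv ^^ 2) g x * cos (real n * x)) / (real n * real n) - 2 * (deriv g x * sin (real n * x)) / real n"
  have "(\<lambda>n. CI x. (- g x * cos (real n * x) + ?r n x)^2) \<longlonglongrightarrow> (CI x. (g x)^2) / 2"
  proof (rule square_perturbation_tendsto[where B = B and D = "D2 + D3 + 2 * D1"])
    show "\<bar>- g x * cos (real n * x)\<bar> \<le> B" for n x using trig(1)[of "- g x" B] B by simp
    show "\<bar>?r n x\<bar> \<le> (D2 + D3 + 2 * D1) / real n" if "1 \<le> n" for n x
    proof -
      have "\<bar>((deriv ^^ 2) V0 x + (deriv ^^ 2) g x * cos (real n * x)) / (real n * real n)\<bar> \<le> (D2 + D3) / (real n * real n)"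
      proof -
        have "\<bar>(deriv ^^ 2) V0 x + (deriv ^^ 2) g x * cos (real n * x)\<bar> \<le> D2 + D3"
          using D2(2)[of x] trig(1)[OF D3(2)[of x], of "real n * x"] by linarith
        then show ?thesis by (simp add: abs_divide divide_right_mono)
      qed
      also have "\<dots> \<le> (D2 + D3) / (real n * 1)" using that D2(1) D3(1) by (intro divide_left_mono mult_left_mono) auto
      finally have 1: "\<bar>((deriv ^^ 2) V0 x + (deriv ^^ 2) g x * cos (real n * x)) / (real n * real n)\<bar> \<le> (D2 + D3) / real n" by simp
      have 2: "\<bar>2 * (deriv g x * sin (real n * x)) / real n\<bar> \<le> 2 * D1 / real n"
        using trig(2)[OF D1(2)[of x], of "real n * x"] by (simp add: abs_divide divide_right_mono)
      have "(D2 + D3) / real n + 2 * D1 / real n = (D2 + D3 + 2 * D1) / real n" by (simp add: add_divide_distrib)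
      then show ?thesis using 1 2 by linarith
    qed
    show "(\<lambda>n. CI x. (- g x * cos (real n * x))^2) \<longlonglongrightarrow> (CI x. (g x)^2) / 2"
      using cint_square_oscillation(1)[OF g] by simp
  qed (unfold divide_inverse, (intro continuous_intros c)+)
  then show "(\<lambda>n. (CI x. ((deriv ^^ 2) (osc V0 g n) x)^2) / (real n) ^ 4) \<longlonglongrightarrow> (CI x. (g x)^2) / 2"
  proof (rule tail)
    fix n :: nat assume n: "1 \<le> n"
    have "(deriv ^^ 2) (osc V0 g n) x / (real n)^2 = - g x * cos (real n * x) + ?r n x" for x
      unfolding osc_DERIV(2)[OF V0 g] using n by (simp add: field_simps power2_eq_square)
    then have "((deriv ^^ 2) (osc V0 g n) x)^2 / (real n) ^ 4 = (- g x * cos (real n * x) + ?r n x)^2" for x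
      by (metis power_divide power_mult numeral_Bit0 mult_2)
    moreover have "(CI x. ((deriv ^^ 2) (osc V0 g n) x)^2) / (real n) ^ 4 = (CI x. ((deriv ^^ 2) (osc V0 g n) x)^2 / (real n) ^ 4)" by simp
    ultimately show "(CI x. ((deriv ^^ 2) (osc V0 g n) x)^2) / (real n) ^ 4 = (CI x. (- g x * cos (real n * x) + ?r n x)^2)" by (simp only:)
  qed
qed

lemma osc_rough_data:
  assumes V0: "V0 \<in> test_circle" and g: "g \<in> test_circle"
  obtains B where "\<And>n v. 1 \<le> n \<Longrightarrow> v 0 0 = osc V0 g n \<Longrightarrow> v 1 0 = deriv (osc V0 g n) \<Longrightarrow>
    v 2 0 = (deriv ^^ 2) (osc V0 g n) \<Longrightarrow> rough_data v B (real n)"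
proof -
  have t: "deriv V0 \<in> test_circle" "deriv g \<in> test_circle" "(deriv ^^ 2) V0 \<in> test_circle" "(deriv ^^ 2) g \<in> test_circle"
    by (intro circle_deriv circle_deriv_funpow V0 g)+
  obtain A where A: "A > 0" "\<And>x. \<bar>V0 x\<bar> \<le> A" using circle_bounded[OF V0] by blast
  obtain B where B: "B > 0" "\<And>x. \<bar>g x\<bar> \<le> B" using circle_bounded[OF g] by blast
  obtain D0 where D0: "D0 > 0" "\<And>x. \<bar>deriv V0 x\<bar> \<le> D0" using circle_bounded[OF t(1)] by blast
  obtain D1 where D1: "D1 > 0" "\<And>x. \<bar>deriv g x\<bar> \<le> D1" using circle_bounded[OF t(2)] by blast
  obtain D2 where D2: "D2 > 0" "\<And>x. \<bar>(deriv ^^ 2) V0 x\<bar> \<le> D2" using circle_bounded[OF t(3)] by blast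
  obtain D3 where D3: "D3 > 0" "\<And>x. \<bar>(deriv ^^ 2) g x\<bar> \<le> D3" using circle_bounded[OF t(4)] by blast
  have trig: "\<bar>y * cos z\<bar> \<le> Y" "\<bar>y * sin z\<bar> \<le> Y" if "\<bar>y\<bar> \<le> Y" for y z Y :: real
    using mult_mono[OF that abs_cos_le_one[of z]] mult_mono[OF that abs_sin_le_one[of z]] that by (simp_all add: abs_mult)
  have m: "\<bar>osc_mean g n\<bar> \<le> B" for n
  proof -
    have "norm (CI x. g x * cos (real n * x)) \<le> B * (2 * pi - 0)"
      by (rule int_norm_le_const) (auto intro!: continuous_intros circle_continuous[OF g] trig B)
    then show ?thesis by (simp add: osc_mean_def abs_divide pos_divide_le_eq)
  qed
  define K where "K = (A + 2 * B) + (B + D0 + D1) + (B + D2 + D3 + 2 * D1)"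
  have nonneg: "0 \<le> A" "0 \<le> B" "0 \<le> D0" "0 \<le> D1" "0 \<le> D2" "0 \<le> D3" using A B D0 D1 D2 D3 by simp_all
  show ?thesis
  proof (rule that[of K])
    fix n :: nat and v :: "nat \<Rightarrow> real \<Rightarrow> real \<Rightarrow> real"
    assume n: "1 \<le> n" and v: "v 0 0 = osc V0 g n" "v 1 0 = deriv (osc V0 g n)" "v 2 0 = (deriv ^^ 2) (osc V0 g n)"
    let ?n = "real n"
    have n1: "1 \<le> ?n" "?n \<le> ?n^2" "1 \<le> ?n^2" using n mult_mono[of 1 "real n" 1 "real n"] mult_right_mono[of 1 "real n" "real n"] by (simp_all add: power2_eq_square)
    have 0: "\<bar>v 0 0 x\<bar> \<le> K" for x
    proof -
      have "\<bar>v 0 0 x\<bar> \<le> A + 2 * B"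
        unfolding v osc_def using A(2)[of x] trig(1)[OF B(2)[of x], of "?n * x"] m[of n] by linarith
      then show ?thesis unfolding K_def using nonneg by linarith
    qed
    have 1: "\<bar>v 1 0 x\<bar> \<le> K * ?n" for x
    proof -
      have "\<bar>v 1 0 x\<bar> \<le> \<bar>?n * (- g x * sin (?n * x))\<bar> + \<bar>deriv V0 x\<bar> + \<bar>deriv g x * cos (?n * x)\<bar>"
        unfolding v osc_DERIV(1)[OF V0 g] by linarith
      also have "\<dots> \<le> ?n * B + D0 * ?n + D1 * ?n"
      proof (intro add_mono)
        show "\<bar>?n * (- g x * sin (?n * x))\<bar> \<le> ?n * B"
          unfolding abs_mult[of ?n] using trig(2)[of "- g x" B "?n * x"] B(2)[of x] by (intro mult_mono) auto
        show "\<bar>deriv V0 x\<bar> \<le> D0 * ?n" using D0(2)[of x] mult_left_mono[OF n1(1) nonneg(3)] by simp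
        show "\<bar>deriv g x * cos (?n * x)\<bar> \<le> D1 * ?n"
          using trig(1)[OF D1(2)[of x], of "?n * x"] mult_left_mono[OF n1(1) nonneg(4)] by simp
      qed
      also have "\<dots> = (B + D0 + D1) * ?n" by (simp add: algebra_simps)
      also have "\<dots> \<le> K * ?n" unfolding K_def using nonneg by (intro mult_right_mono) auto
      finally show ?thesis .
    qed
    have 2: "\<bar>v 2 0 x\<bar> \<le> K * ?n^2" for x
    proof -
      have "\<bar>v 2 0 x\<bar> \<le> \<bar>?n^2 * (- g x * cos (?n * x))\<bar> + \<bar>(deriv ^^ 2) V0 x\<bar> + \<bar>(deriv ^^ 2) g x * cos (?n * x)\<bar>
          + \<bar>2 * ?n * (deriv g x * sin (?n * x))\<bar>"
      proof -
        have tri: "\<bar>a + (b + (c - d))\<bar> \<le> \<bar>a\<bar> + \<bar>b\<bar> + \<bar>c\<bar> + \<bar>d\<bar>" for a b c d :: real by linarith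
        show ?thesis unfolding v osc_DERIV(2)[OF V0 g] mult.assoc[of "2 * ?n"] by (rule tri)
      qed
      also have "\<dots> \<le> ?n^2 * B + D2 * ?n^2 + D3 * ?n^2 + 2 * ?n^2 * D1"
      proof (intro add_mono)
        show "\<bar>?n^2 * (- g x * cos (?n * x))\<bar> \<le> ?n^2 * B"
          unfolding abs_mult[of "?n^2"] using trig(1)[of "- g x" B "?n * x"] B(2)[of x] by (intro mult_mono) auto
        show "\<bar>(deriv ^^ 2) V0 x\<bar> \<le> D2 * ?n^2" using D2(2)[of x] mult_left_mono[OF n1(3) nonneg(5)] by simp
        show "\<bar>(deriv ^^ 2) g x * cos (?n * x)\<bar> \<le> D3 * ?n^2"
          using trig(1)[OF D3(2)[of x], of "?n * x"] mult_left_mono[OF n1(3) nonneg(6)] by simp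
        show "\<bar>2 * ?n * (deriv g x * sin (?n * x))\<bar> \<le> 2 * ?n^2 * D1"
          unfolding abs_mult[of "2 * ?n"] using trig(2)[OF D1(2)[of x], of "?n * x"] n1 by (intro mult_mono) auto
      qed
      also have "\<dots> = (B + D2 + D3 + 2 * D1) * ?n^2" by (simp add: algebra_simps)
      also have "\<dots> \<le> K * ?n^2" unfolding K_def using nonneg by (intro mult_right_mono) auto
      finally show ?thesis .
    qed
    show "rough_data v K ?n"
      unfolding rough_data_def using n1 0 1 2 order_trans[OF abs_ge_zero 0[of 0]] by blast
  qed
qed

section \<open>Convergence in initial topologies\<close>

lemma limitin_initial_topology:
  assumes "F \<noteq> {}" "x \<in> S" "\<And>n. z n \<in> S" "\<And>f. f \<in> F \<Longrightarrow> (\<lambda>n. f (z n)) \<longlonglongrightarrow> f x"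
  shows "limitin (initial_topology S F) z x sequentially"
  unfolding limitin_def topspace_initial_topology[OF assms(1)]
proof (intro conjI allI impI assms(2), elim conjE)
  fix U assume "openin (initial_topology S F) U" and "x \<in> U"
  then show "\<forall>\<^sub>F n in sequentially. z n \<in> U"
    unfolding initial_topology_def openin_topology_generated_by_iff
  proof (induction rule: generate_topology_on.induct)
    case (Int a b)
    then show ?case by (auto intro: eventually_conj)
  next
    case (UN K)
    then obtain k where "k \<in> K" "x \<in> k" by blast
    from UN.IH[OF this] show ?case by (rule eventually_mono) (use \<open>k \<in> K\<close> in blast)
  next
    case (Basis s)
    then obtain f G where s: "s = S \<inter> f -` G" "f \<in> F" "open G" by blast
    with Basis have "\<forall>\<^sub>F n in sequentially. f (z n) \<in> G" by (intro topological_tendstoD[OF assms(4)]) auto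
    then show ?case using s assms(3) by (auto elim: eventually_mono)
  qed simp
qed

text \<open>Topological continuity is exploited through one sequence of data and one test function
  at a time, which is what a refutation calls for.\<close>

lemma topcontinuous_at_initial_topology_limit:
  assumes f: "topcontinuous_at X (initial_topology S F) f x" and z: "limitin X z x sequentially" and \<psi>: "\<psi> \<in> F"
  shows "(\<lambda>n. \<psi> (f (z n))) \<longlonglongrightarrow> \<psi> (f x)"
proof (rule topological_tendstoI)
  fix G assume G: "open G" "\<psi> (f x) \<in> G"
  have "F \<noteq> {}" using \<psi> by blast
  then have S: "f x \<in> S"
    using f by (auto simp: topcontinuous_at_def topspace_initial_topology)
  have "openin (initial_topology S F) (S \<inter> \<psi> -` G)"
    unfolding initial_topology_def by (rule topology_generated_by_Basis) (use \<psi> G in blast)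
  moreover have "f x \<in> S \<inter> \<psi> -` G" using S G by simp
  ultimately have "\<exists>U. openin X U \<and> x \<in> U \<and> (\<forall>y\<in>U. f y \<in> S \<inter> \<psi> -` G)"
    using f[unfolded topcontinuous_at_def, THEN conjunct2, THEN conjunct2, rule_format] by (simp only:)
  then obtain U where U: "openin X U" "x \<in> U" "\<forall>y\<in>U. f y \<in> S \<inter> \<psi> -` G" by (elim exE conjE)
  have "\<forall>\<^sub>F n in sequentially. z n \<in> U" using z U by (simp add: limitin_def)
  then show "\<forall>\<^sub>F n in sequentially. \<psi> (f (z n)) \<in> G" by (rule eventually_mono) (use U(3) in simp)
qed

lemma limitin_pullback_topology:
  assumes "x \<in> A" "\<And>n. z n \<in> A" "limitin X (\<lambda>n. f (z n)) (f x) F"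
  shows "limitin (pullback_topology A f X) z x F"
  unfolding limitin_def
proof (intro conjI allI impI, goal_cases)
  case 1
  then show ?case using assms by (auto simp: topspace_pullback_topology limitin_def)
next
  case (2 U)
  then obtain W where W: "openin X W" "U = f -` W \<inter> A" unfolding openin_pullback_topology by blast
  with 2 have "\<forall>\<^sub>F n in F. f (z n) \<in> W" using assms(3) by (auto simp: limitin_def)
  then show ?case using W assms(2) by (auto elim: eventually_mono)
qed

section \<open>Weak convergence of the data\<close>

lemma dual_space_nonempty: "dual_space V nrm \<noteq> {}"
proof -
  have "(\<lambda>f. 0) \<in> dual_space V nrm"
    unfolding dual_space_def linear_functional_on_def by (auto intro!: exI[of _ 0])
  then show ?thesis by blast
qed

lemma test_circle_L2:
  assumes "f \<in> test_circle"
  shows "f \<in> L2_circle" and "L2_norm_circle f = sqrt (CI x. (f x)^2)"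
proof -
  have c: "continuous_on UNIV (\<lambda>x. (f x)^2)" by (intro continuous_intros circle_continuous[OF assms])
  have "f \<in> borel_measurable borel"
    by (rule borel_measurable_continuous_onI[OF circle_continuous[OF assms]])
  moreover have "set_integrable lborel {0..2 * pi} (\<lambda>x. (f x)^2)"
    by (rule borel_integrable_atLeastAtMost') (rule continuous_on_subset[OF c subset_UNIV])
  ultimately show "f \<in> L2_circle" using assms by (auto simp: L2_circle_def circle_iff)
  show "L2_norm_circle f = sqrt (CI x. (f x)^2)"
    unfolding L2_norm_circle_def lborel_integral_eq_cint[OF c] ..
qed

lemma topspace_Hinf_weak_L2: "topspace Hinf_weak_L2 = Hinf"
  unfolding Hinf_weak_L2_def weak_topology_def
  by (auto simp: topspace_initial_topology[OF dual_space_nonempty] test_circle_L2 Hinf_eq)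

text \<open>What is kept of a dual element is linearity and an L2 bound on test functions, the form
  in which oscillating sequences are handled.\<close>

lemma limitin_Hinf_weak_L2:
  assumes z: "\<And>n. z n \<in> test_circle" and x: "x \<in> test_circle"
    and conv: "\<And>L C. linear_functional_on test_circle L \<Longrightarrow>
      (\<And>f. f \<in> test_circle \<Longrightarrow> \<bar>L f\<bar> \<le> C * sqrt (CI x. (f x)^2)) \<Longrightarrow> (\<lambda>n. L (z n)) \<longlonglongrightarrow> L x"
  shows "limitin Hinf_weak_L2 z x sequentially"
  unfolding Hinf_weak_L2_def limitin_subtopology Hinf_eq
proof (intro conjI x always_eventually allI z)
  show "limitin (weak_topology L2_circle L2_norm_circle) z x sequentially"
    unfolding weak_topology_def
  proof (rule limitin_initial_topology[OF dual_space_nonempty])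
    fix L assume "L \<in> dual_space L2_circle L2_norm_circle"
    then obtain C where L: "linear_functional_on L2_circle L" "\<And>f. f \<in> L2_circle \<Longrightarrow> \<bar>L f\<bar> \<le> C * L2_norm_circle f"
      unfolding dual_space_def by blast
    show "(\<lambda>n. L (z n)) \<longlonglongrightarrow> L x"
    proof (rule conv[of L C])
      show "linear_functional_on test_circle L"
        using L(1) test_circle_L2(1) unfolding linear_functional_on_def by simp
      show "\<bar>L f\<bar> \<le> C * sqrt (CI x. (f x)^2)" if "f \<in> test_circle" for f
        using L(2)[OF test_circle_L2(1)[OF that]] test_circle_L2(2)[OF that] by simp
    qed
  qed (use x z test_circle_L2 in auto)
qed

lemma Hinf0_eq: "Hinf0 = {f \<in> test_circle. cint f = 0}"
  unfolding Hinf0_def Hinf_eq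
  by (auto simp: lborel_integral_eq_cint circle_continuous)

lemma topspace_Hinf0_weak_Hm1: "topspace Hinf0_weak_Hm1 = Hinf0"
  unfolding Hinf0_weak_Hm1_def weak_topology_def topspace_pullback_topology
  by (auto simp: topspace_initial_topology[OF dual_space_nonempty] Hinf0_eq circle_in_Hs)

lemma circle_distr_linear:
  assumes "continuous_on UNIV f" "continuous_on UNIV g"
  shows "circle_distr (\<lambda>x. a * f x + b * g x) = (\<lambda>\<phi>. a * circle_distr f \<phi> + b * circle_distr g \<phi>)"
proof
  fix \<phi>
  show "circle_distr (\<lambda>x. a * f x + b * g x) \<phi> = a * circle_distr f \<phi> + b * circle_distr g \<phi>"
  proof (cases "\<phi> \<in> test_circle")
    case True
    have c: "continuous_on A f" "continuous_on A g" "continuous_on A \<phi>" for A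
      using assms circle_continuous[OF True] by (auto intro: continuous_on_subset)
    have "(CI x. (a * f x + b * g x) * \<phi> x) = (CI x. a * (f x * \<phi> x) + b * (g x * \<phi> x))"
      by (simp add: algebra_simps)
    also have "\<dots> = (CI x. a * (f x * \<phi> x)) + (CI x. b * (g x * \<phi> x))"
      by (intro int_add continuous_intros c)
    finally show ?thesis
      using True by (simp add: circle_distr_eq assms continuous_intros)
  qed (simp add: circle_distr_def)
qed

text \<open>As for L2, with the additional bound on derivatives that the weaker norm provides; the
  functional is pulled back from distributions to functions.\<close>

lemma limitin_Hinf0_weak_Hm1:
  assumes z: "\<And>n. z n \<in> Hinf0" and x: "x \<in> Hinf0"
    and conv: "\<And>L C. linear_functional_on test_circle L \<Longrightarrow>
      (\<And>f. f \<in> test_circle \<Longrightarrow> \<bar>L f\<bar> \<le> C * sqrt (CI x. (f x)^2)) \<Longrightarrow>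
      (\<And>f. f \<in> test_circle \<Longrightarrow> \<bar>L (deriv f)\<bar> \<le> C * sqrt (CI x. (f x)^2)) \<Longrightarrow> (\<lambda>n. L (z n)) \<longlonglongrightarrow> L x"
  shows "limitin Hinf0_weak_Hm1 z x sequentially"
  unfolding Hinf0_weak_Hm1_def weak_topology_def
proof (intro limitin_pullback_topology x z limitin_initial_topology[OF dual_space_nonempty])
  fix L assume "L \<in> dual_space (Hs (- 1)) (Hs_norm (- 1))"
  then obtain C where L: "linear_functional_on (Hs (- 1)) L" "\<And>U. U \<in> Hs (- 1) \<Longrightarrow> \<bar>L U\<bar> \<le> C * Hs_norm (- 1) U"
    unfolding dual_space_def by blast
  have b: "\<bar>L (circle_distr g)\<bar> \<le> \<bar>C\<bar> * s"
    if "g \<in> test_circle" "Hs_norm (- 1) (circle_distr g) \<le> s" for g s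
  proof -
    have n: "0 \<le> Hs_norm (- 1) (circle_distr g)"
      unfolding Hs_norm_def by (auto intro!: infsum_nonneg sobolev_term_nonneg)
    have "\<bar>L (circle_distr g)\<bar> \<le> C * Hs_norm (- 1) (circle_distr g)" by (rule L(2)[OF circle_in_Hs[OF that(1)]])
    also have "\<dots> \<le> \<bar>C\<bar> * Hs_norm (- 1) (circle_distr g)" using n by (intro mult_right_mono) auto
    also have "\<dots> \<le> \<bar>C\<bar> * s" using that(2) by (intro mult_left_mono) auto
    finally show ?thesis .
  qed
  show "(\<lambda>n. L (circle_distr (z n))) \<longlonglongrightarrow> L (circle_distr x)"
  proof (rule conv[of "\<lambda>f. L (circle_distr f)" "\<bar>C\<bar>"])
    show "linear_functional_on test_circle (\<lambda>f. L (circle_distr f))"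
      unfolding linear_functional_on_def
    proof (intro ballI allI)
      fix f g a b assume fg: "f \<in> test_circle" "g \<in> test_circle"
      show "L (circle_distr (\<lambda>x. a * f x + b * g x)) = a * L (circle_distr f) + b * L (circle_distr g)"
        unfolding circle_distr_linear[OF fg[THEN circle_continuous]]
        by (rule linear_functional_onD[OF L(1) fg[THEN circle_in_Hs]])
    qed
    show "\<bar>L (circle_distr f)\<bar> \<le> \<bar>C\<bar> * sqrt (CI x. (f x)^2)" if "f \<in> test_circle" for f
      by (rule b[OF that Hs_norm_minus_one_le(1)[OF that]])
    show "\<bar>L (circle_distr (deriv f))\<bar> \<le> \<bar>C\<bar> * sqrt (CI x. (f x)^2)" if "f \<in> test_circle" for f
      by (rule b[OF circle_deriv[OF that] Hs_norm_minus_one_le(2)[OF that]])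
  qed
qed (use x z in \<open>auto simp: Hinf0_eq circle_in_Hs\<close>)

lemma linear_functional_simps:
  assumes "linear_functional_on test_circle L" "f \<in> test_circle"
  shows "g \<in> test_circle \<Longrightarrow> L (\<lambda>x. f x + g x) = L f + L g"
    and "g \<in> test_circle \<Longrightarrow> L (\<lambda>x. f x - g x) = L f - L g"
    and "L (\<lambda>x. c * f x) = c * L f"
  using linear_functional_onD[OF assms(1,2), of g 1 1] linear_functional_onD[OF assms(1,2), of g 1 "-1"]
    linear_functional_onD[OF assms(1,2,2), of c 0] by simp_all

lemma osc_functional_tendsto:
  assumes L: "linear_functional_on test_circle L"
    and bound: "\<And>f. f \<in> test_circle \<Longrightarrow> \<bar>L f\<bar> \<le> C * sqrt (CI x. (f x)^2)"
    and V0: "V0 \<in> test_circle" and g: "g \<in> test_circle"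
  shows "(\<lambda>n. L (osc V0 g n)) \<longlonglongrightarrow> L V0"
proof -
  have "L (osc V0 g n) = L V0 + (L (\<lambda>x. g x * cos (real n * x)) - osc_mean g n * L (\<lambda>x. 1))" for n
  proof -
    have "L (\<lambda>x. osc_mean g n * 1) = osc_mean g n * L (\<lambda>x. 1)" by (intro linear_functional_simps(3)[OF L]) auto
    moreover have "L (\<lambda>x. g x * cos (real n * x) - osc_mean g n * 1) = L (\<lambda>x. g x * cos (real n * x)) - L (\<lambda>x. osc_mean g n * 1)"
      by (intro linear_functional_simps(2)[OF L] osc_carrier[OF g] circle_const)
    moreover have "L (\<lambda>x. V0 x + (g x * cos (real n * x) - osc_mean g n * 1)) = L V0 + L (\<lambda>x. g x * cos (real n * x) - osc_mean g n * 1)"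
      by (intro linear_functional_simps(1)[OF L] V0 circle_diff osc_carrier[OF g] circle_const)
    ultimately show ?thesis by (simp add: osc_def[abs_def])
  qed
  moreover have "(\<lambda>n. L V0 + (L (\<lambda>x. g x * cos (real n * x)) - osc_mean g n * L (\<lambda>x. 1))) \<longlonglongrightarrow> L V0 + (0 - 0 * L (\<lambda>x. 1))"
    by (intro tendsto_intros oscillation_functional_vanishes[OF L bound g] osc_mean_tendsto[OF g])
  ultimately show ?thesis by simp
qed

definition miura :: "(real \<Rightarrow> real) \<Rightarrow> real \<Rightarrow> real" where
  "miura f x = deriv f x + (f x)^2"

lemma miura_test_circle: "f \<in> test_circle \<Longrightarrow> miura f \<in> test_circle"
  unfolding miura_def[abs_def] by (intro circle_add circle_deriv circle_power)

text \<open>Besides terms oscillating at frequency n or 2 n and terms with the mean correction, the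
  transform of the data contains two others: the derivative of the carrier, large in L2 but seen by
  \<open>L\<close> composed with \<open>deriv\<close> as an L2-bounded oscillation, and the square
  of the carrier, whose local mean g^2 / 2 stays in the limit.\<close>

lemma miura_osc_functional_tendsto:
  assumes L: "linear_functional_on test_circle L"
    and bound: "\<And>f. f \<in> test_circle \<Longrightarrow> \<bar>L f\<bar> \<le> C * sqrt (CI x. (f x)^2)"
      "\<And>f. f \<in> test_circle \<Longrightarrow> \<bar>L (deriv f)\<bar> \<le> C * sqrt (CI x. (f x)^2)"
    and V0: "V0 \<in> test_circle" and g: "g \<in> test_circle"
  shows "(\<lambda>n. L (miura (osc V0 g n))) \<longlonglongrightarrow> L (\<lambda>x. miura V0 x + (g x)^2 / 2)"
proof -
  define F where "F = (\<lambda>x. miura V0 x + (g x)^2 / 2)"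
  define G where "G n x = g x * cos (real n * x)" for n x
  define p where "p = (\<lambda>x. (g x)^2 / 2)"
  define q where "q = (\<lambda>x. 2 * V0 x * g x)"
  have p: "p \<in> test_circle"
    unfolding p_def divide_inverse by (intro circle_mult circle_power g circle_const)
  have q: "q \<in> test_circle" unfolding q_def by (intro circle_mult circle_const V0 g)
  have F: "F \<in> test_circle"
    using p unfolding F_def p_def by (intro circle_add miura_test_circle V0) auto
  have G: "G n \<in> test_circle" for n unfolding G_def[abs_def] by (rule osc_carrier[OF g])
  have oc: "osc V0 g n \<in> test_circle" for n by (rule osc_test_circle[OF V0 g])
  let ?\<gamma> = "osc_mean g"
  have eq: "miura (osc V0 g n) = (\<lambda>x. F x + (deriv (G n) x + (p x * cos (real (2 * n) * x) + (q x * cos (real n * x)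
      - (2 * ?\<gamma> n * osc V0 g n x + (?\<gamma> n)^2 * 1)))))" for n
  proof
    fix x
    have "deriv (osc V0 g n) x = deriv V0 x + deriv (G n) x"
      unfolding osc_def[abs_def] G_def[symmetric]
      by (rule DERIV_imp_deriv) ((rule derivative_eq_intros circle_DERIV V0 G refl)+, simp)
    moreover have "cos (real (2 * n) * x) = 2 * (cos (real n * x))^2 - 1"
      using cos_double_cos[of "real n * x"] by (simp add: mult.assoc)
    ultimately show "miura (osc V0 g n) x = F x + (deriv (G n) x + (p x * cos (real (2 * n) * x) + (q x * cos (real n * x)
        - (2 * ?\<gamma> n * osc V0 g n x + (?\<gamma> n)^2 * 1))))"
      by (simp only: miura_def F_def p_def q_def osc_def) (simp add: power2_eq_square field_simps)
  qed
  have "L (miura (osc V0 g n)) = L F + (L (deriv (G n)) + (L (\<lambda>x. p x * cos (real (2 * n) * x)) + (L (\<lambda>x. q x * cos (real n * x))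
      - (2 * ?\<gamma> n * L (osc V0 g n) + (?\<gamma> n)^2 * L (\<lambda>x. 1)))))" for n
  proof -
    let ?r = "\<lambda>x. 2 * ?\<gamma> n * osc V0 g n x + (?\<gamma> n)^2 * 1"
    let ?s = "\<lambda>x. q x * cos (real n * x)" and ?p = "\<lambda>x. p x * cos (real (2 * n) * x)"
    have r: "?r \<in> test_circle" by (intro circle_add circle_mult circle_const oc)
    have s: "?s \<in> test_circle" and pp: "?p \<in> test_circle" by (intro osc_carrier p q)+
    have sr: "(\<lambda>x. ?s x - ?r x) \<in> test_circle" by (rule circle_diff[OF s r])
    have psr: "(\<lambda>x. ?p x + (?s x - ?r x)) \<in> test_circle" by (rule circle_add[OF pp sr])
    have gpsr: "(\<lambda>x. deriv (G n) x + (?p x + (?s x - ?r x))) \<in> test_circle"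
      by (rule circle_add[OF circle_deriv[OF G] psr])
    have "L ?r = 2 * ?\<gamma> n * L (osc V0 g n) + (?\<gamma> n)^2 * L (\<lambda>x. 1)"
      by (rule linear_functional_onD[OF L oc circle_const])
    then show ?thesis
      unfolding eq linear_functional_simps(1)[OF L F gpsr] linear_functional_simps(1)[OF L circle_deriv[OF G] psr]
        linear_functional_simps(1)[OF L pp sr] linear_functional_simps(2)[OF L s r]
      by (simp only:)
  qed
  moreover have "(\<lambda>n. L (deriv (G n))) \<longlonglongrightarrow> 0"
    unfolding G_def[abs_def]
  proof (rule oscillation_functional_vanishes[of "\<lambda>f. L (deriv f)", OF _ bound(2) g])
    show "linear_functional_on test_circle (\<lambda>f. L (deriv f))"
      unfolding linear_functional_on_def
    proof (intro ballI allI)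
      fix f h a b assume fh: "f \<in> test_circle" "h \<in> test_circle"
      have "deriv (\<lambda>x. a * f x + b * h x) = (\<lambda>x. a * deriv f x + b * deriv h x)"
        by (intro ext DERIV_imp_deriv) (auto intro!: derivative_eq_intros circle_DERIV fh)
      then show "L (deriv (\<lambda>x. a * f x + b * h x)) = a * L (deriv f) + b * L (deriv h)"
        using linear_functional_onD[OF L fh[THEN circle_deriv]] by simp
    qed
  qed
  moreover have "(\<lambda>n. L (\<lambda>x. p x * cos (real (2 * n) * x))) \<longlonglongrightarrow> 0"
    using LIMSEQ_subseq_LIMSEQ[OF oscillation_functional_vanishes[OF L bound(1) p], of "\<lambda>n. 2 * n"]
    by (simp add: o_def strict_mono_def)
  moreover have "(\<lambda>n. L (\<lambda>x. q x * cos (real n * x))) \<longlonglongrightarrow> 0"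
    by (rule oscillation_functional_vanishes[OF L bound(1) q])
  moreover have "(\<lambda>n. L (osc V0 g n)) \<longlonglongrightarrow> L V0" by (rule osc_functional_tendsto[OF L bound(1) V0 g])
  moreover note osc_mean_tendsto[OF g]
  ultimately have "(\<lambda>n. L (miura (osc V0 g n))) \<longlonglongrightarrow> L F + (0 + (0 + (0 - (2 * 0 * L V0 + 0^2 * L (\<lambda>x. 1)))))"
    by (simp only:) (intro tendsto_intros)
  then show ?thesis by (simp add: F_def)
qed

section \<open>Distributions on the cylinder\<close>

lemma tensor_differentiable:
  fixes \<eta> \<phi> :: "real \<Rightarrow> real"
  assumes "smooth \<eta>" "smooth \<phi>"
  shows "(\<lambda>(t, x). \<eta> t * \<phi> x) differentiable_on UNIV"
proof -
  have "\<eta> differentiable at t" "\<phi> differentiable at t" for t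
    using assms by (auto simp: smooth_def differentiable_on_def dest: spec[of _ 0])
  then have "(\<lambda>p. \<eta> (fst p) * \<phi> (snd p)) differentiable at p" for p :: "real \<times> real"
    by (intro differentiable_mult differentiable_compose[of \<eta> fst] differentiable_compose[of \<phi> snd])
      (auto intro!: bounded_linear_imp_differentiable bounded_linear_fst bounded_linear_snd)
  then show ?thesis by (simp add: differentiable_on_def case_prod_unfold)
qed

lemma tensor_test_supported:
  assumes \<eta>: "smooth \<eta>" "\<And>t. t \<notin> {a..b} \<Longrightarrow> \<eta> t = 0" and \<phi>: "\<phi> \<in> test_circle"
  shows "(\<lambda>(t, x). \<eta> t * \<phi> x) \<in> test_supported a b"
proof -
  have "\<exists>\<eta>' \<phi>'. smooth \<eta>' \<and> smooth \<phi>' \<and> \<psi> = (\<lambda>(t, x). \<eta>' t * \<phi>' x)"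
    if "\<psi> \<in> iterated_partials (\<lambda>(t, x). \<eta> t * \<phi> x)" for \<psi>
    using that
  proof (induction rule: iterated_partials.induct)
    case 1
    then show ?case using \<eta>(1) \<phi> by (auto simp: circle_iff)
  next
    case (2 \<psi>)
    then obtain \<eta>' \<phi>' where *: "smooth \<eta>'" "smooth \<phi>'" "\<psi> = (\<lambda>(t, x). \<eta>' t * \<phi>' x)" by blast
    have "partial_t \<psi> = (\<lambda>(t, x). deriv \<eta>' t * \<phi>' x)"
      unfolding partial_t_def *(3) by (auto intro!: ext DERIV_imp_deriv derivative_eq_intros smooth_DERIV *)
    then show ?case using smooth_deriv[OF *(1)] *(2) by blast
  next
    case (3 \<psi>)
    then obtain \<eta>' \<phi>' where *: "smooth \<eta>'" "smooth \<phi>'" "\<psi> = (\<lambda>(t, x). \<eta>' t * \<phi>' x)" by blast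
    have "partial_x \<psi> = (\<lambda>(t, x). \<eta>' t * deriv \<phi>' x)"
      unfolding partial_x_def *(3) by (auto intro!: ext DERIV_imp_deriv derivative_eq_intros smooth_DERIV *)
    then show ?case using smooth_deriv[OF *(2)] *(1) by blast
  qed
  then show ?thesis
    unfolding test_supported_def
    using \<eta>(2) \<phi> by (auto simp: circle_iff periodic_def intro!: tensor_differentiable)
qed

lemma test_supported_continuous:
  assumes "\<phi> \<in> test_supported a b" shows "continuous_on A \<phi>"
proof -
  have "\<phi> differentiable_on UNIV"
    using assms iterated_partials.intros(1)[of \<phi>] unfolding test_supported_def by blast
  then show ?thesis by (meson continuous_on_subset differentiable_imp_continuous_on subset_UNIV)
qed

lemma test_supported_bounded:
  assumes \<phi>: "\<phi> \<in> test_supported a b"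
  shows "bdd_above (range (\<lambda>p. \<bar>\<phi> p\<bar>))"
proof -
  have "compact (\<phi> ` ({a..b} \<times> {0..2 * pi}))"
    by (intro compact_continuous_image test_supported_continuous[OF \<phi>] compact_Times compact_Icc)
  then have "bounded (\<phi> ` ({a..b} \<times> {0..2 * pi}))" by (rule compact_imp_bounded)
  then obtain B where B: "\<And>p. p \<in> {a..b} \<times> {0..2 * pi} \<Longrightarrow> \<bar>\<phi> p\<bar> \<le> B" unfolding bounded_iff by auto
  have "\<bar>\<phi> (t, x)\<bar> \<le> max B 0" for t x
  proof (cases "t \<in> {a..b}")
    case True
    have "periodic (\<lambda>x. \<phi> (t, x))" using \<phi> by (simp add: test_supported_def)
    then obtain y where y: "y \<in> {0..<2 * pi}" "\<phi> (t, y) = \<phi> (t, x)" by (rule periodic_reduce)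
    then show ?thesis using B[of "(t, y)"] True by auto
  next
    case False
    then have "\<phi> (t, x) = 0" using \<phi> by (simp add: test_supported_def)
    then show ?thesis by simp
  qed
  then show ?thesis by (auto intro!: bdd_aboveI[of _ "max B 0"])
qed

lemma test_supported_mono: "\<phi> \<in> test_supported a b \<Longrightarrow> a' \<le> a \<Longrightarrow> b \<le> b' \<Longrightarrow> \<phi> \<in> test_supported a' b'"
  unfolding test_supported_def by auto

lemma differentiable_slices:
  fixes \<phi> :: "real \<times> real \<Rightarrow> real"
  assumes "\<phi> differentiable_on UNIV"
  shows "((\<lambda>r. \<phi> (r, x)) has_real_derivative partial_t \<phi> (t, x)) (at t)"
    and "((\<lambda>y. \<phi> (t, y)) has_real_derivative partial_x \<phi> (t, x)) (at x)"
proof -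
  have d: "\<phi> differentiable at p" for p using assms by (simp add: differentiable_on_def del: split_paired_All)
  have "(\<lambda>r. (r, x)) differentiable at t" "(\<lambda>y. (t, y)) differentiable at x"
    unfolding differentiable_def by (auto intro!: exI derivative_eq_intros)
  from differentiable_compose[OF d this(1)] differentiable_compose[OF d this(2)]
  show "((\<lambda>r. \<phi> (r, x)) has_real_derivative partial_t \<phi> (t, x)) (at t)"
    and "((\<lambda>y. \<phi> (t, y)) has_real_derivative partial_x \<phi> (t, x)) (at x)"
    by (auto simp: partial_t_def partial_x_def DERIV_deriv_iff_real_differentiable)
qed

lemma test_supported_linear:
  assumes \<phi>: "\<phi> \<in> test_supported a b" and \<psi>: "\<psi> \<in> test_supported a b"
  shows "(\<lambda>p. c * \<phi> p + d * \<psi> p) \<in> test_supported a b"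
proof -
  have d: "\<theta> differentiable_on UNIV" if "\<theta> \<in> iterated_partials \<phi> \<union> iterated_partials \<psi>" for \<theta>
    using that \<phi> \<psi> unfolding test_supported_def by blast
  have "\<exists>\<phi>'\<in>iterated_partials \<phi>. \<exists>\<psi>'\<in>iterated_partials \<psi>. \<theta> = (\<lambda>p. c * \<phi>' p + d * \<psi>' p)"
    if "\<theta> \<in> iterated_partials (\<lambda>p. c * \<phi> p + d * \<psi> p)" for \<theta>
    using that
  proof (induction rule: iterated_partials.induct)
    case 1
    then show ?case by (intro bexI[of _ \<phi>] bexI[of _ \<psi>] iterated_partials.intros refl)
  next
    case (2 \<theta>)
    then obtain \<phi>' \<psi>' where *: "\<phi>' \<in> iterated_partials \<phi>" "\<psi>' \<in> iterated_partials \<psi>"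
      "\<theta> = (\<lambda>p. c * \<phi>' p + d * \<psi>' p)" by blast
    have dd: "\<phi>' differentiable_on UNIV" "\<psi>' differentiable_on UNIV" using d * by auto
    have "((\<lambda>r. c * \<phi>' (r, x) + d * \<psi>' (r, x)) has_real_derivative c * partial_t \<phi>' (t, x) + d * partial_t \<psi>' (t, x)) (at t)" for t x
      by (intro DERIV_add DERIV_cmult differentiable_slices dd)
    then have "partial_t \<theta> = (\<lambda>p. c * partial_t \<phi>' p + d * partial_t \<psi>' p)"
      unfolding *(3) by (auto simp: partial_t_def[of "\<lambda>p. c * \<phi>' p + d * \<psi>' p"] intro!: ext DERIV_imp_deriv)
    then show ?case using * by (intro bexI[of _ "partial_t \<phi>'"] bexI[of _ "partial_t \<psi>'"] iterated_partials.intros)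
  next
    case (3 \<theta>)
    then obtain \<phi>' \<psi>' where *: "\<phi>' \<in> iterated_partials \<phi>" "\<psi>' \<in> iterated_partials \<psi>"
      "\<theta> = (\<lambda>p. c * \<phi>' p + d * \<psi>' p)" by blast
    have dd: "\<phi>' differentiable_on UNIV" "\<psi>' differentiable_on UNIV" using d * by auto
    have "((\<lambda>y. c * \<phi>' (t, y) + d * \<psi>' (t, y)) has_real_derivative c * partial_x \<phi>' (t, x) + d * partial_x \<psi>' (t, x)) (at x)" for t x
      by (intro DERIV_add DERIV_cmult differentiable_slices dd)
    then have "partial_x \<theta> = (\<lambda>p. c * partial_x \<phi>' p + d * partial_x \<psi>' p)"
      unfolding *(3) by (auto simp: partial_x_def[of "\<lambda>p. c * \<phi>' p + d * \<psi>' p"] intro!: ext DERIV_imp_deriv)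
    then show ?case using * by (intro bexI[of _ "partial_x \<phi>'"] bexI[of _ "partial_x \<psi>'"] iterated_partials.intros)
  qed
  note partials = this
  have diff: "(\<lambda>p. c * \<phi>' p + d * \<psi>' p) differentiable_on UNIV"
    if "\<phi>' \<in> iterated_partials \<phi>" "\<psi>' \<in> iterated_partials \<psi>" for \<phi>' \<psi>'
    using d that by (intro differentiable_on_add differentiable_on_mult differentiable_on_const) auto
  show ?thesis
    unfolding test_supported_def mem_Collect_eq
  proof (intro conjI ballI allI impI)
    fix \<theta> assume "\<theta> \<in> iterated_partials (\<lambda>p. c * \<phi> p + d * \<psi> p)"
    from partials[OF this] show "\<theta> differentiable_on UNIV" by (elim bexE) (simp add: diff)
  next
    fix t show "periodic (\<lambda>x. c * \<phi> (t, x) + d * \<psi> (t, x))"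
      using \<phi> \<psi> by (simp add: test_supported_def periodic_def)
  next
    fix t x assume "t \<notin> {a..b}"
    then show "c * \<phi> (t, x) + d * \<psi> (t, x) = 0" using \<phi> \<psi> by (simp add: test_supported_def)
  qed
qed

lemma cylinder_set_integrable:
  fixes f :: "real \<times> real \<Rightarrow> real"
  assumes "continuous_on UNIV f"
  shows "set_integrable lborel ({0<..<T} \<times> {0..2 * pi}) f"
proof (rule set_integrable_subset)
  show "set_integrable lborel (cbox (0, 0) (T, 2 * pi)) f"
    unfolding set_integrable_def
    by (rule borel_integrable_compact) (auto intro: continuous_on_subset[OF assms])
  show "{0<..<T} \<times> {0..2 * pi} \<in> sets lborel" by (simp add: borel_Times)
  show "{0<..<T} \<times> {0..2 * pi} \<subseteq> cbox (0, 0) (T, 2 * pi)" by auto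
qed

lemma cylinder_distr_in_distr_cylinder:
  assumes u: "continuous_on UNIV (\<lambda>(t, x). u t x)"
  shows "cylinder_distr T u \<in> distr_cylinder T"
proof -
  let ?A = "{0<..<T} \<times> {0..2 * pi}"
  have \<phi>c: "continuous_on UNIV \<phi>" if "\<phi> \<in> test_cylinder T" for \<phi>
    using that test_supported_continuous unfolding test_cylinder_def by blast
  have uc: "continuous_on UNIV (\<lambda>p. u (fst p) (snd p))" using u by (simp add: case_prod_unfold)
  have val: "cylinder_distr T u \<phi> = (LINT p:?A|lborel. u (fst p) (snd p) * \<phi> p)" if "\<phi> \<in> test_cylinder T" for \<phi>
    using that by (simp add: cylinder_distr_def case_prod_unfold)
  have int: "set_integrable lborel ?A (\<lambda>p. u (fst p) (snd p) * \<phi> p)" if "\<phi> \<in> test_cylinder T" for \<phi>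
    by (intro cylinder_set_integrable continuous_intros uc \<phi>c[OF that])
  have "linear_functional_on (test_cylinder T) (cylinder_distr T u)"
    unfolding linear_functional_on_def
  proof (intro ballI allI)
    fix \<phi> \<psi> c d assume \<phi>: "\<phi> \<in> test_cylinder T" and \<psi>: "\<psi> \<in> test_cylinder T"
    obtain a b where ab: "0 < a" "b < T" "\<phi> \<in> test_supported a b" using \<phi> unfolding test_cylinder_def by auto
    obtain a' b' where ab': "0 < a'" "b' < T" "\<psi> \<in> test_supported a' b'" using \<psi> unfolding test_cylinder_def by auto
    have "(\<lambda>p. c * \<phi> p + d * \<psi> p) \<in> test_supported (min a a') (max b b')"
      by (intro test_supported_linear test_supported_mono[OF ab(3)] test_supported_mono[OF ab'(3)]) auto
    then have "(\<lambda>p. c * \<phi> p + d * \<psi> p) \<in> test_cylinder T"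
      unfolding test_cylinder_def using ab ab' by (intro UN_I[of "min a a'"] UN_I[of "max b b'"]) auto
    then have "cylinder_distr T u (\<lambda>p. c * \<phi> p + d * \<psi> p)
        = (LINT p:?A|lborel. c * (u (fst p) (snd p) * \<phi> p) + d * (u (fst p) (snd p) * \<psi> p))"
      by (simp add: val algebra_simps)
    also have "\<dots> = (LINT p:?A|lborel. c * (u (fst p) (snd p) * \<phi> p)) + (LINT p:?A|lborel. d * (u (fst p) (snd p) * \<psi> p))"
      by (intro set_integral_add set_integrable_mult_right int \<phi> \<psi>)
    finally show "cylinder_distr T u (\<lambda>p. c * \<phi> p + d * \<psi> p) = c * cylinder_distr T u \<phi> + d * cylinder_distr T u \<psi>"
      by (simp add: val \<phi> \<psi>)
  qed
  moreover have "\<exists>C N. \<forall>\<phi>\<in>test_supported a b.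
      \<bar>cylinder_distr T u \<phi>\<bar> \<le> C * (\<Sum>i\<le>(N::nat). \<Sum>j\<le>N. SUP p. \<bar>(partial_t ^^ i) ((partial_x ^^ j) \<phi>) p\<bar>)"
    if "0 < a" "b < T" for a b
  proof (intro exI ballI)
    fix \<phi> assume \<phi>: "\<phi> \<in> test_supported a b"
    then have \<phi>T: "\<phi> \<in> test_cylinder T" using that unfolding test_cylinder_def by auto
    define s where "s = (SUP p. \<bar>\<phi> p\<bar>)"
    have s: "\<bar>\<phi> p\<bar> \<le> s" for p unfolding s_def by (rule cSUP_upper[OF UNIV_I test_supported_bounded[OF \<phi>]])
    have "\<bar>cylinder_distr T u \<phi>\<bar> \<le> (LINT p:?A|lborel. \<bar>u (fst p) (snd p) * \<phi> p\<bar>)"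
      using set_integral_norm_bound[OF int[OF \<phi>T]] by (simp add: val[OF \<phi>T])
    also have "\<dots> \<le> (LINT p:?A|lborel. s * \<bar>u (fst p) (snd p)\<bar>)"
    proof (rule set_integral_mono)
      show "\<bar>u (fst p) (snd p) * \<phi> p\<bar> \<le> s * \<bar>u (fst p) (snd p)\<bar>" for p
        using mult_right_mono[OF s[of p], of "\<bar>u (fst p) (snd p)\<bar>"] by (simp add: abs_mult mult.commute)
    qed (intro cylinder_set_integrable continuous_intros uc \<phi>c[OF \<phi>T])+
    also have "\<dots> = (LINT p:?A|lborel. \<bar>u (fst p) (snd p)\<bar>) * s" by simp
    finally show "\<bar>cylinder_distr T u \<phi>\<bar> \<le> (LINT p:?A|lborel. \<bar>u (fst p) (snd p)\<bar>)
        * (\<Sum>i\<le>0. \<Sum>j\<le>0. SUP p. \<bar>(partial_t ^^ i) ((partial_x ^^ j) \<phi>) p\<bar>)"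
      by (simp add: s_def)
  qed
  moreover have "cylinder_distr T u \<phi> = 0" if "\<phi> \<notin> test_cylinder T" for \<phi>
    using that by (simp add: cylinder_distr_def)
  ultimately show ?thesis unfolding distr_cylinder_def by blast
qed

lemma tensor_test_cylinder:
  assumes "smooth \<eta>" "\<And>t. t \<notin> {a..b} \<Longrightarrow> \<eta> t = 0" "\<phi> \<in> test_circle" "0 < a" "b < T"
  shows "(\<lambda>(t, x). \<eta> t * \<phi> x) \<in> test_cylinder T"
  unfolding test_cylinder_def using tensor_test_supported[OF assms(1-3)] assms(4,5) by blast

text \<open>Products of a time cut-off and a spatial test function reduce convergence of
  distributions on the cylinder to time averages of spatial pairings.\<close>

lemma cylinder_distr_tensor:
  assumes u: "continuous_on UNIV (\<lambda>(t, x). u t x)"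
    and \<eta>: "smooth \<eta>" "\<And>t. t \<notin> {a..b} \<Longrightarrow> \<eta> t = 0" and \<phi>: "\<phi> \<in> test_circle" and ab: "0 < a" "b < T"
  shows "cylinder_distr T u (\<lambda>(t, x). \<eta> t * \<phi> x) = integral {0..b} (\<lambda>t. \<eta> t * (CI x. u t x * \<phi> x))"
proof -
  let ?A = "{0<..<T} \<times> {0..2 * pi}" and ?B = "cbox (0, 0) (T, 2 * pi)"
  let ?f = "\<lambda>p. u (fst p) (snd p) * (\<eta> (fst p) * \<phi> (snd p))"
  have uc: "continuous_on UNIV (\<lambda>p. u (fst p) (snd p))" using u by (simp add: case_prod_unfold)
  have c: "continuous_on A ?f" for A
    by (intro continuous_intros continuous_on_subset[OF uc subset_UNIV] continuous_on_compose2[OF smooth_continuous[OF \<eta>(1)]]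
        circle_continuous_comp[OF \<phi>]) auto
  have "cylinder_distr T u (\<lambda>(t, x). \<eta> t * \<phi> x) = (LINT p:?A|lborel. ?f p)"
    using tensor_test_cylinder[OF \<eta> \<phi> ab] by (simp add: cylinder_distr_def case_prod_unfold)
  also have "\<dots> = (LINT p:?B|lborel. ?f p)"
    unfolding set_lebesgue_integral_def
  proof (rule Bochner_Integration.integral_cong[OF refl])
    fix p :: "real \<times> real"
    show "indicator ?A p *\<^sub>R ?f p = indicator ?B p *\<^sub>R ?f p"
    proof (cases "\<eta> (fst p) = 0")
      case False
      then have "fst p \<in> {a..b}" using \<eta>(2) by blast
      then have "0 < fst p" "fst p < T" using ab by auto
      then show ?thesis by (cases p) (auto simp: indicator_def)
    qed simp
  qed
  also have "\<dots> = integral ?B ?f"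
    by (rule set_borel_integral_eq_integral) (unfold set_integrable_def, rule borel_integrable_compact[OF compact_cbox c])
  also have "\<dots> = integral (cbox 0 T) (\<lambda>t. integral (cbox 0 (2 * pi)) (\<lambda>x. ?f (t, x)))"
    by (rule integral_prod_continuous[OF c])
  also have "\<dots> = integral {0..T} (\<lambda>t. \<eta> t * (CI x. u t x * \<phi> x))"
    by (simp add: mult.left_commute)
  also have "\<dots> = integral {0..T} (\<lambda>t. if t \<in> {0..b} then \<eta> t * (CI x. u t x * \<phi> x) else 0)"
    using \<eta>(2) ab by (intro integral_cong) auto
  also have "\<dots> = integral {0..b} (\<lambda>t. \<eta> t * (CI x. u t x * \<phi> x))"
    unfolding integral_restrict_Int using ab by (simp add: min_def)
  finally show ?thesis .
qed

lemma topspace_distr_cylinder_topology: "topspace (distr_cylinder_topology T) = distr_cylinder T"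
proof -
  have "(\<lambda>(t, x). 0 * 0) \<in> test_cylinder T"
    by (rule tensor_test_cylinder[of "\<lambda>t. 0" 1 "T - 1" "\<lambda>x. 0"]) auto
  then have "test_cylinder T \<noteq> {}" by blast
  then show ?thesis unfolding distr_cylinder_topology_def by (simp add: topspace_initial_topology)
qed

section \<open>The Miura transform and the KdV equation\<close>

lemma cint_le_prim:
  assumes f: "f \<in> test_circle" "cint f = 0" and \<phi>: "\<phi> \<in> test_circle"
    and \<kappa>: "\<And>x. x \<in> {0..2 * pi} \<Longrightarrow> \<bar>prim f x\<bar> \<le> \<kappa>"
  shows "\<bar>(CI x. f x * \<phi> x)\<bar> \<le> \<kappa> * (CI x. \<bar>deriv \<phi> x\<bar>)"
proof -
  note c = circle_continuous[OF f(1)]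
  have p: "prim f \<in> test_circle" by (rule prim_test_circle[OF f])
  have "(CI x. f x * \<phi> x) = - (CI x. prim f x * deriv \<phi> x)"
    by (rule cint_ibp[OF prim_DERIV[OF c] circle_DERIV[OF \<phi>] c circle_continuous[OF circle_deriv[OF \<phi>]]])
      (simp add: circle_period_eq[OF \<phi>] circle_period_eq[OF p])
  moreover have "norm (CI x. prim f x * deriv \<phi> x) \<le> \<kappa> * (CI x. norm (deriv \<phi> x))"
    by (rule int_mult_le) (auto intro!: circle_continuous circle_deriv p \<phi> \<kappa>)
  ultimately show ?thesis by simp
qed

text \<open>v_x + v^2 solves KdV if v solves the defocusing equation. KdV is invariant under
  subtracting a constant m from a solution while moving it with speed 6 m, which serves to restore
  mean zero; uniqueness then identifies the result with the given solution.\<close>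

lemma (in mkdv) galilean_miura:
  assumes \<sigma>: "\<sigma> = 1" and u: "kdv_solution u0 u" and init: "\<And>x. u0 x = v 1 0 x + (v 0 0 x)^2 - m" and "0 \<le> t"
  shows "u t x = v 1 t (x + (- 6 * m) * t) + (v 0 t (x + (- 6 * m) * t))^2 - m"
proof -
  define w0 where "w0 t x = v 1 t x + (v 0 t x)^2" for t x
  define w1 where "w1 t x = v 2 t x + 2 * v 0 t x * v 1 t x" for t x
  define w2 where "w2 t x = v 3 t x + 2 * ((v 1 t x)^2 + v 0 t x * v 2 t x)" for t x
  define w3 where "w3 t x = v 4 t x + 2 * (3 * v 1 t x * v 2 t x + v 0 t x * v 3 t x)" for t x
  define a where "a = - 6 * m"
  note w_defs = w0_def w1_def w2_def w3_def
  have cw: "continuous_on A g \<Longrightarrow> continuous_on A h \<Longrightarrow> continuous_on A (\<lambda>p. w0 (g p) (h p))"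
    "continuous_on A g \<Longrightarrow> continuous_on A h \<Longrightarrow> continuous_on A (\<lambda>p. w1 (g p) (h p))"
    "continuous_on A g \<Longrightarrow> continuous_on A h \<Longrightarrow> continuous_on A (\<lambda>p. w2 (g p) (h p))"
    "continuous_on A g \<Longrightarrow> continuous_on A h \<Longrightarrow> continuous_on A (\<lambda>p. w3 (g p) (h p))"
    for A and g h :: "real \<times> real \<Rightarrow> real"
    unfolding w_defs by (intro continuous_intros; assumption)+
  have d0: "(w0 t has_real_derivative w1 t x) (at x)" for t x
    unfolding w_defs[abs_def]
    by (rule derivative_eq_intros DERIV_v_num refl)+ (simp add: algebra_simps power2_eq_square)
  have d1: "(w1 t has_real_derivative w2 t x) (at x)" for t x
    unfolding w_defs[abs_def]
    by (rule derivative_eq_intros DERIV_v_num refl)+ (simp add: algebra_simps power2_eq_square)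
  have d2: "(w2 t has_real_derivative w3 t x) (at x)" for t x
    unfolding w_defs[abs_def]
    by (rule derivative_eq_intros DERIV_v_num refl)+ (simp add: algebra_simps power2_eq_square)
  have dt: "((\<lambda>t. w0 t x) has_real_derivative - w3 t x + 6 * w0 t x * w1 t x) (at t)" for t x
    unfolding w0_def
    by (rule derivative_eq_intros equation equation_x refl)+ (simp add: w_defs \<sigma> algebra_simps power2_eq_square)
  have line: "((\<lambda>x. g (x + a * t)) has_real_derivative g') (at x)" if "(g has_real_derivative g') (at (x + a * t))" for g g' t x
    using that by (simp only: DERIV_shift)
  have cu: "continuous_in_Hinf u" and u0: "u 0 = u0" using u by (auto simp: kdv_solution_def)
  have eqn: "((\<lambda>t. u t x) has_real_derivative - jet u 3 t x + 6 * jet u 0 t x * jet u 1 t x) (at t)" for t x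
  proof -
    obtain y where y: "((\<lambda>r. u r x) has_real_derivative y) (at t)"
      "y + (deriv ^^ 3) (u t) x - 6 * u t x * deriv (u t) x = 0"
      using u unfolding kdv_solution_def by blast
    then have "y = - jet u 3 t x + 6 * jet u 0 t x * jet u 1 t x" by simp
    with y(1) show ?thesis by (simp only:)
  qed
  have "u t x = w0 t (x + a * t) - m"
  proof (rule kdv_unique[where ?w0.0 = u and ?w1.0 = "jet u 1" and ?w2.0 = "jet u 2" and ?w3.0 = "jet u 3"
        and ?z0.0 = "\<lambda>t x. w0 t (x + a * t) - m" and ?z1.0 = "\<lambda>t x. w1 t (x + a * t)"
        and ?z2.0 = "\<lambda>t x. w2 t (x + a * t)" and ?z3.0 = "\<lambda>t x. w3 t (x + a * t)"])
    show "(u t has_real_derivative jet u 1 t x) (at x)" for t x using jet_DERIV[OF cu, of 0 t x] by simp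
    show "(jet u 1 t has_real_derivative jet u 2 t x) (at x)" for t x
      using jet_DERIV[OF cu, of 1 t x] by (simp add: eval_nat_numeral)
    show "(jet u 2 t has_real_derivative jet u 3 t x) (at x)" for t x
      using jet_DERIV[OF cu, of 2 t x] by (simp add: eval_nat_numeral)
    show "((\<lambda>x. w0 t (x + a * t) - m) has_real_derivative w1 t (x + a * t)) (at x)" for t x
      using DERIV_diff[OF line[OF d0] DERIV_const] by simp
    show "((\<lambda>x. w1 t (x + a * t)) has_real_derivative w2 t (x + a * t)) (at x)"
      "((\<lambda>x. w2 t (x + a * t)) has_real_derivative w3 t (x + a * t)) (at x)" for t x
      by (rule line[OF d1] line[OF d2])+
    show "continuous_on UNIV (\<lambda>(t, x). u t x)" using jet_continuous[OF cu, of 0] by simp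
    show "continuous_on UNIV (\<lambda>(t, x). jet u 1 t x)" "continuous_on UNIV (\<lambda>(t, x). jet u 2 t x)"
      "continuous_on UNIV (\<lambda>(t, x). jet u 3 t x)" by (rule jet_continuous[OF cu])+
    show "continuous_on UNIV (\<lambda>(t, x). w0 t (x + a * t) - m)" "continuous_on UNIV (\<lambda>(t, x). w1 t (x + a * t))"
      "continuous_on UNIV (\<lambda>(t, x). w2 t (x + a * t))" "continuous_on UNIV (\<lambda>(t, x). w3 t (x + a * t))"
      unfolding case_prod_unfold by (intro continuous_intros cw)+
    show "periodic (u t)" for t using jet_test_circle[OF cu, of 0 t] by (simp add: circle_iff)
    show "periodic (\<lambda>x. w0 t (x + a * t) - m)" for t
      unfolding periodic_def
    proof
      fix x
      have "x + 2 * pi + a * t = (x + a * t) + 2 * pi" by simp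
      then show "w0 t (x + 2 * pi + a * t) - m = w0 t (x + a * t) - m" unfolding w0_def by (simp only: periodic_v)
    qed
    show "((\<lambda>t. u t x) has_real_derivative - jet u 3 t x + 6 * u t x * jet u 1 t x) (at t)" for t x
      using eqn[of x t] by simp
    show "((\<lambda>t. w0 t (x + a * t) - m) has_real_derivative
        - w3 t (x + a * t) + 6 * (w0 t (x + a * t) - m) * w1 t (x + a * t)) (at t)" for t x
    proof (rule DERIV_cong[OF DERIV_diff[OF DERIV_along_line[OF dt d0] DERIV_const]])
      show "continuous_on UNIV (\<lambda>(t, x). w1 t x)" unfolding case_prod_unfold by (intro continuous_intros cw)
    qed (simp add: a_def algebra_simps)
    show "u 0 = (\<lambda>x. w0 0 (x + a * 0) - m)" by (simp add: u0 init w0_def fun_eq_iff)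
  qed fact
  then show ?thesis by (simp add: w0_def a_def)
qed

text \<open>The boost is moved onto the test function, at a cost proportional to the shift s; the
  derivative of v is moved there too, after which v may be replaced by \<open>V0\<close> at a cost
  proportional to \<kappa>. The pairing with v^2 is left for the lower bound on the mass.\<close>

lemma (in mkdv) miura_shift_bound:
  assumes \<phi>: "\<phi> \<in> test_circle" and V0: "V0 \<in> test_circle" and mean: "cint (v 0 t) = cint V0"
    and mass: "(CI x. (v 0 t x)^2) \<le> E"
    and X: "\<And>x. \<bar>deriv \<phi> x\<bar> \<le> X1" "\<And>x. \<bar>deriv (deriv \<phi>) x\<bar> \<le> X2"
    and \<kappa>: "\<And>x. x \<in> {0..2 * pi} \<Longrightarrow> \<bar>prim (\<lambda>x. v 0 t x - V0 x) x\<bar> \<le> \<kappa>"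
  shows "(CI x. \<phi> x * (v 0 t x)^2) + (CI x. \<phi> x * deriv V0 x)
      - (\<bar>s\<bar> * (X1 * E + X2 * (sqrt (2 * pi) * sqrt E)) + \<kappa> * (X2 * (2 * pi)))
    \<le> (CI x. (v 1 t (x + s) + (v 0 t (x + s))^2) * \<phi> x)"
proof -
  define r where "r = - s"
  let ?\<phi> = "\<lambda>x. \<phi> (x + r)" and ?\<phi>' = "\<lambda>x. deriv \<phi> (x + r)"
  have \<phi>': "deriv \<phi> \<in> test_circle" by (rule circle_deriv[OF \<phi>])
  have s\<phi>: "?\<phi> \<in> test_circle" "?\<phi>' \<in> test_circle" by (rule circle_shift \<phi> \<phi>')+
  note c = circle_continuous[OF \<phi>] circle_continuous[OF \<phi>'] circle_continuous[OF s\<phi>(1)]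
    circle_continuous[OF s\<phi>(2)]
  have X0: "0 \<le> X1" "0 \<le> X2" using X(1)[of 0] X(2)[of 0] by linarith+
  have lip: "\<bar>f (x + r) - f x\<bar> \<le> X * \<bar>s\<bar>" if "f \<in> test_circle" "\<And>x. \<bar>deriv f x\<bar> \<le> X" for f X x
  proof -
    have "norm (f (x + r) - f x) \<le> X * norm ((x + r) - x)"
      by (rule field_differentiable_bound[of UNIV f "deriv f"])
        (use that in \<open>auto intro!: DERIV_subset[OF circle_DERIV]\<close>)
    then show ?thesis by (simp add: r_def)
  qed
  have "(CI x. (v 1 t (x + s) + (v 0 t (x + s))^2) * \<phi> x) = (CI x. (v 1 t x + (v 0 t x)^2) * ?\<phi> x)"
  proof -
    have "(\<lambda>x. (v 1 t x + (v 0 t x)^2) * ?\<phi> x) \<in> test_circle"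
      by (intro circle_mult circle_add circle_power circle_v s\<phi>)
    then have "(CI x. (v 1 t (x + s) + (v 0 t (x + s))^2) * ?\<phi> (x + s)) = (CI x. (v 1 t x + (v 0 t x)^2) * ?\<phi> x)"
      by (intro cint_shift circle_continuous) (auto simp: circle_iff)
    then show ?thesis by (simp add: r_def)
  qed
  also have "\<dots> = (CI x. v 1 t x * ?\<phi> x) + (CI x. (v 0 t x)^2 * ?\<phi> x)"
    by (subst int_add[symmetric]) (auto intro!: continuous_intros c simp: algebra_simps)
  also have "(CI x. v 1 t x * ?\<phi> x) = - (CI x. v 0 t x * ?\<phi>' x)"
  proof (rule cint_ibp[OF DERIV_v_num(1)])
    show "(?\<phi> has_real_derivative ?\<phi>' x) (at x)" for x
      by (rule DERIV_shift[THEN iffD1, OF circle_DERIV[OF \<phi>]])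
  qed (use circle_period_eq[OF s\<phi>(1)] in \<open>auto intro!: continuous_intros c simp: per_v\<close>)
  finally have main: "(CI x. (v 1 t (x + s) + (v 0 t (x + s))^2) * \<phi> x)
    = - (CI x. v 0 t x * ?\<phi>' x) + (CI x. (v 0 t x)^2 * ?\<phi> x)" .
  have 1: "\<bar>(CI x. (v 0 t x)^2 * ?\<phi> x) - (CI x. \<phi> x * (v 0 t x)^2)\<bar> \<le> \<bar>s\<bar> * (X1 * E)"
  proof -
    have "(CI x. (v 0 t x)^2 * ?\<phi> x) - (CI x. \<phi> x * (v 0 t x)^2) = (CI x. (?\<phi> x - \<phi> x) * (v 0 t x)^2)"
      by (subst int_diff[symmetric]) (auto intro!: continuous_intros c simp: algebra_simps)
    moreover have "norm (CI x. (?\<phi> x - \<phi> x) * (v 0 t x)^2) \<le> (X1 * \<bar>s\<bar>) * (CI x. norm ((v 0 t x)^2))"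
      by (rule int_mult_le) (auto intro!: continuous_intros c lip[OF \<phi> X(1)])
    moreover have "(X1 * \<bar>s\<bar>) * (CI x. norm ((v 0 t x)^2)) \<le> (X1 * \<bar>s\<bar>) * E"
      using mass X0 by (intro mult_left_mono) auto
    ultimately show ?thesis by (simp add: mult_ac)
  qed
  have 2: "\<bar>(CI x. v 0 t x * ?\<phi>' x) - (CI x. v 0 t x * deriv \<phi> x)\<bar> \<le> \<bar>s\<bar> * (X2 * (sqrt (2 * pi) * sqrt E))"
  proof -
    have "(CI x. v 0 t x * ?\<phi>' x) - (CI x. v 0 t x * deriv \<phi> x) = (CI x. (?\<phi>' x - deriv \<phi> x) * v 0 t x)"
      by (subst int_diff[symmetric]) (auto intro!: continuous_intros c simp: algebra_simps)
    moreover have "norm (CI x. (?\<phi>' x - deriv \<phi> x) * v 0 t x) \<le> (X2 * \<bar>s\<bar>) * (CI x. norm (v 0 t x))"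
      by (rule int_mult_le) (auto intro!: continuous_intros c lip[OF \<phi>' X(2)])
    moreover have "(CI x. norm (v 0 t x)) \<le> sqrt (2 * pi) * sqrt E"
    proof -
      have "(CI x. \<bar>v 0 t x\<bar>) \<le> sqrt (2 * pi - 0) * sqrt (CI x. (v 0 t x)^2)"
        by (intro int_abs_le_sqrt_length continuous_intros) auto
      also have "\<dots> \<le> sqrt (2 * pi - 0) * sqrt E" using mass by (intro mult_left_mono) auto
      finally show ?thesis by simp
    qed
    then have "(X2 * \<bar>s\<bar>) * (CI x. norm (v 0 t x)) \<le> (X2 * \<bar>s\<bar>) * (sqrt (2 * pi) * sqrt E)"
      using X0 by (intro mult_left_mono) auto
    ultimately show ?thesis by (simp add: mult_ac)
  qed
  have vV: "(\<lambda>x. v 0 t x - V0 x) \<in> test_circle" by (intro circle_diff circle_v V0)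
  have 3: "\<bar>(CI x. v 0 t x * deriv \<phi> x) - (CI x. V0 x * deriv \<phi> x)\<bar> \<le> \<kappa> * (X2 * (2 * pi))"
  proof -
    have \<kappa>0: "0 \<le> \<kappa>" using \<kappa>[of 0] by simp
    have "(CI x. v 0 t x - V0 x) = 0"
      using mean by (subst int_diff) (auto intro!: continuous_intros circle_continuous[OF V0])
    from cint_le_prim[OF vV this \<phi>' \<kappa>]
    have "\<bar>(CI x. (v 0 t x - V0 x) * deriv \<phi> x)\<bar> \<le> \<kappa> * (CI x. \<bar>deriv (deriv \<phi>) x\<bar>)" .
    also have "(CI x. \<bar>deriv (deriv \<phi>) x\<bar>) \<le> (CI x. X2)"
      by (intro int_mono continuous_intros circle_continuous[OF circle_deriv[OF \<phi>']] X)
    then have "\<kappa> * (CI x. \<bar>deriv (deriv \<phi>) x\<bar>) \<le> \<kappa> * (X2 * (2 * pi))"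
      using \<kappa>0 by (intro mult_left_mono) (auto simp: mult.commute)
    finally have "\<bar>(CI x. (v 0 t x - V0 x) * deriv \<phi> x)\<bar> \<le> \<kappa> * (X2 * (2 * pi))" .
    moreover have "(CI x. v 0 t x * deriv \<phi> x) - (CI x. V0 x * deriv \<phi> x) = (CI x. (v 0 t x - V0 x) * deriv \<phi> x)"
      by (subst int_diff[symmetric]) (auto intro!: continuous_intros c circle_continuous[OF V0] simp: algebra_simps)
    ultimately show ?thesis by simp
  qed
  have 4: "(CI x. \<phi> x * deriv V0 x) = - (CI x. V0 x * deriv \<phi> x)"
    using cint_ibp_test_circle[OF V0 \<phi>] by (simp add: mult.commute)
  have arith: "p + q - (z * (x1 + x2) + k) \<le> - a + b"
    if "\<bar>b - p\<bar> \<le> z * x1" "\<bar>a - a'\<bar> \<le> z * x2" "\<bar>a' - a''\<bar> \<le> k" "q = - a''" for a b p q z x1 x2 k a' a'' :: real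
    using that by (simp add: distrib_left)
  show ?thesis unfolding main by (rule arith[OF 1 2 3 4])
qed

section \<open>Time cut-offs, Miura profiles and solutions near their profile\<close>

lemma bump_integral_pos:
  assumes "0 \<le> a" "a < b" shows "0 < integral {0..b} (bump a b)"
proof (rule ccontr)
  assume neg: "\<not> 0 < integral {0..b} (bump a b)"
  have "sqrt (bump a b ((a + b) / 2)) = 0"
  proof (rule int_zero_imp_zero[of 0 b "\<lambda>t. sqrt (bump a b t)"])
    show "continuous_on {0..b} (\<lambda>t. sqrt (bump a b t))"
      by (intro continuous_intros smooth_continuous[OF bump_smooth])
    show "integral {0..b} (\<lambda>t. (sqrt (bump a b t))^2) \<le> 0" using neg by (simp add: bump_nonneg)
  qed (use assms in auto)
  moreover have "0 < bump a b ((a + b) / 2)" using assms by (intro bump_pos) auto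
  ultimately show False by simp
qed

text \<open>g^2 is twice u - miura V0 plus a constant large enough for positivity. The freedom in
  \<open>V0\<close> secures that g^2 is not constant: \<open>V0\<close> is 0 unless u is constant,
  and then \<open>V0\<close> is \<open>sin\<close>, whose transform takes the values 1 at 0 and -1
  at pi.\<close>

lemma miura_profile:
  assumes u: "u \<in> test_circle"
  obtains V0 g m where "V0 \<in> test_circle" "g \<in> test_circle" "\<And>x. u x + m = miura V0 x + (g x)^2 / 2"
    "\<not> (\<exists>c. \<forall>x. (g x)^2 / 2 = c)"
proof -
  obtain V0 where V0: "V0 \<in> test_circle" and nc: "\<not> (\<exists>c. \<forall>x. u x - miura V0 x = c)"
  proof (cases "\<exists>c. \<forall>x. u x = c")
    case False
    then show ?thesis by (intro that[of "\<lambda>x. 0"]) (auto simp: miura_def)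
  next
    case True
    then obtain c where c: "\<And>x. u x = c" by blast
    have "deriv sin x = cos x" for x :: real by (intro DERIV_imp_deriv DERIV_sin)
    then have "u 0 - miura sin 0 = c - 1" "u pi - miura sin pi = c + 1" by (simp_all add: miura_def c)
    then have "\<not> (\<exists>c. \<forall>x. u x - miura sin x = c)" by (metis add_diff_cancel_left' diff_add_cancel one_neq_neg_one uminus_add_conv_diff)
    moreover have "sin \<in> test_circle" using circle_trig_nat(2)[of 1] by simp
    ultimately show ?thesis by (intro that)
  qed
  define P where "P = (\<lambda>x. u x - miura V0 x)"
  have P: "P \<in> test_circle" unfolding P_def by (intro circle_diff u miura_test_circle V0)
  then obtain B where B: "B > 0" "\<And>x. \<bar>P x\<bar> \<le> B" using circle_bounded by blast
  define g where "g = (\<lambda>x. sqrt (2 * (P x + (B + 1))))"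
  have pos: "2 * (P x + (B + 1)) > 0" for x using abs_le_D2[OF B(2)[of x]] by simp
  show ?thesis
  proof (rule that[OF V0])
    show "g \<in> test_circle" unfolding g_def by (intro circle_sqrt circle_mult circle_add circle_const P pos)
    have g: "(g x)^2 / 2 = P x + (B + 1)" for x
      using pos[of x] by (simp add: g_def)
    show "u x + (B + 1) = miura V0 x + (g x)^2 / 2" for x unfolding g by (simp add: P_def)
    show "\<not> (\<exists>c. \<forall>x. (g x)^2 / 2 = c)" unfolding g using nc by (auto simp: P_def) (metis add_diff_cancel)
  qed
qed

lemma circle_eq_on_period:
  assumes "f \<in> test_circle" "\<And>x. x \<in> {0..2 * pi} \<Longrightarrow> f x = c" shows "f x = c"
proof -
  have "periodic f" using assms(1) by (simp add: circle_iff)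
  then obtain y where "y \<in> {0..<2 * pi}" "f y = f x" by (rule periodic_reduce)
  then show ?thesis using assms(2)[of y] by auto
qed

definition stays_near :: "(nat \<Rightarrow> real \<Rightarrow> real \<Rightarrow> real) \<Rightarrow> (real \<Rightarrow> real) \<Rightarrow> real \<Rightarrow> real \<Rightarrow> bool" where
  "stays_near v V0 \<delta> \<kappa> \<longleftrightarrow> (\<forall>t\<in>{0..\<delta>}. \<forall>x\<in>{0..2 * pi}. \<bar>prim (\<lambda>x. v 0 t x - V0 x) x\<bar> \<le> \<kappa>)"

text \<open>One \<open>e\<close> accounts for the oscillation of the datum, the other for the motion
  up to time \<open>d\<close>. The time \<open>d\<close> is fixed before n, so it stays positive in
  the limit.\<close>

lemma osc_stays_near:
  assumes V0: "V0 \<in> test_circle" and g: "g \<in> test_circle" and e: "e > 0"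
  obtains d where "d > 0" "\<And>\<sigma> v \<delta>. (\<And>n. mkdv \<sigma> (v n)) \<Longrightarrow> (\<And>n. v n 0 0 = osc V0 g n) \<Longrightarrow> \<delta> \<le> d \<Longrightarrow>
    \<forall>\<^sub>F n in sequentially. stays_near (v n) V0 \<delta> (2 * e)"
proof -
  obtain E where E: "\<And>n. (CI x. (osc V0 g n x)^2) \<le> E" using osc_mass_bounded[OF V0 g] by blast
  obtain d where d: "d > 0" "\<And>\<sigma> v s t x. mkdv \<sigma> v \<Longrightarrow> (CI x. (v 0 0 x)^2) \<le> E \<Longrightarrow> cint (v 0 0) = cint V0 \<Longrightarrow>
    \<bar>t - s\<bar> \<le> d \<Longrightarrow> x \<in> {0..2 * pi} \<Longrightarrow> \<bar>prim (v 0 t) x - prim (v 0 s) x\<bar> \<le> e"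
    using equicontinuity[OF e, of E "cint V0"] by blast
  show ?thesis
  proof (rule that[OF d(1)])
    fix \<sigma> v \<delta> assume mk: "\<And>n. mkdv \<sigma> (v n)" and init: "\<And>n. v n 0 0 = osc V0 g n" and \<delta>: "\<delta> \<le> d"
    show "\<forall>\<^sub>F n in sequentially. stays_near (v n) V0 \<delta> (2 * e)"
      using osc_prim_tendsto[OF V0 g e]
    proof eventually_elim
      case (elim n)
      interpret mkdv \<sigma> "v n" by (rule mk)
      have "\<bar>prim (\<lambda>x. v n 0 t x - V0 x) x\<bar> \<le> 2 * e" if t: "t \<in> {0..\<delta>}" and x: "x \<in> {0..2 * pi}" for t x
      proof -
        have "\<bar>prim (v n 0 t) x - prim (v n 0 0) x\<bar> \<le> e"
          using t \<delta> by (intro d(2)[OF mk _ _ _ x]) (auto simp: init E cint_osc[OF V0 g])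
        moreover have "\<bar>prim (v n 0 0) x - prim V0 x\<bar> \<le> e"
          using elim x by (simp add: init prim_diff[symmetric] circle_continuous V0 osc_test_circle[OF V0 g])
        moreover have "prim (\<lambda>x. v n 0 t x - V0 x) x = prim (v n 0 t) x - prim V0 x"
          by (rule prim_diff) (intro continuous_intros circle_continuous[OF V0])+
        ultimately show ?thesis by linarith
      qed
      then show ?case by (simp add: stays_near_def)
    qed
  qed
qed

lemma (in mkdv) second_jet: "v 1 t = deriv (v 0 t)" "v 2 t = (deriv ^^ 2) (v 0 t)"
proof -
  have funpow2: "(deriv ^^ 2) f = deriv (deriv f)" for f :: "real \<Rightarrow> real" by (simp add: numeral_2_eq_2)
  have d: "deriv (v 0 t) = v 1 t" "deriv (v 1 t) = v 2 t" by (rule ext DERIV_imp_deriv DERIV_v_num)+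
  show "v 1 t = deriv (v 0 t)" "v 2 t = (deriv ^^ 2) (v 0 t)" by (simp_all only: d funpow2)
qed

lemma osc_mass_lower_bound:
  assumes V0: "V0 \<in> test_circle" and g: "g \<in> test_circle" and f: "f \<in> test_circle" "\<And>x. 0 \<le> f x"
    and \<eta>: "\<And>t. (\<eta> has_real_derivative \<eta>' t) (at t)" "\<And>X. continuous_on X \<eta>'" "\<And>t. 0 \<le> \<eta> t" and \<delta>: "0 \<le> \<delta>"
    and mk: "\<And>n. mkdv \<sigma> (v n)" and init: "\<And>n. v n 0 0 = osc V0 g n"
    and near: "\<forall>\<^sub>F n in sequentially. stays_near (v n) V0 \<delta> \<kappa>" and e: "0 < e"
  defines "D \<equiv> CI x. \<bar>deriv (\<lambda>x. f x * V0 x) x\<bar>"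
  shows "\<forall>\<^sub>F n in sequentially. integral {0..\<delta>} \<eta> * ((CI x. f x * (V0 x)^2)
      + cint f / (2 * pi) * ((CI x. (g x)^2) / 2) - 2 * D * \<kappa>) - e
    \<le> integral {0..\<delta>} (\<lambda>t. \<eta> t * (CI x. f x * (v n 0 t x)^2))"
proof -
  have jet: "v n 1 0 = deriv (osc V0 g n)" "v n 2 0 = (deriv ^^ 2) (osc V0 g n)" for n
    using mkdv.second_jet[OF mk, of n 0] by (simp_all only: init)
  obtain B where B: "\<And>n. 1 \<le> n \<Longrightarrow> rough_data (v n) B (real n)"
    using osc_rough_data[OF V0 g] init jet by metis
  obtain C where C: "\<And>\<sigma> v n \<kappa>. mkdv \<sigma> v \<Longrightarrow> rough_data v B n \<Longrightarrow> cint (v 0 0) = cint V0 \<Longrightarrow>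
      (\<And>t x. t \<in> {0..\<delta>} \<Longrightarrow> x \<in> {0..2 * pi} \<Longrightarrow> \<bar>prim (\<lambda>x. v 0 t x - V0 x) x\<bar> \<le> \<kappa>) \<Longrightarrow>
      integral {0..\<delta>} \<eta> * ((CI x. f x * (V0 x)^2)
        + cint f / (2 * pi) * (2 * ((CI x. (v 1 0 x)^2) / n^2) - (CI x. (v 2 0 x)^2) / n ^ 4) - 2 * D * \<kappa>) - C / n
      \<le> integral {0..\<delta>} (\<lambda>t. \<eta> t * (CI x. f x * (v 0 t x)^2))"
    unfolding D_def using mass_lower_bound[OF V0 f \<eta> \<delta>, of B] by blast
  let ?a = "\<lambda>n. (CI x. (deriv (osc V0 g n) x)^2) / (real n)^2"
  let ?b = "\<lambda>n. (CI x. ((deriv ^^ 2) (osc V0 g n) x)^2) / (real n) ^ 4"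
  let ?G = "(CI x. (g x)^2) / 2"
  have "(\<lambda>n. integral {0..\<delta>} \<eta> * ((CI x. f x * (V0 x)^2) + cint f / (2 * pi) * (2 * ?a n - ?b n) - 2 * D * \<kappa>) - C / real n)
    \<longlonglongrightarrow> integral {0..\<delta>} \<eta> * ((CI x. f x * (V0 x)^2) + cint f / (2 * pi) * (2 * ?G - ?G) - 2 * D * \<kappa>) - 0"
    by (intro tendsto_intros osc_energies_tendsto[OF V0 g] lim_const_over_n)
  then have "\<forall>\<^sub>F n in sequentially. integral {0..\<delta>} \<eta> * ((CI x. f x * (V0 x)^2) + cint f / (2 * pi) * ?G - 2 * D * \<kappa>) - e
    < integral {0..\<delta>} \<eta> * ((CI x. f x * (V0 x)^2) + cint f / (2 * pi) * (2 * ?a n - ?b n) - 2 * D * \<kappa>) - C / real n"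
    by (rule order_tendstoD) (use e in simp)
  then show ?thesis
    using near eventually_ge_at_top[of 1]
  proof eventually_elim
    case (elim n)
    have "cint (v n 0 0) = cint V0" using cint_osc[OF V0 g] init by simp
    from C[OF mk B[OF elim(3)] this, of \<kappa>] elim(1,2) show ?case
      unfolding jet stays_near_def by fastforce
  qed
qed

text \<open>Continuity would make the limit of the pairings start, up to small errors, at the
  pairing with \<open>u0\<close>. The lower bound on the mass shows that the density h = g^2 / 2
  contained in \<open>u0\<close> enters this limit through its mean only. Tested with a nonnegative
  weight decreasing in h, this is possible only if the variance of h vanishes.\<close>

theorem kdv_not_continuous:
  assumes K: "kdv_solution_map K" and M: "mkdv_solution_map 1 M" and T: "T > 0" and u0: "u0 \<in> Hinf0"
  shows "\<not> topcontinuous_at Hinf0_weak_Hm1 (distr_cylinder_topology T) (\<lambda>w. cylinder_distr T (K w)) u0"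
proof
  assume cont: "topcontinuous_at Hinf0_weak_Hm1 (distr_cylinder_topology T) (\<lambda>w. cylinder_distr T (K w)) u0"
  have u0t: "u0 \<in> test_circle" and mean0: "cint u0 = 0" using u0 by (auto simp: Hinf0_eq)
  obtain V0 g m where V0: "V0 \<in> test_circle" and g: "g \<in> test_circle" and prof: "\<And>x. u0 x + m = miura V0 x + (g x)^2 / 2"
    and nc: "\<not> (\<exists>c. \<forall>x. (g x)^2 / 2 = c)" using miura_profile[OF u0t] by blast
  define h where "h x = (g x)^2 / 2" for x
  have h: "h \<in> test_circle"
    unfolding h_def[abs_def] divide_inverse by (intro circle_mult circle_power g circle_const)
  have cgh: "(CI x. (g x)^2) / 2 = cint h" by (simp add: h_def[abs_def])
  define mn where "mn n = cint (miura (osc V0 g n)) / (2 * pi)" for n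
  define U where "U n = (\<lambda>x. miura (osc V0 g n) x - mn n)" for n
  have o: "osc V0 g n \<in> test_circle" for n by (rule osc_test_circle[OF V0 g])
  have mo: "miura (osc V0 g n) \<in> test_circle" for n by (rule miura_test_circle[OF o])
  have U: "U n \<in> Hinf0" for n
  proof -
    have "cint (U n) = cint (miura (osc V0 g n)) - (CI x. mn n)"
      unfolding U_def by (intro int_diff continuous_intros circle_continuous[OF mo])
    then show ?thesis
      unfolding Hinf0_eq by (auto simp: U_def mn_def intro!: circle_diff mo circle_const)
  qed
  have prof': "(\<lambda>x. miura V0 x + (g x)^2 / 2) = (\<lambda>x. u0 x + m)" using prof by auto
  have mn_lim: "mn \<longlonglongrightarrow> m"
  proof -
    have "(\<lambda>n. cint (miura (osc V0 g n))) \<longlonglongrightarrow> (CI x. miura V0 x + (g x)^2 / 2)"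
    proof (rule miura_osc_functional_tendsto[OF cint_linear cint_L2_bound _ V0 g])
      fix f assume f: "f \<in> test_circle"
      have "cint (deriv f) = 0" by (rule cint_deriv_zero[OF circle_DERIV[OF f] circle_period_eq[OF f]])
      moreover have "0 \<le> (CI x. (f x)^2)" by (rule int_square_nonneg[OF circle_continuous[OF f]])
      ultimately show "\<bar>cint (deriv f)\<bar> \<le> sqrt (2 * pi) * sqrt (CI x. (f x)^2)" by simp
    qed
    also have "(CI x. miura V0 x + (g x)^2 / 2) = cint u0 + (CI x. m)"
      unfolding prof' by (intro int_add continuous_intros circle_continuous[OF u0t])
    finally have "(\<lambda>n. cint (miura (osc V0 g n)) / (2 * pi)) \<longlonglongrightarrow> (cint u0 + (CI x. m)) / (2 * pi)"
      by (intro tendsto_intros) auto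
    then show ?thesis by (simp add: mn_def[abs_def] mean0)
  qed
  have "limitin Hinf0_weak_Hm1 U u0 sequentially"
  proof (rule limitin_Hinf0_weak_Hm1[OF U u0])
    fix L C assume L: "linear_functional_on test_circle L"
      "\<And>f. f \<in> test_circle \<Longrightarrow> \<bar>L f\<bar> \<le> C * sqrt (CI x. (f x)^2)"
      "\<And>f. f \<in> test_circle \<Longrightarrow> \<bar>L (deriv f)\<bar> \<le> C * sqrt (CI x. (f x)^2)"
    have LU: "L (U n) = L (miura (osc V0 g n)) - mn n * L (\<lambda>x. 1)" for n
      using linear_functional_onD[OF L(1) mo circle_const, of 1 n "- mn n" 1] by (simp add: U_def)
    have Lu: "L (\<lambda>x. u0 x + m) = L u0 + m * L (\<lambda>x. 1)"
      using linear_functional_onD[OF L(1) u0t circle_const, of 1 m 1] by simp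
    have "(\<lambda>n. L (miura (osc V0 g n)) - mn n * L (\<lambda>x. 1)) \<longlonglongrightarrow> L (\<lambda>x. u0 x + m) - m * L (\<lambda>x. 1)"
      using miura_osc_functional_tendsto[OF L V0 g] unfolding prof' by (intro tendsto_intros mn_lim)
    then show "(\<lambda>n. L (U n)) \<longlonglongrightarrow> L u0" unfolding LU Lu by simp
  qed
  note lim = topcontinuous_at_initial_topology_limit[OF cont[unfolded distr_cylinder_topology_def] this]
  have Ksol: "kdv_solution w (K w)" if "w \<in> Hinf0" for w
    using K that by (auto simp: kdv_solution_map_def Hinf0_def)
  have Kc: "continuous_on UNIV (\<lambda>(t, x). K w t x)" if "w \<in> Hinf0" for w
    using jet_continuous[of "K w" 0] Ksol[OF that] by (simp add: kdv_solution_def)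
  define v where "v n = jet (M (osc V0 g n))" for n
  have sol: "mkdv_solution 1 (osc V0 g n) (M (osc V0 g n))" for n
    using M o by (auto simp: mkdv_solution_map_def Hinf_eq)
  have mk: "mkdv 1 (v n)" for n unfolding v_def by (rule mkdv_solution_imp_mkdv[OF sol]) simp
  have v0: "v n 0 0 = osc V0 g n" "v n 1 0 = deriv (osc V0 g n)" "v n 2 0 = (deriv ^^ 2) (osc V0 g n)" for n
    using sol[of n] by (auto simp: v_def mkdv_solution_def)
  obtain E where E: "\<And>n. (CI x. (osc V0 g n x)^2) \<le> E" using osc_mass_bounded[OF V0 g] by blast
  obtain Bm where Bm: "\<And>n. \<bar>mn n\<bar> \<le> Bm"
    using convergent_imp_Bseq[OF convergentI[OF mn_lim]] unfolding Bseq_def by (metis real_norm_def)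
  have Bm0: "0 \<le> Bm" using Bm[of 0] by linarith
  obtain Bh where Bh: "\<And>x. \<bar>h x\<bar> \<le> Bh" using circle_bounded[OF h] by blast
  \<comment> \<open>Nonnegative, as the lower bound requires, and anticorrelated with h, so that
    replacing h by its mean increases the pairing.\<close>
  define \<phi> where "\<phi> x = Bh - h x" for x
  have \<phi>: "\<phi> \<in> test_circle" unfolding \<phi>_def[abs_def] by (intro circle_diff circle_const h)
  have \<phi>pos: "0 \<le> \<phi> x" for x using Bh[of x] by (simp add: \<phi>_def)
  obtain X1 where X1: "\<And>x. \<bar>deriv \<phi> x\<bar> \<le> X1" using circle_bounded[OF circle_deriv[OF \<phi>]] by blast
  obtain X2 where X2: "\<And>x. \<bar>deriv (deriv \<phi>) x\<bar> \<le> X2"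
    using circle_bounded[OF circle_deriv[OF circle_deriv[OF \<phi>]]] by blast
  define Q1 where "Q1 = X1 * E + X2 * (sqrt (2 * pi) * sqrt E)"
  have Q1: "0 \<le> Q1"
  proof -
    have "0 \<le> E" using order_trans[OF int_square_nonneg[OF circle_continuous[OF o]] E] by blast
    moreover have "0 \<le> X1" "0 \<le> X2" using X1[of 0] X2[of 0] by linarith+
    ultimately show ?thesis by (simp add: Q1_def)
  qed
  define D where "D = (CI x. \<bar>deriv (\<lambda>x. \<phi> x * V0 x) x\<bar>)"
  \<comment> \<open>Sum of the coefficients of \<open>e\<close> collected below: 2 from the limit in
    the mass bound and the time continuity of the limit solution at 0, the others from closeness
    \<open>2 * e\<close> of the primitives and a shift of size at most \<open>e\<close>.\<close>
  define Q where "Q = 2 + 4 * D + Q1 + 2 * (X2 * (2 * pi))"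
  note fc = circle_continuous[OF \<phi>] circle_continuous[OF V0] circle_continuous[OF h]
    circle_continuous[OF u0t] circle_continuous[OF circle_deriv[OF V0]]
  let ?I = "(CI x. \<phi> x * (V0 x)^2) + cint \<phi> / (2 * pi) * cint h + (CI x. \<phi> x * deriv V0 x) - m * cint \<phi>"
  have key: "?I \<le> (CI x. u0 x * \<phi> x) + Q * e" if e: "e > 0" for e
  proof -
    obtain d where d: "d > 0" "\<And>\<sigma> v \<delta>. (\<And>n. mkdv \<sigma> (v n)) \<Longrightarrow> (\<And>n. v n 0 0 = osc V0 g n) \<Longrightarrow> \<delta> \<le> d \<Longrightarrow>
      \<forall>\<^sub>F n in sequentially. stays_near (v n) V0 \<delta> (2 * e)"
      using osc_stays_near[OF V0 g e] by blast
    define q where "q t = (CI x. K u0 t x * \<phi> x)" for t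
    have qc: "continuous_on A q" for A
      unfolding q_def
      by (rule int_continuous_param) (simp only: case_prod_unfold, intro continuous_intros
          circle_continuous_comp[OF \<phi>] continuous_uncurry_compose[OF Kc[OF u0]])
    have "K u0 0 = u0" using Ksol[OF u0] by (simp add: kdv_solution_def)
    then have q0: "q 0 = (CI x. u0 x * \<phi> x)" by (simp add: q_def)
    have "isCont q 0" using qc[of UNIV] by (simp add: continuous_on_eq_continuous_at)
    then obtain d2 where d2: "d2 > 0" "\<And>t. \<bar>t\<bar> < d2 \<Longrightarrow> \<bar>q t - q 0\<bar> < e"
      using e unfolding continuous_at_eps_delta by (auto simp: dist_real_def)
    \<comment> \<open>Small for four reasons: the solutions stay near \<open>V0\<close>, the limit
      solution stays near its datum, the cut-off fits into the cylinder, and the Galilean shift is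
      at most \<open>e\<close>, uniformly in n by the bound \<open>Bm\<close>.\<close>
    define \<delta> where "\<delta> = Min {d, d2 / 2, T / 2, e / (6 * Bm + 1)}"
    have "0 < e / (6 * Bm + 1)" using e Bm0 by simp
    then have "0 < \<delta>" using d(1) d2(1) T by (simp add: \<delta>_def)
    moreover have "\<delta> \<le> d" "\<delta> \<le> d2 / 2" "\<delta> \<le> T / 2" "\<delta> \<le> e / (6 * Bm + 1)"
      unfolding \<delta>_def by (rule Min_le; simp)+
    ultimately have \<delta>: "0 < \<delta>" "\<delta> \<le> d" "\<delta> < d2" "\<delta> < T" "\<delta> \<le> e / (6 * Bm + 1)"
      using d2(1) T by linarith+
    have shift: "\<bar>- 6 * mn n * t\<bar> \<le> e" if "t \<in> {0..\<delta>}" for n t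
    proof -
      have "\<bar>- 6 * mn n * t\<bar> = 6 * \<bar>mn n\<bar> * t" using that by (simp add: abs_mult)
      also have "\<dots> \<le> (6 * Bm + 1) * \<delta>" using that Bm[of n] Bm0 by (intro mult_mono) auto
      also have "\<dots> \<le> e" using \<delta>(5) Bm0 by (simp add: pos_le_divide_eq mult.commute)
      finally show ?thesis .
    qed
    define \<eta> where "\<eta> = bump (\<delta> / 2) \<delta>"
    have \<eta>: "smooth \<eta>" "\<And>t. 0 \<le> \<eta> t" unfolding \<eta>_def by (rule bump_smooth bump_nonneg)+
    have \<eta>s: "\<eta> t = 0" if "t \<notin> {\<delta> / 2..\<delta>}" for t unfolding \<eta>_def by (rule bump_zero) (use that in auto)
    have \<eta>c: "continuous_on A \<eta>" for A by (rule smooth_continuous[OF \<eta>(1)])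
    define I where "I = integral {0..\<delta>} \<eta>"
    have I: "0 < I" unfolding I_def \<eta>_def using \<delta> by (intro bump_integral_pos) auto
    have near: "\<forall>\<^sub>F n in sequentially. stays_near (v n) V0 \<delta> (2 * e)" by (rule d(2)[OF mk v0(1) \<delta>(2)])
    have "0 < I * e" using I e by simp
    note lower = osc_mass_lower_bound[OF V0 g \<phi> \<phi>pos smooth_DERIV[OF \<eta>(1)] smooth_continuous[OF smooth_deriv[OF \<eta>(1)]] \<eta>(2)
        less_imp_le[OF \<delta>(1)] mk v0(1) near this, folded I_def D_def, unfolded cgh]
    define A where "A n = integral {0..\<delta>} (\<lambda>t. \<eta> t * (CI x. K (U n) t x * \<phi> x))" for n
    have tc: "(\<lambda>(t, x). \<eta> t * \<phi> x) \<in> test_cylinder T"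
      by (rule tensor_test_cylinder[where a = "\<delta> / 2" and b = \<delta>, OF \<eta>(1) \<eta>s \<phi>]) (use \<delta> in simp_all)
    have val: "cylinder_distr T (K w) (\<lambda>(t, x). \<eta> t * \<phi> x) = integral {0..\<delta>} (\<lambda>t. \<eta> t * (CI x. K w t x * \<phi> x))"
      if "w \<in> Hinf0" for w
      by (rule cylinder_distr_tensor[where a = "\<delta> / 2" and b = \<delta>, OF Kc[OF that] \<eta>(1) \<eta>s \<phi>]) (use \<delta> in simp_all)
    have A_lim: "A \<longlonglongrightarrow> integral {0..\<delta>} (\<lambda>t. \<eta> t * q t)"
      using lim[OF imageI[OF tc]] by (simp add: val U u0 A_def[abs_def] q_def)
    have q_le: "integral {0..\<delta>} (\<lambda>t. \<eta> t * q t) \<le> I * ((CI x. u0 x * \<phi> x) + e)"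
    proof -
      have "integral {0..\<delta>} (\<lambda>t. \<eta> t * q t) \<le> integral {0..\<delta>} (\<lambda>t. \<eta> t * (q 0 + e))"
      proof (intro int_mono continuous_intros \<eta>c qc)
        fix t assume "t \<in> {0..\<delta>}"
        then have "q t \<le> q 0 + e" using d2(2)[of t] \<delta> by auto
        then show "\<eta> t * q t \<le> \<eta> t * (q 0 + e)" using \<eta>(2)[of t] by (rule mult_left_mono)
      qed
      then show ?thesis by (simp add: I_def q0)
    qed
    let ?lower = "\<lambda>n. I * ((CI x. \<phi> x * (V0 x)^2) + cint \<phi> / (2 * pi) * cint h - 2 * D * (2 * e)) - I * e
      + I * ((CI x. \<phi> x * deriv V0 x) - (e * Q1 + (2 * e) * (X2 * (2 * pi))) - mn n * cint \<phi>)"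
    have "\<forall>\<^sub>F n in sequentially. ?lower n \<le> A n"
      using lower near
    proof eventually_elim
      case (elim n)
      interpret mkdv 1 "v n" by (rule mk)
      have mean: "cint (v n 0 0) = cint V0" using cint_osc[OF V0 g] v0(1) by simp
      interpret mkdv_gauge 1 "v n" 1 V0
        by (intro mkdv_gauge.intro mk mkdv_gauge_axioms.intro V0 mean) simp
      have massE: "(CI x. (v n 0 t x)^2) \<le> E" for t
        using mass_conserved[of t] E[of n] v0(1)[of n] by simp
      have \<kappa>: "\<bar>prim (\<lambda>x. v n 0 t x - V0 x) x\<bar> \<le> 2 * e" if "t \<in> {0..\<delta>}" "x \<in> {0..2 * pi}" for t x
        using elim(2) that by (simp add: stays_near_def)
      let ?R = "(CI x. \<phi> x * deriv V0 x) - (e * Q1 + (2 * e) * (X2 * (2 * pi))) - mn n * cint \<phi>"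
      have pw: "(CI x. \<phi> x * (v n 0 t x)^2) + ?R \<le> (CI x. K (U n) t x * \<phi> x)" if t: "t \<in> {0..\<delta>}" for t
      proof -
        let ?s = "(- 6 * mn n) * t"
        have "K (U n) t x = v n 1 t (x + ?s) + (v n 0 t (x + ?s))^2 - mn n" for x
          by (rule galilean_miura[OF refl Ksol[OF U]]) (use t v0 in \<open>auto simp: U_def miura_def\<close>)
        then have "(CI x. K (U n) t x * \<phi> x) = (CI x. (v n 1 t (x + ?s) + (v n 0 t (x + ?s))^2) * \<phi> x - mn n * \<phi> x)"
          by (simp only: left_diff_distrib)
        also have "\<dots> = (CI x. (v n 1 t (x + ?s) + (v n 0 t (x + ?s))^2) * \<phi> x) - (CI x. mn n * \<phi> x)"
          by (intro int_diff continuous_intros fc)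
        finally have eq: "(CI x. K (U n) t x * \<phi> x) = (CI x. (v n 1 t (x + ?s) + (v n 0 t (x + ?s))^2) * \<phi> x) - mn n * cint \<phi>"
          by simp
        have "\<bar>?s\<bar> * Q1 \<le> e * Q1" using shift[OF t, of n] Q1 by (intro mult_right_mono) auto
        then show ?thesis
          using miura_shift_bound[OF \<phi> V0 mean_conserved massE X1 X2 \<kappa>[OF t], of ?s] unfolding eq Q1_def[symmetric] by linarith
      qed
      have "integral {0..\<delta>} (\<lambda>t. \<eta> t * (CI x. \<phi> x * (v n 0 t x)^2)) + I * ?R
          = integral {0..\<delta>} (\<lambda>t. \<eta> t * (CI x. \<phi> x * (v n 0 t x)^2)) + integral {0..\<delta>} (\<lambda>t. \<eta> t * ?R)"
        by (simp add: I_def)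
      also have "\<dots> = integral {0..\<delta>} (\<lambda>t. \<eta> t * (CI x. \<phi> x * (v n 0 t x)^2) + \<eta> t * ?R)"
        by (intro int_add[symmetric] continuous_intros \<eta>c int_continuous_param)
          (simp only: case_prod_unfold, intro continuous_intros circle_continuous_comp[OF \<phi>])
      also have "\<dots> \<le> A n"
        unfolding A_def
      proof (rule int_mono)
        show "continuous_on {0..\<delta>} (\<lambda>t. \<eta> t * (CI x. \<phi> x * (v n 0 t x)^2) + \<eta> t * ?R)"
          by (intro continuous_intros \<eta>c int_continuous_param)
            (simp only: case_prod_unfold, intro continuous_intros circle_continuous_comp[OF \<phi>])
        show "continuous_on {0..\<delta>} (\<lambda>t. \<eta> t * (CI x. K (U n) t x * \<phi> x))"
          by (intro continuous_intros \<eta>c int_continuous_param)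
            (simp only: case_prod_unfold, intro continuous_intros circle_continuous_comp[OF \<phi>] continuous_uncurry_compose[OF Kc[OF U]])
        show "\<eta> t * (CI x. \<phi> x * (v n 0 t x)^2) + \<eta> t * ?R \<le> \<eta> t * (CI x. K (U n) t x * \<phi> x)" if "t \<in> {0..\<delta>}" for t
          unfolding distrib_left[symmetric] by (rule mult_left_mono[OF pw[OF that] \<eta>(2)])
      qed
      finally show ?case using elim(1) by linarith
    qed
    moreover have "?lower \<longlonglongrightarrow> I * ((CI x. \<phi> x * (V0 x)^2) + cint \<phi> / (2 * pi) * cint h - 2 * D * (2 * e)) - I * e
      + I * ((CI x. \<phi> x * deriv V0 x) - (e * Q1 + (2 * e) * (X2 * (2 * pi))) - m * cint \<phi>)"
      by (intro tendsto_intros mn_lim)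
    ultimately have "I * ((CI x. \<phi> x * (V0 x)^2) + cint \<phi> / (2 * pi) * cint h - 2 * D * (2 * e)) - I * e
      + I * ((CI x. \<phi> x * deriv V0 x) - (e * Q1 + (2 * e) * (X2 * (2 * pi))) - m * cint \<phi>)
      \<le> integral {0..\<delta>} (\<lambda>t. \<eta> t * q t)"
      by (intro tendsto_le[OF _ A_lim]) auto
    then have "I * (?I - (1 + 4 * D + Q1 + 2 * (X2 * (2 * pi))) * e) \<le> I * ((CI x. u0 x * \<phi> x) + e)"
      using q_le by (simp add: algebra_simps)
    then have "?I - (1 + 4 * D + Q1 + 2 * (X2 * (2 * pi))) * e \<le> (CI x. u0 x * \<phi> x) + e" using I by simp
    then show ?thesis by (simp add: Q_def algebra_simps)
  qed
  have "0 \<le> D" unfolding D_def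
    by (intro int_nonneg continuous_intros circle_continuous[OF circle_deriv[OF circle_mult[OF \<phi> V0]]]) auto
  moreover have "0 \<le> X2" using X2[of 0] by linarith
  ultimately have Q: "0 < Q" unfolding Q_def using Q1 by (intro add_pos_nonneg) auto
  have "?I \<le> (CI x. u0 x * \<phi> x)"
  proof (rule field_le_epsilon)
    fix e :: real assume "0 < e"
    then show "?I \<le> (CI x. u0 x * \<phi> x) + e" using key[of "e / Q"] Q by simp
  qed
  moreover have "(CI x. u0 x * \<phi> x) = (CI x. \<phi> x * (V0 x)^2) + ((CI x. \<phi> x * deriv V0 x) + ((CI x. \<phi> x * h x) - m * cint \<phi>))"
  proof -
    have ueq: "u0 x = deriv V0 x + (V0 x)^2 + h x - m" for x using prof[of x] by (simp add: miura_def h_def)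
    have "u0 x * \<phi> x = \<phi> x * (V0 x)^2 + (\<phi> x * deriv V0 x + (\<phi> x * h x - m * \<phi> x))" for x
      unfolding ueq by (simp add: algebra_simps)
    then show ?thesis by (simp add: int_split continuous_intros fc)
  qed
  \<comment> \<open>Subtracting the common terms leaves h against its mean; for the weight
    \<open>Bh\<close> - h this says that the variance of h is at most 0.\<close>
  ultimately have le: "cint \<phi> / (2 * pi) * cint h \<le> (CI x. \<phi> x * h x)" by linarith
  define c where "c = cint h / (2 * pi)"
  have hc: "cint h = c * (2 * pi)" by (simp add: c_def)
  have c\<phi>: "cint \<phi> = Bh * (2 * pi) - cint h"
    unfolding \<phi>_def[abs_def] by (subst int_diff) (auto intro!: continuous_intros fc)
  have "(CI x. \<phi> x * h x) = Bh * cint h - (CI x. (h x)^2)"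
    by (simp add: \<phi>_def left_diff_distrib power2_eq_square int_split continuous_intros fc)
  moreover have "cint \<phi> / (2 * pi) = Bh - c" unfolding c\<phi> c_def by (simp add: diff_divide_distrib)
  ultimately have "(Bh - c) * cint h \<le> Bh * cint h - (CI x. (h x)^2)" using le by (simp only:)
  then have "(CI x. (h x)^2) \<le> c * cint h" unfolding left_diff_distrib by linarith
  then have "(CI x. (h x)^2) \<le> c^2 * (2 * pi)"
    unfolding hc power2_eq_square[of c] by (simp only: mult.assoc)
  moreover have "(CI x. (h x - c)^2) = (CI x. (h x)^2) - c^2 * (2 * pi)"
  proof -
    have "(CI x. (h x - c)^2) = (CI x. (h x)^2 - ((2 * c) * h x - c^2))" by (simp add: power2_eq_square algebra_simps)
    then show ?thesis by (simp add: int_split continuous_intros fc hc power2_eq_square)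
  qed
  ultimately have "(CI x. (h x - c)^2) \<le> 0" by simp
  then have "h x = c" if "x \<in> {0..2 * pi}" for x
    using int_zero_imp_zero[of 0 "2 * pi" "\<lambda>x. h x - c" x] that by (simp add: continuous_intros fc)
  then have "h x = c" for x by (rule circle_eq_on_period[OF h])
  then show False using nc unfolding h_def by blast
qed

theorem kdv_discontinuous:
  assumes "kdv_solution_map K" "mkdv_solution_map 1 M" "T > 0" "u0 \<in> Hinf0"
  shows "discontinuous_at Hinf0_weak_Hm1 (distr_cylinder_topology T) (\<lambda>w. cylinder_distr T (K w)) u0"
  unfolding discontinuous_at_def topspace_Hinf0_weak_Hm1 topspace_distr_cylinder_topology
proof (intro conjI kdv_not_continuous[OF assms] assms(4) funcsetI)
  fix w assume "w \<in> Hinf0"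
  then have "continuous_in_Hinf (K w)" using assms(1) by (auto simp: kdv_solution_map_def Hinf0_def kdv_solution_def)
  from jet_continuous[OF this, of 0] show "cylinder_distr T (K w) \<in> distr_cylinder T"
    by (intro cylinder_distr_in_distr_cylinder) simp
qed

section \<open>The modified KdV equation\<close>

lemma norm_exp_minus_one_le:
  fixes z :: complex
  assumes "norm z \<le> 1" shows "norm (exp z - 1) \<le> 3 * norm z"
proof -
  have "norm (exp z - exp 0) \<le> 3 * norm (z - 0)"
  proof (rule field_differentiable_bound[of "cball 0 1" exp exp])
    show "norm (exp w) \<le> 3" if "w \<in> cball 0 1" for w :: complex
    proof -
      have "norm (exp w) \<le> exp (norm w)" by (rule norm_exp)
      also have "\<dots> \<le> exp 1" using that by simp
      also have "\<dots> \<le> 3" by (rule exp_le)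
      finally show ?thesis .
    qed
  qed (use assms in \<open>auto intro: DERIV_subset[OF DERIV_exp]\<close>)
  then show ?thesis by simp
qed

context mkdv_gauge
begin

lemma R_near_one:
  assumes \<epsilon>: "norm \<epsilon> = 1" and \<kappa>: "\<bar>prim (\<lambda>x. v 0 t x - V0 x) x\<bar> \<le> \<kappa>" "\<kappa> \<le> 1 / 2"
  shows "norm (R t x - 1) \<le> 6 * \<kappa>" and "norm (inverse (R t x) - 1) \<le> 6 * \<kappa>"
proof -
  let ?z = "2 * \<epsilon> * of_real (prim (v 0 t) x - prim V0 x)"
  have "norm ?z = 2 * \<bar>prim (v 0 t) x - prim V0 x\<bar>" unfolding norm_mult norm_of_real using \<epsilon> by simp
  then have z: "norm ?z \<le> 2 * \<kappa>" using \<kappa>(1) unfolding prim_diff_eq by simp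
  have "norm (exp ?z - 1) \<le> 3 * norm ?z" by (rule norm_exp_minus_one_le) (use z \<kappa>(2) in linarith)
  then show "norm (R t x - 1) \<le> 6 * \<kappa>" unfolding R_def using z by linarith
  have "norm (exp (- ?z) - 1) \<le> 3 * norm (- ?z)" by (rule norm_exp_minus_one_le) (use z \<kappa>(2) in \<open>simp only: norm_minus_cancel\<close>)
  then show "norm (inverse (R t x) - 1) \<le> 6 * \<kappa>" unfolding R_def exp_minus[symmetric] using z by (simp only: norm_minus_cancel)
qed

text \<open>First order expansion in time of the product. Where \<open>R\<close> and its inverse are
  within r of 1, the second factor is near 2 pi, and the first is of size r since f has mean zero;
  so up to an error of size r the rate is 2 pi times the source with \<open>R\<close> replaced by
  1.\<close>

lemma product_rate:
  assumes f: "f \<in> test_circle" "cint f = 0" "\<And>x. \<bar>f x\<bar> \<le> F"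
    and W: "\<And>x. norm (W f 3 x) \<le> B3" "\<And>x. norm (W f 1 x) \<le> B1"
    and W': "\<And>x. norm (cweight \<epsilon> \<sigma> (\<lambda>x. - V0 x) (\<lambda>x. 1) 3 x) \<le> D3" "\<And>x. norm (cweight \<epsilon> \<sigma> (\<lambda>x. - V0 x) (\<lambda>x. 1) 1 x) \<le> D1"
    and mass: "\<And>t. (CI x. (v 0 t x)^2) \<le> E"
    and near: "\<And>t x. t \<in> {0..\<delta>} \<Longrightarrow> x \<in> {0..2 * pi} \<Longrightarrow> norm (R t x - 1) \<le> r"
      "\<And>t x. t \<in> {0..\<delta>} \<Longrightarrow> x \<in> {0..2 * pi} \<Longrightarrow> norm (inverse (R t x) - 1) \<le> r" and r: "r \<le> 1" and \<delta>: "0 \<le> \<delta>"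
  defines "S \<equiv> \<lambda>t. (CI x. of_real (f x) * R t x) * (CI x. inverse (R t x))"
    and "P \<equiv> B3 * (2 * pi) + 6 * B1 * E" and "Q \<equiv> D3 * (2 * pi) + 6 * D1 * E"
  shows "norm (S \<delta> - S 0 - 2 * pi * (\<delta> * cint (W f 3) - 6 * of_real \<sigma> * integral {0..\<delta>} (\<lambda>t. CI x. W f 1 x * of_real ((v 0 t x)^2))))
    \<le> r * (6 * pi * P + 4 * pi * F * Q) * \<delta>"
proof -
  interpret m: mkdv_gauge \<sigma> "\<lambda>j t x. - v j t x" \<epsilon> "\<lambda>x. - V0 x" by (rule gauge_minus)
  have one: "(\<lambda>x. 1) \<in> test_circle" by (rule circle_const)
  have Rne: "R t x \<noteq> 0" for t x by (simp add: R_def)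
  have R'c: "continuous_on A g \<Longrightarrow> continuous_on A h \<Longrightarrow> continuous_on A (\<lambda>p. inverse (R (g p) (h p)))"
    for A and g h :: "real \<Rightarrow> real"
    by (intro continuous_intros) (auto simp: Rne)
  note fc = circle_continuous[OF f(1)] W_continuous[OF f(1) continuous_on_id] m.W_continuous[OF one continuous_on_id]
  define B where "B t = (CI x. inverse (R t x))" for t
  define A where "A t = (CI x. of_real (f x) * R t x)" for t
  define s0 where "s0 t = (CI x. W f 3 x - 6 * of_real \<sigma> * W f 1 x * of_real ((v 0 t x)^2))" for t
  define sk where "sk t = (CI x. (cweight \<epsilon> \<sigma> (\<lambda>x. - V0 x) (\<lambda>x. 1) 3 x
      - 6 * of_real \<sigma> * cweight \<epsilon> \<sigma> (\<lambda>x. - V0 x) (\<lambda>x. 1) 1 x * of_real ((v 0 t x)^2)) * inverse (R t x))" for t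
  have "(S has_vector_derivative src f t * B t + A t * sk t) (at t)" for t
    using product_law[OF f(1) one, of t] unfolding S_def A_def B_def sk_def by simp
  then have S_int: "((\<lambda>t. src f t * B t + A t * sk t) has_integral S \<delta> - S 0) {0..\<delta>}"
    by (intro fundamental_theorem_of_calculus \<delta>) (rule has_vector_derivative_at_within)
  have s0_eq: "s0 t = cint (W f 3) - 6 * of_real \<sigma> * (CI x. W f 1 x * of_real ((v 0 t x)^2))" for t
  proof -
    have "s0 t = cint (W f 3) - (CI x. 6 * of_real \<sigma> * W f 1 x * of_real ((v 0 t x)^2))"
      unfolding s0_def by (intro int_diff continuous_intros fc)
    then show ?thesis by (simp add: mult.assoc)
  qed
  have c1: "continuous_on {0..\<delta>} (\<lambda>t. CI x. W f 1 x * of_real ((v 0 t x)^2))"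
    by (rule int_continuous_param) (simp only: case_prod_unfold, intro continuous_intros W_continuous[OF f(1)])
  have "((\<lambda>t. 2 * pi * s0 t) has_integral 2 * pi * (\<delta> * cint (W f 3) - 6 * of_real \<sigma> * integral {0..\<delta>} (\<lambda>t. CI x. W f 1 x * of_real ((v 0 t x)^2)))) {0..\<delta>}"
  proof -
    have "((\<lambda>t. CI x. W f 1 x * of_real ((v 0 t x)^2)) has_integral integral {0..\<delta>} (\<lambda>t. CI x. W f 1 x * of_real ((v 0 t x)^2))) {0..\<delta>}"
      by (rule integrable_integral[OF integrable_continuous_real[OF c1]])
    moreover have "((\<lambda>t. cint (W f 3)) has_integral \<delta> * cint (W f 3)) {0..\<delta>}"
      using has_integral_const_real[of "cint (W f 3)" 0 \<delta>] \<delta> by (simp add: scaleR_conv_of_real)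
    ultimately show ?thesis unfolding s0_eq by (intro has_integral_mult_right has_integral_diff)
  qed
  from has_integral_diff[OF S_int this]
  have D: "((\<lambda>t. src f t * B t + A t * sk t - 2 * pi * s0 t) has_integral
      S \<delta> - S 0 - 2 * pi * (\<delta> * cint (W f 3) - 6 * of_real \<sigma> * integral {0..\<delta>} (\<lambda>t. CI x. W f 1 x * of_real ((v 0 t x)^2)))) (cbox 0 \<delta>)"
    by simp
  have "norm (R 0 0 - 1) \<le> r" by (rule near(1)) (use \<delta> in simp_all)
  then have r0: "0 \<le> r" by (rule order_trans[OF norm_ge_zero])
  have E: "0 \<le> E" using int_square_nonneg[of 0 "2 * pi" "v 0 0"] mass[of 0] continuous_intros by (meson circle_continuous circle_v order_trans)
  have nn: "0 \<le> B3" "0 \<le> B1" "0 \<le> D3" "0 \<le> D1" "0 \<le> F"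
    using W[of 0] W'[of 0] f(3)[of 0] norm_ge_zero order_trans abs_ge_zero by blast+
  have PQ: "0 \<le> P" "0 \<le> Q" unfolding P_def Q_def using nn E by auto
  have "norm (src f t * B t + A t * sk t - 2 * pi * s0 t) \<le> r * (6 * pi * P + 4 * pi * F * Q)" if "t \<in> cbox 0 \<delta>" for t
  proof -
    have t: "t \<in> {0..\<delta>}" using that by simp
    have 1: "norm (src f t - s0 t) \<le> r * P"
    proof -
      have "src f t - s0 t = (CI x. (W f 3 x - 6 * of_real \<sigma> * W f 1 x * of_real ((v 0 t x)^2)) * (R t x - 1))"
        unfolding src_def s0_def right_diff_distrib mult_1_right by (intro int_diff[symmetric] continuous_intros fc)
      then show ?thesis
        unfolding P_def by (simp only:) (rule source_bound, (intro continuous_intros fc W near(1)[OF t] mass; assumption)+)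
    qed
    have 2: "norm (s0 t) \<le> P"
    proof -
      have "norm (CI x. (W f 3 x - 6 * of_real \<sigma> * W f 1 x * of_real ((v 0 t x)^2)) * 1) \<le> 1 * P"
        unfolding P_def by (rule source_bound) (rule fc W mass continuous_on_const | simp)+
      then show ?thesis by (simp add: s0_def)
    qed
    have iR: "norm (inverse (R t x)) \<le> 2" if "x \<in> {0..2 * pi}" for x
      using norm_triangle_ineq2[of "inverse (R t x)" 1] near(2)[OF t that] r by simp
    have 3: "norm (sk t) \<le> 2 * Q"
      unfolding sk_def Q_def by (rule source_bound) (rule fc W' mass R'c continuous_on_const continuous_on_id iR | assumption)+
    have 4: "norm (B t - 2 * pi) \<le> r * (2 * pi)"
    proof -
      have "B t - 2 * pi = (CI x. inverse (R t x) - 1)"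
        unfolding B_def by (subst int_diff) (auto intro!: R'c continuous_intros simp: scaleR_conv_of_real Rne)
      moreover have "norm (CI x. inverse (R t x) - 1) \<le> r * (2 * pi - 0)"
        by (rule int_norm_le_const) (auto intro!: R'c continuous_intros near(2)[OF t] simp: Rne)
      ultimately show ?thesis by simp
    qed
    have 5: "norm (A t) \<le> r * F * (2 * pi)"
    proof -
      have "(CI x. of_real (f x) :: complex) = 0"
        using f(2) int_of_real[OF fc(1)] by simp
      then have "A t = (CI x. of_real (f x) * R t x) - (CI x. of_real (f x))" by (simp add: A_def)
      also have "\<dots> = (CI x. of_real (f x) * R t x - of_real (f x))" by (intro int_diff[symmetric] continuous_intros fc)
      finally have "A t = (CI x. of_real (f x) * (R t x - 1))" by (simp add: algebra_simps)
      moreover have "norm (CI x. of_real (f x) * (R t x - 1)) \<le> F * r * (2 * pi - 0)"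
      proof (rule int_norm_le_const)
        show "norm (of_real (f x) * (R t x - 1)) \<le> F * r" if "x \<in> {0..2 * pi}" for x
          unfolding norm_mult norm_of_real using f(3)[of x] near(1)[OF t that] nn by (intro mult_mono) auto
      qed (auto intro!: continuous_intros fc)
      ultimately show ?thesis by (simp add: mult.commute[of F])
    qed
    have "r * (2 * pi) \<le> 1 * (2 * pi)" using r by (intro mult_right_mono) auto
    moreover have "norm (B t) - 2 * pi \<le> norm (B t - 2 * pi)"
      using norm_triangle_ineq2[of "B t" "2 * pi"] by (simp add: norm_mult)
    ultimately have "norm (B t) \<le> 4 * pi" using 4 by linarith
    then have "norm (src f t - s0 t) * norm (B t) \<le> (r * P) * (4 * pi)"
      using 1 by (intro mult_mono norm_ge_zero order_trans[OF norm_ge_zero 1])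
    moreover have "norm (s0 t) * norm (B t - 2 * pi) \<le> P * (r * (2 * pi))"
      by (intro mult_mono 2 4 norm_ge_zero PQ)
    moreover have "norm (A t) * norm (sk t) \<le> (r * F * (2 * pi)) * (2 * Q)"
      by (intro mult_mono 5 3 norm_ge_zero order_trans[OF norm_ge_zero 5])
    moreover have "norm (src f t * B t + A t * sk t - 2 * pi * s0 t)
        \<le> norm (src f t - s0 t) * norm (B t) + norm (s0 t) * norm (B t - 2 * pi) + norm (A t) * norm (sk t)"
    proof -
      have tri: "norm (a * b + p - 2 * pi * c) \<le> norm (a - c) * norm b + norm c * norm (b - 2 * pi) + norm p" for a b c p :: complex
      proof -
        have "a * b + p - 2 * pi * c = ((a - c) * b + c * (b - 2 * pi)) + p" by (simp add: algebra_simps)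
        then show ?thesis
          unfolding norm_mult[symmetric] by (simp only:) (intro norm_triangle_le add_right_mono norm_triangle_ineq)
      qed
      show ?thesis using tri[of "src f t" "B t" "A t * sk t" "s0 t"] by (simp only: norm_mult)
    qed
    moreover have "(r * P) * (4 * pi) + P * (r * (2 * pi)) + (r * F * (2 * pi)) * (2 * Q) = r * (6 * pi * P + 4 * pi * F * Q)"
      by (simp add: algebra_simps)
    ultimately show ?thesis by linarith
  qed
  from has_integral_bound[OF _ D this] show ?thesis using r0 PQ nn \<delta> by simp
qed

end

text \<open>The lower bound applied to the nonnegative weights b + F and b - F. The contribution of
  the constant b is determined by conservation of mass, so the two one-sided bounds enclose the
  pairing with F.\<close>

lemma mass_density_limit:
  assumes V0: "V0 \<in> test_circle" and g: "g \<in> test_circle" and F: "F \<in> test_circle"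
    and mk: "\<And>n. mkdv \<sigma> (v n)" and init: "\<And>n. v n 0 0 = osc V0 g n"
  obtains D where "0 \<le> D" "\<And>\<kappa> \<delta> e. 0 < e \<Longrightarrow> 0 \<le> \<delta> \<Longrightarrow> 0 \<le> \<kappa> \<Longrightarrow>
    \<forall>\<^sub>F n in sequentially. stays_near (v n) V0 \<delta> \<kappa> \<Longrightarrow>
    \<forall>\<^sub>F n in sequentially. \<bar>integral {0..\<delta>} (\<lambda>t. CI x. F x * (v n 0 t x)^2)
      - \<delta> * ((CI x. F x * (V0 x)^2) + cint F / (2 * pi) * ((CI x. (g x)^2) / 2))\<bar> \<le> \<delta> * (D * \<kappa>) + e"
proof -
  obtain b where b: "\<And>x. \<bar>F x\<bar> \<le> b" using circle_bounded[OF F] by blast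
  define f where "f s x = s * F x + b" for s x
  have f: "f s \<in> test_circle" for s unfolding f_def[abs_def] by (intro circle_add circle_mult circle_const F)
  have fpos: "0 \<le> f s x" if "s \<in> {1, - 1}" for s x using b[of x] that by (auto simp: f_def)
  note c = circle_continuous[OF F] circle_continuous[OF V0]
  define G where "G = (CI x. (g x)^2) / 2"
  define Z where "Z = (CI x. F x * (V0 x)^2) + cint F / (2 * pi) * G"
  define D where "D s = (CI x. \<bar>deriv (\<lambda>x. f s x * V0 x) x\<bar>)" for s
  have D: "0 \<le> D s" for s unfolding D_def
    by (intro int_nonneg continuous_intros circle_continuous[OF circle_deriv[OF circle_mult[OF f V0]]]) auto
  show ?thesis
  proof (rule that[of "2 * (D 1 + D (- 1))"])
    fix \<kappa> \<delta> e :: real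
    assume e: "0 < e" and \<delta>: "0 \<le> \<delta>" and \<kappa>: "0 \<le> \<kappa>"
      and near: "\<forall>\<^sub>F n in sequentially. stays_near (v n) V0 \<delta> \<kappa>"
    define J where "J n = integral {0..\<delta>} (\<lambda>t. CI x. F x * (v n 0 t x)^2)" for n
    let ?m = "\<lambda>n. (CI x. (osc V0 g n x)^2)"
    have side: "\<forall>\<^sub>F n in sequentially. s * \<delta> * Z - \<delta> * (2 * D s * \<kappa>) - e \<le> s * J n" if s: "s \<in> {1, - 1}" for s
    proof -
      have 1: "(CI x. f s x * (V0 x)^2) = s * (CI x. F x * (V0 x)^2) + b * (CI x. (V0 x)^2)"
        by (simp add: f_def distrib_right mult.assoc int_split continuous_intros c)
      have 2: "cint (f s) / (2 * pi) = s * (cint F / (2 * pi)) + b"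
        unfolding f_def[abs_def] by (simp add: int_split continuous_intros c add_divide_distrib)
      have "(\<lambda>n. \<delta> * (b * ?m n)) \<longlonglongrightarrow> \<delta> * (b * ((CI x. (V0 x)^2) + G))"
        unfolding G_def by (intro tendsto_intros osc_mass_tendsto[OF V0 g])
      then have "\<forall>\<^sub>F n in sequentially. \<delta> * (b * ?m n) < \<delta> * (b * ((CI x. (V0 x)^2) + G)) + e / 2"
        by (rule order_tendstoD) (use e in simp)
      moreover have "\<forall>\<^sub>F n in sequentially. integral {0..\<delta>} (\<lambda>t. 1) * ((CI x. f s x * (V0 x)^2) + cint (f s) / (2 * pi) * G - 2 * D s * \<kappa>) - e / 2
          \<le> integral {0..\<delta>} (\<lambda>t. 1 * (CI x. f s x * (v n 0 t x)^2))"
        unfolding G_def D_def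
        by (rule osc_mass_lower_bound[OF V0 g f fpos[OF s] _ _ _ \<delta> mk init near, where \<eta>' = "\<lambda>t. 0"]) (use e in auto)
      ultimately show ?thesis
      proof eventually_elim
        case (elim n)
        interpret mkdv \<sigma> "v n" by (rule mk)
        have "(CI x. f s x * (v n 0 t x)^2) = s * (CI x. F x * (v n 0 t x)^2) + b * ?m n" for t
          using mass_conserved[of t] by (simp add: f_def distrib_right mult.assoc int_split continuous_intros c init)
        moreover have "continuous_on {0..\<delta>} (\<lambda>t. CI x. F x * (v n 0 t x)^2)"
          by (rule int_continuous_param) (simp only: case_prod_unfold, intro continuous_intros circle_continuous_comp[OF F])
        ultimately have "integral {0..\<delta>} (\<lambda>t. 1 * (CI x. f s x * (v n 0 t x)^2)) = s * J n + \<delta> * (b * ?m n)"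
          using \<delta> by (simp add: J_def int_split continuous_intros)
        then show ?case using elim \<delta> unfolding 1 2 Z_def by (simp add: algebra_simps)
      qed
    qed
    have "0 \<le> \<delta> * (D s * \<kappa>)" for s using \<delta> D \<kappa> by simp
    note nn = this[of 1] this[of "- 1"]
    show "\<forall>\<^sub>F n in sequentially. \<bar>integral {0..\<delta>} (\<lambda>t. CI x. F x * (v n 0 t x)^2)
        - \<delta> * ((CI x. F x * (V0 x)^2) + cint F / (2 * pi) * ((CI x. (g x)^2) / 2))\<bar> \<le> \<delta> * (2 * (D 1 + D (- 1)) * \<kappa>) + e"
      unfolding G_def[symmetric] Z_def[symmetric] J_def[symmetric]
      using side[of 1, simplified] side[of "- 1", simplified]
      by eventually_elim (use nn in \<open>simp add: abs_le_iff algebra_simps\<close>)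
  qed (use D in simp)
qed

lemma cint_diff_square_le:
  assumes "continuous_on {0..2 * pi} f" "continuous_on {0..2 * pi} (g :: real \<Rightarrow> real)"
  shows "(CI x. (f x - g x)^2) \<le> 2 * (CI x. (f x)^2) + 2 * (CI x. (g x)^2)"
proof -
  have "(CI x. (f x - g x)^2) \<le> (CI x. 2 * (f x)^2 + 2 * (g x)^2)"
  proof (intro int_mono continuous_intros assms)
    fix x show "(f x - g x)^2 \<le> 2 * (f x)^2 + 2 * (g x)^2"
      using zero_le_power2[of "f x + g x"] by (simp add: power2_eq_square algebra_simps)
  qed
  also have "\<dots> = (CI x. 2 * (f x)^2) + (CI x. 2 * (g x)^2)" by (intro int_add continuous_intros assms)
  finally show ?thesis by simp
qed

text \<open>The initial rate of the product pairing is computed twice: \<open>Y\<close> along u,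
  where the density starts as V0^2, and \<open>X\<close> along the sequence, where it is V0^2 + 1 /
  2. Convergence at positive times forces \<open>X = Y\<close>. The difference is a multiple of the
  integral of \<open>q\<close>, as \<open>p\<close> is a derivative, and the choice f = V0 - \<mu>
  makes this integral -2 times the square norm of f.\<close>

theorem mkdv_weak_continuity_imp_constant:
  assumes \<sigma>: "\<sigma> = 1 \<or> \<sigma> = - 1" and V0: "V0 \<in> test_circle" and T: "T > 0"
    and mk: "\<And>n. mkdv \<sigma> (v n)" and init: "\<And>n. v n 0 0 = osc V0 (\<lambda>x. 1) n"
    and mku: "mkdv \<sigma> u" and initu: "u 0 0 = V0"
    and conv: "\<And>t \<phi>. t \<in> {0<..<T} \<Longrightarrow> \<phi> \<in> test_circle \<Longrightarrow>
      (\<lambda>n. CI x. v n 0 t x * \<phi> x) \<longlonglongrightarrow> (CI x. u 0 t x * \<phi> x)"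
  shows "V0 x = cint V0 / (2 * pi)"
proof -
  obtain \<epsilon> :: complex where \<epsilon>: "\<epsilon> * \<epsilon> = of_real \<sigma>" "norm \<epsilon> = 1"
  proof (cases "\<sigma> = 1")
    case True then show ?thesis by (intro that[of 1]) auto
  next
    case False then show ?thesis using \<sigma> by (intro that[of \<i>]) auto
  qed
  have one: "(\<lambda>x. 1) \<in> test_circle" by (rule circle_const)
  have meanv: "cint (v n 0 0) = cint V0" for n unfolding init by (rule cint_osc[OF V0 one])
  interpret N: mkdv_gauge \<sigma> "v n" \<epsilon> V0 for n
    by (intro mkdv_gauge.intro mk mkdv_gauge_axioms.intro \<epsilon> V0 meanv)
  interpret U: mkdv_gauge \<sigma> u \<epsilon> V0
    by (intro mkdv_gauge.intro mku mkdv_gauge_axioms.intro \<epsilon> V0) (simp add: initu)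
  define \<mu> where "\<mu> = cint V0 / (2 * pi)"
  define f where "f x = V0 x - \<mu>" for x
  have f: "f \<in> test_circle" unfolding f_def[abs_def] by (intro circle_diff V0 circle_const)
  note c = circle_continuous[OF V0] circle_continuous[OF f]
  have cf: "cint f = 0"
    unfolding f_def[abs_def] by (subst int_diff) (auto intro!: continuous_intros c simp: \<mu>_def)
  obtain Fb where Fb: "\<And>x. \<bar>f x\<bar> \<le> Fb" using circle_bounded[OF f] by blast
  obtain E1 where E1: "\<And>n. (CI x. (osc V0 (\<lambda>x. 1) n x)^2) \<le> E1" using osc_mass_bounded[OF V0 one] by blast
  define E where "E = max E1 (CI x. (V0 x)^2)"
  have massv: "(CI x. (v n 0 t x)^2) \<le> E" for n t
    unfolding N.mass_conserved[of n t] init using E1[of n] by (simp add: E_def)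
  have massu: "(CI x. (u 0 t x)^2) \<le> E" for t
    unfolding U.mass_conserved[of t] initu by (simp add: E_def)
  have massV: "(CI x. (V0 x)^2) \<le> E" by (simp add: E_def)
  define p where "p = fst (weight \<sigma> V0 f 1)"
  define q where "q = snd (weight \<sigma> V0 f 1)"
  have pq: "p \<in> test_circle" "q \<in> test_circle"
    unfolding p_def q_def using weight_test_circle[OF V0 f, of \<sigma> 1] by simp_all
  note cpq = circle_continuous[OF pq(1)] circle_continuous[OF pq(2)]
  have W1: "cweight \<epsilon> \<sigma> V0 f 1 x = of_real (p x) + \<epsilon> * of_real (q x)" for x by (simp only: cweight_def p_def q_def)
  have split: "(CI x. cweight \<epsilon> \<sigma> V0 f 1 x * of_real (h x)) = of_real (CI x. p x * h x) + \<epsilon> * of_real (CI x. q x * h x)"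
    if h: "continuous_on {0..2 * pi} h" for h
  proof -
    have "(CI x. cweight \<epsilon> \<sigma> V0 f 1 x * of_real (h x)) = (CI x. of_real (p x * h x) + \<epsilon> * of_real (q x * h x))"
      by (simp only: W1 distrib_right of_real_mult mult.assoc)
    also have "\<dots> = (CI x. of_real (p x * h x)) + (CI x. \<epsilon> * of_real (q x * h x))"
      by (intro int_add continuous_intros cpq h)
    also have "\<dots> = (CI x. of_real (p x * h x)) + \<epsilon> * (CI x. of_real (q x * h x))" by (simp only: integral_mult_right)
    finally show ?thesis by (simp only: int_of_real continuous_intros cpq h)
  qed
  obtain B3 where B3: "\<And>x. norm (cweight \<epsilon> \<sigma> V0 f 3 x) \<le> B3" using cweight_bound[OF V0 f] \<epsilon>(2) by (metis order_refl)
  obtain B1 where B1: "\<And>x. norm (cweight \<epsilon> \<sigma> V0 f 1 x) \<le> B1" using cweight_bound[OF V0 f] \<epsilon>(2) by (metis order_refl)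
  obtain D3 where D3: "\<And>x. norm (cweight \<epsilon> \<sigma> (\<lambda>x. - V0 x) (\<lambda>x. 1) 3 x) \<le> D3"
    using cweight_bound[OF circle_minus[OF V0] one] \<epsilon>(2) by (metis order_refl)
  obtain D1 where D1: "\<And>x. norm (cweight \<epsilon> \<sigma> (\<lambda>x. - V0 x) (\<lambda>x. 1) 1 x) \<le> D1"
    using cweight_bound[OF circle_minus[OF V0] one] \<epsilon>(2) by (metis order_refl)
  \<comment> \<open>With g = 1 the additional density is the constant 1 / 2, hence the term
    \<open>cint F / 2\<close>.\<close>
  define m where "m F = (CI x. F x * (V0 x)^2) + cint F / 2" for F
  have mF: "(CI x. F x * (V0 x)^2) + cint F / (2 * pi) * ((CI x. 1^2) / 2) = m F" for F
    by (simp add: m_def)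
  obtain L1 where L1: "0 \<le> L1" and M1: "\<And>\<kappa> \<delta> e. 0 < e \<Longrightarrow> 0 \<le> \<delta> \<Longrightarrow> 0 \<le> \<kappa> \<Longrightarrow> \<forall>\<^sub>F n in sequentially. stays_near (v n) V0 \<delta> \<kappa> \<Longrightarrow>
    \<forall>\<^sub>F n in sequentially. \<bar>integral {0..\<delta>} (\<lambda>t. CI x. p x * (v n 0 t x)^2) - \<delta> * m p\<bar> \<le> \<delta> * (L1 * \<kappa>) + e"
    by (rule mass_density_limit[OF V0 one pq(1) mk init, unfolded mF]) (rule that)
  obtain L2 where L2: "0 \<le> L2" and M2: "\<And>\<kappa> \<delta> e. 0 < e \<Longrightarrow> 0 \<le> \<delta> \<Longrightarrow> 0 \<le> \<kappa> \<Longrightarrow> \<forall>\<^sub>F n in sequentially. stays_near (v n) V0 \<delta> \<kappa> \<Longrightarrow>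
    \<forall>\<^sub>F n in sequentially. \<bar>integral {0..\<delta>} (\<lambda>t. CI x. q x * (v n 0 t x)^2) - \<delta> * m q\<bar> \<le> \<delta> * (L2 * \<kappa>) + e"
    by (rule mass_density_limit[OF V0 one pq(2) mk init, unfolded mF]) (rule that)
  define S where "S R t = (CI x. of_real (f x) * R t x) * (CI x. inverse (R t x))" for R :: "real \<Rightarrow> real \<Rightarrow> complex" and t
  let ?W3 = "cint (cweight \<epsilon> \<sigma> V0 f 3)"
  define X where "X = 2 * pi * (?W3 - 6 * of_real \<sigma> * (of_real (m p) + \<epsilon> * of_real (m q)))"
  define Y where "Y = 2 * pi * (?W3 - 6 * of_real \<sigma> * (of_real (CI x. p x * (V0 x)^2) + \<epsilon> * of_real (CI x. q x * (V0 x)^2)))"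
  define P where "P = 6 * pi * (B3 * (2 * pi) + 6 * B1 * E) + 4 * pi * Fb * (D3 * (2 * pi) + 6 * D1 * E)"
  have R0: "U.R 0 x = 1" for x by (simp add: U.R_def initu)
  have r_f: "(CI x. of_real (f x) :: complex) = 0"
    using cf int_of_real[OF c(2)] by simp
  have S0: "S U.R 0 = 0" by (simp add: S_def R0 r_f)
  have SY: "(S U.R has_vector_derivative Y) (at 0)"
  proof -
    have "U.src f 0 = (CI x. cweight \<epsilon> \<sigma> V0 f 3 x - 6 * of_real \<sigma> * (cweight \<epsilon> \<sigma> V0 f 1 x * of_real ((V0 x)^2)))"
      by (simp add: U.src_def R0 initu mult.assoc)
    also have "\<dots> = ?W3 - (CI x. 6 * of_real \<sigma> * (cweight \<epsilon> \<sigma> V0 f 1 x * of_real ((V0 x)^2)))"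
      by (intro int_diff continuous_intros c U.W_continuous[OF f continuous_on_id])
    also have "\<dots> = ?W3 - 6 * of_real \<sigma> * (CI x. cweight \<epsilon> \<sigma> V0 f 1 x * of_real ((V0 x)^2))" by (simp only: integral_mult_right)
    finally have src: "U.src f 0 = ?W3 - 6 * of_real \<sigma> * (of_real (CI x. p x * (V0 x)^2) + \<epsilon> * of_real (CI x. q x * (V0 x)^2))"
      by (simp only: split continuous_intros c)
    show ?thesis
      unfolding S_def[abs_def]
      by (rule has_vector_derivative_eq_rhs[OF U.product_law[OF f one, of 0, unfolded of_real_1 mult_1]])
        (simp add: R0 r_f src Y_def scaleR_conv_of_real)
  qed
  have S_lim: "(\<lambda>n. S (N.R n) t) \<longlonglongrightarrow> S U.R t"
    if pr: "\<And>x. x \<in> {0..2 * pi} \<Longrightarrow> (\<lambda>n. prim (v n 0 t) x) \<longlonglongrightarrow> prim (u 0 t) x" for t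
  proof -
    let ?K = "exp (2 * (sqrt (2 * pi) * sqrt (4 * E)))"
    have bd: "\<bar>prim (v n 0 t) x - prim V0 x\<bar> \<le> sqrt (2 * pi) * sqrt (4 * E)" if "x \<in> {0..2 * pi}" for n x
      unfolding N.prim_diff_eq
    proof (rule abs_prim_le[OF _ that])
      show "continuous_on UNIV (\<lambda>x. v n 0 t x - V0 x)" by (intro continuous_intros c)
      have "(CI x. (v n 0 t x - V0 x)^2) \<le> 2 * (CI x. (v n 0 t x)^2) + 2 * (CI x. (V0 x)^2)"
        by (intro cint_diff_square_le continuous_intros c)
      then show "(CI x. (v n 0 t x - V0 x)^2) \<le> 4 * E" using massv[of n t] massV by linarith
    qed
    have inv: "inverse (N.R n t x) = exp (2 * \<epsilon> * of_real (- (prim (v n 0 t) x - prim V0 x)))"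
      "inverse (U.R t x) = exp (2 * \<epsilon> * of_real (- (prim (u 0 t) x - prim V0 x)))" for n x
      unfolding N.R_def U.R_def exp_minus[symmetric] by (simp_all add: algebra_simps)
    have "(\<lambda>n. CI x. of_real (f x) * N.R n t x) \<longlonglongrightarrow> (CI x. of_real (f x) * U.R t x)"
    proof (rule dominated_convergence(2)[where h = "\<lambda>x. Fb * ?K"])
      show "norm (of_real (f x) * N.R n t x) \<le> Fb * ?K" if "x \<in> {0..2 * pi}" for n x
        unfolding norm_mult norm_of_real N.R_def
        by (intro mult_mono Fb norm_exp_phase_le \<epsilon> bd that) (use Fb[of x] in auto)
      show "(\<lambda>n. of_real (f x) * N.R n t x) \<longlonglongrightarrow> of_real (f x) * U.R t x" if "x \<in> {0..2 * pi}" for x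
        unfolding N.R_def U.R_def by (intro tendsto_intros pr that)
    qed (intro integrable_continuous_real continuous_intros c)+
    moreover have "(\<lambda>n. CI x. inverse (N.R n t x)) \<longlonglongrightarrow> (CI x. inverse (U.R t x))"
    proof (rule dominated_convergence(2)[where h = "\<lambda>x. ?K"])
      show "norm (inverse (N.R n t x)) \<le> ?K" if "x \<in> {0..2 * pi}" for n x
        unfolding inv by (intro norm_exp_phase_le \<epsilon>) (use bd[OF that, of n] in \<open>simp only: abs_minus\<close>)
      show "(\<lambda>n. inverse (N.R n t x)) \<longlonglongrightarrow> inverse (U.R t x)" if "x \<in> {0..2 * pi}" for x
        unfolding inv by (intro tendsto_intros pr that)
      show "(\<lambda>x. inverse (N.R n t x)) integrable_on {0..2 * pi}" for n
        by (intro integrable_continuous_real continuous_intros) (simp add: N.R_def)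
    qed (intro integrable_continuous_real continuous_intros)
    ultimately show ?thesis unfolding S_def by (rule tendsto_mult)
  qed
  have S_lim0: "(\<lambda>n. S (N.R n) 0) \<longlonglongrightarrow> 0"
  proof -
    have "(\<lambda>n. prim (v n 0 0) x) \<longlonglongrightarrow> prim (u 0 0) x" if x: "x \<in> {0..2 * pi}" for x
    proof -
      have "(\<lambda>n. prim (v n 0 0) x - prim V0 x) \<longlonglongrightarrow> 0"
      proof (rule tendstoI)
        fix e :: real assume "0 < e"
        then have "\<forall>\<^sub>F n in sequentially. \<forall>x\<in>{0..2 * pi}. \<bar>prim (\<lambda>x. osc V0 (\<lambda>x. 1) n x - V0 x) x\<bar> \<le> e / 2"
          by (intro osc_prim_tendsto V0 one) simp
        then show "\<forall>\<^sub>F n in sequentially. dist (prim (v n 0 0) x - prim V0 x) 0 < e"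
        proof eventually_elim
          case (elim n)
          from elim[rule_format, OF x] \<open>0 < e\<close> show ?case
            unfolding N.prim_diff_eq unfolding init by (simp add: dist_real_def)
        qed
      qed
      then show ?thesis unfolding initu by (simp add: LIM_zero_iff)
    qed
    from S_lim[OF this] show ?thesis unfolding S0 .
  qed
  have S_limT: "(\<lambda>n. S (N.R n) t) \<longlonglongrightarrow> S U.R t" if t: "t \<in> {0<..<T}" for t
  proof (rule S_lim)
    fix x :: real assume x: "x \<in> {0..2 * pi}"
    have cv: "continuous_on UNIV (v n 0 t)" "continuous_on UNIV (u 0 t)" for n by (intro continuous_intros)+
    have "(\<lambda>n. prim (\<lambda>x. v n 0 t x - u 0 t x) x) \<longlonglongrightarrow> 0"
    proof (rule prim_tendsto_zero[where E = "4 * E", OF _ _ _ _ x])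
      show "(\<lambda>x. v n 0 t x - u 0 t x) \<in> test_circle" for n by (intro circle_diff N.circle_v U.circle_v)
      show "(CI x. v n 0 t x - u 0 t x) = 0" for n
        by (subst int_diff) (auto intro!: continuous_intros simp: N.mean_conserved U.mean_conserved)
      have sq: "(CI x. (v n 0 t x - u 0 t x)^2) \<le> 2 * (CI x. (v n 0 t x)^2) + 2 * (CI x. (u 0 t x)^2)" for n
        by (intro cint_diff_square_le continuous_intros)
      show "(CI x. (v n 0 t x - u 0 t x)^2) \<le> 4 * E" for n
        using sq[of n] massv[of n t] massu[of t] by linarith
      fix \<phi> assume \<phi>: "\<phi> \<in> test_circle"
      have "(CI x. (v n 0 t x - u 0 t x) * \<phi> x) = (CI x. v n 0 t x * \<phi> x) - (CI x. u 0 t x * \<phi> x)" for n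
        unfolding left_diff_distrib by (intro int_diff continuous_intros circle_continuous[OF \<phi>])
      then show "(\<lambda>n. CI x. (v n 0 t x - u 0 t x) * \<phi> x) \<longlonglongrightarrow> 0"
        using conv[OF t \<phi>] by (simp add: LIM_zero_iff)
    qed
    then show "(\<lambda>n. prim (v n 0 t) x) \<longlonglongrightarrow> prim (u 0 t) x"
      unfolding prim_diff[OF cv] by (simp add: LIM_zero_iff)
  qed
  \<comment> \<open>Errors relative to \<open>e * \<delta>\<close>: r = 12 e in
    \<open>product_rate\<close> gives \<open>12 * P\<close>, and the two mass densities, each off by
    at most \<delta> (2 L + 1) e, enter with the factor 12 pi.\<close>
  define K where "K = 12 * P + 12 * pi * (2 * (L1 + L2) + 2)"
  \<comment> \<open>The bound on \<open>e\<close> meets two smallness conditions: r = 12 e is at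
    most 1 in \<open>product_rate\<close>, and \<kappa> = 2 e is at most 1 / 2 in
    \<open>R_near_one\<close>.\<close>
  have key: "norm (X - Y) \<le> (K + 1) * e" if e: "0 < e" "e \<le> 1 / 24" for e
  proof -
    obtain d where d: "d > 0" "\<And>\<sigma> v \<delta>. (\<And>n. mkdv \<sigma> (v n)) \<Longrightarrow> (\<And>n. v n 0 0 = osc V0 (\<lambda>x. 1) n) \<Longrightarrow> \<delta> \<le> d \<Longrightarrow>
      \<forall>\<^sub>F n in sequentially. stays_near (v n) V0 \<delta> (2 * e)"
      using osc_stays_near[OF V0 one e(1)] by blast
    obtain d2 where d2: "d2 > 0" "\<And>h. norm (h - 0) < d2 \<Longrightarrow> norm (S U.R h - S U.R 0 - (h - 0) *\<^sub>R Y) \<le> e * norm (h - 0)"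
      using SY e unfolding has_vector_derivative_def has_derivative_at_alt by blast
    define \<delta> where "\<delta> = Min {d, d2 / 2, T / 2}"
    have "0 < \<delta>" using d(1) d2(1) T by (simp add: \<delta>_def)
    moreover have "\<delta> \<le> d" "\<delta> \<le> d2 / 2" "\<delta> \<le> T / 2" unfolding \<delta>_def by (rule Min_le; simp)+
    ultimately have \<delta>: "0 < \<delta>" "\<delta> \<le> d" "\<delta> < d2" "\<delta> < T" using d2(1) T by linarith+
    have near: "\<forall>\<^sub>F n in sequentially. stays_near (v n) V0 \<delta> (2 * e)" by (rule d(2)[OF mk init \<delta>(2)])
    have ed: "0 < e * \<delta>" "0 \<le> \<delta>" "0 \<le> 2 * e" using e \<delta> by simp_all
    have "\<forall>\<^sub>F n in sequentially. norm (S (N.R n) \<delta> - S (N.R n) 0 - of_real \<delta> * X) \<le> K * e * \<delta>"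
      using near M1[OF ed near] M2[OF ed near]
    proof eventually_elim
      case (elim n)
      define J where "J F = integral {0..\<delta>} (\<lambda>t. CI x. F x * (v n 0 t x)^2)" for F
      note J = elim(2,3)[folded J_def]
      have Jc: "continuous_on {0..\<delta>} (\<lambda>t. CI x. F x * (v n 0 t x)^2)" if "F \<in> test_circle" for F
        by (rule int_continuous_param) (simp only: case_prod_unfold, intro continuous_intros circle_continuous_comp[OF that])
      have Ji: "integral {0..\<delta>} (\<lambda>t. CI x. cweight \<epsilon> \<sigma> V0 f 1 x * of_real ((v n 0 t x)^2)) = of_real (J p) + \<epsilon> * of_real (J q)"
      proof -
        have "integral {0..\<delta>} (\<lambda>t. CI x. cweight \<epsilon> \<sigma> V0 f 1 x * of_real ((v n 0 t x)^2))
            = integral {0..\<delta>} (\<lambda>t. of_real (CI x. p x * (v n 0 t x)^2) + \<epsilon> * of_real (CI x. q x * (v n 0 t x)^2))"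
          by (intro arg_cong[where f = "integral {0..\<delta>}"] ext split continuous_intros)
        also have "\<dots> = integral {0..\<delta>} (\<lambda>t. of_real (CI x. p x * (v n 0 t x)^2)) + integral {0..\<delta>} (\<lambda>t. \<epsilon> * of_real (CI x. q x * (v n 0 t x)^2))"
          by (intro int_add continuous_intros Jc pq)
        also have "\<dots> = integral {0..\<delta>} (\<lambda>t. of_real (CI x. p x * (v n 0 t x)^2)) + \<epsilon> * integral {0..\<delta>} (\<lambda>t. of_real (CI x. q x * (v n 0 t x)^2))"
          by (simp only: integral_mult_right)
        finally show ?thesis by (simp only: int_of_real Jc pq J_def)
      qed
      have nr: "norm (N.R n t x - 1) \<le> 12 * e" "norm (inverse (N.R n t x) - 1) \<le> 12 * e" if "t \<in> {0..\<delta>}" "x \<in> {0..2 * pi}" for t x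
        using N.R_near_one[OF \<epsilon>(2), of n t x "2 * e"] elim(1) that e by (auto simp: stays_near_def)
      have rate: "norm (S (N.R n) \<delta> - S (N.R n) 0 - 2 * pi * (\<delta> * ?W3 - 6 * of_real \<sigma> * (of_real (J p) + \<epsilon> * of_real (J q)))) \<le> (12 * e) * P * \<delta>"
        unfolding S_def P_def Ji[symmetric]
        by (rule N.product_rate[OF f cf Fb B3 B1 D3 D1 massv nr]) (use e \<delta> in auto)
      have "2 * pi * (\<delta> * ?W3 - 6 * of_real \<sigma> * (of_real (J p) + \<epsilon> * of_real (J q))) - of_real \<delta> * X
          = - (12 * pi * of_real \<sigma>) * (of_real (J p - \<delta> * m p) + \<epsilon> * of_real (J q - \<delta> * m q))"
        by (simp add: X_def algebra_simps)
      also have "norm \<dots> \<le> (12 * pi) * ((\<delta> * (L1 * (2 * e)) + e * \<delta>) + (\<delta> * (L2 * (2 * e)) + e * \<delta>))"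
      proof -
        have "norm (of_real (J p - \<delta> * m p) + \<epsilon> * of_real (J q - \<delta> * m q)) \<le> (\<delta> * (L1 * (2 * e)) + e * \<delta>) + (\<delta> * (L2 * (2 * e)) + e * \<delta>)"
          using J \<epsilon>(2) by (intro norm_triangle_le add_mono) (simp_all only: norm_mult norm_of_real mult_1)
        moreover have "norm (- (12 * pi * of_real \<sigma>) :: complex) = 12 * pi" using \<sigma> by (auto simp: norm_mult)
        ultimately show ?thesis unfolding norm_mult by (simp only:) (intro mult_left_mono, auto)
      qed
      also have "\<dots> = 12 * pi * (2 * (L1 + L2) + 2) * (e * \<delta>)"
        by (simp add: algebra_simps)
      finally have shift: "norm (2 * pi * (\<delta> * ?W3 - 6 * of_real \<sigma> * (of_real (J p) + \<epsilon> * of_real (J q))) - of_real \<delta> * X)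
        \<le> 12 * pi * (2 * (L1 + L2) + 2) * (e * \<delta>)" .
      have tri: "norm (s - x) \<le> a + b" if "norm (s - z) \<le> a" "norm (z - x) \<le> b" for s x z :: complex and a b
        using norm_triangle_le[OF add_mono[OF that]] by simp
      from tri[OF rate shift] show ?case by (simp add: K_def algebra_simps)
    qed
    moreover have "(\<lambda>n. norm (S (N.R n) \<delta> - S (N.R n) 0 - of_real \<delta> * X)) \<longlonglongrightarrow> norm (S U.R \<delta> - 0 - of_real \<delta> * X)"
      using \<delta> by (intro tendsto_intros S_limT S_lim0) auto
    ultimately have "norm (S U.R \<delta> - 0 - of_real \<delta> * X) \<le> K * e * \<delta>"
      by (intro tendsto_upperbound) auto
    moreover have "norm (S U.R \<delta> - of_real \<delta> * Y) \<le> e * \<delta>"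
      using d2(2)[of \<delta>] \<delta> by (simp add: S0 scaleR_conv_of_real)
    moreover have "norm (of_real \<delta> * (X - Y)) \<le> norm (S U.R \<delta> - of_real \<delta> * X) + norm (S U.R \<delta> - of_real \<delta> * Y)"
      using norm_triangle_ineq4[of "S U.R \<delta> - of_real \<delta> * Y" "S U.R \<delta> - of_real \<delta> * X"] by (simp add: right_diff_distrib)
    ultimately have "norm (of_real \<delta> * (X - Y)) \<le> K * e * \<delta> + e * \<delta>" unfolding diff_0_right by linarith
    moreover have "norm (of_real \<delta> * (X - Y)) = \<delta> * norm (X - Y)" using \<delta>(1) by (simp add: norm_mult)
    moreover have "K * e * \<delta> + e * \<delta> = \<delta> * ((K + 1) * e)" by (simp add: algebra_simps)
    ultimately have "\<delta> * norm (X - Y) \<le> \<delta> * ((K + 1) * e)" by (simp only:)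
    then show ?thesis using \<delta>(1) by simp
  qed
  have "norm (X - Y) \<le> 0"
  proof (rule field_le_epsilon)
    fix e :: real assume e: "0 < e"
    define e' where "e' = min (1 / 24) (e / (\<bar>K + 1\<bar> + 1))"
    have "0 < e / (\<bar>K + 1\<bar> + 1)" using e by simp
    then have e': "0 < e'" "e' \<le> 1 / 24" "e' \<le> e / (\<bar>K + 1\<bar> + 1)"
      unfolding e'_def by (simp_all only: min.cobounded1 min.cobounded2 min_less_iff_conj) simp
    have "(K + 1) * e' \<le> (\<bar>K + 1\<bar> + 1) * e'" using e' by (intro mult_right_mono) auto
    also have "\<dots> \<le> e" using e'(3) by (simp add: pos_le_divide_eq mult.commute)
    finally show "norm (X - Y) \<le> 0 + e" using key[OF e'(1,2)] by simp
  qed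
  then have "X = Y" by simp
  moreover have "2 * pi * (w - 6 * s * (of_real (a + p / 2) + \<epsilon> * of_real (b + q / 2))) - 2 * pi * (w - 6 * s * (of_real a + \<epsilon> * of_real b))
      = - (of_real (6 * pi) * s) * (of_real p + \<epsilon> * of_real q)" for w s :: complex and a b p q :: real
    by (simp add: field_simps)
  then have "X - Y = - (of_real (6 * pi) * of_real \<sigma>) * (of_real (cint p) + \<epsilon> * of_real (cint q))"
    unfolding X_def Y_def m_def .
  ultimately have "of_real (cint p) + \<epsilon> * of_real (cint q) = (0 :: complex)"
    using \<sigma> by (elim disjE) simp_all
  moreover have "cint p = 0"
  proof -
    have "p = deriv f" by (auto simp: p_def)
    then show ?thesis using cint_deriv_zero[OF circle_DERIV[OF f] circle_period_eq[OF f]] by simp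
  qed
  ultimately have "cint q = 0" using \<epsilon>(2) by auto
  \<comment> \<open>The second component of \<open>weight \<sigma> V0 f 1\<close> is -2 V0 f, and V0
    = f + \<mu>; the part linear in f has mean zero.\<close>
  moreover have "q = (\<lambda>x. (-2) * ((f x)^2 + \<mu> * f x))"
    by (auto simp: q_def f_def power2_eq_square algebra_simps)
  ultimately have "(-2) * (CI x. (f x)^2 + \<mu> * f x) = 0" by (simp only: integral_mult_right)
  then have "(CI x. (f x)^2 + \<mu> * f x) = 0" by simp
  moreover have "(CI x. (f x)^2 + \<mu> * f x) = (CI x. (f x)^2) + (CI x. \<mu> * f x)"
    by (intro int_add continuous_intros c)
  ultimately have "(CI x. (f x)^2) \<le> 0" by (simp add: cf)
  then have "f x = 0" if "x \<in> {0..2 * pi}" for x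
    using int_zero_imp_zero[of 0 "2 * pi" f x] that c by simp
  then have "f x = 0" by (rule circle_eq_on_period[OF f])
  then show ?thesis by (simp add: f_def \<mu>_def)
qed

section \<open>From convergence of distributions to fixed times, and the conclusions for
  mKdV\<close>

lemma (in mkdv) equicontinuous_pairing:
  assumes \<phi>: "\<phi> \<in> test_circle" and mean: "cint (v 0 t) = cint (v 0 s)"
    and near: "\<And>x. x \<in> {0..2 * pi} \<Longrightarrow> \<bar>prim (v 0 t) x - prim (v 0 s) x\<bar> \<le> e"
  shows "\<bar>(CI x. v 0 t x * \<phi> x) - (CI x. v 0 s x * \<phi> x)\<bar> \<le> e * (CI x. \<bar>deriv \<phi> x\<bar>)"
proof -
  have c: "continuous_on UNIV (v 0 t)" "continuous_on UNIV (v 0 s)" by (intro continuous_intros)+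
  have "\<bar>(CI x. (v 0 t x - v 0 s x) * \<phi> x)\<bar> \<le> e * (CI x. \<bar>deriv \<phi> x\<bar>)"
  proof (rule cint_le_prim[OF _ _ \<phi>])
    show "(\<lambda>x. v 0 t x - v 0 s x) \<in> test_circle" by (intro circle_diff circle_v)
    show "(CI x. v 0 t x - v 0 s x) = 0" using mean by (subst int_diff) (auto intro!: continuous_intros)
    show "\<bar>prim (\<lambda>x. v 0 t x - v 0 s x) x\<bar> \<le> e" if "x \<in> {0..2 * pi}" for x
      using near[OF that] by (simp only: prim_diff[OF c])
  qed
  moreover have "(CI x. (v 0 t x - v 0 s x) * \<phi> x) = (CI x. v 0 t x * \<phi> x) - (CI x. v 0 s x * \<phi> x)"
    unfolding left_diff_distrib by (intro int_diff continuous_intros circle_continuous[OF \<phi>])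
  ultimately show ?thesis by simp
qed

text \<open>Equicontinuity in time, uniform in n, lets the average over a bump around
  \<open>t0\<close> replace the value at \<open>t0\<close>, and the averages converge by the
  distributional hypothesis. Thus a failure at fixed times becomes a failure in the
  cylinder.\<close>

lemma fixed_time_convergence:
  assumes mk: "\<And>n. mkdv \<sigma> (v n)" "mkdv \<sigma> u"
    and mass: "\<And>n. (CI x. (v n 0 0 x)^2) \<le> E" "(CI x. (u 0 0 x)^2) \<le> E"
    and mean: "\<And>n. cint (v n 0 0) = M" "cint (u 0 0) = M"
    and \<phi>: "\<phi> \<in> test_circle" and t0: "t0 \<in> {0<..<T}"
    and weak: "\<And>\<eta> a b. smooth \<eta> \<Longrightarrow> (\<And>t. t \<notin> {a..b} \<Longrightarrow> \<eta> t = 0) \<Longrightarrow> 0 < a \<Longrightarrow> b < T \<Longrightarrow>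
      (\<lambda>n. integral {0..b} (\<lambda>t. \<eta> t * (CI x. v n 0 t x * \<phi> x))) \<longlonglongrightarrow> integral {0..b} (\<lambda>t. \<eta> t * (CI x. u 0 t x * \<phi> x))"
  shows "(\<lambda>n. CI x. v n 0 t0 x * \<phi> x) \<longlonglongrightarrow> (CI x. u 0 t0 x * \<phi> x)"
proof (rule LIMSEQ_I)
  fix e :: real assume e: "0 < e"
  define X where "X = (CI x. \<bar>deriv \<phi> x\<bar>)"
  have X: "0 \<le> X" unfolding X_def
    by (intro int_nonneg continuous_intros circle_continuous[OF circle_deriv[OF \<phi>]]) auto
  define e' where "e' = e / (4 * (X + 1))"
  have e': "0 < e'" "e' * X \<le> e / 4" using e X by (simp_all add: e'_def field_simps)
  obtain d where d: "d > 0" "\<And>\<sigma> v s t x. mkdv \<sigma> v \<Longrightarrow> (CI x. (v 0 0 x)^2) \<le> E \<Longrightarrow> cint (v 0 0) = M \<Longrightarrow>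
      \<bar>t - s\<bar> \<le> d \<Longrightarrow> x \<in> {0..2 * pi} \<Longrightarrow> \<bar>prim (v 0 t) x - prim (v 0 s) x\<bar> \<le> e'"
    using equicontinuity[OF e'(1), of E M] by blast
  \<comment> \<open>The interval from \<open>a\<close> to \<open>b\<close> lies within
    \<open>d\<close> of \<open>t0\<close>; halving the distances to 0 and to T keeps it strictly
    inside the time interval.\<close>
  define a where "a = max (t0 - d) (t0 / 2)"
  define b where "b = min (t0 + d) ((t0 + T) / 2)"
  have ab: "0 < a" "a < b" "b < T" "0 < b" "t0 - d \<le> a" "b \<le> t0 + d" using t0 d(1) by (auto simp: a_def b_def min_def max_def)
  define \<eta> where "\<eta> = bump a b"
  have \<eta>: "smooth \<eta>" "\<And>t. 0 \<le> \<eta> t" unfolding \<eta>_def by (rule bump_smooth bump_nonneg)+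
  have \<eta>s: "\<eta> t = 0" if "t \<notin> {a..b}" for t unfolding \<eta>_def by (rule bump_zero) (use that in auto)
  have \<eta>c: "continuous_on A \<eta>" for A by (rule smooth_continuous[OF \<eta>(1)])
  define I where "I = integral {0..b} \<eta>"
  have I: "0 < I" unfolding I_def \<eta>_def using ab by (intro bump_integral_pos) auto
  have avg: "\<bar>integral {0..b} (\<lambda>t. \<eta> t * (CI x. w 0 t x * \<phi> x)) - I * (CI x. w 0 t0 x * \<phi> x)\<bar> \<le> I * (e / 4)"
    if w: "mkdv \<sigma> w" "(CI x. (w 0 0 x)^2) \<le> E" "cint (w 0 0) = M" for w
  proof -
    interpret mkdv \<sigma> w by (rule w(1))
    let ?q = "\<lambda>t. (CI x. w 0 t x * \<phi> x)"
    have qc: "continuous_on A ?q" for A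
      by (rule int_continuous_param) (simp only: case_prod_unfold, intro continuous_intros circle_continuous_comp[OF \<phi>])
    have mean: "cint (w 0 t) = cint (w 0 s)" for s t using mean_invariant[of t] mean_invariant[of s] by simp
    have "integral {0..b} (\<lambda>t. \<eta> t * ?q t) - I * ?q t0 = integral {0..b} (\<lambda>t. \<eta> t * ?q t) - integral {0..b} (\<lambda>t. \<eta> t * ?q t0)"
      by (simp add: I_def)
    also have "\<dots> = integral {0..b} (\<lambda>t. \<eta> t * ?q t - \<eta> t * ?q t0)"
      by (intro int_diff[symmetric] continuous_intros \<eta>c qc)
    finally have "integral {0..b} (\<lambda>t. \<eta> t * ?q t) - I * ?q t0 = integral {0..b} (\<lambda>t. \<eta> t * ?q t - \<eta> t * ?q t0)" .
    moreover have "norm (integral {0..b} (\<lambda>t. \<eta> t * ?q t - \<eta> t * ?q t0)) \<le> integral {0..b} (\<lambda>t. \<eta> t * (e / 4))"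
    proof (rule int_norm_le)
      show "norm (\<eta> t * ?q t - \<eta> t * ?q t0) \<le> \<eta> t * (e / 4)" for t
      proof (cases "t \<in> {a..b}")
        case True
        have "\<bar>?q t - ?q t0\<bar> \<le> e' * X"
          unfolding X_def
        proof (rule equicontinuous_pairing[OF \<phi> mean])
          show "\<bar>prim (w 0 t) x - prim (w 0 t0) x\<bar> \<le> e'" if "x \<in> {0..2 * pi}" for x
            by (rule d(2)[OF w _ that]) (use True ab in auto)
        qed
        then have "\<bar>?q t - ?q t0\<bar> \<le> e / 4" using e'(2) by linarith
        then have "\<eta> t * \<bar>?q t - ?q t0\<bar> \<le> \<eta> t * (e / 4)" using \<eta>(2) by (rule mult_left_mono)
        then show ?thesis unfolding right_diff_distrib[symmetric] real_norm_def abs_mult abs_of_nonneg[OF \<eta>(2)] .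
      qed (simp add: \<eta>s)
    qed (intro continuous_intros \<eta>c qc)+
    moreover have "integral {0..b} (\<lambda>t. \<eta> t * (e / 4)) = I * (e / 4)" unfolding I_def by (rule integral_mult_left)
    ultimately show ?thesis by (simp only: real_norm_def)
  qed
  have "0 < I * (e / 4)" using I e by simp
  from LIMSEQ_D[OF weak[OF \<eta>(1) \<eta>s ab(1,3)] this]
  obtain N where N: "\<And>n. n \<ge> N \<Longrightarrow> norm (integral {0..b} (\<lambda>t. \<eta> t * (CI x. v n 0 t x * \<phi> x)) - integral {0..b} (\<lambda>t. \<eta> t * (CI x. u 0 t x * \<phi> x))) < I * (e / 4)"
    by blast
  show "\<exists>N. \<forall>n\<ge>N. norm ((CI x. v n 0 t0 x * \<phi> x) - (CI x. u 0 t0 x * \<phi> x)) < e"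
  proof (intro exI[of _ N] allI impI)
    fix n assume "n \<ge> N"
    have arith: "\<bar>z - y\<bar> < e" if "\<bar>p - I * z\<bar> \<le> I * (e / 4)" "\<bar>q - I * y\<bar> \<le> I * (e / 4)" "\<bar>p - q\<bar> < I * (e / 4)" for p q y z
    proof -
      have "\<bar>I * z - I * y\<bar> < I * e" using that by (simp add: abs_if split: if_splits)
      then show ?thesis using I by (simp add: right_diff_distrib[symmetric] abs_mult)
    qed
    show "norm ((CI x. v n 0 t0 x * \<phi> x) - (CI x. u 0 t0 x * \<phi> x)) < e"
      unfolding real_norm_def
      by (rule arith[OF avg[OF mk(1) mass(1) mean(1)] avg[OF mk(2) mass(2) mean(2)] N[OF \<open>n \<ge> N\<close>, unfolded real_norm_def]])
  qed
qed

lemma limitin_osc: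
  assumes "V0 \<in> test_circle" "g \<in> test_circle"
  shows "limitin Hinf_weak_L2 (osc V0 g) V0 sequentially"
  by (rule limitin_Hinf_weak_L2[OF osc_test_circle[OF assms] assms(1)]) (rule osc_functional_tendsto[OF _ _ assms])

lemma mkdv_solution_map_jet:
  assumes "mkdv_solution_map \<sigma> S" "\<sigma> \<in> {1, - 1}" "w \<in> test_circle"
  shows "mkdv \<sigma> (jet (S w))" and "jet (S w) 0 0 = w" and "continuous_on UNIV (\<lambda>(t, x). S w t x)"
proof -
  have sol: "mkdv_solution \<sigma> w (S w)" using assms by (auto simp: mkdv_solution_map_def Hinf_eq)
  then show "mkdv \<sigma> (jet (S w))" by (rule mkdv_solution_imp_mkdv[OF _ assms(2)])
  show "jet (S w) 0 0 = w" using sol by (simp add: mkdv_solution_def)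
  show "continuous_on UNIV (\<lambda>(t, x). S w t x)" using sol jet_continuous[of "S w" 0] by (simp add: mkdv_solution_def)
qed

lemma fixed_time_limits_imp_constant:
  assumes S: "mkdv_solution_map \<sigma> S" "\<sigma> \<in> {1, - 1}" and w: "w \<in> test_circle" and T: "T > 0"
    and conv: "\<And>t \<phi>. t \<in> {0<..<T} \<Longrightarrow> \<phi> \<in> test_circle \<Longrightarrow>
      (\<lambda>n. CI x. S (osc w (\<lambda>x. 1) n) t x * \<phi> x) \<longlonglongrightarrow> (CI x. S w t x * \<phi> x)"
  shows "w constant_on UNIV"
proof -
  have "w x = cint w / (2 * pi)" for x
  proof (rule mkdv_weak_continuity_imp_constant[where v = "\<lambda>n. jet (S (osc w (\<lambda>x. 1) n))" and u = "jet (S w)", OF _ w T])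
    show "\<sigma> = 1 \<or> \<sigma> = - 1" using S(2) by simp
    show "(\<lambda>n. CI x. jet (S (osc w (\<lambda>x. 1) n)) 0 t x * \<phi> x) \<longlonglongrightarrow> (CI x. jet (S w) 0 t x * \<phi> x)"
      if "t \<in> {0<..<T}" "\<phi> \<in> test_circle" for t \<phi>
      using conv[OF that] by simp
  qed (rule mkdv_solution_map_jet[OF S] w osc_test_circle circle_const)+
  then show ?thesis by (auto simp: constant_on_def)
qed

theorem mkdv_discontinuous:
  assumes S: "mkdv_solution_map \<sigma> S" "\<sigma> \<in> {1, - 1}" and T: "T > 0" and u0: "u0 \<in> Hinf" "\<not> u0 constant_on UNIV"
  shows "discontinuous_at Hinf_weak_L2 (distr_cylinder_topology T) (\<lambda>v. cylinder_distr T (S v)) u0"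
  unfolding discontinuous_at_def topspace_Hinf_weak_L2 topspace_distr_cylinder_topology
proof (intro conjI u0 funcsetI notI)
  show "cylinder_distr T (S w) \<in> distr_cylinder T" if "w \<in> Hinf" for w
    using mkdv_solution_map_jet(3)[OF S] that by (intro cylinder_distr_in_distr_cylinder) (simp add: Hinf_eq)
  assume cont: "topcontinuous_at Hinf_weak_L2 (distr_cylinder_topology T) (\<lambda>v. cylinder_distr T (S v)) u0"
  have w: "u0 \<in> test_circle" using u0 by (simp add: Hinf_eq)
  have one: "(\<lambda>x. 1) \<in> test_circle" by (rule circle_const)
  note lim = topcontinuous_at_initial_topology_limit[OF cont[unfolded distr_cylinder_topology_def] limitin_osc[OF w one]]
  note jets = mkdv_solution_map_jet[OF S]
  obtain E1 where E1: "\<And>n. (CI x. (osc u0 (\<lambda>x. 1) n x)^2) \<le> E1" using osc_mass_bounded[OF w one] by blast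
  have "u0 constant_on UNIV"
  proof (rule fixed_time_limits_imp_constant[OF S w T])
    fix t \<phi> assume t: "t \<in> {0<..<T}" and \<phi>: "\<phi> \<in> test_circle"
    have "(\<lambda>n. CI x. jet (S (osc u0 (\<lambda>x. 1) n)) 0 t x * \<phi> x) \<longlonglongrightarrow> (CI x. jet (S u0) 0 t x * \<phi> x)"
    proof (rule fixed_time_convergence[where v = "\<lambda>n. jet (S (osc u0 (\<lambda>x. 1) n))" and E = "max E1 (CI x. (u0 x)^2)" and M = "cint u0", OF _ _ _ _ _ _ \<phi> t])
      fix \<eta> a b assume \<eta>: "smooth \<eta>" "\<And>t. t \<notin> {a..b} \<Longrightarrow> \<eta> t = 0" "0 < a" "b < T"
      have tc: "(\<lambda>(t, x). \<eta> t * \<phi> x) \<in> test_cylinder T" by (rule tensor_test_cylinder[OF \<eta>(1,2) \<phi> \<eta>(3,4)])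
      have "cylinder_distr T (S w) (\<lambda>(t, x). \<eta> t * \<phi> x) = integral {0..b} (\<lambda>t. \<eta> t * (CI x. S w t x * \<phi> x))"
        if "w \<in> test_circle" for w
        by (rule cylinder_distr_tensor[OF jets(3)[OF that] \<eta>(1,2) \<phi> \<eta>(3,4)])
      then show "(\<lambda>n. integral {0..b} (\<lambda>t. \<eta> t * (CI x. jet (S (osc u0 (\<lambda>x. 1) n)) 0 t x * \<phi> x)))
          \<longlonglongrightarrow> integral {0..b} (\<lambda>t. \<eta> t * (CI x. jet (S u0) 0 t x * \<phi> x))"
        using lim[OF imageI[OF tc]] w osc_test_circle[OF w one] by simp
    next
      fix n
      note o = osc_test_circle[OF w one, of n]
      show "mkdv \<sigma> (jet (S (osc u0 (\<lambda>x. 1) n)))" "mkdv \<sigma> (jet (S u0))" by (rule jets(1) o w)+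
      show "(CI x. (jet (S (osc u0 (\<lambda>x. 1) n)) 0 0 x)^2) \<le> max E1 (CI x. (u0 x)^2)"
        unfolding jets(2)[OF o] using E1[of n] by simp
      show "(CI x. (jet (S u0) 0 0 x)^2) \<le> max E1 (CI x. (u0 x)^2)" unfolding jets(2)[OF w] by simp
      show "cint (jet (S (osc u0 (\<lambda>x. 1) n)) 0 0) = cint u0" unfolding jets(2)[OF o] by (rule cint_osc[OF w one])
      show "cint (jet (S u0) 0 0) = cint u0" unfolding jets(2)[OF w] ..
    qed
    then show "(\<lambda>n. CI x. S (osc u0 (\<lambda>x. 1) n) t x * \<phi> x) \<longlonglongrightarrow> (CI x. S u0 t x * \<phi> x)" by simp
  qed
  then show False using u0(2) by contradiction
qed

theorem mkdv_flow_not_continuous: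
  assumes S: "mkdv_solution_map \<sigma> S" "\<sigma> \<in> {1, - 1}" and T: "T > 0" and u0: "u0 \<in> Hinf" "\<not> u0 constant_on UNIV"
    and cont: "\<And>t. t \<in> {0<..<T} \<Longrightarrow> topcontinuous_at Hinf_weak_L2 distr_circle_topology (\<lambda>v. circle_distr (S v t)) u0"
  shows False
proof -
  have w: "u0 \<in> test_circle" using u0 by (simp add: Hinf_eq)
  have one: "(\<lambda>x. 1) \<in> test_circle" by (rule circle_const)
  have "u0 constant_on UNIV"
  proof (rule fixed_time_limits_imp_constant[OF S w T])
    fix t \<phi> assume t: "t \<in> {0<..<T}" and \<phi>: "\<phi> \<in> test_circle"
    have "circle_distr (S w t) \<phi> = (CI x. S w t x * \<phi> x)" if "w \<in> test_circle" for w
    proof (rule circle_distr_eq[OF _ \<phi>])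
      show "continuous_on UNIV (S w t)"
        using mkdv.circle_v[OF mkdv_solution_map_jet(1)[OF S that], of 0 t] circle_continuous by simp
    qed
    then show "(\<lambda>n. CI x. S (osc u0 (\<lambda>x. 1) n) t x * \<phi> x) \<longlonglongrightarrow> (CI x. S u0 t x * \<phi> x)"
      using topcontinuous_at_initial_topology_limit[OF cont[OF t, unfolded distr_circle_topology_def] limitin_osc[OF w one] imageI[OF \<phi>]]
        w osc_test_circle[OF w one] by simp
  qed
  then show False using u0(2) by contradiction
qed

section \<open>Discontinuity of the solution-maps\<close>

theorem mainTheorem3:
  fixes K :: "(real \<Rightarrow> real) \<Rightarrow> real \<Rightarrow> real \<Rightarrow> real"
    and M :: "real \<Rightarrow> (real \<Rightarrow> real) \<Rightarrow> real \<Rightarrow> real \<Rightarrow> real"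
  assumes "kdv_solution_map K"
    and "\<forall>\<sigma>\<in>{1, -1}. mkdv_solution_map \<sigma> (M \<sigma>)"
  shows "(\<forall>T>0. \<forall>u0\<in>Hinf0.
            discontinuous_at Hinf0_weak_Hm1 (distr_cylinder_topology T)
              (\<lambda>w. cylinder_distr T (K w)) u0)
       \<and> (\<forall>\<sigma>\<in>{1, -1}. \<forall>T>0. \<forall>u0\<in>Hinf. \<not> u0 constant_on UNIV \<longrightarrow>
            discontinuous_at Hinf_weak_L2 (distr_cylinder_topology T)
              (\<lambda>v. cylinder_distr T (M \<sigma> v)) u0)
       \<and> (\<forall>\<sigma>\<in>{1, -1}. \<forall>u0\<in>Hinf. \<not> u0 constant_on UNIV \<longrightarrow>
            \<not> (\<exists>T>0. \<forall>t\<in>{0<..<T}.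
                 topcontinuous_at Hinf_weak_L2 distr_circle_topology
                   (\<lambda>v. circle_distr (M \<sigma> v t)) u0))"
proof (intro conjI ballI allI impI)
  have M: "mkdv_solution_map \<sigma> (M \<sigma>)" if "\<sigma> \<in> {1, - 1}" for \<sigma> using assms(2) that by blast
  \<comment> \<open>The defocusing flow \<open>M 1\<close> enters here although the claim is about
    KdV: it supplies the solutions to which the Miura transform is applied.\<close>
  show "discontinuous_at Hinf0_weak_Hm1 (distr_cylinder_topology T) (\<lambda>w. cylinder_distr T (K w)) u0"
    if "0 < T" "u0 \<in> Hinf0" for T u0
    by (rule kdv_discontinuous[OF assms(1) M[of 1] that]) simp
  show "discontinuous_at Hinf_weak_L2 (distr_cylinder_topology T) (\<lambda>v. cylinder_distr T (M \<sigma> v)) u0"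
    if "\<sigma> \<in> {1, - 1}" "0 < T" "u0 \<in> Hinf" "\<not> u0 constant_on UNIV" for \<sigma> T u0
    by (rule mkdv_discontinuous[OF M[OF that(1)] that])
  show "\<not> (\<exists>T>0. \<forall>t\<in>{0<..<T}. topcontinuous_at Hinf_weak_L2 distr_circle_topology (\<lambda>v. circle_distr (M \<sigma> v t)) u0)"
    if "\<sigma> \<in> {1, - 1}" "u0 \<in> Hinf" "\<not> u0 constant_on UNIV" for \<sigma> u0
    using mkdv_flow_not_continuous[OF M[OF that(1)] that(1) _ that(2,3)] by blast
qed

end
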